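(* Fix $n>k>0$ and suppose that for every choice of distinct real numbers $t_1,\ldots,t_{k(n-k)}$, the intersection $X_{\alpha}F_\bullet(t_1)\cap\cdots\cap X_{\alpha}F_\bullet(t_{k(n-k)})$ with $\alpha=(1,2,\ldots,k-1,k+1)$ is transverse. Then for any $\alpha^1,\ldots,\alpha^s\in\binom{[n]}{k}$ with $|\alpha^1|+\cdots+|\alpha^s|=k(n-k)$ and any distinct real numbers $t_1,\ldots,t_s$, every point of the intersection $X_{\alpha^1}F_\bullet(t_1)\cap\cdots\cap X_{\alpha^s}F_\bullet(t_s)$ is real.
   Context: $\mathrm{Gr}(k,n)$ is the Grassmannian of $k$-planes in $\mathbb{C}^n$. $\binom{[n]}{k}$ is the set of sequences $1\le\alpha_1<\cdots<\alpha_k\le n$ and $|\alpha|=\sum_j(\alpha_j-j)$. For $t\in\mathbb{C}$, $F_i(t)$ is the span of $\gamma(t),\gamma'(t),\ldots,\gamma^{(i-1)}(t)$ where $\gamma(t)=(1,t,\ldots,t^{n-1})$ (the $i$-plane osculating the rational normal curve), and $F_\bullet(t)$ is the flag $F_1(t)\subset\cdots\subset F_n(t)$. For a flag $F_\bullet$, $X_\alpha F_\bullet=\{K: \dim(K\cap F_{n+1-\alpha_j})\ge k+1-j,\ j=1,\ldots,k\}$, a subvariety of codimension $|\alpha|$. *)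

theory Defs
  imports Complex_Main "HOL-Library.Function_Algebras" "Jordan_Normal_Form.Determinant"
begin

definition cscale :: "complex \<Rightarrow> (nat \<Rightarrow> complex) \<Rightarrow> (nat \<Rightarrow> complex)" where
  "cscale c v = (\<lambda>i. c * v i)"

interpretation cv: vector_space cscale
  by unfold_locales (auto simp: cscale_def fun_eq_iff algebra_simps)

text \<open>C^n: vectors with coordinates 0..n-1 (coordinate i corresponds to entry i+1).\<close>
definition Cn :: "nat \<Rightarrow> (nat \<Rightarrow> complex) set" where
  "Cn n = {v. \<forall>i\<ge>n. v i = 0}"

definition Grass :: "nat \<Rightarrow> nat \<Rightarrow> (nat \<Rightarrow> complex) set set" where
  "Grass k n = {K. cv.subspace K \<and> K \<subseteq> Cn n \<and> cv.dim K = k}"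

text \<open>gamma^(j)(t): the j-th derivative of gamma(t) = (1, t, ..., t^(n-1)); its i-th
  coordinate is d^j/dt^j t^i = i(i-1)...(i-j+1) t^(i-j) (which is 0 when j > i).\<close>
definition gamma_deriv :: "nat \<Rightarrow> nat \<Rightarrow> complex \<Rightarrow> (nat \<Rightarrow> complex)" where
  "gamma_deriv n j t = (\<lambda>i. if i < n then of_nat (\<Prod>m<j. i - m) * t ^ (i - j) else 0)"

definition osc_flag :: "nat \<Rightarrow> nat \<Rightarrow> complex \<Rightarrow> (nat \<Rightarrow> complex) set" where
  "osc_flag n i t = cv.span {gamma_deriv n j t | j. j < i}"

definition schubert_index :: "nat \<Rightarrow> nat \<Rightarrow> nat list set" where
  "schubert_index k n = {a. length a = k \<and> sorted_wrt (<) a \<and> set a \<subseteq> {1..n}}"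

definition schubert_weight :: "nat list \<Rightarrow> nat" where
  "schubert_weight a = (\<Sum>j<length a. a ! j - (j + 1))"

text \<open>X_alpha F(t) (with j 0-based: condition dim(K \<inter> F_{n+1-alpha_(j+1)}) >= k - j).\<close>
definition schubert_var :: "nat \<Rightarrow> nat \<Rightarrow> nat list \<Rightarrow> complex \<Rightarrow> (nat \<Rightarrow> complex) set set" where
  "schubert_var k n a t =
     {K \<in> Grass k n. \<forall>j<k. cv.dim (K \<inter> osc_flag n (n + 1 - a ! j) t) \<ge> k - j}"

definition div_index :: "nat \<Rightarrow> nat list" where
  "div_index k = [1..<k] @ [k + 1]"

text \<open>Local equation of the Schubert divisor X_alpha F(t), alpha = div_index k, in
  Stiefel coordinates: for a basis v_0..v_(k-1) of K,
  f_t(v) = det [v_0; ...; v_(k-1); gamma(t); ...; gamma^(n-k-1)(t)].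
  Its partial derivative with respect to the entry (i,j) of v is the
  determinant with row i replaced by the j-th unit vector.\<close>
definition div_partial ::
  "nat \<Rightarrow> nat \<Rightarrow> complex \<Rightarrow> (nat \<Rightarrow> nat \<Rightarrow> complex) \<Rightarrow> nat \<Rightarrow> nat \<Rightarrow> complex" where
  "div_partial k n t v i j =
     det (mat n n (\<lambda>(r, c). if r < k then (if r = i then (if c = j then 1 else 0) else v r c)
                            else gamma_deriv n (r - k) t c))"

text \<open>Transversality of X_alpha F(t_0) \<inter> ... \<inter> X_alpha F(t_(N-1)), alpha = div_index k,
  N = k(n-k): at every point K of the intersection, for (some) basis of K the
  differentials of the local defining equations are linearly independent.\<close>
definition transverse_div :: "nat \<Rightarrow> nat \<Rightarrow> (nat \<Rightarrow> real) \<Rightarrow> bool" where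
  "transverse_div k n ts \<longleftrightarrow>
     (\<forall>K. (K \<in> Grass k n \<and> (\<forall>l < k * (n - k). K \<in> schubert_var k n (div_index k) (of_real (ts l))))
       \<longrightarrow> (\<exists>v. (\<forall>i<k. v i \<in> K) \<and> cv.independent (v ` {..<k}) \<and> inj_on v {..<k} \<and>
               (\<forall>c::nat \<Rightarrow> complex.
                   (\<forall>i<k. \<forall>j<n. (\<Sum>l < k * (n - k). c l * div_partial k n (of_real (ts l)) v i j) = 0)
                   \<longrightarrow> (\<forall>l < k * (n - k). c l = 0))))"

definition real_point :: "(nat \<Rightarrow> complex) set \<Rightarrow> bool" where
  "real_point K \<longleftrightarrow> (\<forall>v\<in>K. (\<lambda>i. cnj (v i)) \<in> K)"

end

theory Submission
  imports Defs "HOL-Complex_Analysis.Complex_Analysis"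
    "HOL-Computational_Algebra.Fundamental_Theorem_Algebra"
begin

text \<open>
  For a basis $v$ of $K$ let $D_v(z)$ be the determinant of the matrix with rows
  $v_1,\ldots,v_k,\gamma(z),\gamma'(z),\ldots$, a polynomial of degree at most $N = k(n-k)$ that
  depends on $K$ only up to a factor. If $K \in X_\alpha F_\bullet(t)$ then $(z-t)^{|\alpha|}$ divides
  $D_v(z)$, so a point of the intersection is a $K$ all of whose $N$ roots (with multiplicity) are
  the given real numbers, and after a translation they are positive. It remains to see that real
  roots force $K$ to be real.

  For simple roots the hypothesis says that the map from $K$ to its roots is etale, and it is proper,
  so reality of the whole fibre is an open and closed condition along paths of ordered root tuples.
  One real fibre is found for $t_1 \gg t_2 \gg \cdots > 0$: letting the last root tend to $0$
  degenerates a Schubert cell to the cells of one dimension less, each contributing simple real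
  points.

  For multiple roots, suppose that a coordinate $c$ of a point of the fibre has positive imaginary
  part. A nearby point has a nonzero Jacobian $J$ and roots $p_l + i q_l$ with small $q_l$. Consider
  the points over $p_l + w q_l$ with $w$ in a large rectangle above the real axis, and the function
  $|J| \exp(\lambda(\mathrm{Im}\, c - B\, \mathrm{Re}\, h(w)))$ on them, with $B$ a bound for $|c|$
  and $\mathrm{Re}\, h$ nonnegative, and at least $1$ on the sides off the real axis.
  Where $J \ne 0$ it is locally the modulus of a holomorphic function of $w$, and where moreover $w$ is real, $c$ is real. The maximum principle bounds it by $\max |J|$ for every
  $\lambda$, which is impossible at $w = i$ as $\lambda \to \infty$.
\<close>

subsection \<open>Determinants of complex matrices\<close>

text \<open>Repeated roots are the obstacle. The hypothesis speaks of distinct parameters, so over a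
  repeated root the root map need not be locally invertible, and a point there is not visibly a
  limit of points with distinct real roots. Openness of this finite map would give that; here the
  maximum principle takes its place. The factor |J| kills the degenerate points, so that a positive
  maximum sits where a holomorphic branch exists; and since J vanishes as soon as two roots
  coincide, the case of simple roots applies on the real side. The term with h pays for the three
  sides on which nothing but |c| <= B is known. On a rectangle of size rho it costs at most 2 B /
  rho at w = i, and rho may be large because the q_l are small. Positivity of the roots puts K into
  the open cell, where the minor on the last k columns is invertible. Normal forms there have N
  affine coordinates, and D_v(0) is a fixed nonzero constant, so that the values of D_v at N
  distinct nonzero points determine it.\<close>

definition cdet :: "nat \<Rightarrow> (nat \<Rightarrow> nat \<Rightarrow> complex) \<Rightarrow> complex" where
  "cdet n f = Determinant.det (Matrix.mat n n (\<lambda>(r, c). f r c))"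

lemma cdet_leibniz:
  "cdet n f = (\<Sum>p | p permutes {..<n}. of_int (sign p) * (\<Prod>i<n. f i (p i)))"
proof -
  have "(\<Prod>i=0..<n. Matrix.mat n n (\<lambda>(r, c). f r c) $$ (i, p i)) = (\<Prod>i<n. f i (p i))"
    if "p permutes {0..<n}" for p
    using permutes_in_image[OF that] by (intro prod.cong) (auto simp: atLeast0LessThan)
  thus ?thesis
    unfolding cdet_def Determinant.det_def
    by (auto simp: atLeast0LessThan intro!: sum.cong)
qed

lemma cdet_cong: "(\<And>r c. r < n \<Longrightarrow> c < n \<Longrightarrow> f r c = g r c) \<Longrightarrow> cdet n f = cdet n g"
  unfolding cdet_def by (intro arg_cong[where f = Determinant.det] eq_matI) auto

lemma cdet_transpose: "cdet n (\<lambda>r c. f c r) = cdet n f"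
proof -
  have "Matrix.mat n n (\<lambda>(r, c). f c r) = transpose_mat (Matrix.mat n n (\<lambda>(r, c). f r c))"
    by (intro eq_matI) auto
  thus ?thesis unfolding cdet_def by (simp add: Determinant.det_transpose[of _ n])
qed

lemma cdet_mult: "cdet n (\<lambda>r c. \<Sum>s<n. f r s * g s c) = cdet n f * cdet n g"
proof -
  have "Matrix.mat n n (\<lambda>(r, c). \<Sum>s<n. f r s * g s c)
      = Matrix.mat n n (\<lambda>(r, c). f r c) * Matrix.mat n n (\<lambda>(r, c). g r c)"
    by (intro eq_matI) (auto simp: scalar_prod_def atLeast0LessThan)
  thus ?thesis unfolding cdet_def by (simp add: Determinant.det_mult[of _ n])
qed

lemma cdet_right_kernel:
  "cdet n f = 0 \<longleftrightarrow> (\<exists>x. (\<exists>i<n. x i \<noteq> 0) \<and> (\<forall>r<n. (\<Sum>c<n. f r c * x c) = 0))"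
proof -
  let ?A = "Matrix.mat n n (\<lambda>(r, c). f r c)"
  have "cdet n f = 0 \<longleftrightarrow> (\<exists>v. v \<in> carrier_vec n \<and> v \<noteq> 0\<^sub>v n \<and> ?A *\<^sub>v v = 0\<^sub>v n)"
    unfolding cdet_def by (rule det_0_iff_vec_prod_zero) auto
  also have "\<dots> \<longleftrightarrow> (\<exists>x. (\<exists>i<n. x i \<noteq> 0) \<and> (\<forall>r<n. (\<Sum>c<n. f r c * x c) = 0))"
  proof safe
    fix v assume v: "v \<in> carrier_vec n" "v \<noteq> 0\<^sub>v n" "?A *\<^sub>v v = 0\<^sub>v n"
    have "\<exists>i<n. vec_index v i \<noteq> 0"
    proof (rule ccontr)
      assume "\<not> ?thesis"
      hence "v = 0\<^sub>v n" using v by (intro eq_vecI) auto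
      thus False using v by simp
    qed
    moreover have "(\<Sum>c<n. f r c * vec_index v c) = 0" if "r < n" for r
    proof -
      have "vec_index (?A *\<^sub>v v) r = 0" using v(3) that by simp
      thus ?thesis using that v(1) by (simp add: scalar_prod_def atLeast0LessThan)
    qed
    ultimately show "\<exists>x. (\<exists>i<n. x i \<noteq> 0) \<and> (\<forall>r<n. (\<Sum>c<n. f r c * x c) = 0)" by blast
  next
    fix x i assume x: "\<forall>r<n. (\<Sum>c<n. f r c * x c) = 0" "i < n" "x i \<noteq> 0"
    let ?v = "Matrix.vec n x"
    have "?v \<noteq> 0\<^sub>v n" using x by (metis index_vec index_zero_vec(1))
    moreover have "?A *\<^sub>v ?v = 0\<^sub>v n"
      using x(1) by (intro eq_vecI) (auto simp: scalar_prod_def atLeast0LessThan)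
    ultimately show "\<exists>v. v \<in> carrier_vec n \<and> v \<noteq> 0\<^sub>v n \<and> ?A *\<^sub>v v = 0\<^sub>v n"
      by (intro exI[of _ ?v]) auto
  qed
  finally show ?thesis .
qed

lemma cdet_left_kernel:
  "cdet n f = 0 \<longleftrightarrow> (\<exists>x. (\<exists>i<n. x i \<noteq> 0) \<and> (\<forall>c<n. (\<Sum>r<n. x r * f r c) = 0))"
  using cdet_right_kernel[of n "\<lambda>r c. f c r"]
  unfolding cdet_transpose[of n f] by (simp only: mult.commute)

lemma cdet_row_sum:
  assumes "i < n" "finite S"
  shows "cdet n (f(i := \<lambda>c. \<Sum>s\<in>S. a s * g s c)) = (\<Sum>s\<in>S. a s * cdet n (f(i := g s)))"
proof -
  have split: "(\<Prod>j<n. (f(i := h)) j (p j)) = h (p i) * (\<Prod>j\<in>{..<n}-{i}. f j (p j))" for h p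
    using assms(1) by (subst prod.remove[of _ i]) (auto intro!: prod.cong)
  show ?thesis
    unfolding cdet_leibniz split sum_distrib_left sum_distrib_right
    by (subst sum.swap) (simp add: mult_ac)
qed

lemma cdet_row_scale: "cdet n (\<lambda>r c. a r * f r c) = (\<Prod>r<n. a r) * cdet n f"
  unfolding cdet_leibniz sum_distrib_left
  by (simp add: prod.distrib mult_ac)

lemma cdet_col_scale: "cdet n (\<lambda>r c. a c * f r c) = (\<Prod>r<n. a r) * cdet n f"
  using cdet_row_scale[of n a "\<lambda>r c. f c r"] cdet_transpose[of n "\<lambda>r c. a c * f r c"]
  unfolding cdet_transpose[of n f] by simp

lemma cdet_identical_rows:
  assumes "i < n" "j < n" "i \<noteq> j" "\<And>c. c < n \<Longrightarrow> f i c = f j c"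
  shows "cdet n f = 0"
  unfolding cdet_def
  by (rule Determinant.det_identical_rows[of _ n i j]) (use assms in \<open>auto intro!: eq_vecI\<close>)

lemma cdet_lower_triangular:
  assumes "\<And>i j. i < j \<Longrightarrow> j < n \<Longrightarrow> f i j = 0"
  shows "cdet n f = (\<Prod>i<n. f i i)"
proof -
  have "cdet n f = prod_list (diag_mat (Matrix.mat n n (\<lambda>(r, c). f r c)))"
    unfolding cdet_def by (rule det_lower_triangular[of n]) (use assms in auto)
  also have "diag_mat (Matrix.mat n n (\<lambda>(r, c). f r c)) = map (\<lambda>i. f i i) [0..<n]"
    unfolding diag_mat_def by (auto intro!: map_cong)
  also have "prod_list \<dots> = (\<Prod>i<n. f i i)"
    by (subst prod.distinct_set_conv_list[symmetric]) (auto simp: atLeast0LessThan)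
  finally show ?thesis .
qed

lemma cdet_inverse:
  assumes "cdet n f \<noteq> 0"
  obtains g where "\<And>r c. r < n \<Longrightarrow> c < n \<Longrightarrow> (\<Sum>s<n. f r s * g s c) = (if r = c then 1 else 0)"
    and "\<And>r c. r < n \<Longrightarrow> c < n \<Longrightarrow> (\<Sum>s<n. g r s * f s c) = (if r = c then 1 else 0)"
proof -
  let ?A = "Matrix.mat n n (\<lambda>(r, c). f r c)"
  let ?B = "adj_mat ?A"
  have A: "?A \<in> carrier_mat n n" by simp
  note adj = adj_mat[OF A]
  define g where "g s c = ?B $$ (s, c) / cdet n f" for s c
  have B: "dim_row ?B = n" "dim_col ?B = n" using adj(1) by auto
  have "(\<Sum>s<n. f r s * ?B $$ (s, c)) = (if r = c then cdet n f else 0)" if "r < n" "c < n" for r c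
  proof -
    have "(?A * ?B) $$ (r, c) = (Determinant.det ?A \<cdot>\<^sub>m 1\<^sub>m n) $$ (r, c)" using adj(2) by simp
    thus ?thesis using that B by (simp add: scalar_prod_def atLeast0LessThan cdet_def)
  qed
  hence 1: "(\<Sum>s<n. f r s * g s c) = (if r = c then 1 else 0)" if "r < n" "c < n" for r c
    unfolding g_def using that assms by (simp add: sum_divide_distrib[symmetric])
  have "(\<Sum>s<n. ?B $$ (r, s) * f s c) = (if r = c then cdet n f else 0)" if "r < n" "c < n" for r c
  proof -
    have "(?B * ?A) $$ (r, c) = (Determinant.det ?A \<cdot>\<^sub>m 1\<^sub>m n) $$ (r, c)" using adj(3) by simp
    thus ?thesis using that B by (simp add: scalar_prod_def atLeast0LessThan cdet_def)
  qed
  hence 2: "(\<Sum>s<n. g r s * f s c) = (if r = c then 1 else 0)" if "r < n" "c < n" for r c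
    unfolding g_def using that assms by (simp add: sum_divide_distrib[symmetric])
  show ?thesis using that 1 2 by blast
qed

lemma cdet_cramer:
  assumes "\<And>r. r < n \<Longrightarrow> (\<Sum>c<n. f r c * x c) = y r" and "a < n"
  shows "x a * cdet n f = cdet n (\<lambda>r c. if c = a then y r else f r c)"
proof -
  define h where "h = (\<lambda>r c. f c r)"
  have "cdet n (\<lambda>r c. if c = a then y r else f r c) = cdet n (h(a := \<lambda>c. \<Sum>s<n. x s * h s c))"
    by (subst cdet_transpose[symmetric], rule cdet_cong)
      (auto simp: h_def assms(1)[symmetric] mult.commute)
  also have "\<dots> = (\<Sum>s<n. x s * cdet n (h(a := h s)))"
    using assms(2) by (rule cdet_row_sum) auto
  also have "\<dots> = (\<Sum>s<n. if s = a then x a * cdet n h else 0)"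
  proof (rule sum.cong)
    fix s assume "s \<in> {..<n}"
    moreover have "cdet n (h(a := h s)) = 0" if "s \<noteq> a" "s < n"
      by (rule cdet_identical_rows[of s _ a]) (use that assms in auto)
    ultimately show "x s * cdet n (h(a := h s)) = (if s = a then x a * cdet n h else 0)" by auto
  qed auto
  also have "\<dots> = x a * cdet n h" using assms(2) by simp
  also have "cdet n h = cdet n f" unfolding h_def by (rule cdet_transpose)
  finally show ?thesis ..
qed

lemma permutes_less: "p permutes {..<n} \<Longrightarrow> i < n \<Longrightarrow> p i < (n::nat)"
  using permutes_in_image[of p "{..<n}" i] by simp

lemma tendsto_cdet:
  assumes "\<And>r c. r < n \<Longrightarrow> c < n \<Longrightarrow> ((\<lambda>x. f x r c) \<longlongrightarrow> g r c) F"
  shows "((\<lambda>x. cdet n (f x)) \<longlongrightarrow> cdet n g) F"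
  unfolding cdet_leibniz
proof (intro tendsto_sum tendsto_mult tendsto_const tendsto_prod)
  fix p i assume "p \<in> {p. p permutes {..<n}}" "i \<in> {..<n}"
  thus "((\<lambda>x. f x i (p i)) \<longlongrightarrow> g i (p i)) F"
    by (intro assms) (auto intro: permutes_less)
qed

lemma holomorphic_on_cdet:
  assumes "\<And>r c. r < n \<Longrightarrow> c < n \<Longrightarrow> (\<lambda>x. f x r c) holomorphic_on S"
  shows "(\<lambda>x. cdet n (f x)) holomorphic_on S"
  unfolding cdet_leibniz
proof (intro holomorphic_on_sum holomorphic_on_mult holomorphic_on_const holomorphic_on_prod)
  fix p i assume "p \<in> {p. p permutes {..<n}}" "i \<in> {..<n}"
  thus "(\<lambda>x. f x i (p i)) holomorphic_on S"
    by (intro assms) (auto intro: permutes_less)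
qed

subsection \<open>Square systems of equations\<close>

lemma tendsto_fun_iff:
  fixes f :: "'a \<Rightarrow> 'i \<Rightarrow> 'b::topological_space"
  shows "(f \<longlongrightarrow> l) F \<longleftrightarrow> (\<forall>i. ((\<lambda>x. f x i) \<longlongrightarrow> l i) F)"
proof -
  have "(f \<longlongrightarrow> l) F \<longleftrightarrow> limitin (product_topology (\<lambda>i. euclidean) UNIV) f l F"
    by (simp add: euclidean_product_topology)
  thus ?thesis by (simp add: limitin_componentwise)
qed

text \<open>Coordinates from \<open>m\<close> on are frozen, so that a closed polydisc is compact in
  the product topology of the whole function space.\<close>

definition polydisc :: "nat \<Rightarrow> (nat \<Rightarrow> complex) \<Rightarrow> real \<Rightarrow> (nat \<Rightarrow> complex) set" where
  "polydisc m c r = {x. (\<forall>a<m. dist (x a) (c a) \<le> r) \<and> (\<forall>a\<ge>m. x a = c a)}"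

lemma compact_polydisc: "compact (polydisc m c r)"
proof -
  have "polydisc m c r = PiE UNIV (\<lambda>a. if a < m then cball (c a) r else {c a})"
    by (auto simp: polydisc_def PiE_def Pi_def dist_commute not_less split: if_splits)
  moreover have "compactin (product_topology (\<lambda>i. euclidean) UNIV)
      (PiE UNIV (\<lambda>a. if a < m then cball (c a) r else {c a}))"
    by (subst compactin_PiE) auto
  ultimately show ?thesis by (simp add: euclidean_product_topology)
qed

text \<open>Otherwise points outside \<open>V\<close>, taken from smaller and smaller polydiscs,
  would converge coordinatewise to \<open>c\<close>.\<close>

lemma polydisc_subset_open:
  assumes "open V" "c \<in> V"
  obtains r where "r > 0" "polydisc m c r \<subseteq> V"
proof (rule ccontr)
  assume "\<not> thesis"
  hence "\<exists>x. x \<in> polydisc m c (1 / real (Suc j)) \<and> x \<notin> V" for j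
    using that[of "1 / real (Suc j)"] by auto
  then obtain x where x: "\<And>j. x j \<in> polydisc m c (1 / real (Suc j))" "\<And>j. x j \<notin> V" by metis
  have "x \<longlonglongrightarrow> c"
    unfolding tendsto_fun_iff
  proof
    fix i show "(\<lambda>j. x j i) \<longlonglongrightarrow> c i"
    proof (cases "i < m")
      case True
      have "dist (x j i) (c i) \<le> 1 / real (Suc j)" for j
        using x(1)[of j] True unfolding polydisc_def by blast
      moreover have "(\<lambda>j. 1 / real (Suc j)) \<longlonglongrightarrow> 0"
        using LIMSEQ_inverse_real_of_nat by (simp add: inverse_eq_divide)
      ultimately have "(\<lambda>j. dist (x j i) (c i)) \<longlonglongrightarrow> 0"
        by - (rule tendsto_sandwich[where f = "\<lambda>_. 0" and h = "\<lambda>j. 1 / real (Suc j)"]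
          , simp_all)
      thus ?thesis by (rule tendsto_dist_iff[THEN iffD2])
    next
      case False
      hence "x j i = c i" for j using x(1)[of j] unfolding polydisc_def by (simp add: not_less)
      thus ?thesis by simp
    qed
  qed
  hence "eventually (\<lambda>j. x j \<in> V) sequentially" using assms by (rule topological_tendstoD)
  thus False using x(2) by (auto simp: eventually_sequentially)
qed

text \<open>\<open>m\<close> equations in \<open>m\<close> unknowns \<open>c\<close> with a
  parameter \<open>t\<close>. The divided differences \<open>A\<close> stand in for
  differentiability: on the diagonal \<open>c = c'\<close> they form the Jacobian matrix, and their
  continuity together with a nonzero determinant \<open>D\<close> yields uniqueness, existence and
  holomorphy of local solutions.\<close>

locale square_system =
  fixes m :: nat
    and G :: "nat \<Rightarrow> 't::metric_space \<Rightarrow> (nat \<Rightarrow> complex) \<Rightarrow> complex"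
    and A :: "nat \<Rightarrow> 't \<Rightarrow> (nat \<Rightarrow> complex) \<Rightarrow> (nat \<Rightarrow> complex) \<Rightarrow> nat \<Rightarrow> complex"
  assumes hadamard: "\<And>l t c c'. l < m \<Longrightarrow> G l t c' - G l t c = (\<Sum>a<m. A l t c c' a * (c' a - c a))"
    and continuous_G: "\<And>l. l < m \<Longrightarrow> continuous_on UNIV (\<lambda>(t, c). G l t c)"
    and continuous_A: "\<And>l a. l < m \<Longrightarrow> a < m \<Longrightarrow> continuous_on UNIV (\<lambda>(t, c, c'). A l t c c' a)"
begin

definition D :: "'t \<Rightarrow> (nat \<Rightarrow> complex) \<Rightarrow> (nat \<Rightarrow> complex) \<Rightarrow> complex" where
  "D t c c' = cdet m (\<lambda>l a. A l t c c' a)"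

lemma tendsto_G:
  assumes "l < m" "(t \<longlongrightarrow> t0) F" "(c \<longlongrightarrow> c0) F"
  shows "((\<lambda>x. G l (t x) (c x)) \<longlongrightarrow> G l t0 c0) F"
proof -
  have "isCont (\<lambda>(t, c). G l t c) (t0, c0)"
    using continuous_G[OF assms(1)] by (simp add: continuous_on_eq_continuous_at)
  from isCont_tendsto_compose[OF this tendsto_Pair[OF assms(2,3)]] show ?thesis by simp
qed

lemma tendsto_A:
  assumes "l < m" "a < m" "(t \<longlongrightarrow> t0) F" "(c \<longlongrightarrow> c0) F" "(c' \<longlongrightarrow> c0') F"
  shows "((\<lambda>x. A l (t x) (c x) (c' x) a) \<longlongrightarrow> A l t0 c0 c0' a) F"
proof -
  have "isCont (\<lambda>(t, c, c'). A l t c c' a) (t0, c0, c0')"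
    using continuous_A[OF assms(1,2)] by (simp add: continuous_on_eq_continuous_at)
  from isCont_tendsto_compose[OF this tendsto_Pair[OF assms(3) tendsto_Pair[OF assms(4,5)]]]
  show ?thesis by simp
qed

lemma tendsto_D:
  assumes "(t \<longlongrightarrow> t0) F" "(c \<longlongrightarrow> c0) F" "(c' \<longlongrightarrow> c0') F"
  shows "((\<lambda>x. D (t x) (c x) (c' x)) \<longlongrightarrow> D t0 c0 c0') F"
  unfolding D_def by (intro tendsto_cdet tendsto_A assms)

text \<open>The difference of two points with equal values lies in the kernel of the matrix of
  divided differences.\<close>

lemma solution_unique:
  assumes "D t c c' \<noteq> 0" "\<And>l. l < m \<Longrightarrow> G l t c = G l t c'" "a < m"
  shows "c a = c' a"
proof (rule ccontr)
  assume "c a \<noteq> c' a"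
  hence "\<exists>x. (\<exists>i<m. x i \<noteq> 0) \<and> (\<forall>r<m. (\<Sum>i<m. A r t c c' i * x i) = 0)"
    using assms(2,3) by (intro exI[of _ "\<lambda>a. c' a - c a"]) (auto simp: hadamard[symmetric])
  hence "D t c c' = 0" unfolding D_def by (subst cdet_right_kernel)
  thus False using assms(1) by simp
qed

text \<open>Applied later with \<open>c'\<close> the complex conjugate of \<open>c\<close>: near a
  nondegenerate real solution the solutions for real parameters are real.\<close>

lemma locally_injective:
  assumes "(t \<longlongrightarrow> t0) F" "(c \<longlongrightarrow> c0) F" "(c' \<longlongrightarrow> c0) F" "D t0 c0 c0 \<noteq> 0"
  shows "eventually (\<lambda>x. (\<forall>l<m. G l (t x) (c x) = G l (t x) (c' x)) \<longrightarrow> (\<forall>a<m. c x a = c' x a)) F"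
proof -
  have "eventually (\<lambda>x. D (t x) (c x) (c' x) \<noteq> 0) F"
    using tendsto_D[OF assms(1-3)] assms(4) by (rule tendsto_imp_eventually_ne)
  thus ?thesis by eventually_elim (use solution_unique in blast)
qed

text \<open>A short Newton step from \<open>c\<close> would lower the sum of the norms, so a
  positive minimum cannot be interior.\<close>

lemma interior_minimum_imp_zero:
  assumes D: "D t c c \<noteq> 0"
    and min: "\<And>x. x \<in> polydisc m c0 r \<Longrightarrow> (\<Sum>l<m. norm (G l t c)) \<le> (\<Sum>l<m. norm (G l t x))"
    and c: "\<And>a. a < m \<Longrightarrow> dist (c a) (c0 a) < r" "\<And>a. a \<ge> m \<Longrightarrow> c a = c0 a"
  shows "\<forall>l<m. G l t c = 0"
proof (rule ccontr)
  assume "\<not> ?thesis"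
  then obtain l0 where l0: "l0 < m" "G l0 t c \<noteq> 0" by auto
  define f where "f = (\<Sum>l<m. norm (G l t c))"
  have "f \<ge> norm (G l0 t c)"
    unfolding f_def using l0(1) by (intro member_le_sum) auto
  hence fpos: "f > 0" using l0(2) by (smt (verit) zero_less_norm_iff)
  obtain g where g: "\<And>r c'. r < m \<Longrightarrow> c' < m \<Longrightarrow> (\<Sum>s<m. A r t c c s * g s c') = (if r = c' then 1 else 0)"
    using D unfolding D_def by (rule cdet_inverse) blast
  \<comment> \<open>The Newton direction: along it \<open>G\<close> changes by \<open>- G\<close> to
    first order.\<close>
  define h where "h a = (if a < m then - (\<Sum>l<m. g a l * G l t c) else 0)" for a
  have h: "(\<Sum>a<m. A l t c c a * h a) = - G l t c" if "l < m" for l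
  proof -
    have "(\<Sum>a<m. A l t c c a * h a) = - (\<Sum>a<m. \<Sum>l'<m. A l t c c a * g a l' * G l' t c)"
      by (simp add: h_def sum_distrib_left sum_negf mult_ac)
    also have "(\<Sum>a<m. \<Sum>l'<m. A l t c c a * g a l' * G l' t c)
        = (\<Sum>l'<m. (\<Sum>a<m. A l t c c a * g a l') * G l' t c)"
      by (subst sum.swap) (simp add: sum_distrib_right)
    also have "\<dots> = (\<Sum>l'<m. if l = l' then G l' t c else 0)"
      by (intro sum.cong) (auto simp: g that)
    finally show ?thesis using that by simp
  qed
  define x where "x s = (\<lambda>a. c a + of_real s * h a)" for s :: real
  have x_lim: "(x \<longlongrightarrow> c) (at_right 0)"
    unfolding tendsto_fun_iff x_def by (auto intro!: tendsto_eq_intros)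
  \<comment> \<open>The error of the step, due to the change of \<open>A\<close> between
    \<open>c\<close> and \<open>x s\<close>. After a step of length \<open>s\<close> the value is
    \<open>(1 - s) * G + s * R\<close>, and \<open>R\<close> tends to 0.\<close>
  define R where "R l s = (\<Sum>a<m. (A l t c (x s) a - A l t c c a) * h a)" for l and s :: real
  have "((\<lambda>s. \<Sum>l<m. norm (R l s)) \<longlongrightarrow> (\<Sum>l<m. norm (\<Sum>a<m. (A l t c c a - A l t c c a) * h a))) (at_right 0)"
    unfolding R_def by (intro tendsto_intros tendsto_A x_lim) auto
  hence "((\<lambda>s. \<Sum>l<m. norm (R l s)) \<longlongrightarrow> 0) (at_right 0)" by simp
  hence ev1: "eventually (\<lambda>s. (\<Sum>l<m. norm (R l s)) < f) (at_right 0)"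
    using fpos by (rule order_tendstoD)
  have ev2: "eventually (\<lambda>s. \<forall>a\<in>{..<m}. dist (x s a) (c0 a) < r) (at_right 0)"
  proof (intro eventually_ball_finite ballI)
    fix a assume a: "a \<in> {..<m}"
    have "((\<lambda>s. dist (x s a) (c0 a)) \<longlongrightarrow> dist (c a) (c0 a)) (at_right 0)"
      using x_lim unfolding tendsto_fun_iff by (intro tendsto_intros) auto
    thus "eventually (\<lambda>s. dist (x s a) (c0 a) < r) (at_right 0)"
      by (rule order_tendstoD) (use c(1) a in auto)
  qed auto
  have ev3: "eventually (\<lambda>s::real. s > 0 \<and> s < 1) (at_right 0)"
    using eventually_at_right_less[of "0::real"] eventually_at_right_real[of 0 1]
    by (auto elim: eventually_elim2)
  obtain s where s: "(\<Sum>l<m. norm (R l s)) < f" "\<forall>a\<in>{..<m}. dist (x s a) (c0 a) < r" "0 < s" "s < 1"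
    using eventually_happens[OF eventually_conj[OF ev1 eventually_conj[OF ev2 ev3]]] by auto
  have "x s \<in> polydisc m c0 r"
    using s(2) c(2) by (auto simp: polydisc_def x_def h_def intro: less_imp_le)
  from min[OF this] have "f \<le> (\<Sum>l<m. norm (G l t (x s)))" unfolding f_def .
  also have "\<dots> \<le> (\<Sum>l<m. (1 - s) * norm (G l t c) + s * norm (R l s))"
  proof (rule sum_mono)
    fix l assume l: "l \<in> {..<m}"
    have "G l t (x s) = G l t c + (\<Sum>a<m. A l t c (x s) a * (x s a - c a))"
      using hadamard[of l t "x s" c] l by (simp add: algebra_simps)
    also have "(\<Sum>a<m. A l t c (x s) a * (x s a - c a)) = of_real s * (R l s + (\<Sum>a<m. A l t c c a * h a))"
      by (simp add: x_def R_def sum_distrib_left algebra_simps flip: sum.distrib)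
    also have "(\<Sum>a<m. A l t c c a * h a) = - G l t c" using h l by simp
    also have "G l t c + of_real s * (R l s + - G l t c) = of_real (1 - s) * G l t c + of_real s * R l s"
      by (simp add: algebra_simps)
    finally show "norm (G l t (x s)) \<le> (1 - s) * norm (G l t c) + s * norm (R l s)"
      using s(3,4) norm_triangle_ineq[of "of_real (1 - s) * G l t c" "of_real s * R l s"]
      by (simp add: norm_mult del: of_real_diff)
  qed
  also have "\<dots> = (1 - s) * f + s * (\<Sum>l<m. norm (R l s))"
    by (simp add: f_def sum.distrib sum_distrib_left)
  also have "\<dots> < (1 - s) * f + s * f" using s by simp
  finally show False by (simp add: algebra_simps)
qed

lemma nondegenerate_neighbourhood:
  assumes "D t0 c0 c0 \<noteq> 0"
  obtains U r where "open U" "t0 \<in> U" "r > 0"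
    "\<And>t c c'. t \<in> U \<Longrightarrow> c \<in> polydisc m c0 r \<Longrightarrow> c' \<in> polydisc m c0 r \<Longrightarrow> D t c c' \<noteq> 0"
proof -
  have "((\<lambda>x. D (fst x) (fst (snd x)) (snd (snd x))) \<longlongrightarrow> D t0 c0 c0) (nhds (t0, c0, c0))"
    by (rule tendsto_D) (auto intro!: tendsto_eq_intros filterlim_ident)
  hence "eventually (\<lambda>x. D (fst x) (fst (snd x)) (snd (snd x)) \<noteq> 0) (nhds (t0, c0, c0))"
    using assms by (rule tendsto_imp_eventually_ne)
  then obtain S where S: "open S" "(t0, c0, c0) \<in> S" "\<And>x. x \<in> S \<Longrightarrow> D (fst x) (fst (snd x)) (snd (snd x)) \<noteq> 0"
    unfolding eventually_nhds by auto
  obtain U V where U: "open U" "open V" "t0 \<in> U" "(c0, c0) \<in> V" "U \<times> V \<subseteq> S"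
    using S(1,2) by (rule open_prod_elim) auto
  obtain V1 V2 where V: "open V1" "open V2" "c0 \<in> V1" "c0 \<in> V2" "V1 \<times> V2 \<subseteq> V"
    using U(2,4) by (rule open_prod_elim) auto
  obtain r where r: "r > 0" "polydisc m c0 r \<subseteq> V1 \<inter> V2"
    using polydisc_subset_open[of "V1 \<inter> V2" c0 m] V by auto
  show ?thesis
  proof (rule that[OF U(1,3) r(1)])
    fix t c c' assume "t \<in> U" "c \<in> polydisc m c0 r" "c' \<in> polydisc m c0 r"
    hence "(c, c') \<in> V" "t \<in> U" using r(2) V(5) by blast+
    hence "(t, c, c') \<in> S" using U(5) by blast
    from S(3)[OF this] show "D t c c' \<noteq> 0" by simp
  qed
qed

text \<open>The existence half of the implicit function theorem, by minimising the sum of the norms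
  over a compact polydisc. As \<open>t\<close> tends to \<open>t0\<close>, minimisers accumulate at
  a solution for \<open>t0\<close>, which is \<open>c0\<close> by uniqueness; hence they are
  eventually interior and are solutions.\<close>

lemma solution_persists:
  assumes D: "D t0 c0 c0 \<noteq> 0" and sol: "\<And>l. l < m \<Longrightarrow> G l t0 c0 = 0" and "e > 0"
  shows "eventually (\<lambda>t. \<exists>c. (\<forall>a<m. dist (c a) (c0 a) < e) \<and> (\<forall>a\<ge>m. c a = c0 a) \<and> (\<forall>l<m. G l t c = 0)) (nhds t0)"
proof -
  define P where "P t \<longleftrightarrow> (\<exists>c. (\<forall>a<m. dist (c a) (c0 a) < e) \<and> (\<forall>a\<ge>m. c a = c0 a) \<and> (\<forall>l<m. G l t c = 0))" for t
  \<comment> \<open>Written as a filter within \<open>UNIV\<close> so that the claim can be tested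
    on sequences \<open>t\<close>.\<close>
  have "eventually P (inf (nhds t0) (principal UNIV))"
  proof (rule sequentially_imp_eventually_nhds_within, intro allI impI, elim conjE)
  fix t assume t: "t \<longlonglongrightarrow> t0"
  obtain U r0 where Ur: "open U" "t0 \<in> U" "r0 > 0"
    "\<And>t c c'. t \<in> U \<Longrightarrow> c \<in> polydisc m c0 r0 \<Longrightarrow> c' \<in> polydisc m c0 r0 \<Longrightarrow> D t c c' \<noteq> 0"
    using nondegenerate_neighbourhood[OF D] by metis
  define r where "r = min r0 (e / 2)"
  have r: "r > 0" "r < e" "r \<le> r0" using Ur(3) assms(3) by (auto simp: r_def)
  hence sub: "polydisc m c0 r \<subseteq> polydisc m c0 r0" by (fastforce simp: polydisc_def)
  have c0in: "c0 \<in> polydisc m c0 r" using r by (auto simp: polydisc_def)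
  define f where "f t c = (\<Sum>l<m. norm (G l t c))" for t c
  have cont_fun: "((\<lambda>x. f (a x) (b x)) \<longlongrightarrow> f a0 b0) F" if "(a \<longlongrightarrow> a0) F" "(b \<longlongrightarrow> b0) F" for a b a0 b0 and F :: "(nat \<Rightarrow> complex) filter"
    unfolding f_def by (intro tendsto_intros tendsto_G that) auto
  have cont_seq: "((\<lambda>x. f (a x) (b x)) \<longlongrightarrow> f a0 b0) F" if "(a \<longlongrightarrow> a0) F" "(b \<longlongrightarrow> b0) F" for a b a0 b0 and F :: "nat filter"
    unfolding f_def by (intro tendsto_intros tendsto_G that) auto
  have "\<exists>c\<in>polydisc m c0 r. \<forall>x\<in>polydisc m c0 r. f (t j) c \<le> f (t j) x" for j
  proof (rule continuous_attains_inf[OF compact_polydisc])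
    show "polydisc m c0 r \<noteq> {}" using c0in by auto
    show "continuous_on (polydisc m c0 r) (f (t j))"
      unfolding continuous_on_def
      by (auto intro!: cont_fun tendsto_const tendsto_ident_at)
  qed
  then obtain c where c: "\<And>j. c j \<in> polydisc m c0 r" "\<And>j x. x \<in> polydisc m c0 r \<Longrightarrow> f (t j) (c j) \<le> f (t j) x"
    by metis
  show "eventually (\<lambda>j. P (t j)) sequentially"
  proof (rule ccontr)
    assume "\<not> ?thesis"
    hence "frequently (\<lambda>j. \<not> P (t j)) sequentially"
      by (simp add: frequently_def)
    hence "infinite {j. \<not> P (t j)}"
      using INFM_iff_infinite cofinite_eq_sequentially by metis
    then obtain \<phi> :: "nat \<Rightarrow> nat" where \<phi>: "strict_mono \<phi>" "\<And>j. \<not> P (t (\<phi> j))"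
      using infinite_enumerate[of "{j. \<not> P (t j)}"] by auto
    obtain c1 \<psi> where \<psi>: "c1 \<in> polydisc m c0 r" "strict_mono \<psi>" "((c \<circ> \<phi>) \<circ> \<psi>) \<longlonglongrightarrow> c1"
      using compact_polydisc[of m c0 r, unfolded compact_eq_seq_compact_metric seq_compact_def, rule_format, of "c \<circ> \<phi>"] c(1)
      by auto
    have lim_c: "(\<lambda>j. c (\<phi> (\<psi> j))) \<longlonglongrightarrow> c1" using \<psi>(3) by (simp add: o_def)
    have lim_t: "(\<lambda>j. t (\<phi> (\<psi> j))) \<longlonglongrightarrow> t0"
      using LIMSEQ_subseq_LIMSEQ[OF t strict_mono_o[OF \<phi>(1) \<psi>(2)]] by (simp add: o_def)
    have "f t0 c1 \<le> f t0 c0"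
      by (rule LIMSEQ_le[OF cont_seq[OF lim_t lim_c] cont_seq[OF lim_t tendsto_const]]) (use c(2) c0in in auto)
    also have "f t0 c0 = 0" by (simp add: f_def sol)
    finally have "f t0 c1 = 0" by (simp add: f_def sum_nonneg order_antisym)
    hence G1: "\<forall>l<m. G l t0 c1 = 0" by (simp add: f_def sum_nonneg_eq_0_iff)
    have eq: "c1 a = c0 a" if "a < m" for a
    proof (rule solution_unique[of t0 c1 c0, OF Ur(4)[OF Ur(2)]])
      show "c1 \<in> polydisc m c0 r0" "c0 \<in> polydisc m c0 r0" using \<psi>(1) c0in sub by auto
    qed (use G1 sol that in auto)
    have "eventually (\<lambda>j. \<forall>a\<in>{..<m}. dist (c (\<phi> (\<psi> j)) a) (c0 a) < r) sequentially"
    proof (intro eventually_ball_finite ballI)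
      fix a assume a: "a \<in> {..<m}"
      have "(\<lambda>j. dist (c (\<phi> (\<psi> j)) a) (c0 a)) \<longlonglongrightarrow> dist (c1 a) (c0 a)"
        using lim_c unfolding tendsto_fun_iff by (intro tendsto_intros) auto
      thus "eventually (\<lambda>j. dist (c (\<phi> (\<psi> j)) a) (c0 a) < r) sequentially"
        by (rule order_tendstoD) (use eq a r in auto)
    qed auto
    moreover have "eventually (\<lambda>j. t (\<phi> (\<psi> j)) \<in> U) sequentially"
      using lim_t Ur(1,2) by (rule topological_tendstoD)
    ultimately have "eventually (\<lambda>j. (\<forall>a\<in>{..<m}. dist (c (\<phi> (\<psi> j)) a) (c0 a) < r) \<and> t (\<phi> (\<psi> j)) \<in> U) sequentially"
      by (rule eventually_conj)
    then obtain j where j: "\<forall>a\<in>{..<m}. dist (c (\<phi> (\<psi> j)) a) (c0 a) < r" "t (\<phi> (\<psi> j)) \<in> U"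
      by (auto dest: eventually_happens)
    let ?c = "c (\<phi> (\<psi> j))" and ?t = "t (\<phi> (\<psi> j))"
    have oc: "?c a = c0 a" if "a \<ge> m" for a using c(1)[of "\<phi> (\<psi> j)"] that by (auto simp: polydisc_def)
    have "\<forall>l<m. G l ?t ?c = 0"
    proof (rule interior_minimum_imp_zero)
      show "D ?t ?c ?c \<noteq> 0" using Ur(4)[OF j(2)] sub c(1) by blast
      show "(\<Sum>l<m. norm (G l ?t ?c)) \<le> (\<Sum>l<m. norm (G l ?t x))" if "x \<in> polydisc m c0 r" for x
        using c(2)[OF that] by (simp add: f_def)
    qed (use j(1) oc in auto)
    moreover have "\<forall>a<m. dist (?c a) (c0 a) < e" using j(1) r(2) by force
    ultimately have "P ?t" unfolding P_def using oc by blast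
    thus False using \<phi>(2) by blast
  qed
  qed
  thus ?thesis by (simp add: P_def[abs_def])
qed

text \<open>\<open>G\<close> is only assumed holomorphic in the parameter for fixed
  \<open>c\<close>. The derivative of the branch comes from Cramer's rule for its difference
  quotients, whose coefficient matrix is \<open>A\<close> between the two points of the
  branch.\<close>

lemma holomorphic_branch:
  fixes \<tau> :: "complex \<Rightarrow> 't"
  assumes cont: "continuous_on UNIV \<tau>"
    and hol: "\<And>l c. l < m \<Longrightarrow> (\<lambda>w. G l (\<tau> w) c) holomorphic_on UNIV"
    and D: "D (\<tau> w0) c0 c0 \<noteq> 0" and sol: "\<And>l. l < m \<Longrightarrow> G l (\<tau> w0) c0 = 0"
  obtains r \<gamma> where "r > 0" "\<gamma> w0 = c0" "\<And>a. (\<lambda>w. \<gamma> w a) holomorphic_on ball w0 r"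
    "\<And>w l. w \<in> ball w0 r \<Longrightarrow> l < m \<Longrightarrow> G l (\<tau> w) (\<gamma> w) = 0"
    "\<And>w a. w \<in> ball w0 r \<Longrightarrow> a \<ge> m \<Longrightarrow> \<gamma> w a = c0 a"
proof -
  have \<tau>: "(\<tau> \<longlongrightarrow> \<tau> w) (nhds w)" for w
    using cont by (simp add: continuous_on_eq_continuous_at isCont_def tendsto_at_iff_tendsto_nhds)
  obtain U r1 where Ur: "open U" "\<tau> w0 \<in> U" "r1 > 0"
    "\<And>t c c'. t \<in> U \<Longrightarrow> c \<in> polydisc m c0 r1 \<Longrightarrow> c' \<in> polydisc m c0 r1 \<Longrightarrow> D t c c' \<noteq> 0"
    using nondegenerate_neighbourhood[OF D] by metis
  define P where "P w c \<longleftrightarrow> (\<forall>a<m. dist (c a) (c0 a) < r1) \<and> (\<forall>a\<ge>m. c a = c0 a) \<and> (\<forall>l<m. G l (\<tau> w) c = 0)" for w c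
  have Pd: "c \<in> polydisc m c0 r1" if "P w c" for w c
    using that by (auto simp: P_def polydisc_def intro: less_imp_le)
  have "eventually (\<lambda>w. \<exists>c. P w c) (nhds w0)"
    unfolding P_def by (rule eventually_compose_filterlim[OF solution_persists[OF D sol Ur(3)] \<tau>])
  moreover have "eventually (\<lambda>w. \<tau> w \<in> U) (nhds w0)"
    using \<tau> Ur(1,2) by (rule topological_tendstoD)
  ultimately have "eventually (\<lambda>w. (\<exists>c. P w c) \<and> \<tau> w \<in> U) (nhds w0)"
    by (rule eventually_conj)
  then obtain r where r: "r > 0" "\<And>w. w \<in> ball w0 r \<Longrightarrow> (\<exists>c. P w c) \<and> \<tau> w \<in> U"
    unfolding eventually_nhds_metric by (auto simp: dist_commute)
  define \<gamma> where "\<gamma> w = (SOME c. P w c)" for w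
  have P\<gamma>: "P w (\<gamma> w)" if "w \<in> ball w0 r" for w
    unfolding \<gamma>_def using r(2)[OF that] someI_ex[of "P w"] by blast
  have uniq: "c = c'" if "P w c" "P w c'" "w \<in> ball w0 r" for w c c'
  proof
    fix a
    have "D (\<tau> w) c c' \<noteq> 0" using Ur(4)[OF _ Pd[OF that(1)] Pd[OF that(2)]] r(2)[OF that(3)] by blast
    hence "a < m \<Longrightarrow> c a = c' a" by (rule solution_unique) (use that in \<open>auto simp: P_def\<close>)
    thus "c a = c' a" using that by (cases "a < m") (auto simp: P_def)
  qed
  have \<gamma>0: "\<gamma> w0 = c0"
    by (rule uniq[of w0]) (use r P\<gamma> sol Ur(3) in \<open>auto simp: P_def\<close>)
  have D\<gamma>: "D (\<tau> w) (\<gamma> w) (\<gamma> w) \<noteq> 0" if "w \<in> ball w0 r" for w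
    using Ur(4) Pd[OF P\<gamma>[OF that]] r(2)[OF that] by blast
  have cont\<gamma>: "(\<gamma> \<longlongrightarrow> \<gamma> w) (at w)" if w: "w \<in> ball w0 r" for w
    unfolding tendsto_fun_iff
  proof (rule allI, rule tendstoI)
    fix a and e :: real assume e: "e > 0"
    \<comment> \<open>Also below the distance of \<open>\<gamma> w\<close> to the boundary of the
      polydisc, so that the solution found nearby stays in the region of uniqueness and must be
      \<open>\<gamma> w'\<close>.\<close>
    define e1 where "e1 = Min (insert e ((\<lambda>a. r1 - dist (\<gamma> w a) (c0 a)) ` {..<m}))"
    have e1: "e1 > 0" "e1 \<le> e" "\<And>a. a < m \<Longrightarrow> e1 \<le> r1 - dist (\<gamma> w a) (c0 a)"
      using e P\<gamma>[OF w] by (auto simp: e1_def P_def)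
    have "eventually (\<lambda>w'. \<exists>c. (\<forall>a<m. dist (c a) (\<gamma> w a) < e1) \<and> (\<forall>a\<ge>m. c a = \<gamma> w a) \<and> (\<forall>l<m. G l (\<tau> w') c = 0)) (nhds w)"
      by (rule eventually_compose_filterlim[OF solution_persists[OF D\<gamma>[OF w] _ e1(1)] \<tau>])
        (use P\<gamma>[OF w] in \<open>auto simp: P_def\<close>)
    moreover have "eventually (\<lambda>w'. w' \<in> ball w0 r) (nhds w)"
      using w by (intro eventually_nhds_in_open) auto
    ultimately have "eventually (\<lambda>w'. dist (\<gamma> w' a) (\<gamma> w a) < e) (nhds w)"
    proof eventually_elim
      case (elim w')
      then obtain c where c: "\<forall>a<m. dist (c a) (\<gamma> w a) < e1" "\<forall>a\<ge>m. c a = \<gamma> w a" "\<forall>l<m. G l (\<tau> w') c = 0"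
        by blast
      have "dist (c a) (c0 a) < r1" if "a < m" for a
      proof -
        have "dist (c a) (c0 a) \<le> dist (c a) (\<gamma> w a) + dist (\<gamma> w a) (c0 a)" by (rule dist_triangle)
        thus ?thesis using c(1) e1(3)[OF that] that by (smt (verit))
      qed
      hence "P w' c" using c P\<gamma>[OF w] by (auto simp: P_def)
      hence "c = \<gamma> w'" using uniq P\<gamma> elim(2) by blast
      thus ?case using c e1(2) e by (cases "a < m") force+
    qed
    thus "eventually (\<lambda>w'. dist (\<gamma> w' a) (\<gamma> w a) < e) (at w)"
      by (simp add: eventually_nhds_conv_at)
  qed
  have "(\<lambda>w. \<gamma> w a) holomorphic_on ball w0 r" for a
  proof (cases "a < m")
    case False
    hence "\<gamma> w a = c0 a" if "w \<in> ball w0 r" for w using P\<gamma>[OF that] by (auto simp: P_def)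
    hence "(\<lambda>w. \<gamma> w a) holomorphic_on ball w0 r \<longleftrightarrow> (\<lambda>w. c0 a) holomorphic_on ball w0 r"
      by (intro holomorphic_cong) auto
    thus ?thesis by simp
  next
    case a: True
    show ?thesis
      unfolding holomorphic_on_open[OF open_ball]
    proof
      fix w assume w: "w \<in> ball w0 r"
      have "\<exists>d. ((\<lambda>w'. (G l (\<tau> w') (\<gamma> w) - G l (\<tau> w) (\<gamma> w)) / (w' - w)) \<longlongrightarrow> d) (at w)" if "l < m" for l
        using holomorphic_on_imp_differentiable_at[OF hol[OF that, of "\<gamma> w"] open_UNIV, of w]
        by (auto simp: field_differentiable_def has_field_derivative_iff)
      then obtain d where d: "\<And>l. l < m \<Longrightarrow>
          ((\<lambda>w'. (G l (\<tau> w') (\<gamma> w) - G l (\<tau> w) (\<gamma> w)) / (w' - w)) \<longlongrightarrow> d l) (at w)" by metis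
      \<comment> \<open>The right-hand side of the linear system for the difference quotients of the
        branch: \<open>G\<close> vanishes along it, so only the change of the parameter is
        left.\<close>
      define y where "y l w' = - ((G l (\<tau> w') (\<gamma> w) - G l (\<tau> w) (\<gamma> w)) / (w' - w))" for l w'
      define C where "C w' = cdet m (\<lambda>l b. if b = a then y l w' else A l (\<tau> w') (\<gamma> w) (\<gamma> w') b)" for w'
      have \<tau>': "(\<tau> \<longlongrightarrow> \<tau> w) (at w)"
        using cont by (simp add: continuous_on_eq_continuous_at isCont_def)
      have limC: "(C \<longlongrightarrow> cdet m (\<lambda>l b. if b = a then - d l else A l (\<tau> w) (\<gamma> w) (\<gamma> w) b)) (at w)"
        unfolding C_def
      proof (rule tendsto_cdet)
        fix l b assume lb: "l < m" "b < m"
        show "((\<lambda>x. if b = a then y l x else A l (\<tau> x) (\<gamma> w) (\<gamma> x) b)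
          \<longlongrightarrow> (if b = a then - d l else A l (\<tau> w) (\<gamma> w) (\<gamma> w) b)) (at w)"
          using lb d[OF lb(1)] unfolding y_def
          by (cases "b = a") (auto intro!: tendsto_minus tendsto_A \<tau>' cont\<gamma>[OF w])
      qed
      have limD: "((\<lambda>w'. D (\<tau> w') (\<gamma> w) (\<gamma> w')) \<longlongrightarrow> D (\<tau> w) (\<gamma> w) (\<gamma> w)) (at w)"
        by (intro tendsto_D \<tau>' cont\<gamma>[OF w] tendsto_const)
      have "eventually (\<lambda>w'. w' \<in> ball w0 r) (at w)"
        using w by (intro eventually_at_in_open') auto
      moreover have "eventually (\<lambda>w'. w' \<noteq> w) (at w)" by (rule eventually_neq_at_within)
      moreover have "eventually (\<lambda>w'. D (\<tau> w') (\<gamma> w) (\<gamma> w') \<noteq> 0) (at w)"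
        using limD D\<gamma>[OF w] by (rule tendsto_imp_eventually_ne)
      ultimately have "eventually (\<lambda>w'. (\<gamma> w' a - \<gamma> w a) / (w' - w) = C w' / D (\<tau> w') (\<gamma> w) (\<gamma> w')) (at w)"
      proof eventually_elim
        case (elim w')
        have "(\<Sum>b<m. A l (\<tau> w') (\<gamma> w) (\<gamma> w') b * ((\<gamma> w' b - \<gamma> w b) / (w' - w))) = y l w'" if "l < m" for l
        proof -
          have "(\<Sum>b<m. A l (\<tau> w') (\<gamma> w) (\<gamma> w') b * (\<gamma> w' b - \<gamma> w b)) = - G l (\<tau> w') (\<gamma> w)"
            using hadamard[OF that, of "\<tau> w'" "\<gamma> w'" "\<gamma> w"] P\<gamma>[OF elim(1)] that by (simp add: P_def)
          moreover have "G l (\<tau> w) (\<gamma> w) = 0" using P\<gamma>[OF w] that by (simp add: P_def)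
          ultimately show ?thesis by (simp add: y_def flip: sum_divide_distrib)
        qed
        from cdet_cramer[OF this a] show ?case
          using elim(3) by (simp add: C_def D_def field_simps)
      qed
      moreover have "((\<lambda>w'. C w' / D (\<tau> w') (\<gamma> w) (\<gamma> w')) \<longlongrightarrow>
          cdet m (\<lambda>l b. if b = a then - d l else A l (\<tau> w) (\<gamma> w) (\<gamma> w) b) / D (\<tau> w) (\<gamma> w) (\<gamma> w)) (at w)"
        by (intro tendsto_divide limC limD D\<gamma>[OF w])
      ultimately have "((\<lambda>w'. (\<gamma> w' a - \<gamma> w a) / (w' - w)) \<longlongrightarrow>
          cdet m (\<lambda>l b. if b = a then - d l else A l (\<tau> w) (\<gamma> w) (\<gamma> w) b) / D (\<tau> w) (\<gamma> w) (\<gamma> w)) (at w)"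
        by (simp add: tendsto_cong)
      thus "\<exists>f'. ((\<lambda>w. \<gamma> w a) has_field_derivative f') (at w)"
        unfolding has_field_derivative_iff by blast
    qed
  qed
  moreover have "G l (\<tau> w) (\<gamma> w) = 0" if "w \<in> ball w0 r" "l < m" for w l
    using P\<gamma>[OF that(1)] that(2) by (simp add: P_def)
  moreover have "\<gamma> w a = c0 a" if "w \<in> ball w0 r" "a \<ge> m" for w a
    using P\<gamma>[OF that(1)] that(2) by (simp add: P_def)
  ultimately show ?thesis using that[of r \<gamma>] r(1) \<gamma>0 by blast
qed

end

subsection \<open>The Wronskian determinant\<close>

text \<open>The coefficient in the $r$-th derivative of $z^j$; it vanishes for $j < r$ since one factor
  of the truncated product is $j - j$.\<close>
definition ff :: "nat \<Rightarrow> nat \<Rightarrow> complex" where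
  "ff r j = of_nat (\<Prod>m<r. j - m)"

lemma ff_eq_0: "j < r \<Longrightarrow> ff r j = 0"
  by (auto simp: ff_def)

lemma ff_self: "ff r r \<noteq> 0"
  by (auto simp: ff_def)

lemma ff_eq_prod: "ff r j = (\<Prod>m<r. of_nat j - of_nat m)"
proof (cases "j < r")
  case True
  hence "(\<Prod>m<r. of_nat j - of_nat m) = (0::complex)" by (intro prod_zero) auto
  thus ?thesis using True by (simp add: ff_eq_0)
next
  case False
  thus ?thesis unfolding ff_def of_nat_prod by (intro prod.cong) (auto simp: of_nat_diff)
qed

text \<open>Remove the largest of the values, which is at least their number minus one. This bounds
  the exponents in the Leibniz expansions below.\<close>

lemma sum_lessThan_le_sum_inj:
  fixes f :: "nat \<Rightarrow> nat"
  assumes "inj_on f {..<k}"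
  shows "(\<Sum>i<k. i) \<le> (\<Sum>i<k. f i)"
proof -
  have "(\<Sum>i<card A. i) \<le> \<Sum>A" if "finite A" for A :: "nat set"
    using that
  proof (induction "card A" arbitrary: A)
    case (Suc m)
    hence ne: "A \<noteq> {}" by auto
    define M where "M = Max A"
    have M: "M \<in> A" using Suc.prems ne by (simp add: M_def)
    have "A \<subseteq> {..M}" using Suc.prems by (auto simp: M_def)
    hence "card A \<le> Suc M" using card_mono[of "{..M}" A] by simp
    moreover have "(\<Sum>i<card (A - {M}). i) \<le> \<Sum>(A - {M})"
      using Suc M by (intro Suc.hyps(1)) auto
    moreover have "\<Sum>A = M + \<Sum>(A - {M})" using M Suc.prems by (simp add: sum.remove)
    moreover have "card A = Suc m" "card (A - {M}) = m"
      using M Suc.prems Suc.hyps(2)[symmetric] by auto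
    ultimately show ?case by simp
  qed simp
  from this[of "f ` {..<k}"] show ?thesis
    using assms by (simp add: card_image sum.reindex)
qed

locale grass =
  fixes k n :: nat
  assumes k_pos: "0 < k" and k_less: "k < n"
begin

text \<open>The determinant $D_v(z)$ with row $r$ scaled by $z^{e_r}$ (respectively $z^{r-k}$) and column $c$ by
  $z^{-c}$, i.e. up to a power of $z$ the determinant itself, see \<open>Dv_Q\<close>. For \<open>v \<in> Y e\<close> it is a
  polynomial in $z$ whose value at $0$ is a multiple of \<open>kappa e\<close>; for other \<open>v\<close> the subtraction
  \<open>e r - c\<close> truncates.\<close>
definition Q :: "(nat \<Rightarrow> nat) \<Rightarrow> (nat \<Rightarrow> nat \<Rightarrow> complex) \<Rightarrow> complex \<Rightarrow> complex" where
  "Q e v z = cdet n (\<lambda>r c. if r < k then v r c * z ^ (e r - c) else ff (r - k) c)"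

definition Y :: "(nat \<Rightarrow> nat) \<Rightarrow> (nat \<Rightarrow> nat \<Rightarrow> complex) set" where
  "Y e = {v. \<forall>l<k. \<forall>j. e l < j \<longrightarrow> v l j = 0}"

text \<open>For distinct positions \<open>e\<close> below \<open>n\<close>, expansion along the unit
  rows leaves, up to sign, the minor of falling factorials on the complementary columns. It is a
  Vandermonde determinant, because \<open>ff r c\<close> is a monic polynomial in \<open>c\<close>
  of degree \<open>r\<close>.\<close>

definition kappa :: "(nat \<Rightarrow> nat) \<Rightarrow> complex" where
  "kappa e = cdet n (\<lambda>r c. if r < k then (if c = e r then 1 else 0) else ff (r - k) c)"

text \<open>\<open>Q\<close> is linear in row \<open>i\<close>, so this is its partial derivative in
  the entry \<open>(i, j)\<close>.\<close>

definition dQ :: "(nat \<Rightarrow> nat) \<Rightarrow> (nat \<Rightarrow> nat \<Rightarrow> complex) \<Rightarrow> nat \<Rightarrow> nat \<Rightarrow> complex \<Rightarrow> complex" where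
  "dQ e v i j z = Q e (v(i := (\<lambda>c. if c = j then 1 else 0))) z"

definition Dv :: "(nat \<Rightarrow> nat \<Rightarrow> complex) \<Rightarrow> complex \<Rightarrow> complex" where
  "Dv v z = cdet n (\<lambda>r c. if r < k then v r c else gamma_deriv n (r - k) z c)"

definition ssum :: "(nat \<Rightarrow> nat) \<Rightarrow> nat" where "ssum e = (\<Sum>l<k. e l)"

text \<open>The least value of \<open>ssum\<close> on injective sequences. For strictly increasing
  \<open>e\<close> the difference \<open>ssum e - tri\<close> is the dimension of the Schubert cell
  with leading positions \<open>e\<close>.\<close>

definition tri :: nat where "tri = (\<Sum>l<k. l)"

definition rowops :: "(nat \<Rightarrow> nat \<Rightarrow> complex) \<Rightarrow> (nat \<Rightarrow> nat \<Rightarrow> complex) \<Rightarrow> nat \<Rightarrow> nat \<Rightarrow> complex" where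
  "rowops b v = (\<lambda>l j. \<Sum>p\<le>l. b l p * v p j)"

lemma prod_rows: "(\<Prod>r<n. if r < k then f r else 1) = (\<Prod>r<k. f r)"
  for f :: "nat \<Rightarrow> complex"
proof -
  have "(\<Prod>r<n. if r < k then f r else 1) = (\<Prod>r\<in>{..<k}. if r < k then f r else 1)"
    using k_less by (intro prod.mono_neutral_right) auto
  thus ?thesis by simp
qed

lemma Y_nonzeroD: "v \<in> Y e \<Longrightarrow> l < k \<Longrightarrow> v l j \<noteq> 0 \<Longrightarrow> j \<le> e l"
  unfolding Y_def using not_less by blast

lemma Q_cong: "(\<And>l j. l < k \<Longrightarrow> j < n \<Longrightarrow> v l j = w l j) \<Longrightarrow> Q e v z = Q e w z"
  unfolding Q_def by (rule cdet_cong) auto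

text \<open>Adding row \<open>s\<close> to a later row \<open>r\<close> costs a power
  \<open>z ^ (e r - e s)\<close>, since the rows carry different weights. The resulting matrix is
  still triangular, with diagonal entries free of \<open>z\<close>.\<close>

lemma Q_rowops:
  assumes e: "\<And>p l. p \<le> l \<Longrightarrow> l < k \<Longrightarrow> e p \<le> e l" and w: "w \<in> Y e"
  shows "Q e (rowops b w) z = (\<Prod>l<k. b l l) * Q e w z"
proof -
  define B where "B r s = (if r < k then (if s \<le> r then b r s * z ^ (e r - e s) else 0)
      else if s = r then 1 else 0)" for r s
  define M where "M r c = (if r < k then w r c * z ^ (e r - c) else ff (r - k) c)" for r c
  have "Q e (rowops b w) z = cdet n (\<lambda>r c. \<Sum>s<n. B r s * M s c)"
    unfolding Q_def
  proof (rule cdet_cong)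
    fix r c assume rc: "r < n" "c < n"
    show "(if r < k then rowops b w r c * z ^ (e r - c) else ff (r - k) c) = (\<Sum>s<n. B r s * M s c)"
    proof (cases "r < k")
      case True
      have "(\<Sum>s<n. B r s * M s c) = (\<Sum>s\<le>r. B r s * M s c)"
        using True k_less by (intro sum.mono_neutral_right) (auto simp: B_def)
      also have "\<dots> = (\<Sum>s\<le>r. b r s * w s c * z ^ (e r - c))"
      proof (rule sum.cong)
        fix s assume s: "s \<in> {..r}"
        show "B r s * M s c = b r s * w s c * z ^ (e r - c)"
        proof (cases "w s c = 0")
          case False
          hence "c \<le> e s" using s True by (intro Y_nonzeroD[OF w]) auto
          moreover have "e s \<le> e r" using e s True by auto
          ultimately have "z ^ (e r - e s) * z ^ (e s - c) = z ^ (e r - c)"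
            by (simp flip: power_add)
          thus ?thesis using True s by (simp add: B_def M_def mult_ac)
        qed (use True s in \<open>simp add: B_def M_def\<close>)
      qed simp
      finally show ?thesis using True by (simp add: rowops_def sum_distrib_right)
    next
      case False
      have "(\<Sum>s<n. B r s * M s c) = (\<Sum>s<n. if s = r then M s c else 0)"
        using False by (intro sum.cong) (auto simp: B_def)
      thus ?thesis using False rc by (simp add: M_def)
    qed
  qed
  also have "\<dots> = cdet n B * cdet n M" by (rule cdet_mult)
  also have "cdet n B = (\<Prod>r<n. B r r)"
    by (rule cdet_lower_triangular) (auto simp: B_def)
  also have "\<dots> = (\<Prod>r<n. if r < k then b r r else 1)"
    by (intro prod.cong) (auto simp: B_def)
  also have "\<dots> = (\<Prod>l<k. b l l)" by (rule prod_rows)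
  finally show ?thesis by (simp add: Q_def M_def)
qed

definition Qcoef :: "(nat \<Rightarrow> nat \<Rightarrow> complex) \<Rightarrow> (nat \<Rightarrow> nat) \<Rightarrow> complex" where
  "Qcoef v p = of_int (sign p) * (\<Prod>i<n. if i < k then v i (p i) else ff (i - k) (p i))"

definition Qexp :: "(nat \<Rightarrow> nat) \<Rightarrow> (nat \<Rightarrow> nat) \<Rightarrow> nat" where
  "Qexp e p = (\<Sum>i<k. e i - p i)"

definition Qp :: "(nat \<Rightarrow> nat) \<Rightarrow> (nat \<Rightarrow> nat \<Rightarrow> complex) \<Rightarrow> complex poly" where
  "Qp e v = (\<Sum>p | p permutes {..<n}. monom (Qcoef v p) (Qexp e p))"

lemma finite_perms: "finite {p. p permutes {..<n}}"
  by (rule finite_permutations) simp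

lemma Q_leibniz: "Q e v z = (\<Sum>p | p permutes {..<n}. Qcoef v p * z ^ Qexp e p)"
  unfolding Q_def cdet_leibniz
proof (intro sum.cong refl)
  fix p
  have "(\<Prod>i<n. if i < k then v i (p i) * z ^ (e i - p i) else ff (i - k) (p i))
     = (\<Prod>i<n. (if i < k then v i (p i) else ff (i - k) (p i)) * (if i < k then z ^ (e i - p i) else 1))"
    by (intro prod.cong) auto
  also have "\<dots> = (\<Prod>i<n. (if i < k then v i (p i) else ff (i - k) (p i))) * (\<Prod>i<k. z ^ (e i - p i))"
    by (simp add: prod.distrib prod_rows)
  finally show "of_int (sign p) * (\<Prod>i<n. if i < k then v i (p i) * z ^ (e i - p i) else ff (i - k) (p i))
      = Qcoef v p * z ^ Qexp e p"
    by (simp add: Qcoef_def Qexp_def power_sum)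
qed

lemma poly_Qp: "poly (Qp e v) z = Q e v z"
  by (simp add: Qp_def Q_leibniz poly_sum poly_monom)

text \<open>A nonzero term has \<open>p i \<le> e i\<close> in every row, so that the subtractions
  are not truncated and the exponent is \<open>ssum e\<close> minus a sum of \<open>k\<close>
  distinct columns.\<close>

lemma Qexp_le:
  assumes "v \<in> Y e" "p permutes {..<n}" "Qcoef v p \<noteq> 0"
  shows "Qexp e p \<le> ssum e - tri"
proof -
  have le: "p i \<le> e i" if "i < k" for i
  proof (rule ccontr)
    assume "\<not> ?thesis"
    hence "v i (p i) = 0" using assms(1) that by (auto simp: Y_def)
    hence "(\<Prod>i<n. if i < k then v i (p i) else ff (i - k) (p i)) = 0"
      using that k_less by (intro prod_zero bexI[of _ i]) auto
    thus False using assms(3) by (simp add: Qcoef_def)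
  qed
  have "Qexp e p = ssum e - (\<Sum>i<k. p i)"
    unfolding Qexp_def ssum_def using le by (intro sum_subtractf_nat) auto
  moreover have "tri \<le> (\<Sum>i<k. p i)"
    unfolding tri_def using permutes_inj[OF assms(2)]
    by (intro sum_lessThan_le_sum_inj) (auto simp: inj_on_def)
  ultimately show ?thesis by simp
qed

lemma degree_Qp: "v \<in> Y e \<Longrightarrow> degree (Qp e v) \<le> ssum e - tri"
  unfolding Qp_def
proof (rule degree_sum_le[OF finite_perms])
  fix p assume "v \<in> Y e" "p \<in> {p. p permutes {..<n}}"
  thus "degree (monom (Qcoef v p) (Qexp e p)) \<le> ssum e - tri"
    using Qexp_le[of v e p] by (cases "Qcoef v p = 0") (auto simp: degree_monom_eq)
qed

text \<open>At \<open>z = 0\<close> only the entries in the columns \<open>e l\<close> survive,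
  since \<open>0 ^ 0 = 1\<close>.\<close>

lemma Q_at_0:
  assumes "v \<in> Y e"
  shows "Q e v 0 = (\<Prod>l<k. v l (e l)) * kappa e"
proof -
  have "Q e v 0 = cdet n (\<lambda>r c. (if r < k then v r (e r) else 1) *
      (if r < k then (if c = e r then 1 else 0) else ff (r - k) c))"
    unfolding Q_def
  proof (rule cdet_cong)
    fix r c
    show "(if r < k then v r c * 0 ^ (e r - c) else ff (r - k) c) = (if r < k then v r (e r) else 1) *
      (if r < k then (if c = e r then 1 else 0) else ff (r - k) c)"
      using assms by (cases "c \<le> e r") (auto simp: Y_def not_le power_0_left)
  qed
  thus ?thesis by (simp add: cdet_row_scale prod_rows kappa_def)
qed

text \<open>A left kernel vector gives a polynomial of degree below \<open>n - k\<close>, written in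
  falling factorials, that vanishes at the \<open>n - k\<close> columns missed by
  \<open>e\<close>.\<close>

lemma kappa_nonzero:
  assumes inj: "inj_on e {..<k}" and le: "\<And>l. l < k \<Longrightarrow> e l < n"
  shows "kappa e \<noteq> 0"
proof
  assume "kappa e = 0"
  then obtain x i where i: "i < n" "x i \<noteq> 0" and
    x: "\<And>c. c < n \<Longrightarrow> (\<Sum>r<n. x r * (if r < k then (if c = e r then 1 else 0) else ff (r - k) c)) = 0"
    unfolding kappa_def cdet_left_kernel by blast
  have split: "(\<Sum>r<n. f r) = (\<Sum>r<k. f r) + (\<Sum>r<n-k. f (r + k))" for f :: "nat \<Rightarrow> complex"
  proof -
    have "{..<n} = {..<k} \<union> {k..<n}" "{..<k} \<inter> {k..<n} = {}" using k_less by auto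
    moreover have "sum f {k..<n} = (\<Sum>r<n-k. f (r + k))"
      using k_less sum.shift_bounds_nat_ivl[of f 0 k "n - k"] by (simp add: atLeast0LessThan)
    ultimately show ?thesis by (simp add: sum.union_disjoint)
  qed
  have x': "(\<Sum>r<k. if c = e r then x r else 0) + (\<Sum>r<n-k. x (r + k) * ff r c) = 0" if "c < n" for c
  proof -
    have "(\<Sum>r<k. x r * (if r < k then (if c = e r then 1 else 0) else ff (r - k) c))
        = (\<Sum>r<k. if c = e r then x r else 0)" by (intro sum.cong) auto
    thus ?thesis using x[OF that] unfolding split by simp
  qed
  define P where "P = (\<Sum>r<n-k. smult (x (r + k)) (\<Prod>m<r. [:- of_nat m, 1:]))"
  have P: "poly P (of_nat c) = (\<Sum>r<n-k. x (r + k) * ff r c)" for c :: nat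
    by (simp add: P_def poly_sum poly_prod ff_eq_prod)
  have "degree P \<le> n - k - 1" unfolding P_def
  proof (rule degree_sum_le)
    fix r assume "r \<in> {..<n - k}"
    have "degree (\<Prod>m<r. [:- of_nat m, 1:] :: complex poly) \<le> (\<Sum>m<r. 1)"
      by (rule order_trans[OF degree_prod_sum_le]) auto
    thus "degree (smult (x (r + k)) (\<Prod>m<r. [:- of_nat m, 1:])) \<le> n - k - 1"
      using \<open>r \<in> {..<n - k}\<close> by (intro order_trans[OF degree_smult_le]) auto
  qed simp
  define Z :: "complex set" where "Z = of_nat ` ({..<n} - e ` {..<k})"
  have "card Z = n - k"
    unfolding Z_def using inj le
    by (subst card_image) (auto simp: inj_on_def card_Diff_subset card_image subset_eq)
  have "Z \<subseteq> {z. poly P z = 0}"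
  proof
    fix z assume "z \<in> Z"
    then obtain c where c: "c < n" "c \<notin> e ` {..<k}" "z = of_nat c" by (auto simp: Z_def)
    hence "(\<Sum>r<k. if c = e r then x r else 0) = 0" by (intro sum.neutral) auto
    thus "z \<in> {z. poly P z = 0}" using x'[OF c(1)] c(3) P by simp
  qed
  have "P = 0"
  proof (rule ccontr)
    assume "P \<noteq> 0"
    hence "card Z \<le> degree P"
      using card_mono[OF poly_roots_finite \<open>Z \<subseteq> _\<close>] card_poly_roots_bound[of P] by (meson le_trans)
    thus False using \<open>card Z = n - k\<close> \<open>degree P \<le> _\<close> k_less by simp
  qed
  \<comment> \<open>Evaluation at \<open>r = 0, 1, ...\<close> is triangular, as
    \<open>ff s r\<close> vanishes for \<open>s > r\<close>.\<close>
  have xk: "x (r + k) = 0" if "r < n - k" for r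
    using that
  proof (induction r rule: less_induct)
    case (less r)
    have "0 = (\<Sum>s<n-k. x (s + k) * ff s r)" using P[of r] \<open>P = 0\<close> by simp
    also have "\<dots> = (\<Sum>s<n-k. if s = r then x (r + k) * ff r r else 0)"
      by (intro sum.cong) (use less in \<open>auto simp: ff_eq_0 neq_iff\<close>)
    finally show ?case using less ff_self[of r] by simp
  qed
  have "x l = 0" if "l < k" for l
  proof -
    have "(\<Sum>r<k. if e l = e r then x r else 0) = (\<Sum>r<k. if r = l then x l else 0)"
      using inj that by (intro sum.cong) (auto simp: inj_on_def)
    thus ?thesis using x'[OF le[OF that]] xk that by simp
  qed
  moreover have "i - k < n - k" if "\<not> i < k" using that i(1) by arith
  ultimately show False using i xk[of "i - k"] by (cases "i < k") auto
qed

text \<open>A point of a smaller cell, read in a larger one, thus acquires the root 0; each step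
  down in dimension contributes one factor \<open>z\<close>.\<close>

lemma Q_change:
  assumes "v \<in> Y f" "\<And>l. l < k \<Longrightarrow> f l \<le> e l"
  shows "Q e v z = z ^ (ssum e - ssum f) * Q f v z"
proof -
  have "Q e v z = cdet n (\<lambda>r c. (if r < k then z ^ (e r - f r) else 1) *
      (if r < k then v r c * z ^ (f r - c) else ff (r - k) c))"
    unfolding Q_def
  proof (rule cdet_cong)
    fix r c
    show "(if r < k then v r c * z ^ (e r - c) else ff (r - k) c) = (if r < k then z ^ (e r - f r) else 1) *
      (if r < k then v r c * z ^ (f r - c) else ff (r - k) c)"
    proof (cases "r < k \<and> c \<le> f r")
      case True
      hence "z ^ (e r - c) = z ^ (e r - f r) * z ^ (f r - c)"
        using assms(2)[of r] by (simp flip: power_add)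
      thus ?thesis using True by simp
    next
      case False
      thus ?thesis using assms(1) by (auto simp: Y_def)
    qed
  qed
  also have "\<dots> = (\<Prod>l<k. z ^ (e l - f l)) * Q f v z"
    by (simp add: cdet_row_scale prod_rows Q_def)
  also have "(\<Prod>l<k. z ^ (e l - f l)) = z ^ (ssum e - ssum f)"
    unfolding ssum_def using assms(2) by (subst sum_subtractf_nat[symmetric]) (auto simp: power_sum)
  finally show ?thesis .
qed

lemma Q_row:
  assumes "i < k"
  shows "Q e (v(i := x)) z = (\<Sum>j<n. x j * dQ e v i j z)"
proof -
  define M where "M r c = (if r < k then v r c * z ^ (e r - c) else ff (r - k) c)" for r c
  have *: "Q e (v(i := x)) z = cdet n (M(i := (\<lambda>c. x c * z ^ (e i - c))))" for x
    unfolding Q_def by (rule cdet_cong) (use assms in \<open>auto simp: M_def\<close>)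
  have "Q e (v(i := x)) z
      = cdet n (M(i := (\<lambda>c. \<Sum>j<n. x j * ((if c = j then 1 else 0) * z ^ (e i - c)))))"
    unfolding * by (rule cdet_cong) (simp add: if_distrib if_distribR cong: if_cong)
  also have "\<dots> = (\<Sum>j<n. x j * dQ e v i j z)"
    unfolding dQ_def * using assms k_less by (subst cdet_row_sum) auto
  finally show ?thesis .
qed

text \<open>Passing from \<open>v\<close> to \<open>w\<close> one row at a time telescopes the
  difference of the values of \<open>Q\<close> into divided differences, which become partial
  derivatives for \<open>v = w\<close>.\<close>

definition mix :: "(nat \<Rightarrow> nat \<Rightarrow> complex) \<Rightarrow> (nat \<Rightarrow> nat \<Rightarrow> complex) \<Rightarrow> nat \<Rightarrow> nat \<Rightarrow> nat \<Rightarrow> complex" where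
  "mix v w i = (\<lambda>r. if r < i then w r else v r)"

lemma Q_hadamard:
  "Q e w z - Q e v z = (\<Sum>i<k. \<Sum>j<n. (w i j - v i j) * dQ e (mix v w i) i j z)"
proof -
  have "Q e (mix v w (Suc i)) z - Q e (mix v w i) z = (\<Sum>j<n. (w i j - v i j) * dQ e (mix v w i) i j z)"
    if "i < k" for i
  proof -
    have "mix v w (Suc i) = (mix v w i)(i := w i)" "mix v w i = (mix v w i)(i := v i)"
      by (auto simp: mix_def fun_eq_iff)
    hence "Q e (mix v w (Suc i)) z - Q e (mix v w i) z
        = Q e ((mix v w i)(i := w i)) z - Q e ((mix v w i)(i := v i)) z" by simp
    thus ?thesis unfolding Q_row[OF that] by (simp add: sum_subtractf algebra_simps)
  qed
  hence "(\<Sum>i<k. \<Sum>j<n. (w i j - v i j) * dQ e (mix v w i) i j z)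
      = (\<Sum>i<k. Q e (mix v w (Suc i)) z - Q e (mix v w i) z)" by simp
  also have "\<dots> = Q e (mix v w k) z - Q e (mix v w 0) z" by (rule sum_lessThan_telescope)
  also have "Q e (mix v w k) z = Q e w z" by (rule Q_cong) (simp add: mix_def)
  also have "mix v w 0 = v" by (simp add: mix_def)
  finally show ?thesis ..
qed

lemma tendsto_Q:
  assumes "\<And>l j. l < k \<Longrightarrow> j < n \<Longrightarrow> ((\<lambda>x. v x l j) \<longlongrightarrow> w l j) F" "(z \<longlongrightarrow> z0) F"
  shows "((\<lambda>x. Q e (v x) (z x)) \<longlongrightarrow> Q e w z0) F"
  unfolding Q_def
proof (rule tendsto_cdet)
  fix r c assume "r < n" "c < n"
  thus "((\<lambda>x. if r < k then v x r c * z x ^ (e r - c) else ff (r - k) c) \<longlongrightarrow>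
      (if r < k then w r c * z0 ^ (e r - c) else ff (r - k) c)) F"
    by (cases "r < k") (auto intro!: tendsto_intros assms)
qed

lemma tendsto_dQ:
  assumes "\<And>l j. l < k \<Longrightarrow> j < n \<Longrightarrow> ((\<lambda>x. v x l j) \<longlongrightarrow> w l j) F" "(z \<longlongrightarrow> z0) F"
  shows "((\<lambda>x. dQ e (v x) a b (z x)) \<longlongrightarrow> dQ e w a b z0) F"
  unfolding dQ_def by (rule tendsto_Q) (use assms in auto)

lemma holomorphic_on_Q:
  assumes "\<And>l j. l < k \<Longrightarrow> j < n \<Longrightarrow> (\<lambda>x. v x l j) holomorphic_on S" "z holomorphic_on S"
  shows "(\<lambda>x. Q e (v x) (z x)) holomorphic_on S"
  unfolding Q_def
proof (rule holomorphic_on_cdet)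
  fix r c assume "r < n" "c < n"
  thus "(\<lambda>x. if r < k then v x r c * z x ^ (e r - c) else ff (r - k) c) holomorphic_on S"
    by (cases "r < k") (auto intro!: holomorphic_intros assms)
qed

lemma holomorphic_on_dQ:
  assumes "\<And>l j. l < k \<Longrightarrow> j < n \<Longrightarrow> (\<lambda>x. v x l j) holomorphic_on S" "z holomorphic_on S"
  shows "(\<lambda>x. dQ e (v x) a b (z x)) holomorphic_on S"
  unfolding dQ_def
proof (rule holomorphic_on_Q)
  fix l j assume "l < k" "j < n"
  thus "(\<lambda>x. ((v x)(a := \<lambda>c. if c = b then 1 else 0)) l j) holomorphic_on S"
    using assms(1) by (cases "l = a") auto
qed fact

text \<open>After row \<open>r\<close> is multiplied by \<open>z ^ e r\<close>, or by
  \<open>z ^ (r - k)\<close> for the rows of derivatives, column \<open>c\<close> has the factor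
  \<open>z ^ c\<close>. Both powers stay on their sides, so that nothing is divided by
  \<open>z\<close>.\<close>

lemma Dv_Q:
  assumes "v \<in> Y e"
  shows "z ^ (ssum e + (\<Sum>r<n-k. r)) * Dv v z = z ^ (\<Sum>r<n. r) * Q e v z"
proof -
  define M where "M r c = (if r < k then v r c * z ^ (e r - c) else ff (r - k) c)" for r c
  have "(\<Prod>r<n. z ^ (if r < k then e r else r - k)) * Dv v z
      = cdet n (\<lambda>r c. z ^ (if r < k then e r else r - k) * (if r < k then v r c else gamma_deriv n (r - k) z c))"
    by (simp add: Dv_def cdet_row_scale)
  also have "\<dots> = cdet n (\<lambda>r c. z ^ c * M r c)"
  proof (rule cdet_cong)
    fix r c assume rc: "r < n" "c < n"
    show "z ^ (if r < k then e r else r - k) * (if r < k then v r c else gamma_deriv n (r - k) z c) = z ^ c * M r c"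
    proof (cases "r < k")
      case True
      show ?thesis
      proof (cases "c \<le> e r")
        case False
        thus ?thesis using assms True by (auto simp: Y_def M_def)
      next
        case le: True
        hence "z ^ e r = z ^ c * z ^ (e r - c)" by (simp flip: power_add)
        thus ?thesis using True by (simp add: M_def)
      qed
    next
      case False
      show ?thesis
      proof (cases "r - k \<le> c")
        case True
        hence "z ^ c = z ^ (r - k) * z ^ (c - (r - k))" by (simp flip: power_add)
        thus ?thesis using False rc by (simp add: M_def gamma_deriv_def ff_def)
      next
        case c: False
        have "of_nat (\<Prod>m<r - k. c - m) = (0::complex)" using c ff_eq_0[of c "r - k"] by (simp add: ff_def)
        thus ?thesis using False c rc by (simp add: M_def gamma_deriv_def ff_eq_0 del: of_nat_prod)
      qed
    qed
  qed
  also have "\<dots> = (\<Prod>r<n. z ^ r) * Q e v z"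
    by (simp add: cdet_col_scale Q_def M_def)
  also have "(\<Prod>r<n. z ^ (if r < k then e r else r - k)) = z ^ (ssum e + (\<Sum>r<n-k. r))"
  proof -
    have "{..<n} = {..<k} \<union> {k..<n}" "{..<k} \<inter> {k..<n} = {}" using k_less by auto
    moreover have "sum (\<lambda>r. r - k) {k..<n} = (\<Sum>r<n-k. r)"
      using k_less sum.shift_bounds_nat_ivl[of "\<lambda>r. r - k" 0 k "n - k"] by (simp add: atLeast0LessThan)
    ultimately have "(\<Sum>r<n. if r < k then e r else r - k) = ssum e + (\<Sum>r<n-k. r)"
      by (simp add: sum.union_disjoint ssum_def)
    thus ?thesis by (simp flip: power_sum)
  qed
  also have "(\<Prod>r<n. z ^ r) = z ^ (\<Sum>r<n. r)" by (simp add: power_sum)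
  finally show ?thesis .
qed

end

lemma sum_indicator_mult: "l < k \<Longrightarrow> (\<Sum>p<k. (if p = l then 1 else 0) * g p) = (g l :: 'a::comm_semiring_1)" for l k :: nat
proof -
  assume "l < k"
  have "(\<Sum>p<k. (if p = l then 1 else 0) * g p) = (\<Sum>p<k. if p = l then g l else 0)"
    by (intro sum.cong) auto
  thus ?thesis using \<open>l < k\<close> by simp
qed

context grass begin

subsection \<open>Row equivalence and normal forms\<close>

text \<open>Only invertible lower triangular row changes: these preserve \<open>Y e\<close> for
  monotone \<open>e\<close> and multiply \<open>Q e\<close> by a constant.\<close>

definition req :: "(nat \<Rightarrow> nat \<Rightarrow> complex) \<Rightarrow> (nat \<Rightarrow> nat \<Rightarrow> complex) \<Rightarrow> bool" where
  "req v w \<longleftrightarrow> (\<forall>l<k. \<exists>b. b l \<noteq> 0 \<and> (\<forall>p>l. b p = 0) \<and> (\<forall>j. v l j = (\<Sum>p<k. b p * w p j)))"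

lemma reqE:
  assumes "req v w"
  obtains b where "\<And>l. l < k \<Longrightarrow> b l l \<noteq> 0" "\<And>l p. l < k \<Longrightarrow> p > l \<Longrightarrow> b l p = 0"
    "\<And>l j. l < k \<Longrightarrow> v l j = (\<Sum>p<k. b l p * w p j)"
proof -
  from assms obtain b where "\<forall>l<k. b l l \<noteq> 0 \<and> (\<forall>p>l. b l p = 0) \<and> (\<forall>j. v l j = (\<Sum>p<k. b l p * w p j))"
    unfolding req_def by metis
  thus ?thesis using that by blast
qed

lemma reqI:
  assumes "\<And>l. l < k \<Longrightarrow> b l l \<noteq> 0" "\<And>l p. l < k \<Longrightarrow> p > l \<Longrightarrow> b l p = 0"
    "\<And>l j. l < k \<Longrightarrow> v l j = (\<Sum>p<k. b l p * w p j)"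
  shows "req v w"
  unfolding req_def
proof (intro allI impI)
  fix l assume "l < k"
  thus "\<exists>b. b l \<noteq> 0 \<and> (\<forall>p>l. b p = 0) \<and> (\<forall>j. v l j = (\<Sum>p<k. b p * w p j))"
    by (intro exI[of _ "b l"]) (use assms in auto)
qed

lemma req_refl: "(\<And>l j. l < k \<Longrightarrow> v l j = w l j) \<Longrightarrow> req v w"
  by (rule reqI[where b = "\<lambda>l p. if p = l then 1 else 0"]) (auto simp: sum_indicator_mult)

lemma req_trans:
  assumes "req u v" "req v w"
  shows "req u w"
proof -
  obtain b where b: "\<And>l. l < k \<Longrightarrow> b l l \<noteq> 0" "\<And>l p. l < k \<Longrightarrow> p > l \<Longrightarrow> b l p = 0"
    "\<And>l j. l < k \<Longrightarrow> u l j = (\<Sum>p<k. b l p * v p j)" using assms(1) by (rule reqE) blast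
  obtain a where a: "\<And>l. l < k \<Longrightarrow> a l l \<noteq> 0" "\<And>l p. l < k \<Longrightarrow> p > l \<Longrightarrow> a l p = 0"
    "\<And>l j. l < k \<Longrightarrow> v l j = (\<Sum>p<k. a l p * w p j)" using assms(2) by (rule reqE) blast
  show ?thesis
  proof (rule reqI[where b = "\<lambda>l q. \<Sum>p<k. b l p * a p q"])
    fix l assume l: "l < k"
    have "(\<Sum>p<k. b l p * a p l) = (\<Sum>p<k. if p = l then b l l * a l l else 0)"
      by (intro sum.cong) (use a b l in \<open>auto simp: neq_iff\<close>)
    thus "(\<Sum>p<k. b l p * a p l) \<noteq> 0" using a b l by simp
  next
    fix l q assume l: "l < k" "q > l"
    show "(\<Sum>p<k. b l p * a p q) = 0"
    proof (rule sum.neutral, intro ballI)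
      fix p assume "p \<in> {..<k}"
      thus "b l p * a p q = 0" using l a(2)[of p q] b(2)[of l p] by (cases "p > l") auto
    qed
  next
    fix l j assume l: "l < k"
    have "u l j = (\<Sum>p<k. \<Sum>q<k. b l p * a p q * w q j)"
      using l b(3) a(3) by (simp add: sum_distrib_left mult_ac)
    also have "\<dots> = (\<Sum>q<k. (\<Sum>p<k. b l p * a p q) * w q j)"
      by (subst sum.swap) (simp add: sum_distrib_right)
    finally show "u l j = (\<Sum>q<k. (\<Sum>p<k. b l p * a p q) * w q j)" .
  qed
qed

text \<open>The triangular matrix is inverted by forward substitution, row after row.\<close>

lemma req_sym:
  assumes "req v w"
  shows "req w v"
proof -
  obtain b where b: "\<And>l. l < k \<Longrightarrow> b l l \<noteq> 0" "\<And>l p. l < k \<Longrightarrow> p > l \<Longrightarrow> b l p = 0"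
    "\<And>l j. l < k \<Longrightarrow> v l j = (\<Sum>p<k. b l p * w p j)" using assms by (rule reqE) blast
  have "\<exists>a. a l \<noteq> 0 \<and> (\<forall>p>l. a p = 0) \<and> (\<forall>j. w l j = (\<Sum>p<k. a p * v p j))" if "l < k" for l
    using that
  proof (induction l rule: less_induct)
    case (less l)
    hence "\<forall>p. \<exists>a. p < l \<longrightarrow> a p \<noteq> 0 \<and> (\<forall>q>p. a q = 0) \<and> (\<forall>j. w p j = (\<Sum>q<k. a q * v q j))" by auto
    then obtain a where a: "\<And>p q. p < l \<Longrightarrow> q > p \<Longrightarrow> a p q = 0"
      "\<And>p j. p < l \<Longrightarrow> w p j = (\<Sum>q<k. a p q * v q j)" by metis
    define c where "c q = ((if q = l then 1 else 0) - (\<Sum>p<l. b l p * a p q)) / b l l" for q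
    have "c l \<noteq> 0" using a b less.prems by (simp add: c_def)
    moreover have "c q = 0" if "q > l" for q using that a by (simp add: c_def)
    moreover have "w l j = (\<Sum>q<k. c q * v q j)" for j
    proof -
      have "v l j = (\<Sum>p<Suc l. b l p * w p j)"
        unfolding b(3)[OF less.prems] using less.prems b(2)[OF less.prems]
        by (intro sum.mono_neutral_right) auto
      also have "\<dots> = (\<Sum>p<l. b l p * (\<Sum>q<k. a p q * v q j)) + b l l * w l j"
        using a by simp
      finally have "b l l * w l j = v l j - (\<Sum>p<l. b l p * (\<Sum>q<k. a p q * v q j))" by simp
      also have "(\<Sum>p<l. b l p * (\<Sum>q<k. a p q * v q j)) = (\<Sum>q<k. (\<Sum>p<l. b l p * a p q) * v q j)"
        unfolding sum_distrib_left sum_distrib_right by (subst sum.swap) (simp add: mult_ac)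
      also have "v l j = (\<Sum>q<k. (if q = l then 1 else 0) * v q j)"
        using less.prems by (simp add: sum_indicator_mult)
      also have "(\<Sum>q<k. (if q = l then 1 else 0) * v q j) - (\<Sum>q<k. (\<Sum>p<l. b l p * a p q) * v q j)
          = (\<Sum>q<k. (b l l * c q) * v q j)"
        using b(1)[OF less.prems]
        by (simp only: sum_subtractf[symmetric] left_diff_distrib[symmetric]) (simp add: c_def)
      also have "\<dots> = b l l * (\<Sum>q<k. c q * v q j)" by (simp add: sum_distrib_left mult.assoc)
      finally have "b l l * w l j = b l l * (\<Sum>q<k. c q * v q j)" .
      thus ?thesis using b(1)[OF less.prems] by simp
    qed
    ultimately show ?case by blast
  qed
  thus ?thesis unfolding req_def by blast
qed

definition mono_idx :: "(nat \<Rightarrow> nat) \<Rightarrow> bool" where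
  "mono_idx e \<longleftrightarrow> (\<forall>p l. p \<le> l \<longrightarrow> l < k \<longrightarrow> e p \<le> e l)"

lemma req_Y:
  assumes "req v w" "w \<in> Y e" "mono_idx e"
  shows "v \<in> Y e"
  unfolding Y_def
proof (intro CollectI allI impI)
  fix l j assume lj: "l < k" "e l < j"
  obtain b where b: "\<And>l p. l < k \<Longrightarrow> p > l \<Longrightarrow> b l p = 0"
    "\<And>l j. l < k \<Longrightarrow> v l j = (\<Sum>p<k. b l p * w p j)" using assms(1) by (rule reqE) blast
  have "b l p * w p j = 0" if "p < k" for p
  proof (cases "p > l")
    case False
    hence "e p \<le> e l" using assms(3) lj by (auto simp: mono_idx_def)
    hence "e p < j" using lj by simp
    thus ?thesis using assms(2) that by (simp add: Y_def)
  qed (use b lj in auto)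
  thus "v l j = 0" using b(2) lj by (simp add: sum.neutral)
qed

lemma Q_lower_rowops:
  assumes "mono_idx e" "u \<in> Y e" "\<And>l p. l < k \<Longrightarrow> p > l \<Longrightarrow> b l p = 0"
    "\<And>l j. l < k \<Longrightarrow> x l j = (\<Sum>p<k. b l p * u p j)"
  shows "Q e x z = (\<Prod>l<k. b l l) * Q e u z"
proof -
  have "Q e x z = Q e (rowops b u) z"
  proof (rule Q_cong)
    fix l j assume l: "l < k"
    show "x l j = rowops b u l j"
      unfolding assms(4)[OF l] rowops_def
      by (intro sum.mono_neutral_right) (use l assms(3)[OF l] in auto)
  qed
  also have "\<dots> = (\<Prod>l<k. b l l) * Q e u z"
    by (rule Q_rowops) (use assms(1,2) in \<open>auto simp: mono_idx_def\<close>)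
  finally show ?thesis .
qed

lemma Q_req:
  assumes "req v w" "w \<in> Y e" "mono_idx e"
  obtains \<mu> where "\<mu> \<noteq> 0" "\<And>z. Q e v z = \<mu> * Q e w z"
proof -
  obtain b where b: "\<And>l. l < k \<Longrightarrow> b l l \<noteq> 0" "\<And>l p. l < k \<Longrightarrow> p > l \<Longrightarrow> b l p = 0"
    "\<And>l j. l < k \<Longrightarrow> v l j = (\<Sum>p<k. b l p * w p j)" using assms(1) by (rule reqE) blast
  show ?thesis
    using that[of "\<Prod>l<k. b l l"] b(1) Q_lower_rowops[of e w b v] assms b(2,3) by auto
qed

definition DQ :: "(nat \<Rightarrow> nat) \<Rightarrow> (nat \<Rightarrow> nat \<Rightarrow> complex) \<Rightarrow> (nat \<Rightarrow> nat \<Rightarrow> complex) \<Rightarrow> complex \<Rightarrow> complex" where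
  "DQ e v d z = (\<Sum>i<k. \<Sum>j<n. d i j * dQ e v i j z)"

text \<open>As a limit of difference quotients the directional derivative inherits every identity
  between values of \<open>Q\<close>.\<close>

lemma DQ_limit:
  "((\<lambda>s::complex. (Q e (\<lambda>l j. v l j + s * d l j) z - Q e v z) / s) \<longlongrightarrow> DQ e v d z) (at 0)"
proof -
  let ?w = "\<lambda>s l j. v l j + s * d l j"
  have "((\<lambda>s::complex. \<Sum>i<k. \<Sum>j<n. d i j * dQ e (mix v (?w s) i) i j z) \<longlongrightarrow> DQ e v d z) (at 0)"
    unfolding DQ_def
  proof (intro tendsto_sum tendsto_mult tendsto_const tendsto_dQ)
    fix i l j
    show "((\<lambda>s. mix v (?w s) i l j) \<longlongrightarrow> v l j) (at 0)"
      by (cases "l < i") (auto simp: mix_def intro!: tendsto_eq_intros)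
  qed
  moreover have "(Q e (?w s) z - Q e v z) / s = (\<Sum>i<k. \<Sum>j<n. d i j * dQ e (mix v (?w s) i) i j z)"
    if "s \<noteq> 0" for s
    using that by (simp add: Q_hadamard sum_distrib_left[symmetric] mult.assoc)
  hence "eventually (\<lambda>s. (Q e (?w s) z - Q e v z) / s = (\<Sum>i<k. \<Sum>j<n. d i j * dQ e (mix v (?w s) i) i j z)) (at 0)"
    by (auto simp: eventually_at_filter)
  ultimately show ?thesis by (simp add: tendsto_cong)
qed

text \<open>The differentials of the equations \<open>Q e v (t l) = 0\<close> at \<open>v\<close>, as functions on all of
  \<open>Y e\<close>, are linearly independent.\<close>
definition nondeg :: "(nat \<Rightarrow> nat) \<Rightarrow> (nat \<Rightarrow> nat \<Rightarrow> complex) \<Rightarrow> (nat \<Rightarrow> complex) \<Rightarrow> nat \<Rightarrow> bool" where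
  "nondeg e v t m \<longleftrightarrow> (\<forall>y. (\<forall>i<k. \<forall>j\<le>e i. (\<Sum>l<m. y l * dQ e v i j (t l)) = 0) \<longrightarrow> (\<forall>l<m. y l = 0))"

text \<open>Differentiate \<open>Q e v = \<mu> * Q e w\<close>: moving the entry
  \<open>(i, j)\<close> of \<open>w\<close> moves column \<open>j\<close> of \<open>v\<close> by
  column \<open>i\<close> of the triangular matrix.\<close>

lemma nondeg_req:
  assumes "req v w" "w \<in> Y e" "mono_idx e" "nondeg e w t m" and en: "\<And>l. l < k \<Longrightarrow> e l < n"
  shows "nondeg e v t m"
  unfolding nondeg_def
proof (intro allI impI)
  fix y l0 assume y: "\<forall>i<k. \<forall>j\<le>e i. (\<Sum>l<m. y l * dQ e v i j (t l)) = 0" and l0: "l0 < m"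
  obtain b where b: "\<And>l. l < k \<Longrightarrow> b l l \<noteq> 0" "\<And>l p. l < k \<Longrightarrow> p > l \<Longrightarrow> b l p = 0"
    "\<And>l j. l < k \<Longrightarrow> v l j = (\<Sum>p<k. b l p * w p j)" using assms(1) by (rule reqE) blast
  define \<mu> where "\<mu> = (\<Prod>l<k. b l l)"
  have \<mu>: "\<mu> \<noteq> 0" using b(1) by (simp add: \<mu>_def)
  have "(\<Sum>l<m. y l * dQ e w i j (t l)) = 0" if ij: "i < k" "j \<le> e i" for i j
  proof -
    define d where "d l c = (if l = i \<and> c = j then 1 else 0 :: complex)" for l c
    define d' where "d' l c = (if c = j then b l i else 0)" for l c
    have d': "d' l c = (\<Sum>p<k. b l p * d p c)" if "l < k" for l c
      using ij by (simp add: d'_def d_def if_distrib cong: if_cong)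
    have eq: "DQ e v d' z = \<mu> * DQ e w d z" for z
    proof (rule tendsto_unique[OF _ DQ_limit])
      have "(Q e (\<lambda>l j. v l j + s * d' l j) z - Q e v z) / s = \<mu> * ((Q e (\<lambda>l j. w l j + s * d l j) z - Q e w z) / s)" for s
      proof -
        have "(\<lambda>l j. w l j + s * d l j) \<in> Y e"
          using assms(2) ij by (auto simp: Y_def d_def)
        hence "Q e (\<lambda>l j. v l j + s * d' l j) z = \<mu> * Q e (\<lambda>l j. w l j + s * d l j) z"
          unfolding \<mu>_def
        proof (rule Q_lower_rowops[where b = b, OF assms(3)])
          fix l j assume l: "l < k"
          show "v l j + s * d' l j = (\<Sum>p<k. b l p * (w p j + s * d p j))"
            unfolding b(3)[OF l] d'[OF l] by (simp add: algebra_simps sum.distrib sum_distrib_left)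
        qed (use b(2) in auto)
        moreover have "Q e v z = \<mu> * Q e w z" unfolding \<mu>_def using Q_lower_rowops[of e w b v] assms b(2,3) by blast
        ultimately show ?thesis by (simp add: algebra_simps diff_divide_distrib)
      qed
      thus "((\<lambda>s. (Q e (\<lambda>l j. v l j + s * d' l j) z - Q e v z) / s) \<longlongrightarrow> \<mu> * DQ e w d z) (at 0)"
        by (simp only: tendsto_mult_left DQ_limit)
    qed simp
    have dw: "DQ e w d z = dQ e w i j z" for z
    proof -
      have "DQ e w d z = (\<Sum>l<k. \<Sum>c<n. if c = j then (if l = i then dQ e w i j z else 0) else 0)"
        unfolding DQ_def by (intro sum.cong) (auto simp: d_def)
      thus ?thesis using ij en[OF ij(1)] by simp
    qed
    have dv: "DQ e v d' z = (\<Sum>l<k. b l i * dQ e v l j z)" for z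
    proof -
      have "DQ e v d' z = (\<Sum>l<k. \<Sum>c<n. if c = j then b l i * dQ e v l j z else 0)"
        unfolding DQ_def by (intro sum.cong) (auto simp: d'_def)
      thus ?thesis using ij en[OF ij(1)] by simp
    qed
    have "\<mu> * (\<Sum>l<m. y l * dQ e w i j (t l)) = (\<Sum>l<m. y l * (\<Sum>r<k. b r i * dQ e v r j (t l)))"
      using eq unfolding dw dv by (simp add: sum_distrib_left mult_ac)
    also have "\<dots> = (\<Sum>r<k. b r i * (\<Sum>l<m. y l * dQ e v r j (t l)))"
      unfolding sum_distrib_left by (subst sum.swap) (simp add: mult_ac)
    also have "\<dots> = 0"
    proof (rule sum.neutral, intro ballI)
      fix r assume r: "r \<in> {..<k}"
      show "b r i * (\<Sum>l<m. y l * dQ e v r j (t l)) = 0"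
      proof (cases "i > r")
        case False
        hence "j \<le> e r" using assms(3) ij r by (auto simp: mono_idx_def intro: order_trans)
        thus ?thesis using y r by auto
      qed (use b r in auto)
    qed
    finally show ?thesis using \<mu> by simp
  qed
  thus "y l0 = 0" using assms(4) l0 unfolding nondeg_def by blast
qed

definition SY :: "(nat \<Rightarrow> nat) \<Rightarrow> (nat \<Rightarrow> nat) \<Rightarrow> (nat \<Rightarrow> nat \<Rightarrow> complex) set" where
  "SY e f = {v \<in> Y e. \<forall>l<k. \<forall>p<k. v l (f p) = (if l = p then 1 else 0)}"

text \<open>Read in the pivot columns, the transition matrix is the identity.\<close>

lemma SY_unique:
  assumes "v \<in> SY e f" "w \<in> SY e f" "req v w" "l < k"
  shows "v l = w l"
proof
  fix j
  obtain b where b: "\<And>l j. l < k \<Longrightarrow> v l j = (\<Sum>p<k. b l p * w p j)" using assms(3) by (rule reqE) blast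
  have "b l q = (if l = q then 1 else 0)" if "q < k" for q
  proof -
    have "v l (f q) = (\<Sum>p<k. if p = q then b l q else 0)"
      unfolding b[OF assms(4)] by (intro sum.cong) (use assms(2) that in \<open>auto simp: SY_def\<close>)
    thus ?thesis using assms(1,4) that by (simp add: SY_def)
  qed
  hence "(\<Sum>p<k. b l p * w p j) = (\<Sum>p<k. if p = l then w l j else 0)" by (intro sum.cong) auto
  thus "v l j = w l j" using b assms(4) by simp
qed

text \<open>Forward elimination. For \<open>adm e f\<close> it already reaches the reduced form:
  \<open>e l < f p\<close> for \<open>l < p\<close>, so row \<open>l\<close> vanishes in the pivot
  columns of later rows.\<close>

fun nf :: "(nat \<Rightarrow> nat) \<Rightarrow> (nat \<Rightarrow> nat \<Rightarrow> complex) \<Rightarrow> nat \<Rightarrow> nat \<Rightarrow> complex" where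
  "nf f x l = (\<lambda>j. (x l j - (\<Sum>p<l. x l (f p) * nf f x p j)) / x l (f l))"

declare nf.simps [simp del]

text \<open>The row-reduced matrices in \<open>Y e\<close> with pivot columns \<open>f\<close> form a chart of the Schubert variety with
  leading positions \<open>e\<close>. Besides \<open>f = e\<close> the proof needs \<open>f = e(i := e i - 1)\<close>, a chart around
  the points where the coordinate \<open>(i, e i)\<close> vanishes.\<close>
definition adm :: "(nat \<Rightarrow> nat) \<Rightarrow> (nat \<Rightarrow> nat) \<Rightarrow> bool" where
  "adm e f \<longleftrightarrow> (\<forall>l p. l < p \<longrightarrow> p < k \<longrightarrow> e l < e p) \<and> (\<forall>l<k. e l < n) \<and> inj_on f {..<k} \<and>
     (\<forall>l<k. f l \<le> e l) \<and> (\<forall>l p. l < p \<longrightarrow> p < k \<longrightarrow> e l < f p)"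

lemma adm_mono: "adm e f \<Longrightarrow> mono_idx e"
  unfolding adm_def mono_idx_def using le_eq_less_or_eq by auto

lemma
  assumes adm: "adm e f" and x: "x \<in> Y e" "\<And>l. l < k \<Longrightarrow> x l (f l) \<noteq> 0"
  shows req_nf: "req (nf f x) x" and nf_SY: "nf f x \<in> SY e f"
proof -
  have eq: "x l j = (\<Sum>p<k. (if p \<le> l then x l (f p) else 0) * nf f x p j)" if "l < k" for l j
  proof -
    have "(\<Sum>p<k. (if p \<le> l then x l (f p) else 0) * nf f x p j) = (\<Sum>p<Suc l. (if p \<le> l then x l (f p) else 0) * nf f x p j)"
      using that by (intro sum.mono_neutral_right) auto
    also have "\<dots> = (\<Sum>p<l. x l (f p) * nf f x p j) + x l (f l) * nf f x l j"
      by simp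
    also have "x l (f l) * nf f x l j = x l j - (\<Sum>p<l. x l (f p) * nf f x p j)"
      using x(2)[OF that] by (subst nf.simps) simp
    finally show ?thesis by simp
  qed
  have "req x (nf f x)"
    by (rule reqI[where b = "\<lambda>l p. if p \<le> l then x l (f p) else 0"]) (use eq x(2) in auto)
  thus req: "req (nf f x) x" by (rule req_sym)
  have Y: "nf f x \<in> Y e" using req x(1) adm_mono[OF adm] by (rule req_Y)
  have up: "nf f x l (f q) = 0" if "l < q" "q < k" for l q
    using Y that adm unfolding Y_def adm_def by auto
  have "nf f x l (f q) = (if l = q then 1 else 0)" if "l < k" "q < k" for l q
    using that
  proof (induction l arbitrary: q rule: less_induct)
    case (less l)
    show ?case
    proof (cases "l < q")
      case False
      have "(\<Sum>p<l. x l (f p) * nf f x p (f q)) = (\<Sum>p<l. if p = q then x l (f q) else 0)"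
        by (intro sum.cong) (use less in auto)
      thus ?thesis using x(2)[OF less.prems(1)] False by (subst nf.simps) auto
    qed (use up less in auto)
  qed
  thus "nf f x \<in> SY e f" using Y by (simp add: SY_def)
qed

lemma nf_id:
  assumes "adm e f" "x \<in> SY e f" "l < k"
  shows "nf f x l = x l"
proof -
  have x: "x \<in> Y e" "\<And>l. l < k \<Longrightarrow> x l (f l) \<noteq> 0" using assms(2) by (auto simp: SY_def)
  show ?thesis by (rule SY_unique[OF nf_SY[OF assms(1) x] assms(2) req_nf[OF assms(1) x] assms(3)])
qed

lemma tendsto_nf:
  assumes "\<And>l j. l < k \<Longrightarrow> ((\<lambda>i. x i l j) \<longlongrightarrow> y l j) F" "\<And>l. l < k \<Longrightarrow> y l (f l) \<noteq> 0" "l < k"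
  shows "((\<lambda>i. nf f (x i) l j) \<longlongrightarrow> nf f y l j) F"
  using assms(3)
proof (induction l arbitrary: j rule: less_induct)
  case (less l)
  show ?case
    by (subst (1 2) nf.simps) (intro tendsto_intros assms less; use less.prems in simp)
qed

definition indep :: "(nat \<Rightarrow> nat \<Rightarrow> complex) \<Rightarrow> bool" where
  "indep v \<longleftrightarrow> (\<forall>x. (\<forall>j. (\<Sum>l<k. x l * v l j) = 0) \<longrightarrow> (\<forall>l<k. x l = 0))"

subsection \<open>Compactness and charts of Schubert cells\<close>

text \<open>Triangular elimination with pivots of largest modulus. The bound on the entries gives
  convergent subsequences, and the estimate for \<open>x\<close> is a quantitative independence that
  survives the limit. Together they replace compactness of the flag variety. The factor
  \<open>2 ^ l\<close> accumulates when the \<open>x l\<close> are solved for one after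
  another.\<close>

lemma bounded_representative:
  assumes ind: "indep v" and vn: "\<And>l j. l < k \<Longrightarrow> j \<ge> n \<Longrightarrow> v l j = 0"
  obtains w where "req w v" "\<And>l j. l < k \<Longrightarrow> norm (w l j) \<le> 1"
    "\<And>x l. l < k \<Longrightarrow> norm (x l) \<le> 2 ^ l * (\<Sum>j<n. norm (\<Sum>p<k. x p * w p j))"
proof -
  define ok where "ok l \<beta> \<longleftrightarrow> \<beta> l \<noteq> 0 \<and> (\<forall>p>l. \<beta> p = 0)" for l :: nat and \<beta> :: "nat \<Rightarrow> complex"
  define cb where "cb \<beta> j = (\<Sum>p<k. \<beta> p * v p j)" for \<beta> :: "nat \<Rightarrow> complex" and j
  \<comment> \<open>The pivot of a row is an entry of largest modulus, scaled to 1; the pivot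
    columns of all earlier rows are cleared in it.\<close>
  define good where "good r \<beta> I \<longleftrightarrow> (\<forall>l<r. ok l (\<beta> l) \<and> I l < n \<and> cb (\<beta> l) (I l) = 1 \<and>
      (\<forall>j. norm (cb (\<beta> l) j) \<le> 1) \<and> (\<forall>q<l. cb (\<beta> l) (I q) = 0))"
    for r :: nat and \<beta> :: "nat \<Rightarrow> nat \<Rightarrow> complex" and I :: "nat \<Rightarrow> nat"
  have cb_lin: "cb (\<lambda>p. \<beta> p - c * \<beta>' p) j = cb \<beta> j - c * cb \<beta>' j" for \<beta> \<beta>' c j
    by (simp add: cb_def algebra_simps sum_subtractf sum_distrib_left)
  have cb_div: "cb (\<lambda>p. \<beta> p / c) j = cb \<beta> j / c" for \<beta> c j
    by (simp add: cb_def sum_divide_distrib)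
  have "\<exists>\<beta> I. good r \<beta> I" if "r \<le> k" for r
    using that
  proof (induction r)
    case 0
    show ?case by (auto simp: good_def)
  next
    case (Suc r)
    then obtain \<beta> I where g: "good r \<beta> I" by auto
    have "\<exists>\<xi>. ok r \<xi> \<and> (\<forall>p<q. cb \<xi> (I p) = 0)" if "q \<le> r" for q
      using that
    proof (induction q)
      case 0
      show ?case by (intro exI[of _ "\<lambda>p. if p = r then 1 else 0"]) (auto simp: ok_def)
    next
      case (Suc q)
      then obtain \<xi> where \<xi>: "ok r \<xi>" "\<forall>p<q. cb \<xi> (I p) = 0" by auto
      have gq: "ok q (\<beta> q)" "cb (\<beta> q) (I q) = 1" "\<forall>p<q. cb (\<beta> q) (I p) = 0"
        using g Suc.prems by (auto simp: good_def)
      show ?case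
      proof (intro exI[of _ "\<lambda>p. \<xi> p - cb \<xi> (I q) * \<beta> q p"] conjI allI impI)
        show "ok r (\<lambda>p. \<xi> p - cb \<xi> (I q) * \<beta> q p)"
          using \<xi>(1) gq(1) Suc.prems by (auto simp: ok_def)
        fix p assume "p < Suc q"
        thus "cb (\<lambda>p. \<xi> p - cb \<xi> (I q) * \<beta> q p) (I p) = 0"
          using \<xi>(2) gq by (auto simp: cb_lin less_Suc_eq)
      qed
    qed
    then obtain \<xi> where \<xi>: "ok r \<xi>" "\<And>p. p < r \<Longrightarrow> cb \<xi> (I p) = 0" by blast
    have cbn: "cb \<xi> j = 0" if "j \<ge> n" for j using vn that by (simp add: cb_def)
    define M where "M = Max ((\<lambda>j. norm (cb \<xi> j)) ` {..<n})"
    have "M \<in> (\<lambda>j. norm (cb \<xi> j)) ` {..<n}" unfolding M_def using k_less by (intro Max_in) auto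
    then obtain J where J: "J < n" "norm (cb \<xi> J) = M" by auto
    have le: "norm (cb \<xi> j) \<le> norm (cb \<xi> J)" for j
    proof (cases "j < n")
      case True
      thus ?thesis unfolding J(2) M_def by (intro Max_ge) auto
    qed (simp add: cbn)
    have nz: "cb \<xi> J \<noteq> 0"
    proof
      assume "cb \<xi> J = 0"
      hence "cb \<xi> j = 0" for j using le[of j] by simp
      hence "\<xi> r = 0" using ind Suc.prems unfolding indep_def cb_def by (metis Suc_le_eq)
      thus False using \<xi>(1) by (simp add: ok_def)
    qed
    let ?\<beta> = "\<beta>(r := (\<lambda>p. \<xi> p / cb \<xi> J))" and ?I = "I(r := J)"
    have "good (Suc r) ?\<beta> ?I"
      unfolding good_def
    proof (intro allI impI)
      fix l assume l: "l < Suc r"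
      show "ok l (?\<beta> l) \<and> ?I l < n \<and> cb (?\<beta> l) (?I l) = 1 \<and>
        (\<forall>j. norm (cb (?\<beta> l) j) \<le> 1) \<and> (\<forall>q<l. cb (?\<beta> l) (?I q) = 0)"
      proof (cases "l = r")
        case True
        thus ?thesis using \<xi> nz J le by (auto simp: cb_div ok_def norm_divide)
      next
        case False
        thus ?thesis using l g by (auto simp: good_def)
      qed
    qed
    thus ?case by blast
  qed
  then obtain \<beta> I where g: "good k \<beta> I" by blast
  define w where "w l j = cb (\<beta> l) j" for l j
  have 1: "req w v"
    by (rule reqI[where b = \<beta>]) (use g in \<open>auto simp: good_def ok_def w_def cb_def\<close>)
  have 2: "norm (w l j) \<le> 1" if "l < k" for l j using g that by (auto simp: good_def w_def)
  have 3: "norm (x l) \<le> 2 ^ l * (\<Sum>j<n. norm (\<Sum>p<k. x p * w p j))" if "l < k" for x l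
    using that
  proof (induction l rule: less_induct)
    case (less q)
    define S where "S = (\<Sum>j<n. norm (\<Sum>p<k. x p * w p j))"
    have "(\<Sum>p<k. x p * w p (I q)) = (\<Sum>p<Suc q. x p * w p (I q))"
      using g less.prems by (intro sum.mono_neutral_right) (auto simp: good_def w_def)
    also have "\<dots> = (\<Sum>p<q. x p * w p (I q)) + x q"
      using g less.prems by (simp add: good_def w_def)
    finally have "x q = (\<Sum>p<k. x p * w p (I q)) - (\<Sum>p<q. x p * w p (I q))" by simp
    hence "norm (x q) \<le> norm (\<Sum>p<k. x p * w p (I q)) + norm (\<Sum>p<q. x p * w p (I q))"
      by (metis norm_triangle_ineq4)
    also have "norm (\<Sum>p<k. x p * w p (I q)) \<le> S"
      unfolding S_def using g less.prems by (intro member_le_sum) (auto simp: good_def)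
    also have "norm (\<Sum>p<q. x p * w p (I q)) \<le> (\<Sum>p<q. 2 ^ p * S)"
    proof (rule sum_norm_le)
      fix p assume p: "p \<in> {..<q}"
      have "norm (x p) * norm (w p (I q)) \<le> norm (x p) * 1"
        using 2 p less.prems by (intro mult_left_mono) auto
      also have "\<dots> \<le> 2 ^ p * S" using less p unfolding S_def by auto
      finally show "norm (x p * w p (I q)) \<le> 2 ^ p * S" by (simp add: norm_mult)
    qed
    also have "(\<Sum>p<q. 2 ^ p * S) = (2 ^ q - 1) * S"
      by (induction q) (auto simp: algebra_simps)
    finally show ?case by (simp add: S_def algebra_simps)
  qed
  show ?thesis using that 1 2 3 by blast
qed

text \<open>For each \<open>l\<close> take a combination of the rows up to \<open>l\<close>, truly
  involving row \<open>l\<close>, whose leading position is least. If two of them had the same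
  leading position, subtracting a multiple of the earlier one would lower the later. This finds the
  cell in which a limit point lies.\<close>

lemma distinct_leads:
  assumes ind: "indep v" and v: "v \<in> Y e"
  obtains w f where "req w v" "w \<in> Y f" "inj_on f {..<k}" "\<And>l. l < k \<Longrightarrow> f l \<le> e l"
    "\<And>l. l < k \<Longrightarrow> w l (f l) \<noteq> 0"
proof -
  define ok where "ok l \<beta> \<longleftrightarrow> \<beta> l \<noteq> 0 \<and> (\<forall>p>l. \<beta> p = 0)" for l :: nat and \<beta> :: "nat \<Rightarrow> complex"
  define cb where "cb \<beta> j = (\<Sum>p<k. \<beta> p * v p j)" for \<beta> :: "nat \<Rightarrow> complex" and j
  define cand where "cand l d \<longleftrightarrow> (\<exists>\<beta>. ok l \<beta> \<and> (\<forall>j>d. cb \<beta> j = 0))" for l d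
  have cb_lin: "cb (\<lambda>p. \<beta> p - c * \<beta>' p) j = cb \<beta> j - c * cb \<beta>' j" for \<beta> \<beta>' c j
    by (simp add: cb_def algebra_simps sum_subtractf sum_distrib_left)
  define f where "f l = (LEAST d. cand l d)" for l
  have cand_e: "cand l (e l)" if "l < k" for l
    unfolding cand_def
  proof (intro exI[of _ "\<lambda>p. if p = l then 1 else 0"] conjI)
    show "ok l (\<lambda>p. if p = l then 1 else 0)" by (simp add: ok_def)
    show "\<forall>j>e l. cb (\<lambda>p. if p = l then 1 else 0) j = 0"
      using v that by (auto simp: cb_def Y_def sum_indicator_mult)
  qed
  have f_le: "f l \<le> e l" if "l < k" for l unfolding f_def by (rule Least_le) (rule cand_e[OF that])
  have "cand l (f l)" if "l < k" for l unfolding f_def by (rule LeastI) (rule cand_e[OF that])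
  hence "\<exists>\<beta>. ok l \<beta> \<and> (\<forall>j>f l. cb \<beta> j = 0)" if "l < k" for l using that unfolding cand_def by blast
  then obtain \<beta> where \<beta>: "\<And>l. l < k \<Longrightarrow> ok l (\<beta> l)" "\<And>l j. l < k \<Longrightarrow> j > f l \<Longrightarrow> cb (\<beta> l) j = 0" by metis
  have minimal: "cb \<xi> (f l) \<noteq> 0" if \<xi>: "l < k" "ok l \<xi>" "\<And>j. j > f l \<Longrightarrow> cb \<xi> j = 0" for l \<xi>
  proof
    assume z: "cb \<xi> (f l) = 0"
    show False
    proof (cases "f l")
      case 0
      hence "cb \<xi> j = 0" for j using z \<xi>(3) by (cases j) auto
      hence "\<xi> l = 0" using ind \<xi>(1) unfolding indep_def cb_def by blast
      thus False using \<xi>(2) by (simp add: ok_def)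
    next
      case (Suc d)
      have "cb \<xi> j = 0" if "j > d" for j
        using z \<xi>(3) Suc that by (cases "j = f l") auto
      hence "cand l d" using \<xi>(2) unfolding cand_def by blast
      hence "f l \<le> d" unfolding f_def by (rule Least_le)
      thus False using Suc by simp
    qed
  qed
  define w where "w l j = cb (\<beta> l) j" for l j
  have wf: "w l (f l) \<noteq> 0" if "l < k" for l unfolding w_def by (rule minimal) (use \<beta> that in auto)
  have "f l \<noteq> f p" if "p < l" "l < k" for p l
  proof
    assume eq: "f l = f p"
    let ?c = "w l (f l) / w p (f l)"
    have "cb (\<lambda>q. \<beta> l q - ?c * \<beta> p q) (f l) \<noteq> 0"
    proof (rule minimal)
      show "ok l (\<lambda>q. \<beta> l q - ?c * \<beta> p q)" using \<beta>(1)[of l] \<beta>(1)[of p] that by (auto simp: ok_def)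
      show "cb (\<lambda>q. \<beta> l q - ?c * \<beta> p q) j = 0" if "j > f l" for j
        using \<beta>(2)[of l j] \<beta>(2)[of p j] that eq \<open>p < l\<close> \<open>l < k\<close> unfolding cb_lin by simp
    qed fact
    thus False using wf[of p] that eq unfolding cb_lin by (simp add: w_def)
  qed
  hence "inj_on f {..<k}" unfolding inj_on_def by (metis lessThan_iff linorder_neqE_nat)
  moreover have "req w v"
    by (rule reqI[where b = \<beta>]) (use \<beta> in \<open>auto simp: ok_def w_def cb_def\<close>)
  moreover have "w \<in> Y f" using \<beta> by (auto simp: Y_def w_def)
  ultimately show ?thesis using that f_le wf by blast
qed

section \<open>Coordinates on the charts\<close>

definition cells :: "(nat \<Rightarrow> nat) \<Rightarrow> (nat \<Rightarrow> nat) \<Rightarrow> (nat \<times> nat) set" where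
  "cells e f = {(l, j). l < k \<and> j \<le> e l \<and> j \<notin> f ` {..<k}}"

lemma finite_cells: "finite (cells e f)"
  by (rule finite_subset[of _ "{..<k} \<times> {..Max (e ` {..<k})}"])
    (auto simp: cells_def intro: order_trans)

lemma adm_ge: "adm e f \<Longrightarrow> l < k \<Longrightarrow> l \<le> e l"
proof (induction l)
  case (Suc l)
  hence "e l < e (Suc l)" by (auto simp: adm_def)
  thus ?case using Suc by simp
qed simp

text \<open>By \<open>adm\<close>, the pivots \<open>f p\<close> within \<open>{..e l}\<close> are
  those with \<open>p \<le> l\<close>, so row \<open>l\<close> has \<open>e l - l\<close> free
  entries.\<close>

lemma card_cells:
  assumes adm: "adm e f"
  shows "card (cells e f) = ssum e - tri"
proof -
  have "cells e f = (SIGMA l:{..<k}. {..e l} - f ` {..l})"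
  proof -
    have "f p \<le> e l \<longleftrightarrow> p \<le> l" if "p < k" "l < k" for p l
    proof
      assume "f p \<le> e l"
      thus "p \<le> l" using adm that unfolding adm_def by (meson not_less)
    next
      assume "p \<le> l"
      hence "e p \<le> e l" using adm_mono[OF adm] that by (auto simp: mono_idx_def)
      thus "f p \<le> e l" using adm that unfolding adm_def by (meson le_trans)
    qed
    thus ?thesis unfolding cells_def by (fastforce simp: image_iff)
  qed
  hence "card (cells e f) = (\<Sum>l<k. card ({..e l} - f ` {..l}))" by simp
  also have "\<dots> = (\<Sum>l<k. e l - l)"
  proof (rule sum.cong)
    fix l assume l: "l \<in> {..<k}"
    have "inj_on f {..l}" using adm l by (auto simp: adm_def intro: inj_on_subset)
    moreover have "f ` {..l} \<subseteq> {..e l}"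
    proof safe
      fix p assume "p \<le> l"
      hence "e p \<le> e l" "f p \<le> e p" using adm adm_mono[OF adm] l by (auto simp: mono_idx_def adm_def)
      thus "f p \<le> e l" by simp
    qed
    ultimately show "card ({..e l} - f ` {..l}) = e l - l"
      by (simp add: card_Diff_subset card_image)
  qed simp
  also have "\<dots> = ssum e - tri"
    unfolding ssum_def tri_def using adm_ge[OF adm] by (intro sum_subtractf_nat) auto
  finally show ?thesis .
qed

definition idx :: "(nat \<Rightarrow> nat) \<Rightarrow> (nat \<Rightarrow> nat) \<Rightarrow> nat \<Rightarrow> nat \<times> nat" where
  "idx e f = (SOME h. bij_betw h {..<ssum e - tri} (cells e f))"

lemma bij_idx: "adm e f \<Longrightarrow> bij_betw (idx e f) {..<ssum e - tri} (cells e f)"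
proof -
  assume "adm e f"
  hence "\<exists>h. bij_betw h {..<ssum e - tri} (cells e f)"
    using ex_bij_betw_nat_finite[OF finite_cells[of e f]] by (simp add: card_cells atLeast0LessThan)
  from someI_ex[OF this] show ?thesis unfolding idx_def .
qed

text \<open>Parametrises the chart \<open>SY e f\<close> by \<open>ssum e - tri\<close> numbers;
  \<open>coords\<close> is the inverse.\<close>

definition V :: "(nat \<Rightarrow> nat) \<Rightarrow> (nat \<Rightarrow> nat) \<Rightarrow> (nat \<Rightarrow> complex) \<Rightarrow> nat \<Rightarrow> nat \<Rightarrow> complex" where
  "V e f c l j = (if l < k \<and> j \<in> f ` {..<k} then (if j = f l then 1 else 0)
     else (\<Sum>a<ssum e - tri. if idx e f a = (l, j) then c a else 0))"

definition coords :: "(nat \<Rightarrow> nat) \<Rightarrow> (nat \<Rightarrow> nat) \<Rightarrow> (nat \<Rightarrow> nat \<Rightarrow> complex) \<Rightarrow> nat \<Rightarrow> complex" where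
  "coords e f v a = (if a < ssum e - tri then v (fst (idx e f a)) (snd (idx e f a)) else 0)"

lemma idx_in: "adm e f \<Longrightarrow> a < ssum e - tri \<Longrightarrow> idx e f a = (l, j) \<Longrightarrow> l < k \<and> j \<le> e l \<and> j < n \<and> j \<notin> f ` {..<k}"
proof -
  assume adm: "adm e f" and a: "a < ssum e - tri" "idx e f a = (l, j)"
  have "(l, j) \<in> cells e f" using bij_betwE[OF bij_idx[OF adm]] a by (metis lessThan_iff)
  moreover have "e l < n" if "l < k" using adm that by (simp add: adm_def)
  ultimately show ?thesis by (auto simp: cells_def)
qed

lemma V_idx:
  assumes "adm e f" "a < ssum e - tri" "idx e f a = (l, j)"
  shows "V e f c l j = c a"
proof -
  have "(\<Sum>b<ssum e - tri. if idx e f b = (l, j) then c b else 0) = (\<Sum>b<ssum e - tri. if b = a then c a else 0)"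
    using bij_idx[OF assms(1)] assms(2,3) by (intro sum.cong) (auto simp: bij_betw_def inj_on_def)
  thus ?thesis using assms idx_in[OF assms] by (simp add: V_def)
qed

lemma V_SY:
  assumes "adm e f"
  shows "V e f c \<in> SY e f"
proof -
  have "V e f c l j = 0" if "l < k" "e l < j" for l j
  proof (cases "j \<in> f ` {..<k}")
    case True
    thus ?thesis using that assms by (auto simp: V_def adm_def)
  next
    case False
    have "(\<Sum>a<ssum e - tri. if idx e f a = (l, j) then c a else 0) = 0"
      using idx_in[OF assms, of _ l j] that by (intro sum.neutral) auto
    thus ?thesis using False by (simp add: V_def)
  qed
  moreover have "V e f c l (f p) = (if l = p then 1 else 0)" if "l < k" "p < k" for l p
    using that assms by (auto simp: V_def adm_def inj_on_def)
  ultimately show ?thesis by (auto simp: SY_def Y_def)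
qed

lemma V_coords:
  assumes "adm e f" "v \<in> SY e f" "l < k"
  shows "V e f (coords e f v) l j = v l j"
proof (cases "j \<in> f ` {..<k} \<or> e l < j")
  case True
  thus ?thesis using V_SY[OF assms(1), of "coords e f v"] assms(2,3) by (auto simp: SY_def Y_def)
next
  case False
  hence "(l, j) \<in> cells e f" using assms by (auto simp: cells_def)
  then obtain a where a: "a < ssum e - tri" "idx e f a = (l, j)"
    unfolding bij_betw_imp_surj_on[OF bij_idx[OF assms(1)], symmetric] by auto
  thus ?thesis using V_idx[OF assms(1) a] by (simp add: coords_def)
qed

lemma coords_V: "adm e f \<Longrightarrow> a < ssum e - tri \<Longrightarrow> coords e f (V e f c) a = c a"
  using V_idx[of e f a "fst (idx e f a)" "snd (idx e f a)" c] by (simp add: coords_def)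

text \<open>Divided differences of \<open>Q\<close> in the chart: those of
  \<open>Q_hadamard\<close>, kept for the free entries only because all others agree at both
  points.\<close>

definition VA :: "(nat \<Rightarrow> nat) \<Rightarrow> (nat \<Rightarrow> nat) \<Rightarrow> complex \<Rightarrow> (nat \<Rightarrow> complex) \<Rightarrow> (nat \<Rightarrow> complex) \<Rightarrow> nat \<Rightarrow> complex" where
  "VA e f z c c' a = dQ e (mix (V e f c) (V e f c') (fst (idx e f a))) (fst (idx e f a)) (snd (idx e f a)) z"

lemma V_hadamard:
  assumes "adm e f"
  shows "Q e (V e f c') z - Q e (V e f c) z = (\<Sum>a<ssum e - tri. VA e f z c c' a * (c' a - c a))"
proof -
  define m where "m = ssum e - tri"
  define g where "g i j = dQ e (mix (V e f c) (V e f c') i) i j z" for i j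
  have dV: "V e f c' i j - V e f c i j = (\<Sum>a<m. if idx e f a = (i, j) then c' a - c a else 0)" for i j
  proof (cases "i < k \<and> j \<in> f ` {..<k}")
    case True
    have "(\<Sum>a<m. if idx e f a = (i, j) then c' a - c a else 0) = 0"
      using idx_in[OF assms, of _ i j] True unfolding m_def by (intro sum.neutral) auto
    thus ?thesis using True by (simp add: V_def)
  next
    case False
    thus ?thesis by (auto simp: V_def m_def simp flip: sum_subtractf intro!: sum.cong)
  qed
  have "Q e (V e f c') z - Q e (V e f c) z = (\<Sum>i<k. \<Sum>j<n. \<Sum>a<m. (if idx e f a = (i, j) then c' a - c a else 0) * g i j)"
    unfolding Q_hadamard dV g_def by (simp add: sum_distrib_right)
  also have "\<dots> = (\<Sum>i<k. \<Sum>a<m. \<Sum>j<n. (if idx e f a = (i, j) then c' a - c a else 0) * g i j)"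
    by (intro sum.cong refl sum.swap)
  also have "\<dots> = (\<Sum>a<m. \<Sum>i<k. \<Sum>j<n. (if idx e f a = (i, j) then c' a - c a else 0) * g i j)"
    by (rule sum.swap)
  also have "\<dots> = (\<Sum>a<m. VA e f z c c' a * (c' a - c a))"
  proof (rule sum.cong)
    fix a assume a: "a \<in> {..<m}"
    obtain l0 j0 where lj: "idx e f a = (l0, j0)" by (cases "idx e f a")
    have in': "l0 < k" "j0 < n" using idx_in[OF assms _ lj] a by (auto simp: m_def)
    have inner: "(\<Sum>j<n. (if idx e f a = (i, j) then c' a - c a else 0) * g i j)
        = (if i = l0 then (\<Sum>j<n. if j = j0 then (c' a - c a) * g l0 j0 else 0) else 0)" for i
    proof (cases "i = l0")
      case True
      have "(\<Sum>j<n. (if idx e f a = (i, j) then c' a - c a else 0) * g i j)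
          = (\<Sum>j<n. if j = j0 then (c' a - c a) * g l0 j0 else 0)"
        using lj True by (intro sum.cong) auto
      thus ?thesis using True by simp
    qed (simp add: lj)
    have "(\<Sum>i<k. \<Sum>j<n. (if idx e f a = (i, j) then c' a - c a else 0) * g i j)
        = (\<Sum>i<k. if i = l0 then (\<Sum>j<n. if j = j0 then (c' a - c a) * g l0 j0 else 0) else 0)"
      by (simp only: inner)
    also have "\<dots> = (c' a - c a) * g l0 j0" using in' by simp
    finally show "(\<Sum>i<k. \<Sum>j<n. (if idx e f a = (i, j) then c' a - c a else 0) * g i j) = VA e f z c c' a * (c' a - c a)"
      by (simp add: VA_def g_def lj)
  qed simp
  finally show ?thesis by (simp add: m_def)
qed

lemma tendsto_V: "(\<And>a. ((\<lambda>x. c x a) \<longlongrightarrow> c0 a) F) \<Longrightarrow> ((\<lambda>x. V e f (c x) l j) \<longlongrightarrow> V e f c0 l j) F"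
  unfolding V_def by (auto intro!: tendsto_intros)

lemma tendsto_VA:
  assumes "\<And>a. ((\<lambda>x. c x a) \<longlongrightarrow> c0 a) F" "\<And>a. ((\<lambda>x. c' x a) \<longlongrightarrow> c0' a) F" "(z \<longlongrightarrow> z0) F"
  shows "((\<lambda>x. VA e f (z x) (c x) (c' x) a) \<longlongrightarrow> VA e f z0 c0 c0' a) F"
  unfolding VA_def
proof (intro tendsto_dQ assms)
  fix l j i
  show "((\<lambda>x. mix (V e f (c x)) (V e f (c' x)) i l j) \<longlongrightarrow> mix (V e f c0) (V e f c0') i l j) F"
    unfolding mix_def by (cases "l < i") (auto intro!: tendsto_V assms)
qed

text \<open>\<open>Q\<close> is evaluated at the points \<open>\<tau>\<close> and prescribed to have
  the values \<open>\<rho>\<close>. It is used in two ways: with moving roots and values 0, and with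
  fixed points and moving values.\<close>

lemma chart_system:
  fixes \<tau> :: "nat \<Rightarrow> 't::metric_space \<Rightarrow> complex" and \<rho> :: "nat \<Rightarrow> 't \<Rightarrow> complex"
  assumes "adm e f" and cont: "\<And>l. continuous_on UNIV (\<tau> l)" "\<And>l. continuous_on UNIV (\<rho> l)"
  shows "square_system (ssum e - tri) (\<lambda>l t c. Q e (V e f c) (\<tau> l t) - \<rho> l t) (\<lambda>l t. VA e f (\<tau> l t))"
proof
  fix l t c c'
  show "Q e (V e f c') (\<tau> l t) - \<rho> l t - (Q e (V e f c) (\<tau> l t) - \<rho> l t)
      = (\<Sum>a<ssum e - tri. VA e f (\<tau> l t) c c' a * (c' a - c a))"
    using V_hadamard[OF assms(1)] by simp
next
  fix l
  have "((\<lambda>(t, c). Q e (V e f c) (\<tau> l t) - \<rho> l t) \<longlongrightarrow> Q e (V e f c0) (\<tau> l t0) - \<rho> l t0) (at (t0, c0))" for t0 and c0 :: "nat \<Rightarrow> complex"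
  proof -
    have "((\<lambda>x. fst x) \<longlongrightarrow> t0) (at (t0, c0))" "((\<lambda>x. snd x) \<longlongrightarrow> c0) (at (t0, c0))"
      by (auto intro!: tendsto_eq_intros)
    hence "((\<lambda>x. \<tau> l (fst x)) \<longlongrightarrow> \<tau> l t0) (at (t0, c0))" "((\<lambda>x. \<rho> l (fst x)) \<longlongrightarrow> \<rho> l t0) (at (t0, c0))"
      "\<And>a. ((\<lambda>x. snd x a) \<longlongrightarrow> c0 a) (at (t0, c0))"
      using cont[of l] unfolding tendsto_fun_iff
      by (auto simp: continuous_on_eq_continuous_at intro: isCont_tendsto_compose)
    thus ?thesis unfolding case_prod_beta by (intro tendsto_diff tendsto_Q tendsto_V) auto
  qed
  thus "continuous_on UNIV (\<lambda>(t, c). Q e (V e f c) (\<tau> l t) - \<rho> l t)"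
    by (auto simp: continuous_on_def)
next
  fix l a
  have "((\<lambda>(t, c, c'). VA e f (\<tau> l t) c c' a) \<longlongrightarrow> VA e f (\<tau> l t0) c0 c1 a) (at (t0, c0, c1))" for t0 and c0 c1 :: "nat \<Rightarrow> complex"
  proof -
    have *: "((\<lambda>x. fst x) \<longlongrightarrow> t0) (at (t0, c0, c1))" "((\<lambda>x. fst (snd x)) \<longlongrightarrow> c0) (at (t0, c0, c1))"
       "((\<lambda>x. snd (snd x)) \<longlongrightarrow> c1) (at (t0, c0, c1))"
      by (auto intro!: tendsto_eq_intros)
    hence "((\<lambda>x. \<tau> l (fst x)) \<longlongrightarrow> \<tau> l t0) (at (t0, c0, c1))"
      using cont[of l] by (auto simp: continuous_on_eq_continuous_at intro: isCont_tendsto_compose)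
    with * show ?thesis unfolding case_prod_beta tendsto_fun_iff by (intro tendsto_VA) auto
  qed
  thus "continuous_on UNIV (\<lambda>(t, c, c'). VA e f (\<tau> l t) c c' a)"
    by (auto simp: continuous_on_def)
qed

definition Jac :: "(nat \<Rightarrow> nat) \<Rightarrow> (nat \<Rightarrow> nat) \<Rightarrow> (nat \<Rightarrow> complex) \<Rightarrow> (nat \<Rightarrow> complex) \<Rightarrow> complex" where
  "Jac e f t c = cdet (ssum e - tri) (\<lambda>l a. VA e f (t l) c c a)"

lemma VA_diag: "VA e f z c c a = dQ e (V e f c) (fst (idx e f a)) (snd (idx e f a)) z"
  by (simp add: VA_def mix_def)

lemma Jac_imp_nondeg:
  assumes "adm e f" "Jac e f t c \<noteq> 0"
  shows "nondeg e (V e f c) t (ssum e - tri)"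
  unfolding nondeg_def
proof (rule ccontr, clarsimp)
  fix y l0 assume y: "\<forall>i<k. \<forall>j\<le>e i. (\<Sum>l<ssum e - tri. y l * dQ e (V e f c) i j (t l)) = 0" 
    and l0: "l0 < ssum e - tri" "y l0 \<noteq> 0"
  have "(\<Sum>l<ssum e - tri. y l * VA e f (t l) c c a) = 0" if "a < ssum e - tri" for a
    unfolding VA_diag using y idx_in[OF assms(1) that, of "fst (idx e f a)" "snd (idx e f a)"] by auto
  hence "Jac e f t c = 0" unfolding Jac_def cdet_left_kernel using l0 by blast
  thus False using assms by simp
qed

text \<open>By linearity in row \<open>i\<close> the sum is \<open>Q\<close> with row
  \<open>i\<close> replaced by row \<open>p\<close>. For \<open>p < i\<close>, adding row
  \<open>p\<close> to row \<open>i\<close> is a row operation, which takes a zero of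
  \<open>Q\<close> to a zero.\<close>

lemma dQ_row_relation:
  assumes "adm e f" "v \<in> SY e f" "p \<le> i" "i < k" "Q e v z = 0"
  shows "(\<Sum>j<n. v p j * dQ e v i j z) = 0"
proof -
  have "(\<Sum>j<n. v p j * dQ e v i j z) = Q e (v(i := v p)) z" by (rule Q_row[symmetric]) fact
  also have "\<dots> = 0"
  proof (cases "p = i")
    case True
    thus ?thesis using assms by simp
  next
    case False
    define w where "w = v(i := (\<lambda>j. v i j + v p j))"
    have r: "req w v"
    proof (rule reqI[where b = "\<lambda>l q. if q = l then 1 else if l = i \<and> q = p then 1 else 0"])
      fix l j assume l: "l < k"
      show "w l j = (\<Sum>q<k. (if q = l then 1 else if l = i \<and> q = p then 1 else 0) * v q j)"
      proof (cases "l = i")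
        case True
        have "(\<Sum>q<k. (if q = l then 1 else if l = i \<and> q = p then 1 else 0) * v q j)
          = (\<Sum>q<k. (if q = i then v i j else 0) + (if q = p then v p j else 0))"
          using True False by (intro sum.cong) auto
        thus ?thesis using True assms by (simp add: w_def sum.distrib)
      next
        case False
        hence "(\<Sum>q<k. (if q = l then 1 else if l = i \<and> q = p then 1 else 0) * v q j)
          = (\<Sum>q<k. (if q = l then 1 else 0) * v q j)" by (intro sum.cong) auto
        thus ?thesis using l False by (simp add: w_def sum_indicator_mult)
      qed
    qed (use assms(3) in auto)
    have "v \<in> Y e" using assms(2) by (simp add: SY_def)
    have "Q e w z = 0"
      by (rule Q_req[OF r \<open>v \<in> Y e\<close> adm_mono[OF assms(1)]]) (use assms(5) in simp)
    moreover have "Q e w z = Q e v z + Q e (v(i := v p)) z"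
    proof -
      have "Q e w z = (\<Sum>j<n. (v i j + v p j) * dQ e v i j z)" unfolding w_def by (rule Q_row) fact
      also have "\<dots> = Q e (v(i := v i)) z + Q e (v(i := v p)) z"
        unfolding Q_row[OF assms(4)] by (simp add: algebra_simps sum.distrib)
      finally show ?thesis by simp
    qed
    ultimately show ?thesis using assms(5) by simp
  qed
  finally show ?thesis .
qed

text \<open>The entries in pivot columns give nothing beyond the free ones: at a zero of
  \<open>Q\<close> the relation for row \<open>p\<close> expresses the derivative in column
  \<open>f p\<close> through those in free columns.\<close>

lemma nondeg_imp_Jac:
  assumes adm: "adm e f" and sol: "\<And>l. l < ssum e - tri \<Longrightarrow> Q e (V e f c) (t l) = 0"
    and nd: "nondeg e (V e f c) t (ssum e - tri)"
  shows "Jac e f t c \<noteq> 0"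
proof
  define m where "m = ssum e - tri"
  define v where "v = V e f c"
  have v: "v \<in> SY e f" unfolding v_def by (rule V_SY[OF adm])
  assume "Jac e f t c = 0"
  then obtain y l0 where y: "l0 < m" "y l0 \<noteq> 0" "\<And>a. a < m \<Longrightarrow> (\<Sum>l<m. y l * VA e f (t l) c c a) = 0"
    unfolding Jac_def cdet_left_kernel m_def by blast
  have free: "(\<Sum>l<m. y l * dQ e v i j (t l)) = 0" if "i < k" "j \<le> e i" "j \<notin> f ` {..<k}" for i j
  proof -
    have "(i, j) \<in> cells e f" using that by (simp add: cells_def)
    then obtain a where "a < m" "idx e f a = (i, j)"
      unfolding bij_betw_imp_surj_on[OF bij_idx[OF adm], symmetric] m_def by auto
    thus ?thesis using y(3)[of a] by (simp add: VA_diag v_def)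
  qed
  have "(\<Sum>l<m. y l * dQ e v i j (t l)) = 0" if ij: "i < k" "j \<le> e i" for i j
  proof (cases "j \<in> f ` {..<k}")
    case True
    then obtain p where p: "p < k" "j = f p" by auto
    have "p \<le> i" using adm ij p unfolding adm_def by (meson not_less)
    have ep: "e p \<le> e i" using adm_mono[OF adm] \<open>p \<le> i\<close> ij by (auto simp: mono_idx_def)
    have jn: "j < n" using adm p unfolding adm_def by (meson le_less_trans)
    have "0 = (\<Sum>l<m. y l * (\<Sum>c<n. v p c * dQ e v i c (t l)))"
      using dQ_row_relation[OF adm v \<open>p \<le> i\<close> ij(1)] sol by (simp add: m_def v_def)
    also have "\<dots> = (\<Sum>c<n. v p c * (\<Sum>l<m. y l * dQ e v i c (t l)))"
      unfolding sum_distrib_left by (subst sum.swap) (simp add: mult_ac)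
    also have "\<dots> = (\<Sum>c<n. if c = j then (\<Sum>l<m. y l * dQ e v i j (t l)) else 0)"
    proof (rule sum.cong)
      fix c
      consider "c = j" | "c \<noteq> j" "c \<in> f ` {..<k}" | "c \<notin> f ` {..<k}" "c > e p" | "c \<notin> f ` {..<k}" "c \<le> e p"
        by linarith
      thus "v p c * (\<Sum>l<m. y l * dQ e v i c (t l)) = (if c = j then (\<Sum>l<m. y l * dQ e v i j (t l)) else 0)"
      proof cases
        case 4
        thus ?thesis using free[OF ij(1), of c] ep p by auto
      qed (use v p in \<open>auto simp: SY_def Y_def\<close>)
    qed simp
    finally show ?thesis using jn by simp
  qed (use free ij in blast)
  hence "\<forall>l<m. y l = 0" using nd unfolding nondeg_def v_def m_def by blast
  thus False using y by blast
qed

end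

lemma convergent_subsequence_double:
  fixes f :: "nat \<Rightarrow> nat \<Rightarrow> nat \<Rightarrow> complex"
  assumes "\<And>i l c. norm (f i l c) \<le> B l c"
  obtains \<phi> g where "strict_mono (\<phi> :: nat \<Rightarrow> nat)" "\<And>l c. (\<lambda>i. f (\<phi> i) l c) \<longlonglongrightarrow> g l c"
proof -
  define K where "K = PiE UNIV (\<lambda>l. PiE UNIV (\<lambda>c. cball (0::complex) (B l c)))"
  have inner: "compact (PiE UNIV (\<lambda>c. cball (0::complex) (B l c)))" for l
  proof -
    have "compactin (product_topology (\<lambda>i. euclidean) UNIV) (PiE UNIV (\<lambda>c. cball (0::complex) (B l c)))"
      by (subst compactin_PiE) auto
    thus ?thesis by (simp add: euclidean_product_topology)
  qed
  have "compactin (product_topology (\<lambda>i. euclidean) UNIV) K"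
    unfolding K_def by (subst compactin_PiE) (use inner in auto)
  hence "compact K" by (simp add: euclidean_product_topology)
  moreover have "f i \<in> K" for i using assms by (auto simp: K_def)
  ultimately obtain g \<phi> where "strict_mono (\<phi> :: nat \<Rightarrow> nat)" "(f \<circ> \<phi>) \<longlonglongrightarrow> g"
    unfolding compact_eq_seq_compact_metric seq_compact_def by metis
  thus ?thesis using that[of \<phi> g] by (simp add: tendsto_fun_iff o_def)
qed

context grass begin

subsection \<open>A totally real fibre by degeneration\<close>

lemma Q_cnj: "Q e (\<lambda>l j. cnj (v l j)) (cnj z) = cnj (Q e v z)"
proof -
  have "Qcoef (\<lambda>l j. cnj (v l j)) p = cnj (Qcoef v p)" for p
    unfolding Qcoef_def complex_cnj_mult cnj_prod
    by (intro arg_cong2[where f = "(*)"] prod.cong) (auto simp: ff_def)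
  thus ?thesis by (simp add: Q_leibniz)
qed

lemma V_cnj: "V e f (\<lambda>a. cnj (c a)) l j = cnj (V e f c l j)"
  by (simp add: V_def if_distrib cong: if_cong)

lemma nondeg_cong:
  assumes "\<And>l j. l < k \<Longrightarrow> v l j = w l j" "\<And>l. l < m \<Longrightarrow> t l = t' l"
  shows "nondeg e v t m \<longleftrightarrow> nondeg e w t' m"
proof -
  have "dQ e v i j z = dQ e w i j z" for i j z
    unfolding dQ_def by (rule Q_cong) (use assms in auto)
  thus ?thesis unfolding nondeg_def using assms(2) by simp
qed

lemma nondegD:
  "nondeg e v t m \<Longrightarrow> (\<And>i j. i < k \<Longrightarrow> j \<le> e i \<Longrightarrow> (\<Sum>l<m. y l * dQ e v i j (t l)) = 0) \<Longrightarrow> l < m \<Longrightarrow> y l = 0"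
  unfolding nondeg_def by blast

lemma SY_imp_indep:
  assumes "v \<in> SY e f"
  shows "indep v"
  unfolding indep_def
proof (intro allI impI)
  fix x l assume x: "\<forall>j. (\<Sum>l<k. x l * v l j) = 0" and l: "l < k"
  have "0 = (\<Sum>p<k. x p * v p (f l))" using x by simp
  also have "\<dots> = (\<Sum>p<k. if p = l then x l else 0)"
    using assms l by (intro sum.cong) (auto simp: SY_def)
  finally show "x l = 0" using l by simp
qed

lemma number_of_roots_le:
  assumes "v \<in> Y e" "Q e v z0 \<noteq> 0" "inj_on t {..<r}" "\<And>l. l < r \<Longrightarrow> Q e v (t l) = 0"
  shows "r \<le> ssum e - tri"
proof -
  have "Qp e v \<noteq> 0" using assms(2) by (auto simp flip: poly_Qp)
  moreover have "t ` {..<r} \<subseteq> {z. poly (Qp e v) z = 0}" using assms(4) by (auto simp: poly_Qp)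
  ultimately have "card (t ` {..<r}) \<le> card {z. poly (Qp e v) z = 0}"
    by (intro card_mono poly_roots_finite)
  also have "\<dots> \<le> degree (Qp e v)" using \<open>Qp e v \<noteq> 0\<close> by (rule card_poly_roots_bound)
  finally have "card (t ` {..<r}) \<le> degree (Qp e v)" .
  thus ?thesis using degree_Qp[OF assms(1)] assms(3) by (simp add: card_image)
qed

lemma adm_self: "adm e e \<longleftrightarrow> (\<forall>l p. l < p \<longrightarrow> p < k \<longrightarrow> e l < e p) \<and> (\<forall>l<k. e l < n)"
  unfolding adm_def inj_on_def by (auto; metis neq_iff)

lemma Y_mono: "(\<And>l. l < k \<Longrightarrow> f l \<le> e l) \<Longrightarrow> Y f \<subseteq> Y e"
  unfolding Y_def by (auto intro: le_less_trans)

text \<open>The condition on \<open>l < i\<close> says that lowering \<open>e i\<close> keeps the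
  positions strictly increasing. Such \<open>i\<close> give the cells of codimension one in the
  closure of the cell \<open>e\<close>.\<close>

lemma adm_decrement:
  assumes "adm e e" "i < k" "e i > 0" "\<And>l. l < i \<Longrightarrow> e l < e i - 1"
  shows "adm e (e(i := e i - 1))" "adm (e(i := e i - 1)) (e(i := e i - 1))"
    "ssum e = Suc (ssum (e(i := e i - 1)))"
proof -
  let ?f = "e(i := e i - 1)"
  have e: "e l < e p" if "l < p" "p < k" for l p using assms(1) that by (simp add: adm_self)
  have f: "?f l < ?f p" if "l < p" "p < k" for l p
  proof (cases "l = i")
    case True
    thus ?thesis using e[OF that] that by auto
  next
    case False
    thus ?thesis using e[OF that] assms(4)[of l] that by auto
  qed
  have n: "e l < n" if "l < k" for l using assms(1) that by (simp add: adm_self)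
  show 2: "adm ?f ?f" unfolding adm_self
    using f n assms(2) by (auto intro: le_less_trans[OF diff_le_self])
  have ef: "e l < ?f p" if "l < p" "p < k" for l p
    using e[OF that] assms(4)[of l] that by auto
  have fe: "?f l \<le> e l" for l by simp
  have inj: "inj_on ?f {..<k}" using 2 unfolding adm_def by blast
  show "adm e ?f" unfolding adm_def using e n ef fe inj by blast
  have "ssum e = e i + sum e ({..<k} - {i})" "ssum ?f = (e i - 1) + sum e ({..<k} - {i})"
    unfolding ssum_def using assms(2) by (simp_all add: sum.remove)
  thus "ssum e = Suc (ssum ?f)" using assms(3) by simp
qed

text \<open>The system is block triangular. Derivatives along the small cell carry a factor
  \<open>z\<close>, so they vanish at the new root 0 and reduce the other rows to the old system.
  Along the new entry \<open>(i, e i)\<close> the derivative at 0 is \<open>kappa e\<close>.\<close>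

lemma nondeg_add_zero:
  assumes adm: "adm e e" and i: "i < k" "e i > 0" "\<And>l. l < i \<Longrightarrow> e l < e i - 1"
    and f: "f = e(i := e i - 1)" and u: "u \<in> SY f f" and t: "\<And>l. l < m \<Longrightarrow> t l \<noteq> 0" and t0: "t m = 0"
    and nd: "nondeg f u t m"
  shows "nondeg e u t (Suc m)"
  unfolding nondeg_def
proof (intro allI impI)
  fix y l0 assume y: "\<forall>a<k. \<forall>b\<le>e a. (\<Sum>l<Suc m. y l * dQ e u a b (t l)) = 0" and l0: "l0 < Suc m"
  note dec = adm_decrement[OF adm i, folded f]
  have fe: "f l \<le> e l" for l by (simp add: f)
  have uY: "u \<in> Y f" using u by (simp add: SY_def)
  have dQ: "dQ e u a b z = z * dQ f u a b z" if "a < k" "b \<le> f a" for a b z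
  proof -
    have "u(a := \<lambda>c. if c = b then 1 else 0) \<in> Y f" using uY that by (auto simp: Y_def)
    from Q_change[OF this fe] show ?thesis unfolding dQ_def using dec(3) by simp
  qed
  have "y l * t l = 0" if "l < m" for l
  proof (rule nondegD[where y = "\<lambda>l. y l * t l", OF nd _ that])
    show "(\<Sum>l<m. (y l * t l) * dQ f u a b (t l)) = 0" if "a < k" "b \<le> f a" for a b
    proof -
      have "b \<le> e a" using that fe[of a] by simp
      hence "(\<Sum>l<Suc m. y l * dQ e u a b (t l)) = 0" using y that by blast
      thus ?thesis using t0 by (simp add: dQ[OF that] mult.assoc)
    qed
  qed
  hence y0: "y l = 0" if "l < m" for l using t[OF that] that by (metis mult_eq_0_iff)
  have "dQ e u i (e i) 0 \<noteq> 0"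
  proof -
    let ?w = "u(i := \<lambda>c. if c = e i then 1 else 0)"
    have "u \<in> Y e" using uY Y_mono[of f e] fe by blast
    hence "?w \<in> Y e" by (simp add: Y_def)
    hence "Q e ?w 0 = (\<Prod>l<k. ?w l (e l)) * kappa e" by (rule Q_at_0)
    moreover have "(\<Prod>l<k. ?w l (e l)) = 1"
      using u by (intro prod.neutral) (auto simp: SY_def f split: if_splits)
    moreover have "kappa e \<noteq> 0" using adm by (intro kappa_nonzero) (auto simp: adm_def)
    ultimately show ?thesis by (simp add: dQ_def)
  qed
  moreover have "(\<Sum>l<Suc m. y l * dQ e u i (e i) (t l)) = 0" using y i by blast
  ultimately have "y m = 0" using y0 t0 by simp
  thus "y l0 = 0" using y0 l0 by (auto simp: less_Suc_eq)
qed

definition real_rows :: "(nat \<Rightarrow> nat \<Rightarrow> complex) \<Rightarrow> bool" where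
  "real_rows v \<longleftrightarrow> (\<forall>l<k. \<forall>j. v l j \<in> \<real>)"

text \<open>The cell \<open>SY e e\<close> contains a point with roots \<open>t\<close>, and all such points are real and simple.\<close>
definition good :: "nat \<Rightarrow> (nat \<Rightarrow> real) \<Rightarrow> (nat \<Rightarrow> nat) \<Rightarrow> bool" where
  "good m t e \<longleftrightarrow> (\<exists>v\<in>SY e e. \<forall>l<m. Q e v (of_real (t l)) = 0) \<and>
     (\<forall>v\<in>SY e e. (\<forall>l<m. Q e v (of_real (t l)) = 0) \<longrightarrow> real_rows v \<and> nondeg e v (\<lambda>l. of_real (t l)) m)"

text \<open>The cells of dimension \<open>m\<close>. Fixing the values outside \<open>{..<k}\<close>
  makes the set finite.\<close>

definition positions :: "nat \<Rightarrow> (nat \<Rightarrow> nat) set" where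
  "positions m = {e. adm e e \<and> ssum e = tri + m \<and> (\<forall>l\<ge>k. e l = 0)}"

lemma finite_positions: "finite (positions m)"
proof (rule finite_subset)
  show "positions m \<subseteq> {e. \<forall>l. (l \<in> {..<k} \<longrightarrow> e l \<in> {..<n}) \<and> (l \<notin> {..<k} \<longrightarrow> e l = 0)}"
    by (auto simp: positions_def adm_self)
  show "finite {e. \<forall>l. (l \<in> {..<k} \<longrightarrow> e l \<in> {..<n}) \<and> (l \<notin> {..<k} \<longrightarrow> e l = (0::nat))}"
    by (rule finite_set_of_finite_funs) auto
qed

lemma positions_decrement:
  assumes "e \<in> positions (Suc m)" "i < k" "e i > 0" "\<And>l. l < i \<Longrightarrow> e l < e i - 1"
  shows "e(i := e i - 1) \<in> positions m"
  using adm_decrement[of e i] assms by (auto simp: positions_def)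

definition param :: "nat \<Rightarrow> (nat \<Rightarrow> real) \<Rightarrow> real \<Rightarrow> nat \<Rightarrow> complex" where
  "param m t s = (\<lambda>l. of_real ((t(m := s)) l))"

lemma tendsto_param: "(s \<longlongrightarrow> s0) F \<Longrightarrow> ((\<lambda>x. param m t (s x)) \<longlongrightarrow> param m t s0) F"
  unfolding tendsto_fun_iff param_def by (auto intro!: tendsto_intros)

lemma chart_square_system:
  "adm e f \<Longrightarrow> square_system (ssum e - tri) (\<lambda>l t c. Q e (V e f c) (t l)) (\<lambda>l t. VA e f (t l))"
  using chart_system[of e f "\<lambda>l t. t l" "\<lambda>l t. 0"]
  by (simp add: continuous_on_product_then_coordinatewise[OF continuous_on_id])

lemma chart_D: "adm e f \<Longrightarrow> square_system.D (ssum e - tri) (\<lambda>l t. VA e f (t l)) t c c = Jac e f t c"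
  by (simp add: square_system.D_def[OF chart_square_system] Jac_def)

section \<open>Adding one small positive root\<close>

context
  fixes m :: nat and t :: "nat \<Rightarrow> real" and e :: "nat \<Rightarrow> nat"
  assumes t_pos: "\<And>l. l < m \<Longrightarrow> t l > 0" and t_inj: "inj_on t {..<m}"
    and good: "\<And>e. e \<in> positions m \<Longrightarrow> good m t e"
    and e: "e \<in> positions (Suc m)"
begin

text \<open>A solution in a boundary cell \<open>f\<close> becomes, for \<open>s = 0\<close>, a
  solution for the cell \<open>e\<close> with the additional root 0. The chart with pivots
  \<open>f\<close> contains it, while the chart with pivots \<open>e\<close> does not, its entry
  \<open>(i, e i)\<close> being 0.\<close>

lemma Jac_limit_nonzero:
  assumes i: "i < k" "e i > 0" "\<And>l. l < i \<Longrightarrow> e l < e i - 1" and f: "f = e(i := e i - 1)"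
    and u: "u \<in> SY f f" and sol: "\<And>l. l < m \<Longrightarrow> Q f u (of_real (t l)) = 0"
  shows "Jac e f (param m t 0) (coords e f u) \<noteq> 0" "\<And>l. l < Suc m \<Longrightarrow> Q e u (param m t 0 l) = 0"
    "u \<in> SY e f" "real_rows u"
proof -
  have adm: "adm e e" and se: "ssum e = tri + Suc m" using e by (auto simp: positions_def)
  note dec = adm_decrement[OF adm i, folded f]
  have fe: "f l \<le> e l" for l by (simp add: f)
  have "f \<in> positions m" unfolding f by (rule positions_decrement[OF e i])
  hence "real_rows u \<and> nondeg f u (\<lambda>l. of_real (t l)) m" using good u sol unfolding good_def by blast
  hence nd: "nondeg f u (param m t 0) m" and "real_rows u"
    using nondeg_cong[of u u m "\<lambda>l. of_real (t l)" "param m t 0"] by (auto simp: param_def)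
  show "real_rows u" by fact
  have nd': "nondeg e u (param m t 0) (Suc m)"
    by (rule nondeg_add_zero[OF adm i f u _ _ nd]) (use t_pos in \<open>force simp: param_def\<close>)+
  have uY: "u \<in> Y f" using u by (simp add: SY_def)
  show sol': "Q e u (param m t 0 l) = 0" if "l < Suc m" for l
    using Q_change[OF uY fe, where z = "param m t 0 l"] dec(3) sol[of l] that
    by (auto simp: param_def less_Suc_eq)
  show uS: "u \<in> SY e f" using u Y_mono[of f e] fe by (auto simp: SY_def)
  note Vu = V_coords[OF dec(1) uS]
  show "Jac e f (param m t 0) (coords e f u) \<noteq> 0"
  proof (rule nondeg_imp_Jac[OF dec(1)])
    show "nondeg e (V e f (coords e f u)) (param m t 0) (ssum e - tri)"
      using nd' nondeg_cong[of "V e f (coords e f u)" u "Suc m"] Vu se by simp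
    show "Q e (V e f (coords e f u)) (param m t 0 l) = 0" if "l < ssum e - tri" for l
      using sol'[of l] that se Q_cong[of "V e f (coords e f u)" u e] Vu by simp
  qed
qed

text \<open>A solution in one boundary cell is continued from \<open>s = 0\<close> to small
  \<open>s > 0\<close>. It leaves the boundary there, so it can be brought to the normal form of the
  cell \<open>e\<close>.\<close>

lemma eventually_solution_exists:
  "eventually (\<lambda>s. \<exists>v\<in>SY e e. \<forall>l<Suc m. Q e v (param m t s l) = 0) (at_right 0)"
proof -
  have adm: "adm e e" and se: "ssum e = tri + Suc m" using e by (auto simp: positions_def)
  have "\<exists>i<k. e i > i"
  proof (rule ccontr)
    assume "\<not> ?thesis"
    hence "e l \<le> l" if "l < k" for l using that not_less by blast
    hence "ssum e \<le> tri" unfolding ssum_def tri_def by (intro sum_mono) auto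
    thus False using se by simp
  qed
  \<comment> \<open>The least such index can be lowered: for \<open>l < i\<close> one has
    \<open>e l \<le> l < i \<le> e i - 1\<close>.\<close>
  define i where "i = (LEAST i. i < k \<and> e i > i)"
  have i1: "i < k \<and> e i > i" unfolding i_def by (rule LeastI_ex) fact
  have i: "i < k" "e i > 0" "\<And>l. l < i \<Longrightarrow> e l < e i - 1"
  proof -
    show "i < k" "e i > 0" using i1 by auto
    fix l assume "l < i"
    hence "\<not> (l < k \<and> e l > l)" unfolding i_def by (rule not_less_Least)
    thus "e l < e i - 1" using \<open>l < i\<close> i1 by auto
  qed
  define f where "f = e(i := e i - 1)"
  note dec = adm_decrement[OF adm i, folded f_def]
  have "f \<in> positions m" unfolding f_def by (rule positions_decrement[OF e i])
  then obtain u where u: "u \<in> SY f f" "\<And>l. l < m \<Longrightarrow> Q f u (of_real (t l)) = 0"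
    using good unfolding good_def by blast
  note J = Jac_limit_nonzero[OF i f_def u]
  define c0 where "c0 = coords e f u"
  interpret sys: square_system "ssum e - tri" "\<lambda>l t c. Q e (V e f c) (t l)" "\<lambda>l t. VA e f (t l)"
    by (rule chart_square_system[OF dec(1)])
  have sol0: "Q e (V e f c0) (param m t 0 l) = 0" if "l < ssum e - tri" for l
    using J(2)[of l] that se Q_cong[of "V e f c0" u e] V_coords[OF dec(1) J(3)] by (simp add: c0_def)
  have D0: "sys.D (param m t 0) c0 c0 \<noteq> 0" using J(1) by (simp add: chart_D[OF dec(1)] c0_def)
  have "eventually (\<lambda>s. \<exists>c. (\<forall>a<ssum e - tri. dist (c a) (c0 a) < 1) \<and> (\<forall>a\<ge>ssum e - tri. c a = c0 a) \<and>
      (\<forall>l<ssum e - tri. Q e (V e f c) (param m t s l) = 0)) (at_right 0)"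
    by (rule eventually_compose_filterlim[OF sys.solution_persists[OF D0 sol0] tendsto_param]) auto
  moreover have "eventually (\<lambda>s::real. s > 0) (at_right 0)" by (rule eventually_at_right_less)
  moreover have "eventually (\<lambda>s::real. \<forall>l\<in>{..<m}. s < t l) (at_right 0)"
    using t_pos by (intro eventually_ball_finite ballI) (auto simp: eventually_at_right_field)
  ultimately show ?thesis
  proof eventually_elim
    case (elim s)
    then obtain c where c: "\<And>l. l < Suc m \<Longrightarrow> Q e (V e f c) (param m t s l) = 0" using se by auto
    define w where "w = V e f c"
    have w: "w \<in> SY e f" unfolding w_def by (rule V_SY[OF dec(1)])
    \<comment> \<open>Otherwise \<open>w\<close> would be in \<open>Y f\<close>, where the
      polynomial \<open>Q f w\<close> has degree at most \<open>m\<close>, whereas it would have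
      \<open>m + 1\<close> distinct nonzero roots.\<close>
    have "w i (e i) \<noteq> 0"
    proof
      assume z: "w i (e i) = 0"
      have wY: "w \<in> Y f"
      proof -
        have "w l j = 0" if "l < k" "f l < j" for l j
          using w that z by (cases "l = i \<and> j = e i") (auto simp: SY_def Y_def f_def split: if_splits)
        thus ?thesis by (simp add: Y_def)
      qed
      have "Q f w 0 = (\<Prod>l<k. w l (f l)) * kappa f" by (rule Q_at_0[OF wY])
      also have "(\<Prod>l<k. w l (f l)) = 1" using w by (intro prod.neutral) (auto simp: SY_def)
      finally have nz: "Q f w 0 \<noteq> 0" using kappa_nonzero[of f] dec(2) by (auto simp: adm_def)
      have "Suc m \<le> ssum f - tri"
      proof (rule number_of_roots_le[OF wY nz])
        show "inj_on (param m t s) {..<Suc m}"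
          using t_inj elim(3) by (auto simp: inj_on_def param_def less_Suc_eq)
        fix l assume l: "l < Suc m"
        have "param m t s l * Q f w (param m t s l) = 0"
          using Q_change[OF wY, of e "param m t s l"] c[OF l] dec(3) by (simp add: w_def f_def)
        moreover have "param m t s l \<noteq> 0" using l t_pos[of l] elim(2) by (auto simp: param_def less_Suc_eq)
        ultimately show "Q f w (param m t s l) = 0" by simp
      qed
      thus False using dec(3) se by simp
    qed
    moreover have "w l (f l) = 1" if "l < k" for l using w that by (simp add: SY_def)
    ultimately have we: "w l (e l) \<noteq> 0" if "l < k" for l
      using that by (cases "l = i") (force simp: f_def)+
    have wYe: "w \<in> Y e" using w by (simp add: SY_def)
    have "Q e (nf e w) (param m t s l) = 0" if "l < Suc m" for l
      by (rule Q_req[OF req_nf[OF adm wYe we] wYe adm_mono[OF adm]]) (use c[OF that] in \<open>auto simp: w_def\<close>)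
    thus ?case using nf_SY[OF adm wYe we] by blast
  qed
qed

text \<open>Renormalised solutions converge along a subsequence, and counting roots puts the limit
  into a boundary cell. There it is real and nondegenerate by the induction hypothesis, so the
  nearby solutions are nondegenerate and agree with their conjugates.\<close>

lemma subsequence_real_nondeg:
  assumes s: "s \<longlonglongrightarrow> 0" "\<And>j. s j > 0"
    and v: "\<And>j. v j \<in> SY e e" "\<And>j l. l < Suc m \<Longrightarrow> Q e (v j) (param m t (s j) l) = 0"
  obtains j where "real_rows (v j)" "nondeg e (v j) (param m t (s j)) (Suc m)"
proof -
  have adm: "adm e e" and se: "ssum e = tri + Suc m" using e by (auto simp: positions_def)
  note mono = adm_mono[OF adm]
  have en: "e l < n" if "l < k" for l using adm that by (simp add: adm_def)
  have vY: "v j \<in> Y e" for j using v(1) by (simp add: SY_def)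
  have vn: "v j l c = 0" if "l < k" "c \<ge> n" for j l c
    using vY[of j] en[OF that(1)] that by (auto simp: Y_def)
  define PW where "PW j w \<longleftrightarrow> req w (v j) \<and> (\<forall>l<k. \<forall>c. norm (w l c) \<le> 1) \<and>
      (\<forall>x. \<forall>l<k. norm (x l) \<le> 2 ^ l * (\<Sum>c<n. norm (\<Sum>p<k. x p * w p c)))" for j w
  have "\<exists>w. PW j w" for j
    by (rule bounded_representative[OF SY_imp_indep[OF v(1)[of j]] vn[where j = j]]) (auto simp: PW_def)
  then obtain w where w: "\<And>j. PW j (w j)" by metis
  \<comment> \<open>Rows from \<open>k\<close> on are cleared, so that the bound holds for all
    indices.\<close>
  define w1 where "w1 j l c = (if l < k then w j l c else 0)" for j l c
  have w1: "req (w1 j) (v j)" for j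
    by (rule req_trans[OF req_refl]) (use w in \<open>auto simp: PW_def w1_def\<close>)
  have w1Y: "w1 j \<in> Y e" for j by (rule req_Y[OF w1 vY mono])
  have w1b: "norm (w1 j l c) \<le> 1" for j l c using w by (simp add: w1_def PW_def)
  obtain \<phi> w2 where \<phi>: "strict_mono \<phi>" "\<And>l c. (\<lambda>i. w1 (\<phi> i) l c) \<longlonglongrightarrow> w2 l c"
    using convergent_subsequence_double[of w1 "\<lambda>_ _. 1", OF w1b] by blast
  have s\<phi>: "(\<lambda>i. s (\<phi> i)) \<longlonglongrightarrow> 0"
    using LIMSEQ_subseq_LIMSEQ[OF s(1) \<phi>(1)] by (simp add: o_def)
  have par: "(\<lambda>i. param m t (s (\<phi> i)) l) \<longlonglongrightarrow> param m t 0 l" for l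
    using tendsto_param[OF s\<phi>] unfolding tendsto_fun_iff by blast
  have w2Y: "w2 \<in> Y e"
  proof -
    have "w2 l c = 0" if "l < k" "e l < c" for l c
      using \<phi>(2)[of l c] w1Y that by (simp add: Y_def LIMSEQ_const_iff)
    thus ?thesis by (simp add: Y_def)
  qed
  have ind: "indep w2"
    unfolding indep_def
  proof (intro allI impI)
    fix x l assume x: "\<forall>j. (\<Sum>l<k. x l * w2 l j) = 0" and l: "l < k"
    have "(\<lambda>i. 2 ^ l * (\<Sum>c<n. norm (\<Sum>p<k. x p * w1 (\<phi> i) p c)))
        \<longlonglongrightarrow> 2 ^ l * (\<Sum>c<n. norm (\<Sum>p<k. x p * w2 p c))"
      by (intro tendsto_intros \<phi>(2))
    moreover have "norm (x l) \<le> 2 ^ l * (\<Sum>c<n. norm (\<Sum>p<k. x p * w1 (\<phi> i) p c))" for i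
      using w[of "\<phi> i"] l unfolding PW_def by (simp add: w1_def)
    hence "\<exists>N. \<forall>i\<ge>N. norm (x l) \<le> 2 ^ l * (\<Sum>c<n. norm (\<Sum>p<k. x p * w1 (\<phi> i) p c))" by blast
    ultimately have "norm (x l) \<le> 2 ^ l * (\<Sum>c<n. norm (\<Sum>p<k. x p * w2 p c))"
      by (rule LIMSEQ_le_const)
    thus "x l = 0" using x by simp
  qed
  have w2sol: "Q e w2 (param m t 0 l) = 0" if "l < Suc m" for l
  proof -
    have "Q e (w1 (\<phi> i)) (param m t (s (\<phi> i)) l) = 0" for i
      by (rule Q_req[OF w1[of "\<phi> i"] vY[of "\<phi> i"] mono]) (use v(2)[OF that] in simp)
    moreover have "(\<lambda>i. Q e (w1 (\<phi> i)) (param m t (s (\<phi> i)) l)) \<longlonglongrightarrow> Q e w2 (param m t 0 l)"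
      by (intro tendsto_Q \<phi>(2) par)
    ultimately show ?thesis by (simp add: LIMSEQ_const_iff)
  qed
  obtain u1 g where u1: "req u1 w2" "u1 \<in> Y g" "inj_on g {..<k}" "\<And>l. l < k \<Longrightarrow> g l \<le> e l"
    "\<And>l. l < k \<Longrightarrow> u1 l (g l) \<noteq> 0"
    using distinct_leads[OF ind w2Y] by blast
  have u1sol: "Q e u1 (param m t 0 l) = 0" if "l < Suc m" for l
    by (rule Q_req[OF u1(1) w2Y mono]) (use w2sol[OF that] in simp)
  have nz: "Q g u1 0 \<noteq> 0"
    unfolding Q_at_0[OF u1(2)] using u1(5) kappa_nonzero[OF u1(3)] u1(4) en by (auto intro: le_less_trans)
  have ssum_le: "ssum g \<le> ssum e" unfolding ssum_def using u1(4) by (intro sum_mono) auto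
  \<comment> \<open>The root 0 excludes equality, and \<open>m\<close> distinct nonzero roots need
    degree at least \<open>m\<close>. Hence \<open>ssum g\<close> is exactly one less than
    \<open>ssum e\<close>, and only one position can have dropped.\<close>
  have "ssum g \<noteq> ssum e"
  proof
    assume "ssum g = ssum e"
    hence "Q e u1 0 = Q g u1 0" using Q_change[OF u1(2,4), where z = 0] by simp
    thus False using nz u1sol[of m] by (simp add: param_def)
  qed
  moreover have "tri \<le> ssum g" unfolding tri_def ssum_def by (rule sum_lessThan_le_sum_inj[OF u1(3)])
  moreover have "m \<le> ssum g - tri"
  proof (rule number_of_roots_le[OF u1(2) nz])
    show "inj_on (\<lambda>l. complex_of_real (t l)) {..<m}" using t_inj by (auto simp: inj_on_def)
    fix l assume l: "l < m"
    thus "Q g u1 (of_real (t l)) = 0"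
      using Q_change[OF u1(2,4), where z = "of_real (t l)"] u1sol[of l] t_pos[OF l] by (simp add: param_def)
  qed
  ultimately have sg: "Suc (ssum g) = ssum e" using ssum_le se by linarith
  have "\<exists>i<k. g i \<noteq> e i"
  proof (rule ccontr)
    assume "\<not> ?thesis"
    hence "ssum g = ssum e" unfolding ssum_def by (intro sum.cong) auto
    thus False using sg by simp
  qed
  then obtain i where i: "i < k" "g i < e i" using u1(4) by (meson le_neq_implies_less)
  have "sum g ({..<k} - {i}) \<le> sum e ({..<k} - {i})" using u1(4) by (intro sum_mono) auto
  moreover have "ssum g = g i + sum g ({..<k} - {i})" "ssum e = e i + sum e ({..<k} - {i})"
    unfolding ssum_def using i(1) by (simp_all add: sum.remove)
  ultimately have gi: "g i = e i - 1" and rest: "sum g ({..<k} - {i}) = sum e ({..<k} - {i})"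
    using sg i(2) by linarith+
  have ge: "g l = e l" if "l < k" "l \<noteq> i" for l
  proof (rule ccontr)
    assume "g l \<noteq> e l"
    hence "sum g ({..<k} - {i}) < sum e ({..<k} - {i})"
      using that u1(4) by (intro sum_strict_mono_ex1) (auto intro!: bexI[of _ l] le_neq_implies_less)
    thus False using rest by simp
  qed
  define f where "f = e(i := e i - 1)"
  have gf: "g l = f l" if "l < k" for l using ge gi that by (auto simp: f_def)
  have i3: "e l < e i - 1" if "l < i" for l
  proof -
    have "e l < e i" using adm that i(1) by (simp add: adm_self)
    moreover have "e l \<noteq> e i - 1" using u1(3) ge[of l] gi that i(1) unfolding inj_on_def
      by (metis lessThan_iff less_trans nat_neq_iff)
    ultimately show ?thesis by simp
  qed
  have i2: "e i > 0" using i(2) by simp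
  have dec: "adm e f" "adm f f" "ssum e = Suc (ssum f)"
    unfolding f_def by (rule adm_decrement[OF adm i(1) i2]; use i3 in simp)+
  have u1f: "u1 \<in> Y f" "\<And>l. l < k \<Longrightarrow> u1 l (f l) \<noteq> 0" using u1(2,5) gf by (auto simp: Y_def)
  define u where "u = nf f u1"
  have uS: "u \<in> SY f f" unfolding u_def by (rule nf_SY[OF dec(2) u1f])
  have uu1: "req u u1" unfolding u_def by (rule req_nf[OF dec(2) u1f])
  have usol: "Q f u (of_real (t l)) = 0" if l: "l < m" for l
  proof (rule Q_req[OF uu1 u1f(1) adm_mono[OF dec(2)]])
    fix \<mu> assume "\<And>z. Q f u z = \<mu> * Q f u1 z"
    moreover have "Q f u1 (of_real (t l)) = 0"
      using Q_change[OF u1f(1), where e = e and z = "of_real (t l)"] u1sol[of l] t_pos[OF l] l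
      by (simp add: param_def f_def)
    ultimately show ?thesis by simp
  qed
  note J = Jac_limit_nonzero[OF i(1) i2 i3 f_def uS usol]
  define c0 where "c0 = coords e f u"
  \<comment> \<open>This row change takes the limit \<open>w2\<close> to its normal form
    \<open>u\<close>. Applied to the approximating matrices it gives representatives that converge
    to \<open>u\<close>.\<close>
  obtain b where b: "\<And>l. l < k \<Longrightarrow> b l l \<noteq> 0" "\<And>l p. l < k \<Longrightarrow> p > l \<Longrightarrow> b l p = 0"
    "\<And>l j. l < k \<Longrightarrow> u l j = (\<Sum>p<k. b l p * w2 p j)" using req_trans[OF uu1 u1(1)] by (rule reqE) blast
  define x where "x j l c = (\<Sum>p<k. b l p * w1 (\<phi> j) p c)" for j l c
  have xw: "req (x j) (w1 (\<phi> j))" for j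
    by (rule reqI[where b = b]) (use b in \<open>auto simp: x_def\<close>)
  have xv: "req (x j) (v (\<phi> j))" for j by (rule req_trans[OF xw w1])
  have xY: "x j \<in> Y e" for j by (rule req_Y[OF xv vY mono])
  have xlim: "(\<lambda>j. x j l c) \<longlonglongrightarrow> u l c" if "l < k" for l c
    unfolding x_def b(3)[OF that] by (intro tendsto_intros \<phi>(2))
  have uf: "u l (f l) = 1" if "l < k" for l using uS that by (simp add: SY_def)
  define y where "y j = nf f (x j)" for j
  have ylim: "(\<lambda>j. y j l c) \<longlonglongrightarrow> u l c" if "l < k" for l c
    using tendsto_nf[of "\<lambda>j. x j" u sequentially f l c] xlim uf that nf_id[OF dec(1) J(3) that]
    by (simp add: y_def)
  have ev_x: "eventually (\<lambda>j. \<forall>l\<in>{..<k}. x j l (f l) \<noteq> 0) sequentially"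
  proof (intro eventually_ball_finite ballI)
    fix l assume "l \<in> {..<k}"
    thus "eventually (\<lambda>j. x j l (f l) \<noteq> 0) sequentially"
      by (intro tendsto_imp_eventually_ne[OF xlim]) (use uf in auto)
  qed auto
  define c where "c j = coords e f (y j)" for j
  have clim: "c \<longlonglongrightarrow> c0"
    unfolding tendsto_fun_iff
  proof
    fix a
    show "(\<lambda>j. c j a) \<longlonglongrightarrow> c0 a"
    proof (cases "a < ssum e - tri")
      case True
      have "fst (idx e f a) < k" using idx_in[OF dec(1) True] by (metis prod.collapse)
      thus ?thesis using True ylim by (simp add: c_def c0_def coords_def)
    qed (simp add: c_def c0_def coords_def)
  qed
  interpret sys: square_system "ssum e - tri" "\<lambda>l t c. Q e (V e f c) (t l)" "\<lambda>l t. VA e f (t l)"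
    by (rule chart_square_system[OF dec(1)])
  have D0: "sys.D (param m t 0) c0 c0 \<noteq> 0" using J(1) by (simp add: chart_D[OF dec(1)] c0_def)
  have parlim: "(\<lambda>j. param m t (s (\<phi> j))) \<longlonglongrightarrow> param m t 0" by (rule tendsto_param[OF s\<phi>])
  have c0real: "cnj (c0 a) = c0 a" for a
  proof (cases "a < ssum e - tri")
    case True
    have "fst (idx e f a) < k" using idx_in[OF dec(1) True] by (metis prod.collapse)
    hence "c0 a \<in> \<real>" using J(4) True by (simp add: c0_def coords_def real_rows_def)
    thus ?thesis by (simp add: Reals_cnj_iff)
  qed (simp add: c0_def coords_def)
  have clim': "(\<lambda>j a. cnj (c j a)) \<longlonglongrightarrow> c0"
    unfolding tendsto_fun_iff
  proof
    fix a
    have "(\<lambda>j. cnj (c j a)) \<longlonglongrightarrow> cnj (c0 a)"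
      using clim unfolding tendsto_fun_iff by (intro tendsto_cnj) blast
    thus "(\<lambda>j. cnj (c j a)) \<longlonglongrightarrow> c0 a" by (simp add: c0real)
  qed
  have ev1: "eventually (\<lambda>j. sys.D (param m t (s (\<phi> j))) (c j) (c j) \<noteq> 0) sequentially"
    by (rule tendsto_imp_eventually_ne[OF sys.tendsto_D[OF parlim clim clim] D0])
  have ev2: "eventually (\<lambda>j. (\<forall>l<ssum e - tri. Q e (V e f (c j)) (param m t (s (\<phi> j)) l)
       = Q e (V e f (\<lambda>a. cnj (c j a))) (param m t (s (\<phi> j)) l)) \<longrightarrow>
       (\<forall>a<ssum e - tri. c j a = cnj (c j a))) sequentially"
    by (rule sys.locally_injective[OF parlim clim clim' D0])
  from ev_x ev1 ev2 have "eventually (\<lambda>j. real_rows (v (\<phi> j)) \<and>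
      nondeg e (v (\<phi> j)) (param m t (s (\<phi> j))) (Suc m)) sequentially"
  proof eventually_elim
    case (elim j)
    have xnz: "x j l (f l) \<noteq> 0" if "l < k" for l using elim(1) that by blast
    have yS: "y j \<in> SY e f" unfolding y_def by (rule nf_SY[OF dec(1) xY xnz])
    have yv: "req (y j) (v (\<phi> j))" unfolding y_def by (rule req_trans[OF req_nf[OF dec(1) xY xnz] xv])
    have yY: "y j \<in> Y e" using yS by (simp add: SY_def)
    have Vy: "V e f (c j) l q = y j l q" if "l < k" for l q
      unfolding c_def by (rule V_coords[OF dec(1) yS that])
    have solV: "Q e (V e f (c j)) (param m t (s (\<phi> j)) l) = 0" if "l < Suc m" for l
    proof (rule Q_req[OF yv vY mono])
      fix \<mu> assume "\<And>z. Q e (y j) z = \<mu> * Q e (v (\<phi> j)) z"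
      moreover have "Q e (V e f (c j)) z = Q e (y j) z" for z by (rule Q_cong) (rule Vy)
      ultimately show ?thesis using v(2)[OF that] by simp
    qed
    have "nondeg e (V e f (c j)) (param m t (s (\<phi> j))) (ssum e - tri)"
      by (rule Jac_imp_nondeg[OF dec(1)]) (rule elim(2)[unfolded chart_D[OF dec(1)]])
    hence "nondeg e (y j) (param m t (s (\<phi> j))) (Suc m)"
      using nondeg_cong[of "V e f (c j)" "y j" "Suc m"] Vy se by simp
    hence nd: "nondeg e (v (\<phi> j)) (param m t (s (\<phi> j))) (Suc m)"
      using nondeg_req[OF req_sym[OF yv] yY mono] en by blast
    have "Q e (V e f (\<lambda>a. cnj (c j a))) (param m t (s (\<phi> j)) l) = 0" if "l < Suc m" for l
    proof -
      have "param m t (s (\<phi> j)) l = cnj (param m t (s (\<phi> j)) l)" by (simp add: param_def)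
      moreover have "V e f (\<lambda>a. cnj (c j a)) = (\<lambda>l q. cnj (V e f (c j) l q))" by (intro ext V_cnj)
      ultimately show ?thesis using Q_cnj[of e "V e f (c j)" "param m t (s (\<phi> j)) l"] solV[OF that] by simp
    qed
    hence creal: "c j a = cnj (c j a)" if "a < ssum e - tri" for a using elim(3) solV se that by simp
    have yreal: "cnj (y j l q) = y j l q" if "l < k" for l q
    proof -
      have "cnj (V e f (c j) l q) = V e f (\<lambda>a. cnj (c j a)) l q" by (simp add: V_cnj)
      also have "\<dots> = V e f (c j) l q" using creal unfolding V_def by (auto intro!: sum.cong)
      finally show ?thesis using Vy[OF that] by simp
    qed
    \<comment> \<open>\<open>y j\<close> is real, so conjugation changes \<open>v (\<phi> j)\<close>
      by a row operation only, and the normal form in \<open>SY e e\<close> is unique.\<close>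
    have "req (\<lambda>l q. cnj (v (\<phi> j) l q)) (y j)"
    proof -
      obtain b where b: "\<And>l. l < k \<Longrightarrow> b l l \<noteq> 0" "\<And>l p. l < k \<Longrightarrow> p > l \<Longrightarrow> b l p = 0"
        "\<And>l q. l < k \<Longrightarrow> v (\<phi> j) l q = (\<Sum>p<k. b l p * y j p q)" using req_sym[OF yv] by (rule reqE) blast
      show ?thesis
        by (rule reqI[where b = "\<lambda>l p. cnj (b l p)"]) (use b yreal in auto)
    qed
    hence "req (\<lambda>l q. cnj (v (\<phi> j) l q)) (v (\<phi> j))" using yv by (rule req_trans)
    moreover have "(\<lambda>l q. cnj (v (\<phi> j) l q)) \<in> SY e e" using v(1)[of "\<phi> j"] by (auto simp: SY_def Y_def)
    ultimately have "(\<lambda>q. cnj (v (\<phi> j) l q)) = v (\<phi> j) l" if "l < k" for l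
      using SY_unique[OF _ v(1) _ that] by blast
    hence "cnj (v (\<phi> j) l q) = v (\<phi> j) l q" if "l < k" for l q using that by (metis)
    hence "real_rows (v (\<phi> j))" by (simp add: real_rows_def Reals_cnj_iff)
    thus ?case using nd by blast
  qed
  then obtain j where "real_rows (v (\<phi> j)) \<and> nondeg e (v (\<phi> j)) (param m t (s (\<phi> j))) (Suc m)"
    using eventually_happens by force
  thus ?thesis using that by blast
qed

lemma eventually_good: "eventually (\<lambda>s. good (Suc m) (t(m := s)) e) (at_right 0)"
proof -
  define P where "P s \<longleftrightarrow> (\<forall>v\<in>SY e e. (\<forall>l<Suc m. Q e v (param m t s l) = 0) \<longrightarrow>
      real_rows v \<and> nondeg e v (param m t s) (Suc m))" for s
  have "eventually P (at_right 0)"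
  proof (rule ccontr)
    assume np: "\<not> ?thesis"
    have "\<exists>s. 0 < s \<and> s < 1 / real (Suc j) \<and> \<not> P s" for j
    proof (rule ccontr)
      assume "\<not> ?thesis"
      hence "eventually P (at_right 0)"
        unfolding eventually_at_right_field by (intro exI[of _ "1 / real (Suc j)"]) auto
      thus False using np by simp
    qed
    then obtain s where s: "\<And>j. 0 < s j" "\<And>j. s j < 1 / real (Suc j)" "\<And>j. \<not> P (s j)" by metis
    have "(\<lambda>j. 1 / real (Suc j)) \<longlonglongrightarrow> 0"
      using LIMSEQ_inverse_real_of_nat by (simp add: inverse_eq_divide)
    hence lim: "s \<longlonglongrightarrow> 0"
      by (rule tendsto_sandwich[OF always_eventually always_eventually tendsto_const, rotated 2])
        (use s in \<open>auto intro: less_imp_le\<close>)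
    have "\<exists>v. v \<in> SY e e \<and> (\<forall>l<Suc m. Q e v (param m t (s j) l) = 0) \<and>
        \<not> (real_rows v \<and> nondeg e v (param m t (s j)) (Suc m))" for j
      using s(3)[of j] unfolding P_def by blast
    then obtain v where v: "\<And>j. v j \<in> SY e e" "\<And>j l. l < Suc m \<Longrightarrow> Q e (v j) (param m t (s j) l) = 0"
      "\<And>j. \<not> (real_rows (v j) \<and> nondeg e (v j) (param m t (s j)) (Suc m))" by metis
    show False by (rule subsequence_real_nondeg[OF lim s(1) v(1,2)]) (use v(3) in blast)+
  qed
  with eventually_solution_exists show ?thesis
    by eventually_elim (simp add: good_def P_def param_def)
qed

end

text \<open>The new root is taken below all earlier ones and small enough for all of the finitely
  many cells at once. A cell of dimension 0 is a single coordinate plane.\<close>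

lemma exists_good:
  "\<exists>t :: nat \<Rightarrow> real. (\<forall>l<m. t l > 0) \<and> (\<forall>l p. l < p \<longrightarrow> p < m \<longrightarrow> t p < t l) \<and> (\<forall>e\<in>positions m. good m t e)"
proof (induction m)
  case 0
  have "good 0 t e" if e: "e \<in> positions 0" for t e
  proof -
    have adm: "adm e e" and "ssum e = tri" using e by (auto simp: positions_def)
    have el: "e l = l" if "l < k" for l
    proof (rule ccontr)
      assume "e l \<noteq> l"
      hence "tri < ssum e" unfolding tri_def ssum_def
        using that adm_ge[OF adm] by (intro sum_strict_mono_ex1) (auto intro!: bexI[of _ l] le_neq_implies_less)
      thus False using \<open>ssum e = tri\<close> by simp
    qed
    have "real_rows v" if "v \<in> SY e e" for v
      unfolding real_rows_def
    proof (intro allI impI)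
      fix l j assume "l < k"
      thus "v l j \<in> \<real>" using that el by (cases "j \<le> l") (auto simp: SY_def Y_def)
    qed
    thus ?thesis using V_SY[OF adm] by (auto simp: good_def nondeg_def)
  qed
  thus ?case by auto
next
  case (Suc m)
  then obtain t :: "nat \<Rightarrow> real" where t: "\<forall>l<m. t l > 0" "\<forall>l p. l < p \<longrightarrow> p < m \<longrightarrow> t p < t l" "\<forall>e\<in>positions m. good m t e"
    by blast
  have inj: "inj_on t {..<m}" unfolding inj_on_def using t(2) by (metis lessThan_iff linorder_neqE_nat order_less_irrefl)
  have "eventually (\<lambda>s. \<forall>e\<in>positions (Suc m). good (Suc m) (t(m := s)) e) (at_right 0)"
    by (intro eventually_ball_finite finite_positions ballI eventually_good) (use t inj in auto)
  moreover have "eventually (\<lambda>s::real. s > 0) (at_right 0)" by (rule eventually_at_right_less)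
  moreover have "eventually (\<lambda>s::real. \<forall>l\<in>{..<m}. s < t l) (at_right 0)"
    using t(1) by (intro eventually_ball_finite ballI) (auto simp: eventually_at_right_field)
  ultimately have "eventually (\<lambda>s. (\<forall>e\<in>positions (Suc m). good (Suc m) (t(m := s)) e) \<and> s > 0 \<and> (\<forall>l\<in>{..<m}. s < t l)) (at_right 0)"
    by eventually_elim blast
  from eventually_happens[OF this]
  obtain s where s: "\<forall>e\<in>positions (Suc m). good (Suc m) (t(m := s)) e" "s > 0" "\<forall>l\<in>{..<m}. s < t l"
    by auto
  show ?case
  proof (intro exI[of _ "t(m := s)"] conjI)
    show "\<forall>e\<in>positions (Suc m). good (Suc m) (t(m := s)) e" by (rule s(1))
  qed (use s t in \<open>auto simp: less_Suc_eq\<close>)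
qed

subsection \<open>Fibres over distinct positive roots\<close>

text \<open>Leading positions of the open cell: its pivots are the last \<open>k\<close>
  columns.\<close>

definition topc :: "nat \<Rightarrow> nat" where "topc l = (if l < k then n - k + l else 0)"

definition N :: nat where "N = k * (n - k)"

lemma top_position: "topc \<in> positions N"
proof -
  have "ssum topc = (\<Sum>l<k. (n - k) + l)" unfolding ssum_def topc_def by (intro sum.cong) auto
  also have "\<dots> = N + tri" unfolding sum.distrib N_def tri_def by simp
  finally show ?thesis using k_less by (auto simp: positions_def adm_self topc_def)
qed

lemma adm_top: "adm topc topc" and ssum_top: "ssum topc - tri = N"
  using top_position by (auto simp: positions_def)

lemma top_less: "l < k \<Longrightarrow> topc l < n"
  using adm_top by (simp add: adm_def)

lemma kappa_top: "kappa topc \<noteq> 0"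
  using adm_top by (intro kappa_nonzero) (auto simp: adm_def)

lemma Q_top_0: "v \<in> SY topc topc \<Longrightarrow> Q topc v 0 = kappa topc"
  by (subst Q_at_0) (auto simp: SY_def)

text \<open>The roots of \<open>Q topc v\<close> are the numbers \<open>t l\<close> with multiplicity, in a form without division so
  that it passes to limits.\<close>
definition Fib :: "(nat \<Rightarrow> complex) \<Rightarrow> (nat \<Rightarrow> nat \<Rightarrow> complex) \<Rightarrow> bool" where
  "Fib t v \<longleftrightarrow> (\<forall>z. Q topc v z * (\<Prod>l<N. t l) = kappa topc * (\<Prod>l<N. t l - z))"

lemma Fib_root: "Fib t v \<Longrightarrow> (\<And>l. l < N \<Longrightarrow> t l \<noteq> 0) \<Longrightarrow> Q topc v z = 0 \<longleftrightarrow> (\<exists>l<N. z = t l)"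
proof -
  assume F: "Fib t v" and t: "\<And>l. l < N \<Longrightarrow> t l \<noteq> 0"
  have "Q topc v z = 0 \<longleftrightarrow> Q topc v z * (\<Prod>l<N. t l) = 0" using t by simp
  also have "\<dots> \<longleftrightarrow> kappa topc * (\<Prod>l<N. t l - z) = 0" using F unfolding Fib_def by simp
  also have "\<dots> \<longleftrightarrow> (\<exists>l<N. z = t l)" using kappa_top by auto
  finally show ?thesis .
qed

lemma polys_eqI:
  fixes p q :: "complex poly"
  assumes "degree p \<le> m" "degree q \<le> m" "inj_on t {..<m}" "\<And>l. l < m \<Longrightarrow> t l \<noteq> 0"
    "\<And>l. l < m \<Longrightarrow> poly p (t l) = poly q (t l)" "poly p 0 = poly q 0"
  shows "p = q"
proof (rule ccontr)
  assume "p \<noteq> q"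
  hence nz: "p - q \<noteq> 0" by simp
  have "insert 0 (t ` {..<m}) \<subseteq> {z. poly (p - q) z = 0}" using assms(5,6) by auto
  hence "card (insert 0 (t ` {..<m})) \<le> card {z. poly (p - q) z = 0}"
    by (intro card_mono poly_roots_finite nz)
  also have "\<dots> \<le> degree (p - q)" using nz by (rule card_poly_roots_bound)
  also have "\<dots> \<le> m" using assms(1,2) by (rule degree_diff_le)
  also have "card (insert 0 (t ` {..<m})) = Suc m"
    using assms(3,4) by (subst card_insert_disjoint) (auto simp: card_image)
  finally show False by simp
qed

lemma degree_prod_linear: "degree (\<Prod>l<m. [:t l, - 1:] :: complex poly) \<le> m"
proof -
  have "degree (\<Prod>l<m. [:t l, - 1:] :: complex poly) \<le> (\<Sum>l<m. degree [:t l, - 1:])"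
    by (rule degree_prod_sum_le[unfolded o_def]) simp
  thus ?thesis by simp
qed

lemma poly_target: "poly (smult a (\<Prod>l<m. [:t l, - 1:])) (z::complex) = a * (\<Prod>l<m. t l - z)"
proof -
  have "(\<Prod>l<m. poly [:t l, - 1:] z) = (\<Prod>l<m. t l - z)" by (intro prod.cong) auto
  thus ?thesis by (simp only: poly_smult poly_prod)
qed

lemma Fib_iff_poly:
  "Fib t v \<longleftrightarrow> smult (\<Prod>l<N. t l) (Qp topc v) = smult (kappa topc) (\<Prod>l<N. [:t l, - 1:])"
  (is "_ \<longleftrightarrow> ?p = ?q")
proof -
  have "?p = ?q \<longleftrightarrow> (\<forall>z. poly ?p z = poly ?q z)" by (simp only: poly_eq_poly_eq_iff[symmetric] fun_eq_iff)
  also have "\<dots> \<longleftrightarrow> Fib t v"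
    unfolding Fib_def poly_target by (simp add: poly_Qp mult.commute)
  finally show ?thesis by simp
qed

text \<open>A polynomial of degree at most \<open>N\<close> is determined by its values at
  \<open>N\<close> distinct nonzero points and at 0, where the normal form fixes it to be
  \<open>kappa topc\<close>. The points \<open>x\<close> are independent of the roots
  \<open>t\<close>, which may therefore be repeated.\<close>

lemma FibI:
  assumes v: "v \<in> SY topc topc" and x: "inj_on x {..<N}" "\<And>l. l < N \<Longrightarrow> x l \<noteq> 0"
    and eq: "\<And>l. l < N \<Longrightarrow> Q topc v (x l) * (\<Prod>i<N. t i) = kappa topc * (\<Prod>i<N. t i - x l)"
  shows "Fib t v"
  unfolding Fib_iff_poly
proof (rule polys_eqI[OF _ _ x])
  have "v \<in> Y topc" using v by (simp add: SY_def)
  thus "degree (smult (\<Prod>l<N. t l) (Qp topc v)) \<le> N"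
    using degree_Qp[of v topc] ssum_top by (intro order_trans[OF degree_smult_le]) simp
  show "degree (smult (kappa topc) (\<Prod>l<N. [:t l, - 1:])) \<le> N"
    by (intro order_trans[OF degree_smult_le] degree_prod_linear)
  show "poly (smult (\<Prod>l<N. t l) (Qp topc v)) (x l) = poly (smult (kappa topc) (\<Prod>l<N. [:t l, - 1:])) (x l)"
    if "l < N" for l using eq[OF that] unfolding poly_target by (simp add: poly_Qp mult.commute)
  show "poly (smult (\<Prod>l<N. t l) (Qp topc v)) 0 = poly (smult (kappa topc) (\<Prod>l<N. [:t l, - 1:])) 0"
    unfolding poly_target using Q_top_0[OF v] by (simp add: poly_Qp)
qed

lemma Fib_iff:
  assumes v: "v \<in> SY topc topc" and t: "inj_on t {..<N}" "\<And>l. l < N \<Longrightarrow> t l \<noteq> 0"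
  shows "Fib t v \<longleftrightarrow> (\<forall>l<N. Q topc v (t l) = 0)"
proof
  assume "Fib t v"
  thus "\<forall>l<N. Q topc v (t l) = 0" using Fib_root[of t v, OF _ t(2)] by blast
next
  assume *: "\<forall>l<N. Q topc v (t l) = 0"
  show "Fib t v"
  proof (rule FibI[OF v t])
    fix l assume "l < N"
    hence "(\<Prod>i<N. t i - t l) = 0" by (intro prod_zero) auto
    thus "Q topc v (t l) * (\<Prod>i<N. t i) = kappa topc * (\<Prod>i<N. t i - t l)" using * \<open>l < N\<close> by simp
  qed
qed

text \<open>A representative with distinct leading positions \<open>g\<close> has nonzero value at 0
  in its own normalisation. A nonzero \<open>z\<close> avoids the powers of \<open>z\<close> between
  \<open>Q g\<close> and \<open>Q e\<close>.\<close>

lemma Qp_nonzero: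
  assumes "indep v" "v \<in> Y e" "mono_idx e" "\<And>l. l < k \<Longrightarrow> e l < n"
  shows "\<exists>z. z \<noteq> 0 \<and> Q e v z \<noteq> 0"
proof -
  obtain u g where u: "req u v" "u \<in> Y g" "inj_on g {..<k}" "\<And>l. l < k \<Longrightarrow> g l \<le> e l"
    "\<And>l. l < k \<Longrightarrow> u l (g l) \<noteq> 0" using distinct_leads[OF assms(1,2)] by blast
  have "Q g u 0 \<noteq> 0"
    unfolding Q_at_0[OF u(2)] using u(5) kappa_nonzero[OF u(3)] u(4) assms(4) by (auto intro: le_less_trans)
  hence "Qp g u \<noteq> 0" by (auto simp flip: poly_Qp)
  hence "finite (insert 0 {z. poly (Qp g u) z = 0})" using poly_roots_finite by blast
  then obtain z where z: "z \<notin> insert 0 {z. poly (Qp g u) z = 0}"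
    using ex_new_if_finite[OF infinite_UNIV_char_0] by blast
  hence "Q e u z \<noteq> 0" using Q_change[OF u(2,4), of z] by (simp add: poly_Qp)
  hence "Q e v z \<noteq> 0" by (rule contrapos_nn) (rule Q_req[OF u(1) assms(2,3)], simp)
  thus ?thesis using z by auto
qed

text \<open>Properness of the root map over nonzero roots. Bounded representatives converge to
  independent rows, whose polynomial is not zero. Passing to the limit in the equation of the fibre,
  the product of the leading entries is a factor of this polynomial, so it is nonzero and the limit
  is again in the open cell.\<close>

lemma Fib_compact:
  fixes t :: "nat \<Rightarrow> nat \<Rightarrow> complex"
  assumes lim: "\<And>l. l < N \<Longrightarrow> (\<lambda>j. t j l) \<longlonglongrightarrow> t0 l" and nz: "\<And>l. l < N \<Longrightarrow> t0 l \<noteq> 0"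
    and v: "\<And>j. v j \<in> SY topc topc" "\<And>j. Fib (t j) (v j)"
  obtains \<phi> v0 where "strict_mono (\<phi> :: nat \<Rightarrow> nat)" "v0 \<in> SY topc topc" "Fib t0 v0"
    "\<And>l c. l < k \<Longrightarrow> (\<lambda>i. v (\<phi> i) l c) \<longlonglongrightarrow> v0 l c"
proof -
  note mono = adm_mono[OF adm_top]
  have vY: "v j \<in> Y topc" for j using v(1) by (simp add: SY_def)
  have vn: "v j l c = 0" if "l < k" "c \<ge> n" for j l c
    using vY[of j] top_less[OF that(1)] that by (auto simp: Y_def)
  define PW where "PW j w \<longleftrightarrow> req w (v j) \<and> (\<forall>l<k. \<forall>c. norm (w l c) \<le> 1) \<and>
      (\<forall>x. \<forall>l<k. norm (x l) \<le> 2 ^ l * (\<Sum>c<n. norm (\<Sum>p<k. x p * w p c)))" for j w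
  have "\<exists>w. PW j w" for j
    by (rule bounded_representative[OF SY_imp_indep[OF v(1)[of j]] vn[where j = j]]) (auto simp: PW_def)
  then obtain w where w: "\<And>j. PW j (w j)" by metis
  define w1 where "w1 j l c = (if l < k then w j l c else 0)" for j l c
  have w1: "req (w1 j) (v j)" for j
    by (rule req_trans[OF req_refl]) (use w in \<open>auto simp: PW_def w1_def\<close>)
  have w1Y: "w1 j \<in> Y topc" for j by (rule req_Y[OF w1 vY mono])
  have w1b: "norm (w1 j l c) \<le> 1" for j l c using w by (simp add: w1_def PW_def)
  obtain \<phi> w2 where \<phi>: "strict_mono \<phi>" "\<And>l c. (\<lambda>i. w1 (\<phi> i) l c) \<longlonglongrightarrow> w2 l c"
    using convergent_subsequence_double[of w1 "\<lambda>_ _. 1", OF w1b] by blast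
  have w2Y: "w2 \<in> Y topc"
  proof -
    have "w2 l c = 0" if "l < k" "topc l < c" for l c
      using \<phi>(2)[of l c] w1Y that by (simp add: Y_def LIMSEQ_const_iff)
    thus ?thesis by (simp add: Y_def)
  qed
  have ind: "indep w2"
    unfolding indep_def
  proof (intro allI impI)
    fix x l assume x: "\<forall>j. (\<Sum>l<k. x l * w2 l j) = 0" and l: "l < k"
    have "(\<lambda>i. 2 ^ l * (\<Sum>c<n. norm (\<Sum>p<k. x p * w1 (\<phi> i) p c)))
        \<longlonglongrightarrow> 2 ^ l * (\<Sum>c<n. norm (\<Sum>p<k. x p * w2 p c))"
      by (intro tendsto_intros \<phi>(2))
    moreover have "norm (x l) \<le> 2 ^ l * (\<Sum>c<n. norm (\<Sum>p<k. x p * w1 (\<phi> i) p c))" for i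
      using w[of "\<phi> i"] l unfolding PW_def by (simp add: w1_def)
    hence "\<exists>N. \<forall>i\<ge>N. norm (x l) \<le> 2 ^ l * (\<Sum>c<n. norm (\<Sum>p<k. x p * w1 (\<phi> i) p c))" by blast
    ultimately have "norm (x l) \<le> 2 ^ l * (\<Sum>c<n. norm (\<Sum>p<k. x p * w2 p c))"
      by (rule LIMSEQ_le_const)
    thus "x l = 0" using x by simp
  qed
  \<comment> \<open>The diagonal of the row change can be read in the pivot columns, so the factor
    between the two polynomials depends continuously on the matrix.\<close>
  have diag: "w1 j l (topc l) \<noteq> 0 \<and> (\<forall>z. Q topc (w1 j) z = (\<Prod>l<k. w1 j l (topc l)) * Q topc (v j) z)" if "l < k" for j l
  proof -
    obtain b where b: "\<And>l. l < k \<Longrightarrow> b l l \<noteq> 0" "\<And>l p. l < k \<Longrightarrow> p > l \<Longrightarrow> b l p = 0"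
      "\<And>l q. l < k \<Longrightarrow> w1 j l q = (\<Sum>p<k. b l p * v j p q)" using w1[of j] by (rule reqE) blast
    have bl: "w1 j l (topc l) = b l l" if "l < k" for l
    proof -
      have "w1 j l (topc l) = (\<Sum>p<k. if p = l then b l l else 0)"
        unfolding b(3)[OF that] using v(1)[of j] that by (intro sum.cong) (auto simp: SY_def)
      thus ?thesis using that by simp
    qed
    have "Q topc (w1 j) z = (\<Prod>l<k. b l l) * Q topc (v j) z" for z
      by (rule Q_lower_rowops[where b = b, OF mono vY]) (use b in auto)
    thus ?thesis using b(1) bl that by simp
  qed
  have lim_eq: "Q topc w2 z * (\<Prod>l<N. t0 l) = (\<Prod>l<k. w2 l (topc l)) * (kappa topc * (\<Prod>l<N. t0 l - z))" for z
  proof (rule LIMSEQ_unique)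
    have lim': "(\<lambda>i. t (\<phi> i) l) \<longlonglongrightarrow> t0 l" if "l < N" for l
      using LIMSEQ_subseq_LIMSEQ[OF lim[OF that] \<phi>(1)] by (simp add: o_def)
    show "(\<lambda>i. Q topc (w1 (\<phi> i)) z * (\<Prod>l<N. t (\<phi> i) l)) \<longlonglongrightarrow> Q topc w2 z * (\<Prod>l<N. t0 l)"
      by (intro tendsto_mult tendsto_Q \<phi>(2) tendsto_const tendsto_prod lim') auto
    have "(\<lambda>i. (\<Prod>l<k. w1 (\<phi> i) l (topc l)) * (kappa topc * (\<Prod>l<N. t (\<phi> i) l - z)))
        \<longlonglongrightarrow> (\<Prod>l<k. w2 l (topc l)) * (kappa topc * (\<Prod>l<N. t0 l - z))"
      by (intro tendsto_mult \<phi>(2) tendsto_const tendsto_prod tendsto_diff lim') auto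
    moreover have "Q topc (w1 (\<phi> i)) z * (\<Prod>l<N. t (\<phi> i) l)
        = (\<Prod>l<k. w1 (\<phi> i) l (topc l)) * (kappa topc * (\<Prod>l<N. t (\<phi> i) l - z))" for i
      using diag[OF k_pos, of "\<phi> i"] v(2)[of "\<phi> i"] by (simp add: Fib_def mult.assoc)
    ultimately show "(\<lambda>i. Q topc (w1 (\<phi> i)) z * (\<Prod>l<N. t (\<phi> i) l))
        \<longlonglongrightarrow> (\<Prod>l<k. w2 l (topc l)) * (kappa topc * (\<Prod>l<N. t0 l - z))" by simp
  qed
  have "(\<Prod>l<k. w2 l (topc l)) \<noteq> 0"
  proof
    assume "(\<Prod>l<k. w2 l (topc l)) = 0"
    hence "Q topc w2 z * (\<Prod>l<N. t0 l) = 0" for z using lim_eq[of z] by (simp only: mult_zero_left)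
    hence "Q topc w2 z = 0" for z using nz by simp
    thus False using Qp_nonzero[OF ind w2Y mono top_less] by blast
  qed
  hence w2nz: "w2 l (topc l) \<noteq> 0" if "l < k" for l using that by auto
  define v0 where "v0 = nf topc w2"
  have v0S: "v0 \<in> SY topc topc" unfolding v0_def by (rule nf_SY[OF adm_top w2Y w2nz])
  have r0: "req v0 w2" unfolding v0_def by (rule req_nf[OF adm_top w2Y w2nz])
  have "Fib t0 v0"
  proof (rule Q_req[OF r0 w2Y mono])
    fix \<mu> assume \<mu>: "\<And>z. Q topc v0 z = \<mu> * Q topc w2 z"
    have w20: "Q topc w2 0 = (\<Prod>l<k. w2 l (topc l)) * kappa topc" by (rule Q_at_0[OF w2Y])
    have "\<mu> * (\<Prod>l<k. w2 l (topc l)) = 1"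
      using \<mu>[of 0] Q_top_0[OF v0S] kappa_top unfolding w20 by simp
    hence \<mu>1: "\<mu> * ((\<Prod>l<k. w2 l (topc l)) * x) = x" for x by (metis mult.assoc mult_1)
    have "Q topc v0 z * (\<Prod>l<N. t0 l) = kappa topc * (\<Prod>l<N. t0 l - z)" for z
    proof -
      have "Q topc v0 z * (\<Prod>l<N. t0 l) = \<mu> * (Q topc w2 z * (\<Prod>l<N. t0 l))"
        unfolding \<mu> by (rule mult.assoc)
      thus ?thesis unfolding lim_eq \<mu>1 .
    qed
    thus ?thesis unfolding Fib_def by blast
  qed
  moreover have "(\<lambda>i. v (\<phi> i) l c) \<longlonglongrightarrow> v0 l c" if "l < k" for l c
  proof -
    have "v j l = nf topc (w1 j) l" for j
    proof (rule SY_unique[OF v(1) nf_SY[OF adm_top w1Y] _ that])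
      show "w1 j l (topc l) \<noteq> 0" if "l < k" for l using diag[OF that] by blast
      have "req (nf topc (w1 j)) (w1 j)" by (rule req_nf[OF adm_top w1Y]) (use diag in blast)
      thus "req (v j) (nf topc (w1 j))" using w1[of j] by (meson req_sym req_trans)
    qed
    thus ?thesis unfolding v0_def using tendsto_nf[of "\<lambda>i. w1 (\<phi> i)" w2 sequentially topc l c] \<phi>(2) w2nz that by simp
  qed
  ultimately show ?thesis using that \<phi>(1) v0S by blast
qed

section \<open>Reality of the fibre along paths of root tuples\<close>

definition real_fibre :: "(nat \<Rightarrow> real) \<Rightarrow> bool" where
  "real_fibre t \<longleftrightarrow> (\<forall>v\<in>SY topc topc. Fib (\<lambda>l. of_real (t l)) v \<longrightarrow> real_rows v)"

definition pos_decreasing :: "(nat \<Rightarrow> real) \<Rightarrow> bool" where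
  "pos_decreasing t \<longleftrightarrow> (\<forall>l<N. t l > 0) \<and> (\<forall>l p. l < p \<longrightarrow> p < N \<longrightarrow> t p < t l)"

lemma pos_decreasing_inj: "pos_decreasing t \<Longrightarrow> inj_on (\<lambda>l. complex_of_real (t l)) {..<N}"
  unfolding pos_decreasing_def inj_on_def
  by (metis lessThan_iff linorder_neqE_nat of_real_eq_iff order_less_irrefl)

lemma Fib_iff_pos:
  assumes "pos_decreasing t" "v \<in> SY topc topc"
  shows "Fib (\<lambda>l. of_real (t l)) v \<longleftrightarrow> (\<forall>l<N. Q topc v (of_real (t l)) = 0)"
proof (rule Fib_iff[OF assms(2) pos_decreasing_inj[OF assms(1)]])
  show "complex_of_real (t l) \<noteq> 0" if "l < N" for l
    using assms(1) that unfolding pos_decreasing_def by (metis less_irrefl of_real_eq_0_iff)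
qed

abbreviation etale :: "(nat \<Rightarrow> real) \<Rightarrow> bool" where
  "etale t \<equiv> (\<forall>v\<in>SY topc topc. (\<forall>l<N. Q topc v (of_real (t l)) = 0) \<longrightarrow> nondeg topc v (\<lambda>l. of_real (t l)) N)"

lemma etale_Jac:
  assumes "etale t" "v \<in> SY topc topc" "\<And>l. l < N \<Longrightarrow> Q topc v (of_real (t l)) = 0"
  shows "Jac topc topc (\<lambda>l. of_real (t l)) (coords topc topc v) \<noteq> 0"
proof (rule nondeg_imp_Jac[OF adm_top])
  note V = V_coords[OF adm_top assms(2)]
  show "nondeg topc (V topc topc (coords topc topc v)) (\<lambda>l. of_real (t l)) (ssum topc - tri)"
    using nondeg_cong[of "V topc topc (coords topc topc v)" v N] V assms by (simp add: ssum_top)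
  show "Q topc (V topc topc (coords topc topc v)) (of_real (t l)) = 0" if "l < ssum topc - tri" for l
    using Q_cong[of "V topc topc (coords topc topc v)" v topc] V assms(3) that by (simp add: ssum_top)
qed

lemma real_rows_iff_coords:
  assumes "v \<in> SY topc topc"
  shows "real_rows v \<longleftrightarrow> (\<forall>a<N. coords topc topc v a \<in> \<real>)"
proof
  assume r: "real_rows v"
  show "\<forall>a<N. coords topc topc v a \<in> \<real>"
  proof (intro allI impI)
    fix a assume a: "a < N"
    hence "fst (idx topc topc a) < k" using idx_in[OF adm_top, of a] ssum_top by (metis prod.collapse)
    thus "coords topc topc v a \<in> \<real>" using r by (simp add: coords_def real_rows_def)
  qed
next
  assume r: "\<forall>a<N. coords topc topc v a \<in> \<real>"
  have "V topc topc (coords topc topc v) l j \<in> \<real>" for l j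
    unfolding V_def ssum_top using r by (auto intro!: sum_in_Reals)
  thus "real_rows v" using V_coords[OF adm_top assms] unfolding real_rows_def by metis
qed

text \<open>A point over \<open>t0\<close> is nondegenerate, so it continues to nearby fibres and is
  a limit of real points.\<close>

lemma real_fibre_closed:
  assumes lim: "\<And>l. l < N \<Longrightarrow> (\<lambda>j. t j l) \<longlonglongrightarrow> t0 l" and t: "\<And>j. pos_decreasing (t j)" "pos_decreasing t0"
    and et: "etale t0" and r: "\<And>j. real_fibre (t j)"
  shows "real_fibre t0"
  unfolding real_fibre_def
proof (intro ballI impI)
  fix v assume v: "v \<in> SY topc topc" "Fib (\<lambda>l. of_real (t0 l)) v"
  \<comment> \<open>Cut off beyond \<open>N\<close>, because convergence of tuples is convergence in
    all coordinates.\<close>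
  define \<theta> where "\<theta> j = (\<lambda>l. if l < N then complex_of_real (t j l) else 0)" for j
  define \<theta>0 where "\<theta>0 = (\<lambda>l. if l < N then complex_of_real (t0 l) else 0)"
  have \<theta>: "\<theta> \<longlonglongrightarrow> \<theta>0" unfolding tendsto_fun_iff \<theta>_def \<theta>0_def using lim by (auto intro: tendsto_of_real)
  have sol: "Q topc v (of_real (t0 l)) = 0" if "l < N" for l
    using Fib_iff_pos[OF t(2) v(1)] v(2) that by blast
  interpret sys: square_system "ssum topc - tri" "\<lambda>l t c. Q topc (V topc topc c) (t l)" "\<lambda>l t. VA topc topc (t l)"
    by (rule chart_square_system[OF adm_top])
  define c0 where "c0 = coords topc topc v"
  have "Jac topc topc \<theta>0 c0 = Jac topc topc (\<lambda>l. of_real (t0 l)) c0"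
    unfolding Jac_def by (rule cdet_cong) (simp add: \<theta>0_def ssum_top)
  hence D0: "sys.D \<theta>0 c0 c0 \<noteq> 0"
    using etale_Jac[OF et v(1) sol] unfolding chart_D[OF adm_top] by (simp add: c0_def)
  have sol0: "Q topc (V topc topc c0) (\<theta>0 l) = 0" if "l < ssum topc - tri" for l
    using Q_cong[of "V topc topc c0" v topc] V_coords[OF adm_top v(1)] sol[of l] that
    by (simp add: c0_def \<theta>0_def ssum_top)
  show "real_rows v"
    unfolding real_rows_iff_coords[OF v(1)]
  proof (intro allI impI)
    fix a assume a: "a < N"
    have "\<bar>Im (c0 a)\<bar> \<le> e" if e: "e > 0" for e
    proof -
      have "eventually (\<lambda>j. \<exists>c. (\<forall>a<ssum topc - tri. dist (c a) (c0 a) < e) \<and> (\<forall>a\<ge>ssum topc - tri. c a = c0 a) \<and>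
          (\<forall>l<ssum topc - tri. Q topc (V topc topc c) (\<theta> j l) = 0)) sequentially"
        by (rule eventually_compose_filterlim[OF sys.solution_persists[OF D0 sol0 e] \<theta>])
      then obtain j c where c: "\<forall>a<N. dist (c a) (c0 a) < e" "\<forall>l<N. Q topc (V topc topc c) (\<theta> j l) = 0"
        unfolding ssum_top by (auto dest: eventually_happens)
      have S: "V topc topc c \<in> SY topc topc" by (rule V_SY[OF adm_top])
      have "Fib (\<lambda>l. of_real (t j l)) (V topc topc c)"
        using Fib_iff_pos[OF t(1) S] c(2) by (simp add: \<theta>_def)
      hence "real_rows (V topc topc c)" using r S unfolding real_fibre_def by blast
      hence "c a \<in> \<real>" using a unfolding real_rows_iff_coords[OF S] by (simp add: coords_V[OF adm_top] ssum_top)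
      hence "Im (c a) = 0" by (simp add: complex_is_Real_iff)
      hence "\<bar>Im (c0 a)\<bar> = \<bar>Im (c a - c0 a)\<bar>" by simp
      also have "\<dots> \<le> norm (c a - c0 a)" by (rule abs_Im_le_cmod)
      also have "\<dots> < e" using c(1) a by (simp add: dist_norm)
      finally show ?thesis by simp
    qed
    hence "\<bar>Im (c0 a)\<bar> \<le> 0" by (rule field_le_epsilon) simp
    thus "coords topc topc v a \<in> \<real>" by (simp add: complex_is_Real_iff c0_def)
  qed
qed

text \<open>By properness, nonreal points over \<open>t j\<close> have a limit over
  \<open>t0\<close>. Were it real, these points and their conjugates would be two solutions near a
  nondegenerate one, against local injectivity.\<close>

lemma real_fibre_open:
  assumes lim: "\<And>l. l < N \<Longrightarrow> (\<lambda>j. t j l) \<longlonglongrightarrow> t0 l" and t: "\<And>j. pos_decreasing (t j)" "pos_decreasing t0"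
    and et: "etale t0" and r: "\<And>j. \<not> real_fibre (t j)"
  shows "\<not> real_fibre t0"
proof
  assume r0: "real_fibre t0"
  have "\<exists>v. v \<in> SY topc topc \<and> Fib (\<lambda>l. of_real (t j l)) v \<and> \<not> real_rows v" for j
    using r[of j] unfolding real_fibre_def by blast
  then obtain v where v: "\<And>j. v j \<in> SY topc topc" "\<And>j. Fib (\<lambda>l. of_real (t j l)) (v j)" "\<And>j. \<not> real_rows (v j)"
    by metis
  obtain \<phi> v0 where \<phi>: "strict_mono (\<phi> :: nat \<Rightarrow> nat)" "v0 \<in> SY topc topc" "Fib (\<lambda>l. of_real (t0 l)) v0"
    "\<And>l c. l < k \<Longrightarrow> (\<lambda>i. v (\<phi> i) l c) \<longlonglongrightarrow> v0 l c"
  proof (rule Fib_compact[of "\<lambda>j l. of_real (t j l)" "\<lambda>l. of_real (t0 l)" v])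
    show "(\<lambda>j. complex_of_real (t j l)) \<longlonglongrightarrow> complex_of_real (t0 l)" if "l < N" for l
      by (rule tendsto_of_real[OF lim[OF that]])
    show "complex_of_real (t0 l) \<noteq> 0" if "l < N" for l using t(2) that by (auto simp: pos_decreasing_def)
  qed (use v in auto)
  define \<theta> where "\<theta> j = (\<lambda>l. if l < N then complex_of_real (t (\<phi> j) l) else 0)" for j
  define \<theta>0 where "\<theta>0 = (\<lambda>l. if l < N then complex_of_real (t0 l) else 0)"
  have \<theta>: "\<theta> \<longlonglongrightarrow> \<theta>0" unfolding tendsto_fun_iff \<theta>_def \<theta>0_def
    using LIMSEQ_subseq_LIMSEQ[OF lim \<phi>(1)] by (auto intro!: tendsto_of_real simp: o_def)
  have sol: "Q topc v0 (of_real (t0 l)) = 0" if "l < N" for l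
    using Fib_iff_pos[OF t(2) \<phi>(2)] \<phi>(3) that by blast
  interpret sys: square_system "ssum topc - tri" "\<lambda>l t c. Q topc (V topc topc c) (t l)" "\<lambda>l t. VA topc topc (t l)"
    by (rule chart_square_system[OF adm_top])
  define c0 where "c0 = coords topc topc v0"
  define c where "c j = coords topc topc (v (\<phi> j))" for j
  have "Jac topc topc \<theta>0 c0 = Jac topc topc (\<lambda>l. of_real (t0 l)) c0"
    unfolding Jac_def by (rule cdet_cong) (simp add: \<theta>0_def ssum_top)
  hence D0: "sys.D \<theta>0 c0 c0 \<noteq> 0"
    using etale_Jac[OF et \<phi>(2) sol] unfolding chart_D[OF adm_top] by (simp add: c0_def)
  have clim: "c \<longlonglongrightarrow> c0"
    unfolding tendsto_fun_iff
  proof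
    fix a
    show "(\<lambda>j. c j a) \<longlonglongrightarrow> c0 a"
    proof (cases "a < ssum topc - tri")
      case True
      have "fst (idx topc topc a) < k" using idx_in[OF adm_top True] by (metis prod.collapse)
      thus ?thesis using True \<phi>(4) by (simp add: c_def c0_def coords_def)
    qed (simp add: c_def c0_def coords_def)
  qed
  have c0real: "cnj (c0 a) = c0 a" for a
  proof (cases "a < N")
    case True
    have "real_rows v0" using r0 \<phi>(2,3) unfolding real_fibre_def by blast
    thus ?thesis using True unfolding real_rows_iff_coords[OF \<phi>(2)] by (simp add: c0_def Reals_cnj_iff)
  qed (simp add: c0_def coords_def ssum_top)
  have clim': "(\<lambda>j a. cnj (c j a)) \<longlonglongrightarrow> c0"
    unfolding tendsto_fun_iff
  proof
    fix a
    have "(\<lambda>j. cnj (c j a)) \<longlonglongrightarrow> cnj (c0 a)"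
      using clim unfolding tendsto_fun_iff by (intro tendsto_cnj) blast
    thus "(\<lambda>j. cnj (c j a)) \<longlonglongrightarrow> c0 a" by (simp add: c0real)
  qed
  have "eventually (\<lambda>j. (\<forall>l<ssum topc - tri. Q topc (V topc topc (c j)) (\<theta> j l)
       = Q topc (V topc topc (\<lambda>a. cnj (c j a))) (\<theta> j l)) \<longrightarrow> (\<forall>a<ssum topc - tri. c j a = cnj (c j a))) sequentially"
    by (rule sys.locally_injective[OF \<theta> clim clim' D0])
  from eventually_happens[OF this]
  obtain j where j: "(\<forall>l<N. Q topc (V topc topc (c j)) (\<theta> j l)
       = Q topc (V topc topc (\<lambda>a. cnj (c j a))) (\<theta> j l)) \<longrightarrow> (\<forall>a<N. c j a = cnj (c j a))"
    unfolding ssum_top by (elim disjE) (simp, blast)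
  have "Q topc (V topc topc (c j)) (\<theta> j l) = 0" if "l < N" for l
    using Fib_iff_pos[OF t(1) v(1)[of "\<phi> j"]] v(2)[of "\<phi> j"] that
      Q_cong[of "V topc topc (c j)" "v (\<phi> j)" topc] V_coords[OF adm_top v(1)]
    by (simp add: \<theta>_def c_def)
  moreover have "Q topc (V topc topc (\<lambda>a. cnj (c j a))) (\<theta> j l) = cnj (Q topc (V topc topc (c j)) (\<theta> j l))" for l
  proof -
    have "V topc topc (\<lambda>a. cnj (c j a)) = (\<lambda>l q. cnj (V topc topc (c j) l q))" by (intro ext V_cnj)
    moreover have "\<theta> j l = cnj (\<theta> j l)" by (simp add: \<theta>_def)
    ultimately show ?thesis using Q_cnj[of topc "V topc topc (c j)" "\<theta> j l"] by simp
  qed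
  ultimately have "\<forall>a<N. c j a = cnj (c j a)" using j by simp
  hence "real_rows (v (\<phi> j))" unfolding real_rows_iff_coords[OF v(1)] by (auto simp: c_def Reals_cnj_iff)
  thus False using v(3) by blast
qed

text \<open>Decreasing positive tuples form a convex set, so the segment from the tuple of
  \<open>exists_good\<close> stays in it. The parameters with real fibre form a closed subset with
  closed complement.\<close>

lemma real_fibre_pos_decreasing:
  assumes et: "\<And>t. pos_decreasing t \<Longrightarrow> etale t" and t1: "pos_decreasing t1"
  shows "real_fibre t1"
proof -
  obtain t0 :: "nat \<Rightarrow> real" where t0: "\<forall>l<N. t0 l > 0" "\<forall>l p. l < p \<longrightarrow> p < N \<longrightarrow> t0 p < t0 l" "\<forall>e\<in>positions N. good N t0 e"
    using exists_good[of N] by blast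
  have p0: "pos_decreasing t0" using t0 by (simp add: pos_decreasing_def)
  have g: "good N t0 topc" using t0(3) top_position by blast
  have r0: "real_fibre t0"
    unfolding real_fibre_def
  proof (intro ballI impI)
    fix v assume v: "v \<in> SY topc topc" "Fib (\<lambda>l. of_real (t0 l)) v"
    hence "\<forall>l<N. Q topc v (of_real (t0 l)) = 0"
      using Fib_iff_pos[OF p0] by blast
    thus "real_rows v" using g v(1) unfolding good_def by blast
  qed
  define T where "T s l = (1 - s) * t0 l + s * t1 l" for s l
  have T: "pos_decreasing (T s)" if "s \<in> {0..1}" for s
  proof -
    have cc: "(1 - s) * x + s * y < (1 - s) * x' + s * y'" if "x < x'" "y < y'" for x x' y y' :: real
    proof (cases "s = 0")
      case False
      hence "s * y < s * y'" using \<open>s \<in> {0..1}\<close> that by simp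
      moreover have "(1 - s) * x \<le> (1 - s) * x'" using \<open>s \<in> {0..1}\<close> that by (intro mult_left_mono) auto
      ultimately show ?thesis by simp
    qed (use that in simp)
    show ?thesis using p0 t1 cc[of 0 _ 0] cc unfolding pos_decreasing_def T_def by auto
  qed
  define A where "A = {s \<in> {0..1}. real_fibre (T s)}"
  have T_lim: "(\<lambda>j. T (s j) l) \<longlonglongrightarrow> T s0 l" if "s \<longlonglongrightarrow> s0" for s s0 l
    unfolding T_def by (intro tendsto_intros that)
  have "closed A"
    unfolding closed_sequential_limits
  proof (intro allI impI, elim conjE)
    fix s s0 assume s: "\<forall>j. s j \<in> A" "s \<longlonglongrightarrow> s0"
    have sj: "s j \<in> {0..1}" for j using s(1) by (simp add: A_def)
    have s0: "s0 \<in> {0..1}" by (rule closed_sequentially[OF closed_atLeastAtMost sj s(2)])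
    have "real_fibre (T s0)"
    proof (rule real_fibre_closed[OF T_lim[OF s(2)] T[OF sj] T[OF s0]])
      show "etale (T s0)" by (rule et[OF T[OF s0]])
      show "real_fibre (T (s j))" for j using s(1) by (simp add: A_def)
    qed
    thus "s0 \<in> A" using s0 by (simp add: A_def)
  qed
  moreover have "closed ({0..1} - A)"
    unfolding closed_sequential_limits
  proof (intro allI impI, elim conjE)
    fix s s0 assume s: "\<forall>j. s j \<in> {0..1} - A" "s \<longlonglongrightarrow> s0"
    have sj: "s j \<in> {0..1}" for j using s(1) by simp
    have s0: "s0 \<in> {0..1}" by (rule closed_sequentially[OF closed_atLeastAtMost sj s(2)])
    have "\<not> real_fibre (T s0)"
    proof (rule real_fibre_open[OF T_lim[OF s(2)] T[OF sj] T[OF s0]])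
      show "etale (T s0)" by (rule et[OF T[OF s0]])
      show "\<not> real_fibre (T (s j))" for j using s(1) sj by (simp add: A_def)
    qed
    thus "s0 \<in> {0..1} - A" using s0 by (simp add: A_def)
  qed
  moreover have "connected {0..1::real}" by simp
  moreover have T01: "T 0 = t0" "T 1 = t1" by (simp_all add: T_def fun_eq_iff)
  moreover have A0: "0 \<in> A" using r0 T01 by (simp add: A_def)
  moreover have "{0..1} \<subseteq> A \<union> ({0..1} - A)" "A \<inter> ({0..1} - A) \<inter> {0..1} = {}" "A \<inter> {0..1} \<noteq> {}"
    using A0 by auto
  ultimately have "({0..1} - A) \<inter> {0..1} = {}" unfolding connected_closed by blast
  moreover have "(1::real) \<in> {0..1}" by simp
  ultimately have "1 \<in> A" by blast
  thus ?thesis using T01 by (simp add: A_def)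
qed

text \<open>The fibre is symmetric in the roots, which can therefore be sorted.\<close>

lemma real_fibre_distinct:
  assumes et: "\<And>t. pos_decreasing t \<Longrightarrow> etale t" and t: "\<And>l. l < N \<Longrightarrow> t l > 0" "inj_on t {..<N}"
  shows "real_fibre t"
proof -
  define xs where "xs = rev (sorted_list_of_set (t ` {..<N}))"
  have len: "length xs = N" unfolding xs_def using t(2) by (simp add: card_image)
  have set: "set xs = t ` {..<N}" by (simp add: xs_def)
  have dist: "distinct xs" by (simp add: xs_def)
  have dec: "xs ! p < xs ! l" if "l < p" "p < N" for l p
  proof -
    have "sorted_wrt (<) (sorted_list_of_set (t ` {..<N}))" by simp
    hence "sorted_wrt (\<lambda>x y. y < x) xs" unfolding xs_def by (simp add: sorted_wrt_rev)
    thus ?thesis using that len by (simp add: sorted_wrt_iff_nth_less)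
  qed
  have "xs ! l > 0" if "l < N" for l
  proof -
    have "xs ! l \<in> t ` {..<N}" using nth_mem[of l xs] len that set by simp
    thus ?thesis using t(1) by auto
  qed
  hence pd: "pos_decreasing (\<lambda>l. xs ! l)" using dec by (simp add: pos_decreasing_def)
  have prods: "(\<Prod>l<N. f (xs ! l)) = (\<Prod>l<N. f (t l))" for f :: "real \<Rightarrow> complex"
  proof -
    have inj: "inj_on (\<lambda>l. xs ! l) {..<N}" using dist len by (auto simp: inj_on_def nth_eq_iff_index_eq)
    have im: "(\<lambda>l. xs ! l) ` {..<N} = t ` {..<N}" using set len by (auto simp: set_conv_nth image_iff)
    have "(\<Prod>l<N. f (xs ! l)) = prod f ((\<lambda>l. xs ! l) ` {..<N})" using inj by (simp add: prod.reindex)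
    also have "\<dots> = (\<Prod>l<N. f (t l))" unfolding im using t(2) by (simp add: prod.reindex)
    finally show ?thesis .
  qed
  have "Fib (\<lambda>l. of_real (xs ! l)) v \<longleftrightarrow> Fib (\<lambda>l. of_real (t l)) v" for v
    unfolding Fib_def using prods[of of_real] prods[of "\<lambda>x. of_real x - _"] by simp
  thus ?thesis using real_fibre_pos_decreasing[OF et pd] unfolding real_fibre_def by simp
qed

subsection \<open>Perturbation of roots\<close>

lemma Fib_of_degree:
  assumes v: "v \<in> SY topc topc" and deg: "degree (Qp topc v) = N"
  obtains t where "Fib t v" "\<And>l. l < N \<Longrightarrow> t l \<noteq> 0" "\<And>l. l < N \<Longrightarrow> Q topc v (t l) = 0"
proof -
  define a where "a = lead_coeff (Qp topc v)"
  obtain t where t: "smult a (\<Prod>i<N. [:- t i, 1:]) = Qp topc v"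
    using complex_poly_decompose'[of "Qp topc v"] unfolding deg a_def by blast
  have lin: "poly [:- t i, 1:] z = z - t i" for i z by simp
  have Q: "Q topc v z = a * (\<Prod>i<N. z - t i)" for z
    unfolding poly_Qp[symmetric] t[symmetric] poly_smult poly_prod lin ..
  have kap: "kappa topc = a * (\<Prod>i<N. 0 - t i)" using Q[of 0] Q_top_0[OF v] by simp
  have F: "Fib t v"
    unfolding Fib_def
  proof
    fix z
    have "(\<Prod>i<N. z - t i) * (\<Prod>i<N. t i) = (\<Prod>i<N. 0 - t i) * (\<Prod>i<N. t i - z)"
      unfolding prod.distrib[symmetric] by (intro prod.cong) (auto simp: algebra_simps)
    thus "Q topc v z * (\<Prod>i<N. t i) = kappa topc * (\<Prod>i<N. t i - z)"
      unfolding Q kap by (simp only: mult.assoc)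
  qed
  have nz: "t l \<noteq> 0" if "l < N" for l
  proof
    assume "t l = 0"
    hence "(\<Prod>i<N. 0 - t i) = 0" using that by (intro prod_zero) auto
    thus False using kap kappa_top by simp
  qed
  show ?thesis using that[OF F nz] Fib_root[of t v, OF F nz] by blast
qed

lemma tendsto_Qcoef:
  assumes "\<And>l j. l < k \<Longrightarrow> j < n \<Longrightarrow> ((\<lambda>x. v x l j) \<longlongrightarrow> v0 l j) F" "p permutes {..<n}"
  shows "((\<lambda>x. Qcoef (v x) p) \<longlongrightarrow> Qcoef v0 p) F"
  unfolding Qcoef_def
proof (intro tendsto_mult tendsto_const tendsto_prod)
  fix i assume "i \<in> {..<n}"
  thus "((\<lambda>x. if i < k then v x i (p i) else ff (i - k) (p i)) \<longlongrightarrow>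
     (if i < k then v0 i (p i) else ff (i - k) (p i))) F"
    using assms permutes_less[OF assms(2), of i] by (cases "i < k") auto
qed

lemma Q_difference_bound:
  assumes "v \<in> Y topc" "v0 \<in> Y topc"
  shows "norm (Q topc v z - Q topc v0 z) \<le> (\<Sum>p | p permutes {..<n}. norm (Qcoef v p - Qcoef v0 p)) * (1 + norm z) ^ N"
proof -
  have "norm (Q topc v z - Q topc v0 z) = norm (\<Sum>p | p permutes {..<n}. (Qcoef v p - Qcoef v0 p) * z ^ Qexp topc p)"
    unfolding Q_leibniz by (simp add: sum_subtractf algebra_simps)
  also have "\<dots> \<le> (\<Sum>p | p permutes {..<n}. norm (Qcoef v p - Qcoef v0 p) * (1 + norm z) ^ N)"
  proof (rule sum_norm_le)
    fix p assume p: "p \<in> {p. p permutes {..<n}}"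
    show "norm ((Qcoef v p - Qcoef v0 p) * z ^ Qexp topc p) \<le> norm (Qcoef v p - Qcoef v0 p) * (1 + norm z) ^ N"
    proof (cases "Qcoef v p = 0 \<and> Qcoef v0 p = 0")
      case False
      hence "Qexp topc p \<le> N" using Qexp_le[of v topc p] Qexp_le[of v0 topc p] assms p ssum_top by auto
      have "norm z ^ Qexp topc p \<le> (1 + norm z) ^ Qexp topc p" by (intro power_mono) auto
      also have "\<dots> \<le> (1 + norm z) ^ N" using \<open>Qexp topc p \<le> N\<close> by (intro power_increasing) auto
      finally show ?thesis by (simp add: norm_mult norm_power mult_left_mono)
    qed simp
  qed
  finally show ?thesis by (simp add: sum_distrib_right)
qed

lemma degree_Qp_Fib:
  assumes "Fib t v" "\<And>l. l < N \<Longrightarrow> t l \<noteq> 0"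
  shows "degree (Qp topc v) = N"
proof -
  have "smult (\<Prod>l<N. t l) (Qp topc v) = smult (kappa topc) (\<Prod>l<N. [:t l, - 1:])"
    using assms(1) unfolding Fib_iff_poly .
  moreover have "(\<Prod>l<N. t l) \<noteq> 0" using assms(2) by auto
  ultimately have "degree (Qp topc v) = degree (\<Prod>l<N. [:t l, - 1:])"
    using kappa_top by (metis degree_smult_eq)
  also have "\<dots> = (\<Sum>l<N. degree [:t l, - 1:])" by (rule degree_prod_eq_sum_degree) auto
  finally show ?thesis by simp
qed

text \<open>Away from the \<open>t0 l\<close> the value at \<open>v0\<close> is at least a multiple
  of \<open>(1 + norm z) ^ N\<close>. The same weight bounds the change of \<open>Q\<close>, so the
  comparison is uniform in unbounded \<open>z\<close>. The degree is kept because the coefficient of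
  \<open>z ^ N\<close> is continuous and nonzero at \<open>v0\<close>.\<close>

lemma roots_near:
  fixes v :: "'x \<Rightarrow> nat \<Rightarrow> nat \<Rightarrow> complex"
  assumes v0: "v0 \<in> SY topc topc" "Fib t0 v0" "\<And>l. l < N \<Longrightarrow> t0 l \<noteq> 0"
    and lim: "\<And>l j. l < k \<Longrightarrow> ((\<lambda>x. v x l j) \<longlongrightarrow> v0 l j) F" and v: "\<And>x. v x \<in> SY topc topc" and e: "e > 0"
  shows "eventually (\<lambda>x. degree (Qp topc (v x)) = N \<and> (\<forall>z. Q topc (v x) z = 0 \<longrightarrow> (\<exists>l<N. dist z (t0 l) < e))) F"
proof -
  have vY: "v x \<in> Y topc" "v0 \<in> Y topc" for x using v v0(1) by (auto simp: SY_def)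
  define cN where "cN w = (\<Sum>p | p permutes {..<n}. if Qexp topc p = N then Qcoef w p else 0)" for w
  have cN: "coeff (Qp topc w) N = cN w" for w
    unfolding Qp_def cN_def coeff_sum by (intro sum.cong) auto
  have "((\<lambda>x. cN (v x)) \<longlongrightarrow> cN v0) F"
    unfolding cN_def
  proof (rule tendsto_sum)
    fix p assume "p \<in> {p. p permutes {..<n}}"
    thus "((\<lambda>x. if Qexp topc p = N then Qcoef (v x) p else 0) \<longlongrightarrow> (if Qexp topc p = N then Qcoef v0 p else 0)) F"
      using tendsto_Qcoef[of v v0 F p] lim by auto
  qed
  moreover have "cN v0 \<noteq> 0"
  proof -
    have "Qp topc v0 \<noteq> 0"
    proof
      assume "Qp topc v0 = 0"
      hence "Q topc v0 0 = 0" by (simp flip: poly_Qp)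
      thus False using Q_top_0[OF v0(1)] kappa_top by simp
    qed
    thus ?thesis unfolding cN[symmetric] using degree_Qp_Fib[OF v0(2,3)] by (metis leading_coeff_0_iff)
  qed
  ultimately have ev1: "eventually (\<lambda>x. cN (v x) \<noteq> 0) F" by (rule tendsto_imp_eventually_ne)
  define h where "h x = (\<Sum>p | p permutes {..<n}. norm (Qcoef (v x) p - Qcoef v0 p))" for x
  have "(h \<longlongrightarrow> (\<Sum>p | p permutes {..<n}. norm (Qcoef v0 p - Qcoef v0 p))) F"
    unfolding h_def by (intro tendsto_sum tendsto_norm tendsto_diff tendsto_const tendsto_Qcoef lim) auto
  hence h: "(h \<longlongrightarrow> 0) F" by simp
  define M where "M = (\<Sum>l<N. norm (t0 l))"
  have M: "norm (t0 l) \<le> M" if "l < N" for l unfolding M_def using that by (intro member_le_sum) auto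
  have M0: "M \<ge> 0" by (simp add: M_def sum_nonneg)
  \<comment> \<open>Chosen such that \<open>1 + norm z\<close> is at most \<open>q\<close> times the
    distance from \<open>z\<close> to \<open>t0 l\<close>, once this distance is at least
    \<open>e\<close>: then \<open>1 + M\<close> is at most \<open>(1 + M) / e\<close> times the
    distance.\<close>
  define q where "q = 1 + (1 + M) / e"
  have q: "q > 0" using M0 e by (simp add: q_def add_pos_nonneg)
  define \<kappa> where "\<kappa> = norm (kappa topc) / norm (\<Prod>l<N. t0 l)"
  have \<kappa>: "\<kappa> > 0" using kappa_top v0(3) by (simp add: \<kappa>_def)
  have "eventually (\<lambda>x. h x < \<kappa> * (1 / q) ^ N) F"
    using h \<kappa> q by (intro order_tendstoD(2)[OF h]) simp
  with ev1 show ?thesis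
  proof eventually_elim
    case (elim x)
    have "N \<le> degree (Qp topc (v x))" using elim(1) by (intro le_degree) (simp add: cN)
    hence deg: "degree (Qp topc (v x)) = N" using degree_Qp[OF vY(1)] ssum_top by (simp add: order_antisym)
    have "\<exists>l<N. dist z (t0 l) < e" if z: "Q topc (v x) z = 0" for z
    proof (rule ccontr)
      assume "\<not> ?thesis"
      hence "\<not> dist z (t0 l) < e" if "l < N" for l using that by blast
      hence far: "e \<le> norm (t0 l - z)" if "l < N" for l using that by (simp add: dist_norm norm_minus_commute not_less)
      have fac: "(1 + norm z) / q \<le> norm (t0 l - z)" if l: "l < N" for l
      proof -
        have "norm z \<le> norm (t0 l) + norm (t0 l - z)" by (metis norm_minus_commute norm_triangle_sub)
        hence "1 + norm z \<le> (1 + M) + norm (t0 l - z)" using M[OF l] by simp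
        also have "1 + M \<le> (1 + M) / e * norm (t0 l - z)"
        proof -
          have "(1 + M) / e * e \<le> (1 + M) / e * norm (t0 l - z)"
            using far[OF l] M0 e by (intro mult_left_mono) auto
          thus ?thesis using e by simp
        qed
        finally have "1 + norm z \<le> q * norm (t0 l - z)" by (simp add: q_def algebra_simps)
        thus ?thesis using q by (simp add: field_simps)
      qed
      have "(1 + norm z) ^ N * (1 / q) ^ N = (\<Prod>l<N. (1 + norm z) / q)" by (simp add: power_divide)
      also have "\<dots> \<le> (\<Prod>l<N. norm (t0 l - z))"
        by (rule prod_mono) (use fac q in auto)
      finally have "\<kappa> * ((1 + norm z) ^ N * (1 / q) ^ N) \<le> \<kappa> * (\<Prod>l<N. norm (t0 l - z))"
        using \<kappa> by (intro mult_left_mono) auto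
      also have "\<dots> = norm (Q topc v0 z)"
      proof -
        have "Q topc v0 z * (\<Prod>l<N. t0 l) = kappa topc * (\<Prod>l<N. t0 l - z)" using v0(2) unfolding Fib_def by blast
        hence "norm (Q topc v0 z) * norm (\<Prod>l<N. t0 l) = norm (kappa topc) * (\<Prod>l<N. norm (t0 l - z))"
          by (metis norm_mult prod_norm)
        moreover have "norm (\<Prod>l<N. t0 l) \<noteq> 0" using v0(3) by simp
        ultimately show ?thesis unfolding \<kappa>_def by (simp add: field_simps)
      qed
      also have "norm (Q topc v0 z) = norm (Q topc (v x) z - Q topc v0 z)" using z by simp
      also have "\<dots> \<le> h x * (1 + norm z) ^ N" unfolding h_def by (rule Q_difference_bound[OF vY])
      also have "\<dots> < (\<kappa> * (1 / q) ^ N) * (1 + norm z) ^ N"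
        using elim(2) by (intro mult_strict_right_mono) (auto intro!: zero_less_power add_pos_nonneg)
      finally show False by (simp add: mult_ac)
    qed
    thus ?case using deg by blast
  qed
qed

lemma holomorphic_on_V:
  "(\<And>a. (\<lambda>s. c s a) holomorphic_on S) \<Longrightarrow> (\<lambda>s. V e f (c s) l j) holomorphic_on S"
proof -
  assume h: "\<And>a. (\<lambda>s. c s a) holomorphic_on S"
  have "(\<lambda>s. \<Sum>a<ssum e - tri. if idx e f a = (l, j) then c s a else 0) holomorphic_on S"
  proof (rule holomorphic_on_sum)
    fix a show "(\<lambda>s. if idx e f a = (l, j) then c s a else 0) holomorphic_on S"
      using h by (cases "idx e f a = (l, j)") auto
  qed
  thus ?thesis unfolding V_def by (cases "l < k \<and> j \<in> f ` {..<k}") auto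
qed

lemma holomorphic_on_Jac:
  assumes "\<And>a. (\<lambda>s. c s a) holomorphic_on S" "\<And>l. (\<lambda>s. t s l) holomorphic_on S"
  shows "(\<lambda>s. Jac e f (t s) (c s)) holomorphic_on S"
  unfolding Jac_def
proof (rule holomorphic_on_cdet)
  fix r a
  show "(\<lambda>s. VA e f (t s r) (c s) (c s) a) holomorphic_on S"
    unfolding VA_diag by (intro holomorphic_on_dQ holomorphic_on_V assms)
qed

lemma tendsto_Jac:
  assumes "\<And>a. ((\<lambda>s. c s a) \<longlongrightarrow> c0 a) F" "\<And>l. ((\<lambda>s. t s l) \<longlongrightarrow> t0 l) F"
  shows "((\<lambda>s. Jac e f (t s) (c s)) \<longlongrightarrow> Jac e f t0 c0) F"
  unfolding Jac_def by (intro tendsto_cdet tendsto_VA assms)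

text \<open>On the complex line through \<open>c0\<close> and \<open>c1\<close> the Jacobian is an
  entire function that is nonzero at one point, so it cannot vanish near \<open>c0\<close>.\<close>

lemma Jac_nonzero_dense:
  assumes "Jac e f x c1 \<noteq> 0" "d > 0"
  obtains c where "\<And>a. dist (c a) (c0 a) \<le> d * norm (c1 a - c0 a)" "Jac e f x c \<noteq> 0"
proof (rule ccontr)
  assume "\<not> thesis"
  hence nt: False if "\<And>a. dist (c a) (c0 a) \<le> d * norm (c1 a - c0 a)" "Jac e f x c \<noteq> 0" for c
    using that \<open>\<And>c. (\<And>a. dist (c a) (c0 a) \<le> d * norm (c1 a - c0 a)) \<Longrightarrow> Jac e f x c \<noteq> 0 \<Longrightarrow> thesis\<close> by blast
  define c where "c s a = c0 a + s * (c1 a - c0 a)" for s a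
  have hol: "(\<lambda>s. Jac e f x (c s)) holomorphic_on UNIV"
    unfolding c_def by (intro holomorphic_on_Jac holomorphic_intros)
  have z: "Jac e f x (c s) = 0" if "s \<in> ball 0 d" for s
  proof (rule ccontr)
    assume "Jac e f x (c s) \<noteq> 0"
    moreover have "dist (c s a) (c0 a) \<le> d * norm (c1 a - c0 a)" for a
      using that by (auto simp: c_def dist_norm norm_mult intro: mult_right_mono)
    ultimately show False using nt by blast
  qed
  have "Jac e f x (c 1) = 0"
  proof (rule analytic_continuation[OF hol])
    show "(0::complex) islimpt ball 0 d" using assms(2) by (simp add: islimpt_ball)
  qed (use z in auto)
  moreover have "c 1 = c1" by (auto simp: c_def)
  ultimately show False using assms(1) by simp
qed

text \<open>The columns of the Jacobian matrix are values of polynomials of degree at most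
  \<open>N\<close> that vanish at 0, the chart keeping the leading entries fixed. A relation between
  them at \<open>N\<close> distinct nonzero points is an identity and holds at every
  \<open>x\<close>.\<close>

lemma Jac_transfer:
  assumes J: "Jac topc topc x c \<noteq> 0" and t: "inj_on t {..<N}" "\<And>l. l < N \<Longrightarrow> t l \<noteq> 0"
  shows "Jac topc topc t c \<noteq> 0"
proof
  assume "Jac topc topc t c = 0"
  then obtain d a0 where d: "a0 < N" "d a0 \<noteq> 0" "\<And>l. l < N \<Longrightarrow> (\<Sum>a<N. VA topc topc (t l) c c a * d a) = 0"
    unfolding Jac_def cdet_right_kernel ssum_top by blast
  define i where "i a = fst (idx topc topc a)" for a
  define j where "j a = snd (idx topc topc a)" for a
  have ij: "i a < k" "j a \<le> topc (i a)" "j a \<notin> topc ` {..<k}" if "a < N" for a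
    using idx_in[OF adm_top, of a "i a" "j a"] that ssum_top by (auto simp: i_def j_def)
  define w where "w a = (V topc topc c)(i a := (\<lambda>q. if q = j a then 1 else 0))" for a
  have wY: "w a \<in> Y topc" if "a < N" for a
    using V_SY[OF adm_top, of c] ij[OF that] by (auto simp: w_def SY_def Y_def)
  have VA: "VA topc topc z c c a = poly (Qp topc (w a)) z" for a z
    by (simp add: VA_diag dQ_def w_def i_def j_def poly_Qp)
  define P where "P = (\<Sum>a<N. smult (d a) (Qp topc (w a)))"
  have P: "poly P z = (\<Sum>a<N. VA topc topc z c c a * d a)" for z
    by (simp add: P_def poly_sum VA mult.commute)
  have "P = 0"
  proof (rule polys_eqI[OF _ _ t])
    show "degree P \<le> N" unfolding P_def
    proof (rule degree_sum_le)
      fix a assume "a \<in> {..<N}"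
      thus "degree (smult (d a) (Qp topc (w a))) \<le> N"
        using degree_Qp[OF wY, of a] ssum_top by (intro order_trans[OF degree_smult_le]) auto
    qed simp
    show "poly P (t l) = poly 0 (t l)" if "l < N" for l using d(3)[OF that] by (simp add: P)
    have "poly (Qp topc (w a)) 0 = 0" if "a < N" for a
    proof -
      have "topc (i a) \<noteq> j a" using ij[OF that] by (metis image_eqI lessThan_iff)
      hence "w a (i a) (topc (i a)) = 0" by (simp add: w_def)
      hence "(\<Prod>l<k. w a l (topc l)) = 0" using ij(1)[OF that] by (intro prod_zero bexI[of _ "i a"]) auto
      thus ?thesis unfolding poly_Qp Q_at_0[OF wY[OF that]] by simp
    qed
    thus "poly P 0 = poly 0 0" by (simp add: P_def poly_sum)
  qed simp
  hence "(\<Sum>a<N. VA topc topc z c c a * d a) = 0" for z using P[of z] by simp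
  hence "Jac topc topc x c = 0" unfolding Jac_def cdet_right_kernel ssum_top using d by blast
  thus False using J by simp
qed

text \<open>Prescribing \<open>Q\<close> at fixed points \<open>x\<close> instead of at its roots
  keeps the system nondegenerate when roots coincide. The roots can then be moved to
  \<open>t' l + s * l\<close>, which are distinct for small \<open>s > 0\<close>, and
  \<open>Jac_transfer\<close> passes from \<open>x\<close> to them.\<close>

lemma perturb_to_distinct:
  assumes J: "Jac topc topc x c' \<noteq> 0" and x: "inj_on x {..<N}" "\<And>l. l < N \<Longrightarrow> x l \<noteq> 0"
    and F: "Fib t' (V topc topc c')" and t': "\<And>l. l < N \<Longrightarrow> t' l \<noteq> 0" and e: "e > 0"
  obtains c1 t1 where "\<And>l. l < N \<Longrightarrow> dist (t1 l) (t' l) < e" "\<And>a. a < N \<Longrightarrow> dist (c1 a) (c' a) < e"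
    "\<And>a. a \<ge> N \<Longrightarrow> c1 a = c' a" "Fib t1 (V topc topc c1)" "Jac topc topc t1 c1 \<noteq> 0"
proof -
  interpret sys: square_system "ssum topc - tri" "\<lambda>l t c. Q topc (V topc topc c) (x l) - t l" "\<lambda>l (t :: nat \<Rightarrow> complex). VA topc topc (x l)"
    by (rule chart_system[OF adm_top]) (auto simp: continuous_on_product_then_coordinatewise[OF continuous_on_id])
  have D: "sys.D t c c = Jac topc topc x c" for t c
    by (simp add: sys.D_def Jac_def)
  define tt where "tt s l = t' l + of_real s * of_nat l" for s :: real and l
  \<comment> \<open>The values at \<open>x\<close> of the polynomial with roots \<open>tt s\<close>
    and value \<open>kappa topc\<close> at 0.\<close>
  define \<theta> where "\<theta> s l = (if l < N then kappa topc * (\<Prod>i<N. tt s i - x l) / (\<Prod>i<N. tt s i) else 0)" for s l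
  have tt_lim: "((\<lambda>s. tt s l) \<longlongrightarrow> t' l) (at_right 0)" for l
    unfolding tt_def by (auto intro!: tendsto_eq_intros)
  define \<theta>0 where "\<theta>0 l = (if l < N then Q topc (V topc topc c') (x l) else 0)" for l
  have \<theta>: "(\<theta> \<longlongrightarrow> \<theta>0) (at_right 0)"
    unfolding tendsto_fun_iff
  proof
    fix l
    show "((\<lambda>s. \<theta> s l) \<longlongrightarrow> \<theta>0 l) (at_right 0)"
    proof (cases "l < N")
      case True
      have "((\<lambda>s. kappa topc * (\<Prod>i<N. tt s i - x l) / (\<Prod>i<N. tt s i)) \<longlongrightarrow>
          kappa topc * (\<Prod>i<N. t' i - x l) / (\<Prod>i<N. t' i)) (at_right 0)"
        by (intro tendsto_intros tt_lim) (use t' in auto)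
      also have "kappa topc * (\<Prod>i<N. t' i - x l) = Q topc (V topc topc c') (x l) * (\<Prod>i<N. t' i)"
        using F unfolding Fib_def by simp
      also have "\<dots> / (\<Prod>i<N. t' i) = Q topc (V topc topc c') (x l)" using t' by simp
      finally show ?thesis using True by (simp add: \<theta>_def \<theta>0_def)
    qed (simp add: \<theta>_def \<theta>0_def)
  qed
  have D0: "sys.D \<theta>0 c' c' \<noteq> 0" using J by (simp add: D)
  have sol0: "Q topc (V topc topc c') (x l) - \<theta>0 l = 0" if "l < ssum topc - tri" for l
    using that by (simp add: \<theta>0_def ssum_top)
  obtain U r where U: "open U" "\<theta>0 \<in> U" "r > 0"
    "\<And>t c c''. t \<in> U \<Longrightarrow> c \<in> polydisc (ssum topc - tri) c' r \<Longrightarrow> c'' \<in> polydisc (ssum topc - tri) c' r \<Longrightarrow> sys.D t c c'' \<noteq> 0"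
    using sys.nondegenerate_neighbourhood[OF D0] by metis
  have me: "min e r > 0" using e U(3) by simp
  have "eventually (\<lambda>s. \<exists>c. (\<forall>a<ssum topc - tri. dist (c a) (c' a) < min e r) \<and> (\<forall>a\<ge>ssum topc - tri. c a = c' a) \<and>
      (\<forall>l<ssum topc - tri. Q topc (V topc topc c) (x l) - \<theta> s l = 0)) (at_right 0)"
    by (rule eventually_compose_filterlim[OF sys.solution_persists[OF D0 sol0 me] \<theta>])
  moreover have "eventually (\<lambda>s. \<theta> s \<in> U) (at_right 0)" using \<theta> U(1,2) by (rule topological_tendstoD)
  moreover have "eventually (\<lambda>s. \<forall>l\<in>{..<N}. dist (tt s l) (t' l) < e) (at_right 0)"
    by (intro eventually_ball_finite ballI tendstoD[OF tt_lim] e) auto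
  moreover have "eventually (\<lambda>s. \<forall>l\<in>{..<N}. tt s l \<noteq> 0) (at_right 0)"
    by (intro eventually_ball_finite ballI tendsto_imp_eventually_ne[OF tt_lim]) (use t' in auto)
  moreover have "eventually (\<lambda>s. \<forall>l\<in>{..<N}. \<forall>p\<in>{..<N}. l \<noteq> p \<longrightarrow> tt s l \<noteq> tt s p) (at_right 0)"
  proof (intro eventually_ball_finite ballI)
    fix l p
    show "eventually (\<lambda>s. l \<noteq> p \<longrightarrow> tt s l \<noteq> tt s p) (at_right 0)"
    proof (cases "t' l = t' p")
      case True
      have "eventually (\<lambda>s::real. s > 0) (at_right 0)" by (rule eventually_at_right_less)
      thus ?thesis by eventually_elim (use True in \<open>auto simp: tt_def\<close>)
    next
      case False
      have "((\<lambda>s. tt s l - tt s p) \<longlongrightarrow> t' l - t' p) (at_right 0)" by (intro tendsto_diff tt_lim)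
      hence "eventually (\<lambda>s. tt s l - tt s p \<noteq> 0) (at_right 0)"
        by (rule tendsto_imp_eventually_ne) (use False in simp)
      thus ?thesis by eventually_elim auto
    qed
  qed auto
  ultimately have "eventually (\<lambda>s. \<exists>c. (\<forall>a<N. dist (c a) (c' a) < min e r) \<and> (\<forall>a\<ge>N. c a = c' a) \<and>
      (\<forall>l<N. Q topc (V topc topc c) (x l) - \<theta> s l = 0) \<and> \<theta> s \<in> U \<and> (\<forall>l\<in>{..<N}. dist (tt s l) (t' l) < e) \<and>
      (\<forall>l\<in>{..<N}. tt s l \<noteq> 0) \<and> (\<forall>l\<in>{..<N}. \<forall>p\<in>{..<N}. l \<noteq> p \<longrightarrow> tt s l \<noteq> tt s p)) (at_right 0)"
    unfolding ssum_top by eventually_elim blast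
  from eventually_happens[OF this] obtain s c where s: "\<forall>a<N. dist (c a) (c' a) < min e r" "\<forall>a\<ge>N. c a = c' a"
    "\<forall>l<N. Q topc (V topc topc c) (x l) - \<theta> s l = 0" "\<theta> s \<in> U" "\<forall>l\<in>{..<N}. dist (tt s l) (t' l) < e"
    "\<forall>l\<in>{..<N}. tt s l \<noteq> 0" "\<forall>l\<in>{..<N}. \<forall>p\<in>{..<N}. l \<noteq> p \<longrightarrow> tt s l \<noteq> tt s p"
    by auto
  have cin: "c \<in> polydisc (ssum topc - tri) c' r" using s(1,2) by (auto simp: polydisc_def ssum_top intro: less_imp_le)
  have Jx: "Jac topc topc x c \<noteq> 0" using U(4)[OF s(4) cin cin] by (simp add: D)
  have inj: "inj_on (tt s) {..<N}" using s(7) unfolding inj_on_def by blast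
  have ttnz: "tt s l \<noteq> 0" if "l < N" for l using s(6) that by blast
  have "Fib (tt s) (V topc topc c)"
  proof (rule FibI[OF V_SY[OF adm_top] x])
    fix l assume l: "l < N"
    have "Q topc (V topc topc c) (x l) = kappa topc * (\<Prod>i<N. tt s i - x l) / (\<Prod>i<N. tt s i)"
      using s(3) l by (simp add: \<theta>_def)
    moreover have "(\<Prod>i<N. tt s i) \<noteq> 0" using ttnz by auto
    ultimately show "Q topc (V topc topc c) (x l) * (\<Prod>i<N. tt s i) = kappa topc * (\<Prod>i<N. tt s i - x l)" by simp
  qed
  moreover have "Jac topc topc (tt s) c \<noteq> 0" by (rule Jac_transfer[OF Jx inj ttnz])
  ultimately show ?thesis using that[of "tt s" c] s(1,2,5) by auto
qed

lemma Jac_nonzero_imp_inj: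
  assumes "Jac topc topc t c \<noteq> 0"
  shows "inj_on t {..<N}"
proof (rule inj_onI, rule ccontr)
  fix l p assume lp: "l \<in> {..<N}" "p \<in> {..<N}" "t l = t p" "l \<noteq> p"
  have "Jac topc topc t c = 0"
    unfolding Jac_def ssum_top by (rule cdet_identical_rows[of l _ p]) (use lp in auto)
  thus False using assms by simp
qed

subsection \<open>Fibres over repeated positive roots\<close>

text \<open>The real part is nonnegative on the rectangle \<open>\<bar>Re w\<bar> \<le> \<rho>, 0 \<le> Im w \<le> \<rho>\<close>, at least $1$ on its
  three sides off the real axis, and at most $2/\rho$ at $w = i$.\<close>
definition hfun :: "real \<Rightarrow> complex \<Rightarrow> complex" where
  "hfun \<rho> w = (w\<^sup>2 - 2 * \<i> * of_real \<rho> * w) / of_real (\<rho>\<^sup>2)"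

lemma Re_hfun: "Re (hfun \<rho> w) = ((Re w)\<^sup>2 - (Im w)\<^sup>2 + 2 * \<rho> * Im w) / \<rho>\<^sup>2"
  unfolding hfun_def Re_divide_of_real by (simp add: power2_eq_square)

lemma Re_hfun_ge_0:
  assumes "0 \<le> Im w" "Im w \<le> \<rho>" "\<rho> > 0"
  shows "Re (hfun \<rho> w) \<ge> 0"
proof -
  have "(Im w)\<^sup>2 \<le> \<rho> * Im w" using assms by (simp add: power2_eq_square mult_right_mono)
  moreover have "0 \<le> \<rho> * Im w" using assms by simp
  ultimately show ?thesis unfolding Re_hfun using zero_le_power2[of "Re w"] by (intro divide_nonneg_nonneg) (linarith, simp)
qed

lemma Re_hfun_ge_1:
  assumes "0 \<le> Im w" "Im w \<le> \<rho>" "\<rho> > 0" "\<bar>Re w\<bar> = \<rho> \<or> Im w = \<rho>"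
  shows "Re (hfun \<rho> w) \<ge> 1"
proof -
  have 1: "(Im w)\<^sup>2 \<le> \<rho> * Im w" using assms by (simp add: power2_eq_square mult_right_mono)
  have 2: "0 \<le> \<rho> * Im w" using assms by simp
  have "\<rho>\<^sup>2 \<le> (Re w)\<^sup>2 - (Im w)\<^sup>2 + 2 * \<rho> * Im w"
    using assms(4)
  proof
    assume "\<bar>Re w\<bar> = \<rho>"
    hence "(Re w)\<^sup>2 = \<rho>\<^sup>2" by (metis power2_abs)
    thus ?thesis using 1 2 by linarith
  next
    assume "Im w = \<rho>"
    thus ?thesis using zero_le_power2[of "Re w"] by (simp add: power2_eq_square)
  qed
  thus ?thesis unfolding Re_hfun using assms(3) by simp
qed

text \<open>Among the points of maximal value one of maximal real part of \<open>w\<close> is chosen: were it interior with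
  nonzero Jacobian, the maximum principle would make the function constant along the branch through
  it, so that the branch could be followed further to the right.\<close>
lemma maximum_bound:
  fixes p q :: "nat \<Rightarrow> real" and \<rho> K C lam :: real
  defines "tw \<equiv> \<lambda>w l. of_real (p l) + w * of_real (q l) :: complex"
    and "R \<equiv> cbox (Complex (- \<rho>) 0) (Complex \<rho> \<rho>)"
  assumes \<rho>: "\<rho> \<ge> 1" and K: "K \<ge> 0" and lam: "lam \<ge> 0"
    and real: "\<And>t. (\<And>l. l < N \<Longrightarrow> t l > 0) \<Longrightarrow> inj_on t {..<N} \<Longrightarrow> real_fibre t"
    and pos: "\<And>s l. \<bar>s\<bar> \<le> \<rho> \<Longrightarrow> l < N \<Longrightarrow> p l + s * q l > 0"
    and nz: "\<And>w l. w \<in> R \<Longrightarrow> l < N \<Longrightarrow> tw w l \<noteq> 0"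
    and bound: "\<And>w c a. w \<in> R \<Longrightarrow> Fib (tw w) (V topc topc c) \<Longrightarrow> a < N \<Longrightarrow> norm (c a) \<le> K"
    and Jbound: "\<And>w c. w \<in> R \<Longrightarrow> c \<in> polydisc N (\<lambda>_. 0) K \<Longrightarrow> norm (Jac topc topc (tw w) c) \<le> C"
    and c1: "Fib (tw \<i>) (V topc topc c1)" "\<And>a. a \<ge> N \<Longrightarrow> c1 a = 0" and a0: "a0 < N"
  shows "norm (Jac topc topc (tw \<i>) c1) * exp (lam * (Im (c1 a0) - K * Re (hfun \<rho> \<i>))) \<le> C"
proof -
  define S where "S = {x \<in> R \<times> polydisc N (\<lambda>_. 0) K. Fib (tw (fst x)) (V topc topc (snd x))}"
  define g where "g x = norm (Jac topc topc (tw (fst x)) (snd x)) * exp (lam * (Im (snd x a0) - K * Re (hfun \<rho> (fst x))))"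
    for x :: "complex \<times> (nat \<Rightarrow> complex)"
  have inR: "w \<in> R \<longleftrightarrow> \<bar>Re w\<bar> \<le> \<rho> \<and> 0 \<le> Im w \<and> Im w \<le> \<rho>" for w
    unfolding R_def by (auto simp: in_cbox_complex_iff)
  have lim1: "((\<lambda>x. tw (fst x) l) \<longlongrightarrow> tw (fst y) l) (at y)" for l and y :: "complex \<times> (nat \<Rightarrow> complex)"
    unfolding tw_def by (intro tendsto_intros)
  have lim2: "((\<lambda>x. snd x a) \<longlongrightarrow> snd y a) (at y)" for a and y :: "complex \<times> (nat \<Rightarrow> complex)"
    using tendsto_snd[OF tendsto_ident_at[of y UNIV]] unfolding tendsto_fun_iff by blast
  have contg: "continuous_on A g" for A
  proof -
    have "(g \<longlongrightarrow> g y) (at y)" for y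
      unfolding g_def hfun_def
      by (intro tendsto_intros tendsto_Jac lim1 lim2) (use \<rho> in auto)
    hence "continuous_on UNIV g" by (auto simp: continuous_on_def)
    thus ?thesis by (rule continuous_on_subset) simp
  qed
  have clF: "closed {x. Fib (tw (fst x)) (V topc topc (snd x))}"
    unfolding Fib_def
  proof (intro closed_Collect_all closed_Collect_eq)
    fix z
    have "((\<lambda>x. Q topc (V topc topc (snd x)) z * (\<Prod>l<N. tw (fst x) l)) \<longlongrightarrow> Q topc (V topc topc (snd y)) z * (\<Prod>l<N. tw (fst y) l)) (at y)" for y
      by (intro tendsto_intros tendsto_Q tendsto_V lim1 lim2)
    thus "continuous_on UNIV (\<lambda>x. Q topc (V topc topc (snd x)) z * (\<Prod>l<N. tw (fst x) l))"
      by (simp add: continuous_on_def)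
    have "((\<lambda>x. kappa topc * (\<Prod>l<N. tw (fst x) l - z)) \<longlongrightarrow> kappa topc * (\<Prod>l<N. tw (fst y) l - z)) (at y)"
      for y :: "complex \<times> (nat \<Rightarrow> complex)"
      by (intro tendsto_intros lim1)
    thus "continuous_on UNIV (\<lambda>x::complex \<times> (nat \<Rightarrow> complex). kappa topc * (\<Prod>l<N. tw (fst x) l - z))"
      by (simp add: continuous_on_def)
  qed
  have compR: "compact (R \<times> polydisc N (\<lambda>_. 0) K)"
    unfolding R_def by (intro compact_Times compact_cbox compact_polydisc)
  have S_eq: "S = (R \<times> polydisc N (\<lambda>_. 0) K) \<inter> {x. Fib (tw (fst x)) (V topc topc (snd x))}"
    by (auto simp: S_def)
  have compS: "compact S" unfolding S_eq by (rule compact_Int_closed[OF compR clF])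
  have inS: "(w, c) \<in> S" if "w \<in> R" "Fib (tw w) (V topc topc c)" "\<And>a. a \<ge> N \<Longrightarrow> c a = 0" for w c
    using that bound[OF that(1,2)] by (auto simp: S_def polydisc_def)
  have "\<i> \<in> R" using \<rho> by (simp add: inR)
  hence iS: "(\<i>, c1) \<in> S" by (rule inS[OF _ c1])
  have "\<exists>x\<in>S. \<forall>y\<in>S. g y \<le> g x"
    by (rule continuous_attains_sup[OF compS _ contg]) (use iS in auto)
  then obtain x0 where x0: "x0 \<in> S" "\<And>y. y \<in> S \<Longrightarrow> g y \<le> g x0" by blast
  define S' where "S' = S \<inter> {x. g x = g x0}"
  have "closed {x. g x = g x0}" by (intro closed_Collect_eq contg continuous_on_const)
  hence compS': "compact S'" unfolding S'_def by (rule compact_Int_closed[OF compS])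
  have "\<exists>x\<in>S'. \<forall>y\<in>S'. Re (fst y) \<le> Re (fst x)"
    by (rule continuous_attains_sup[OF compS']) (use x0(1) in \<open>auto simp: S'_def intro!: continuous_intros\<close>)
  then obtain x where x: "x \<in> S'" "\<And>y. y \<in> S' \<Longrightarrow> Re (fst y) \<le> Re (fst x)" by blast
  obtain w c where wc: "x = (w, c)" by (cases x)
  have gx: "g x = g x0" and xS: "x \<in> S" using x(1) by (auto simp: S'_def)
  have wR: "w \<in> R" and cp: "c \<in> polydisc N (\<lambda>_. 0) K" and Fx: "Fib (tw w) (V topc topc c)"
    using xS by (auto simp: S_def wc)
  have cK: "norm (c a) \<le> K" if "a < N" for a using cp that by (auto simp: polydisc_def)
  have w3: "\<bar>Re w\<bar> \<le> \<rho>" "0 \<le> Im w" "Im w \<le> \<rho>" using wR by (auto simp: inR)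
  have hw: "Re (hfun \<rho> w) \<ge> 0" using w3 \<rho> by (intro Re_hfun_ge_0) auto
  \<comment> \<open>Enough on all four sides: a nonpositive exponent leaves only the bound on the
    Jacobian.\<close>
  have fin: "g x \<le> C" if le: "Im (c a0) \<le> K * Re (hfun \<rho> w)"
  proof -
    have "lam * (Im (c a0) - K * Re (hfun \<rho> w)) \<le> 0"
      using lam le by (simp add: mult_nonneg_nonpos)
    hence "exp (lam * (Im (c a0) - K * Re (hfun \<rho> w))) \<le> 1" by simp
    hence "g x \<le> norm (Jac topc topc (tw w) c) * 1" unfolding g_def wc fst_conv snd_conv by (intro mult_left_mono) auto
    also have "\<dots> \<le> C" using Jbound[OF wR cp] by simp
    finally show ?thesis .
  qed
  have "g x \<le> C"
  proof (cases "Jac topc topc (tw w) c = 0")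
    case True
    have "0 \<le> C" using Jbound[OF wR cp] True by simp
    thus ?thesis using True by (simp add: g_def wc)
  next
    case Jnz: False
    consider "Im w = 0" | "\<bar>Re w\<bar> = \<rho> \<or> Im w = \<rho>" | "\<bar>Re w\<bar> < \<rho>" "0 < Im w" "Im w < \<rho>" using w3 by linarith
    thus ?thesis
    proof cases
      case 1
      define t where "t l = p l + Re w * q l" for l
      have tw: "tw w = (\<lambda>l. of_real (t l))" using 1 by (auto simp: tw_def t_def complex_eq_iff)
      have inj: "inj_on t {..<N}" using Jac_nonzero_imp_inj[OF Jnz] unfolding tw by (auto simp: inj_on_def)
      have "real_fibre t" by (rule real[OF _ inj]) (use pos w3(1) in \<open>auto simp: t_def\<close>)
      hence "real_rows (V topc topc c)" using Fx V_SY[OF adm_top] unfolding real_fibre_def tw by blast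
      hence "coords topc topc (V topc topc c) a0 \<in> \<real>" using a0 unfolding real_rows_iff_coords[OF V_SY[OF adm_top]] by blast
      hence "c a0 \<in> \<real>" using coords_V[OF adm_top, of a0 c] a0 by (simp add: ssum_top)
      hence "Im (c a0) = 0" by (simp add: complex_is_Real_iff)
      thus ?thesis using fin K hw by simp
    next
      case 2
      have "Im (c a0) \<le> K" using abs_Im_le_cmod[of "c a0"] cK[OF a0] by linarith
      also have "\<dots> \<le> K * Re (hfun \<rho> w)"
        using K Re_hfun_ge_1[OF w3(2,3) _ 2] \<rho> mult_left_mono[of 1 "Re (hfun \<rho> w)" K] by simp
      finally show ?thesis by (rule fin)
    next
      case 3
      interpret sys: square_system "ssum topc - tri" "\<lambda>l t c. Q topc (V topc topc c) (t l)" "\<lambda>l t. VA topc topc (t l)"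
        by (rule chart_square_system[OF adm_top])
      have D: "sys.D (tw w) c c \<noteq> 0" using Jnz by (simp add: chart_D[OF adm_top])
      have ctw: "continuous_on UNIV tw"
        unfolding tw_def by (intro continuous_on_coordinatewise_then_product continuous_intros)
      have hol: "(\<lambda>w. Q topc (V topc topc c) (tw w l)) holomorphic_on UNIV" for c l
        unfolding tw_def by (intro holomorphic_on_Q holomorphic_intros)
      have sol: "Q topc (V topc topc c) (tw w l) = 0" if "l < ssum topc - tri" for l
        using Fib_root[of "tw w", OF Fx nz[OF wR]] that ssum_top by auto
      obtain r \<gamma> where r: "r > 0" "\<gamma> w = c" "\<And>a. (\<lambda>w. \<gamma> w a) holomorphic_on ball w r"
        "\<And>w' l. w' \<in> ball w r \<Longrightarrow> l < ssum topc - tri \<Longrightarrow> Q topc (V topc topc (\<gamma> w')) (tw w' l) = 0"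
        "\<And>w' a. w' \<in> ball w r \<Longrightarrow> a \<ge> ssum topc - tri \<Longrightarrow> \<gamma> w' a = c a"
        using sys.holomorphic_branch[OF ctw hol D sol] by metis
      have holJ: "(\<lambda>w. Jac topc topc (tw w) (\<gamma> w)) holomorphic_on ball w r"
        unfolding tw_def by (intro holomorphic_on_Jac r(3) holomorphic_intros)
      have "isCont (\<lambda>w. Jac topc topc (tw w) (\<gamma> w)) w"
        using holomorphic_on_imp_continuous_on[OF holJ] r(1) by (simp add: continuous_on_eq_continuous_at)
      hence "eventually (\<lambda>w. Jac topc topc (tw w) (\<gamma> w) \<noteq> 0) (at w)"
        unfolding isCont_def by (rule tendsto_imp_eventually_ne) (use Jnz r(2) in simp)
      then obtain r2 where r2: "r2 > 0" "\<And>w'. w' \<noteq> w \<Longrightarrow> dist w' w < r2 \<Longrightarrow> Jac topc topc (tw w') (\<gamma> w') \<noteq> 0"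
        unfolding eventually_at by auto
      define r3 where "r3 = Min {r, r2, \<rho> - \<bar>Re w\<bar>, Im w, \<rho> - Im w}"
      have "r3 > 0" using r(1) r2(1) 3 by (simp add: r3_def)
      moreover have "r3 \<le> r" "r3 \<le> r2" "r3 \<le> \<rho> - \<bar>Re w\<bar>" "r3 \<le> Im w" "r3 \<le> \<rho> - Im w"
        unfolding r3_def by (rule Min_le; simp)+
      ultimately have r3: "r3 > 0" "r3 \<le> r" "r3 \<le> r2" "r3 \<le> \<rho> - \<bar>Re w\<bar>" "r3 \<le> Im w" "r3 \<le> \<rho> - Im w"
        by blast+
      have ball: "w' \<in> R \<and> w' \<in> ball w r \<and> Jac topc topc (tw w') (\<gamma> w') \<noteq> 0" if w': "w' \<in> ball w r3" for w'
      proof -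
        have d: "norm (w' - w) < r3" using w' by (simp add: dist_norm norm_minus_commute)
        have "\<bar>Re w' - Re w\<bar> < r3" "\<bar>Im w' - Im w\<bar> < r3"
          using d abs_Re_le_cmod[of "w' - w"] abs_Im_le_cmod[of "w' - w"] by auto
        hence "w' \<in> R" unfolding inR using r3 by linarith
        moreover have "w' \<in> ball w r" using w' r3(2) by auto
        moreover have "Jac topc topc (tw w') (\<gamma> w') \<noteq> 0"
          using r2(2)[of w'] d r3(3) Jnz r(2) by (cases "w' = w") (auto simp: dist_norm)
        ultimately show ?thesis by blast
      qed
      have \<gamma>S: "(w', \<gamma> w') \<in> S" if w': "w' \<in> ball w r3" for w'
      proof (rule inS)
        show "w' \<in> R" using ball[OF w'] by blast
        show "Fib (tw w') (V topc topc (\<gamma> w'))"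
        proof -
          have inj: "inj_on (tw w') {..<N}" by (rule Jac_nonzero_imp_inj[where c = "\<gamma> w'"]) (use ball[OF w'] in blast)
          have nz': "tw w' l \<noteq> 0" if "l < N" for l using nz[of w' l] ball[OF w'] that by blast
          have "\<forall>l<N. Q topc (V topc topc (\<gamma> w')) (tw w' l) = 0" using r(4)[of w'] ball[OF w'] ssum_top by simp
          thus ?thesis using Fib_iff[OF V_SY[OF adm_top] inj nz'] by blast
        qed
        show "\<gamma> w' a = 0" if "a \<ge> N" for a
          using r(5)[of w' a] ball[OF w'] that ssum_top cp by (auto simp: polydisc_def)
      qed
      \<comment> \<open>The real part of \<open>- \<i> * z\<close> is \<open>Im z\<close>, so the
        modulus of \<open>F\<close> is \<open>g\<close> along the branch.\<close>
      define F where "F w' = Jac topc topc (tw w') (\<gamma> w') * exp (of_real lam * (- \<i> * \<gamma> w' a0 - of_real K * hfun \<rho> w'))" for w'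
      have nF: "norm (F w') = g (w', \<gamma> w')" for w' by (simp add: F_def g_def norm_mult)
      have "F holomorphic_on ball w r3"
        unfolding F_def hfun_def
        by (intro holomorphic_intros holomorphic_on_subset[OF holJ] holomorphic_on_subset[OF r(3)])
          (use r3(2) \<rho> in auto)
      moreover have "norm (F w') \<le> norm (F w)" if "w' \<in> ball w r3" for w'
        unfolding nF using x0(2)[OF \<gamma>S[OF that]] gx r(2) by (simp add: wc)
      ultimately have "F constant_on ball w r3"
        using r3(1) by (intro maximum_modulus_principle[of F "ball w r3" "ball w r3" w]) auto
      then obtain y where y: "\<And>w'. w' \<in> ball w r3 \<Longrightarrow> F w' = y" unfolding constant_on_def by blast
      define w' where "w' = w + of_real (r3 / 2)"
      have w': "w' \<in> ball w r3" using r3(1) by (simp add: w'_def dist_norm)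
      have "g (w', \<gamma> w') = g (w, \<gamma> w)" unfolding nF[symmetric] using y w' r3(1) by simp
      hence "(w', \<gamma> w') \<in> S'" using \<gamma>S[OF w'] gx r(2) by (simp add: S'_def wc)
      from x(2)[OF this] show ?thesis using r3(1) by (simp add: wc w'_def)
    qed
  qed
  thus ?thesis using x0(2)[OF iS] gx by (simp add: g_def)
qed

text \<open>Properness again: points with ever larger coordinates, over roots in a fixed annulus,
  would have a subsequence converging in the open cell.\<close>

lemma fibre_bounded:
  assumes "0 < a" 
  obtains K where "K > 0" "\<And>t c i. (\<And>l. l < N \<Longrightarrow> a \<le> norm (t l) \<and> norm (t l) \<le> b) \<Longrightarrow>
     Fib t (V topc topc c) \<Longrightarrow> i < N \<Longrightarrow> norm (c i) \<le> K"
proof (rule ccontr)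
  assume nt: "\<not> thesis"
  have "\<exists>t c i. (\<forall>l<N. a \<le> norm (t l) \<and> norm (t l) \<le> b) \<and> Fib t (V topc topc c) \<and> i < N \<and> norm (c i) > real (Suc j)" for j
  proof (rule ccontr)
    assume "\<not> ?thesis"
    thus False using nt that[of "real (Suc j)"] by (meson not_le of_nat_0_less_iff zero_less_Suc)
  qed
  then obtain t c i where tc: "\<And>j l. l < N \<Longrightarrow> a \<le> norm (t j l) \<and> norm (t j l) \<le> b"
    "\<And>j. Fib (t j) (V topc topc (c j))" "\<And>j. i j < N" "\<And>j. norm (c j (i j)) > real (Suc j)" by metis
  \<comment> \<open>The last index is a dummy, to fit
    \<open>convergent_subsequence_double\<close>.\<close>
  define f where "f j (l::nat) (x::nat) = (if l < N then t j l else 0)" for j l x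
  have fb: "norm (f j l x) \<le> max b 0" for j l x using tc(1)[of l j] by (auto simp: f_def)
  obtain \<phi> g where \<phi>: "strict_mono \<phi>" "\<And>l x. (\<lambda>j. f (\<phi> j) l x) \<longlonglongrightarrow> g l x"
    using convergent_subsequence_double[of f "\<lambda>_ _. max b 0", OF fb] by blast
  have glim: "(\<lambda>j. t (\<phi> j) l) \<longlonglongrightarrow> g l 0" if "l < N" for l using \<phi>(2)[of l 0] that by (simp add: f_def)
  have gnz: "g l 0 \<noteq> 0" if "l < N" for l
  proof -
    have "a \<le> norm (g l 0)"
      by (rule tendsto_lowerbound[OF tendsto_norm[OF glim[OF that]]]) (use tc(1) that in auto)
    thus ?thesis using assms by auto
  qed
  obtain \<psi> v0 where \<psi>: "strict_mono (\<psi> :: nat \<Rightarrow> nat)" "v0 \<in> SY topc topc" "Fib (\<lambda>l. g l 0) v0"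
    "\<And>l x. l < k \<Longrightarrow> (\<lambda>j. V topc topc (c (\<phi> (\<psi> j))) l x) \<longlonglongrightarrow> v0 l x"
  proof (rule Fib_compact[of "\<lambda>j. t (\<phi> j)" "\<lambda>l. g l 0" "\<lambda>j. V topc topc (c (\<phi> j))"])
    show "(\<lambda>j. t (\<phi> j) l) \<longlonglongrightarrow> g l 0" if "l < N" for l by (rule glim[OF that])
    show "g l 0 \<noteq> 0" if "l < N" for l by (rule gnz[OF that])
    show "V topc topc (c (\<phi> j)) \<in> SY topc topc" for j by (rule V_SY[OF adm_top])
    show "Fib (t (\<phi> j)) (V topc topc (c (\<phi> j)))" for j by (rule tc(2))
  qed auto
  have clim: "(\<lambda>j. c (\<phi> (\<psi> j)) b) \<longlonglongrightarrow> coords topc topc v0 b" if b: "b < N" for b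
  proof -
    have "fst (idx topc topc b) < k" using idx_in[OF adm_top, of b] b ssum_top by (metis prod.collapse)
    from \<psi>(4)[OF this, of "snd (idx topc topc b)"]
    have "(\<lambda>j. coords topc topc (V topc topc (c (\<phi> (\<psi> j)))) b) \<longlonglongrightarrow> coords topc topc v0 b"
      using b by (simp add: coords_def ssum_top)
    thus ?thesis using b by (simp add: coords_V[OF adm_top] ssum_top)
  qed
  have "eventually (\<lambda>j. \<forall>b\<in>{..<N}. norm (c (\<phi> (\<psi> j)) b) < 1 + (\<Sum>b<N. norm (coords topc topc v0 b))) sequentially"
  proof (intro eventually_ball_finite ballI)
    fix b assume b: "b \<in> {..<N}"
    have "norm (coords topc topc v0 b) \<le> (\<Sum>b<N. norm (coords topc topc v0 b))"
      using b by (intro member_le_sum) auto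
    thus "eventually (\<lambda>j. norm (c (\<phi> (\<psi> j)) b) < 1 + (\<Sum>b<N. norm (coords topc topc v0 b))) sequentially"
      using b by (intro order_tendstoD(2)[OF tendsto_norm[OF clim]]) auto
  qed auto
  moreover have "eventually (\<lambda>j. real j > 1 + (\<Sum>b<N. norm (coords topc topc v0 b))) sequentially"
    using filterlim_real_sequentially by (simp add: filterlim_at_top_dense)
  ultimately have "eventually (\<lambda>j. False) sequentially"
  proof eventually_elim
    case (elim j)
    have "j \<le> \<phi> (\<psi> j)" using seq_suble[OF strict_mono_o[OF \<phi>(1) \<psi>(1)], of j] by simp
    hence "real j \<le> real (\<phi> (\<psi> j))" by simp
    moreover have "norm (c (\<phi> (\<psi> j)) (i (\<phi> (\<psi> j)))) < 1 + (\<Sum>b<N. norm (coords topc topc v0 b))"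
      using elim(1) tc(3) by auto
    ultimately show ?case using tc(4)[of "\<phi> (\<psi> j)"] elim(2) by linarith
  qed
  thus False by simp
qed

lemma Jac_bounded:
  obtains C where "C > 0" "\<And>t c. t \<in> polydisc N (\<lambda>_. 0) b \<Longrightarrow> c \<in> polydisc N (\<lambda>_. 0) K \<Longrightarrow> norm (Jac topc topc t c) \<le> C"
proof -
  have lim1: "((\<lambda>x. fst x a) \<longlongrightarrow> fst y a) (at y)" and lim2: "((\<lambda>x. snd x a) \<longlongrightarrow> snd y a) (at y)"
    for a and y :: "(nat \<Rightarrow> complex) \<times> (nat \<Rightarrow> complex)"
    using tendsto_fst[OF tendsto_ident_at[of y UNIV]] tendsto_snd[OF tendsto_ident_at[of y UNIV]]
    unfolding tendsto_fun_iff by blast+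
  have "((\<lambda>x. Jac topc topc (fst x) (snd x)) \<longlongrightarrow> Jac topc topc (fst y) (snd y)) (at y)" for y
    by (intro tendsto_Jac lim1 lim2)
  hence "continuous_on UNIV (\<lambda>x. Jac topc topc (fst x) (snd x))" by (simp add: continuous_on_def)
  hence "compact ((\<lambda>x. Jac topc topc (fst x) (snd x)) ` (polydisc N (\<lambda>_. 0) b \<times> polydisc N (\<lambda>_. 0) K))"
    by (intro compact_continuous_image compact_Times compact_polydisc) (rule continuous_on_subset, auto)
  hence "bounded ((\<lambda>x. Jac topc topc (fst x) (snd x)) ` (polydisc N (\<lambda>_. 0) b \<times> polydisc N (\<lambda>_. 0) K))"
    by (rule compact_imp_bounded)
  then obtain C where "C > 0" "\<And>x. x \<in> (\<lambda>x. Jac topc topc (fst x) (snd x)) ` (polydisc N (\<lambda>_. 0) b \<times> polydisc N (\<lambda>_. 0) K) \<Longrightarrow> norm x \<le> C"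
    unfolding bounded_pos by blast
  thus ?thesis using that[of C] by force
qed

lemma Fib_cong: "(\<And>l. l < N \<Longrightarrow> t l = t' l) \<Longrightarrow> Fib t v \<longleftrightarrow> Fib t' v"
  unfolding Fib_def by simp

lemma Jac_cong: "(\<And>l. l < N \<Longrightarrow> t l = t' l) \<Longrightarrow> Jac topc topc t c = Jac topc topc t' c"
  unfolding Jac_def by (rule cdet_cong) (simp add: ssum_top)

text \<open>The Jacobian at the special points \<open>x\<close> is nonzero at one point, hence at
  points arbitrarily near \<open>v0\<close>. The roots of such a point are near those of
  \<open>v0\<close> but may still coincide, and a second perturbation separates them. Each new root
  is only compared with some \<open>t0 p\<close>, which suffices for bounds on its real and
  imaginary parts.\<close>

lemma nearby_nondegenerate:
  assumes et: "\<And>t. pos_decreasing t \<Longrightarrow> etale t"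
    and v0: "v0 \<in> SY topc topc" "Fib t0 v0" "\<And>l. l < N \<Longrightarrow> t0 l \<noteq> 0" and e: "e > 0"
  obtains c1 t1 where "\<And>l. l < N \<Longrightarrow> \<exists>p<N. dist (t1 l) (t0 p) < e" "\<And>a. a < N \<Longrightarrow> dist (c1 a) (coords topc topc v0 a) < e"
    "\<And>a. a \<ge> N \<Longrightarrow> c1 a = 0" "Fib t1 (V topc topc c1)" "Jac topc topc t1 c1 \<noteq> 0"
proof -
  define c0 where "c0 = coords topc topc v0"
  obtain ts :: "nat \<Rightarrow> real" where ts: "\<forall>l<N. ts l > 0" "\<forall>l p. l < p \<longrightarrow> p < N \<longrightarrow> ts p < ts l" "\<forall>e\<in>positions N. good N ts e"
    using exists_good[of N] by blast
  have pd: "pos_decreasing ts" using ts by (simp add: pos_decreasing_def)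
  obtain vs where vs: "vs \<in> SY topc topc" "\<And>l. l < N \<Longrightarrow> Q topc vs (of_real (ts l)) = 0"
    using ts(3) top_position unfolding good_def by blast
  define x where "x l = complex_of_real (ts l)" for l
  define cs where "cs = coords topc topc vs"
  have J: "Jac topc topc x cs \<noteq> 0" unfolding x_def cs_def by (rule etale_Jac[OF et[OF pd] vs])
  have xinj: "inj_on x {..<N}" unfolding x_def by (rule pos_decreasing_inj[OF pd])
  have xnz: "x l \<noteq> 0" if "l < N" for l using ts(1) that by (force simp: x_def)
  have "\<exists>c. (\<forall>a. dist (c a) (c0 a) \<le> (1 / real (Suc j)) * norm (cs a - c0 a)) \<and> Jac topc topc x c \<noteq> 0" for j
    by (rule Jac_nonzero_dense[OF J, of "1 / real (Suc j)" c0]) auto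
  then obtain c where c: "\<And>j a. dist (c j a) (c0 a) \<le> (1 / real (Suc j)) * norm (cs a - c0 a)"
    "\<And>j. Jac topc topc x (c j) \<noteq> 0" by metis
  have c_lim: "(\<lambda>j. c j a) \<longlonglongrightarrow> c0 a" for a
  proof -
    have "(\<lambda>j. inverse (real (Suc j)) * norm (cs a - c0 a)) \<longlonglongrightarrow> 0 * norm (cs a - c0 a)"
      by (intro tendsto_mult LIMSEQ_inverse_real_of_nat tendsto_const)
    hence "(\<lambda>j. (1 / real (Suc j)) * norm (cs a - c0 a)) \<longlonglongrightarrow> 0" by (simp add: inverse_eq_divide)
    hence "(\<lambda>j. dist (c j a) (c0 a)) \<longlonglongrightarrow> 0"
      by (rule tendsto_sandwich[where f = "\<lambda>_. 0", rotated 3]) (use c(1) in auto)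
    thus ?thesis by (rule tendsto_dist_iff[THEN iffD2])
  qed
  have cz: "c j a = 0" if "a \<ge> N" for j a
    using c(1)[of j a] that by (simp add: cs_def c0_def coords_def ssum_top)
  have v_lim: "(\<lambda>j. V topc topc (c j) l q) \<longlonglongrightarrow> v0 l q" if "l < k" for l q
    using tendsto_V[of c c0 sequentially topc topc l q] c_lim V_coords[OF adm_top v0(1) that] by (simp add: c0_def)
  have "eventually (\<lambda>j. degree (Qp topc (V topc topc (c j))) = N \<and>
      (\<forall>z. Q topc (V topc topc (c j)) z = 0 \<longrightarrow> (\<exists>l<N. dist z (t0 l) < e / 2))) sequentially"
    by (rule roots_near[OF v0 v_lim V_SY[OF adm_top]]) (use e in auto)
  moreover have "eventually (\<lambda>j. \<forall>a\<in>{..<N}. dist (c j a) (c0 a) < e / 2) sequentially"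
    by (intro eventually_ball_finite ballI tendstoD[OF c_lim]) (use e in auto)
  ultimately have "eventually (\<lambda>j. (degree (Qp topc (V topc topc (c j))) = N \<and>
      (\<forall>z. Q topc (V topc topc (c j)) z = 0 \<longrightarrow> (\<exists>l<N. dist z (t0 l) < e / 2))) \<and>
      (\<forall>a\<in>{..<N}. dist (c j a) (c0 a) < e / 2)) sequentially"
    by (rule eventually_conj)
  from eventually_happens[OF this] obtain j where j: "degree (Qp topc (V topc topc (c j))) = N"
      "\<And>z. Q topc (V topc topc (c j)) z = 0 \<Longrightarrow> \<exists>l<N. dist z (t0 l) < e / 2"
      "\<And>a. a < N \<Longrightarrow> dist (c j a) (c0 a) < e / 2" by auto
  obtain t' where t': "Fib t' (V topc topc (c j))" "\<And>l. l < N \<Longrightarrow> t' l \<noteq> 0"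
    "\<And>l. l < N \<Longrightarrow> Q topc (V topc topc (c j)) (t' l) = 0"
    using Fib_of_degree[OF V_SY[OF adm_top] j(1)] by blast
  obtain c1 t1 where c1: "\<And>l. l < N \<Longrightarrow> dist (t1 l) (t' l) < e / 2" "\<And>a. a < N \<Longrightarrow> dist (c1 a) (c j a) < e / 2"
    "\<And>a. a \<ge> N \<Longrightarrow> c1 a = c j a" "Fib t1 (V topc topc c1)" "Jac topc topc t1 c1 \<noteq> 0"
  proof (rule perturb_to_distinct[OF c(2) xinj xnz t'(1,2)])
    show "e / 2 > 0" using e by simp
  qed auto
  show ?thesis
  proof (rule that[OF _ _ _ c1(4,5)])
    fix l assume l: "l < N"
    obtain p where p: "p < N" "dist (t' l) (t0 p) < e / 2" using j(2)[OF t'(3)[OF l]] by blast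
    have "dist (t1 l) (t0 p) \<le> dist (t1 l) (t' l) + dist (t' l) (t0 p)" by (rule dist_triangle)
    thus "\<exists>p<N. dist (t1 l) (t0 p) < e" using c1(1)[OF l] p by (intro exI[of _ p]) auto
  next
    fix a assume a: "a < N"
    have "dist (c1 a) (c0 a) \<le> dist (c1 a) (c j a) + dist (c j a) (c0 a)" by (rule dist_triangle)
    thus "dist (c1 a) (coords topc topc v0 a) < e" using c1(2)[OF a] j(3)[OF a] by (simp add: c0_def)
  next
    fix a assume "a \<ge> N"
    thus "c1 a = 0" using c1(3) cz by simp
  qed
qed

lemma coords_Im_nonpos:
  assumes et: "\<And>t. pos_decreasing t \<Longrightarrow> etale t"
    and v0: "v0 \<in> SY topc topc" "Fib (\<lambda>l. of_real (t0 l)) v0" and t0: "\<And>l. l < N \<Longrightarrow> t0 l > 0" and a0: "a0 < N"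
  shows "Im (coords topc topc v0 a0) \<le> 0"
proof (rule ccontr)
  assume pos: "\<not> ?thesis"
  define \<eta> where "\<eta> = Im (coords topc topc v0 a0) / 2"
  have \<eta>: "\<eta> > 0" using pos by (simp add: \<eta>_def)
  define a where "a = Min (t0 ` {..<N})"
  define b where "b = Max (t0 ` {..<N})"
  have "t0 ` {..<N} \<noteq> {}" using a0 by auto
  hence a: "a > 0" unfolding a_def using t0 by (subst Min_gr_iff) auto
  have ab: "a \<le> t0 l \<and> t0 l \<le> b" if "l < N" for l unfolding a_def b_def using that by auto
  have a2: "a / 2 > 0" using a by simp
  obtain K where K: "K > 0" "\<And>t c i. (\<And>l. l < N \<Longrightarrow> a / 2 \<le> norm (t l) \<and> norm (t l) \<le> b + a / 2) \<Longrightarrow>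
     Fib t (V topc topc c) \<Longrightarrow> i < N \<Longrightarrow> norm (c i) \<le> K"
    using fibre_bounded[OF a2, of "b + a / 2"] by metis
  obtain C where C: "C > 0" "\<And>t c. t \<in> polydisc N (\<lambda>_. 0) (b + a / 2) \<Longrightarrow> c \<in> polydisc N (\<lambda>_. 0) K \<Longrightarrow> norm (Jac topc topc t c) \<le> C"
    using Jac_bounded[of "b + a / 2" K] by metis
  \<comment> \<open>Both bounds serve \<open>\<rho> = a / (8 * e)\<close>: the first makes it at
    least 1, the second makes the cost \<open>2 * K / \<rho>\<close> at \<open>w = \<i>\<close> at
    most \<open>\<eta> / 2\<close>. Since \<open>\<rho> * e = a / 8\<close>, the term
    \<open>w * q l\<close> is at most \<open>a / 4\<close> on the rectangle, which keeps the roots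
    away from 0.\<close>
  define e where "e = min (a / 8) (a * \<eta> / (32 * K))"
  have e: "e > 0" "e \<le> a / 8" "e \<le> a * \<eta> / (32 * K)" using a \<eta> K(1) by (auto simp: e_def)
  define \<rho> where "\<rho> = a / (8 * e)"
  have \<rho>: "\<rho> \<ge> 1" "\<rho> * e = a / 8" using e a by (auto simp: \<rho>_def field_simps)
  have K\<rho>: "2 * K / \<rho> \<le> \<eta> / 2"
    using e K(1) a by (simp add: \<rho>_def field_simps)
  have me: "min e \<eta> > 0" using e(1) \<eta> by simp
  have t0nz: "complex_of_real (t0 l) \<noteq> 0" if "l < N" for l using t0[OF that] by auto
  obtain c1 t1 where c1: "\<And>l. l < N \<Longrightarrow> \<exists>p<N. dist (t1 l) (of_real (t0 p)) < min e \<eta>"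
    "\<And>a. a < N \<Longrightarrow> dist (c1 a) (coords topc topc v0 a) < min e \<eta>"
    "\<And>a. a \<ge> N \<Longrightarrow> c1 a = 0" "Fib t1 (V topc topc c1)" "Jac topc topc t1 c1 \<noteq> 0"
  proof (rule nearby_nondegenerate[OF et v0 t0nz me])
  qed auto
  define p where "p l = (if l < N then Re (t1 l) else 0)" for l
  define q where "q l = (if l < N then Im (t1 l) else 0)" for l
  have pq: "a - e \<le> p l \<and> p l \<le> b + e \<and> \<bar>q l\<bar> \<le> e" if l: "l < N" for l
  proof -
    obtain i where i: "i < N" "norm (t1 l - of_real (t0 i)) < e" using c1(1)[OF l] by (auto simp: dist_norm)
    have "\<bar>Re (t1 l) - t0 i\<bar> < e" "\<bar>Im (t1 l)\<bar> < e"
      using i(2) abs_Re_le_cmod[of "t1 l - of_real (t0 i)"] abs_Im_le_cmod[of "t1 l - of_real (t0 i)"] by auto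
    thus ?thesis using ab[OF i(1)] l by (auto simp: p_def q_def)
  qed
  define tw where "tw w l = of_real (p l) + w * of_real (q l)" for w :: complex and l
  have tw_i: "tw \<i> l = t1 l" if "l < N" for l using that by (simp add: tw_def p_def q_def complex_eq_iff)
  have tw_bound: "a / 2 \<le> norm (tw w l) \<and> norm (tw w l) \<le> b + a / 2"
    if w: "w \<in> cbox (Complex (- \<rho>) 0) (Complex \<rho> \<rho>)" and l: "l < N" for w l
  proof -
    have "norm w \<le> \<bar>Re w\<bar> + \<bar>Im w\<bar>" by (rule cmod_le)
    also have "\<dots> \<le> 2 * \<rho>" using w by (auto simp: in_cbox_complex_iff)
    finally have "norm w * \<bar>q l\<bar> \<le> (2 * \<rho>) * e" using pq[OF l] \<rho>(1) by (intro mult_mono) auto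
    hence wq: "norm (w * of_real (q l)) \<le> a / 4" using \<rho>(2) by (simp add: norm_mult)
    have pl: "a / 2 + a / 4 \<le> p l" "p l \<le> b + a / 4" using pq[OF l] e(2) a by linarith+
    have "norm (complex_of_real (p l)) = p l" using pl a by simp
    moreover have "norm (tw w l) \<le> norm (complex_of_real (p l)) + norm (w * of_real (q l))"
      unfolding tw_def by (rule norm_triangle_ineq)
    moreover have "norm (complex_of_real (p l)) - norm (w * of_real (q l)) \<le> norm (tw w l)"
      unfolding tw_def by (rule norm_diff_ineq)
    ultimately show ?thesis using wq pl by linarith
  qed
  have main: "norm (Jac topc topc (tw \<i>) c1) * exp (lam * (Im (c1 a0) - K * Re (hfun \<rho> \<i>))) \<le> C" if lam: "lam \<ge> 0" for lam
    unfolding tw_def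
  proof (rule maximum_bound[OF \<rho>(1) _ lam])
    show "0 \<le> K" using K(1) by simp
    show "real_fibre t" if "\<And>l. l < N \<Longrightarrow> t l > 0" "inj_on t {..<N}" for t
      by (rule real_fibre_distinct[OF et that])
    show "p l + s * q l > 0" if s: "\<bar>s\<bar> \<le> \<rho>" and l: "l < N" for s l
    proof -
      have "\<bar>s * q l\<bar> \<le> \<rho> * e" unfolding abs_mult using s pq[OF l] \<rho>(1) by (intro mult_mono) auto
      thus ?thesis using pq[OF l] e(2) \<rho>(2) a by linarith
    qed
    show "complex_of_real (p l) + w * of_real (q l) \<noteq> 0" if "w \<in> cbox (Complex (- \<rho>) 0) (Complex \<rho> \<rho>)" "l < N" for w l
      using tw_bound[OF that] a by (auto simp: tw_def)
    show "norm (c a) \<le> K" if "w \<in> cbox (Complex (- \<rho>) 0) (Complex \<rho> \<rho>)"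
      "Fib (\<lambda>l. complex_of_real (p l) + w * of_real (q l)) (V topc topc c)" "a < N" for w c a
      by (rule K(2)[OF _ that(2,3)]) (use tw_bound[OF that(1)] in \<open>simp add: tw_def\<close>)
    show "norm (Jac topc topc (\<lambda>l. complex_of_real (p l) + w * of_real (q l)) c) \<le> C"
      if "w \<in> cbox (Complex (- \<rho>) 0) (Complex \<rho> \<rho>)" "c \<in> polydisc N (\<lambda>_. 0) K" for w c
      by (rule C(2)[OF _ that(2)]) (use tw_bound[OF that(1)] in \<open>auto simp: polydisc_def tw_def p_def q_def\<close>)
    show "Fib (\<lambda>l. complex_of_real (p l) + \<i> * of_real (q l)) (V topc topc c1)"
    proof -
      have "(\<lambda>l. complex_of_real (p l) + \<i> * of_real (q l)) = tw \<i>" by (simp add: tw_def fun_eq_iff)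
      thus ?thesis using c1(4) Fib_cong[of "tw \<i>" t1] tw_i by simp
    qed
  qed (use c1(3) a0 in auto)
  have J: "norm (Jac topc topc (tw \<i>) c1) > 0" (is "?J > 0") using c1(5) Jac_cong[of "tw \<i>" t1] tw_i by simp
  have Imc: "Im (c1 a0) \<ge> \<eta>"
  proof -
    have "\<bar>Im (c1 a0 - coords topc topc v0 a0)\<bar> < \<eta>"
      using c1(2)[OF a0] abs_Im_le_cmod[of "c1 a0 - coords topc topc v0 a0"] by (auto simp: dist_norm)
    moreover have "Im (coords topc topc v0 a0) = 2 * \<eta>" by (simp add: \<eta>_def)
    ultimately show ?thesis unfolding minus_complex.sel by linarith
  qed
  have "Re (hfun \<rho> \<i>) \<le> 2 / \<rho>"
    unfolding Re_hfun using \<rho>(1) by (simp add: divide_simps power2_eq_square)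
  hence "K * Re (hfun \<rho> \<i>) \<le> K * (2 / \<rho>)" using K(1) by (intro mult_left_mono) auto
  hence gap: "\<eta> / 2 \<le> Im (c1 a0) - K * Re (hfun \<rho> \<i>)" using Imc K\<rho> by simp
  \<comment> \<open>Makes the exponent at least \<open>C / ?J\<close>; then
    \<open>exp y \<ge> 1 + y\<close> already exceeds the bound \<open>C\<close>.\<close>
  define lam where "lam = 2 * C / (?J * \<eta>)"
  have lam: "lam \<ge> 0" using C(1) J \<eta> by (simp add: lam_def)
  have lam_eq: "lam * (\<eta> / 2) = C / ?J" using \<eta> by (simp add: lam_def)
  have expo: "C / ?J \<le> lam * (Im (c1 a0) - K * Re (hfun \<rho> \<i>))"
    using mult_left_mono[OF gap lam] unfolding lam_eq .
  have "C < ?J * (1 + C / ?J)" using J by (simp add: algebra_simps)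
  also have "\<dots> \<le> ?J * exp (C / ?J)" using J exp_ge_add_one_self[of "C / ?J"] by (intro mult_left_mono) auto
  also have "\<dots> \<le> ?J * exp (lam * (Im (c1 a0) - K * Re (hfun \<rho> \<i>)))"
    using J expo by (intro mult_left_mono) simp_all
  also have "\<dots> \<le> C" by (rule main[OF lam])
  finally show False by simp
qed

text \<open>The conjugate point lies over the same real roots, and its bound is the opposite
  inequality.\<close>

lemma real_roots_imp_real_rows:
  assumes et: "\<And>t. pos_decreasing t \<Longrightarrow> etale t"
    and v0: "v0 \<in> SY topc topc" "Fib (\<lambda>l. of_real (t0 l)) v0" and t0: "\<And>l. l < N \<Longrightarrow> t0 l > 0"
  shows "real_rows v0"
  unfolding real_rows_iff_coords[OF v0(1)]
proof (intro allI impI)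
  fix a assume a: "a < N"
  define w where "w = (\<lambda>l j. cnj (v0 l j))"
  have w: "w \<in> SY topc topc" using v0(1) by (auto simp: w_def SY_def Y_def)
  have kap: "cnj (kappa topc) = kappa topc"
    using Q_cnj[of topc v0 0] Q_top_0[OF v0(1)] Q_top_0[OF w] by (simp add: w_def)
  have "Q topc w z * (\<Prod>l<N. complex_of_real (t0 l)) = kappa topc * (\<Prod>l<N. complex_of_real (t0 l) - z)" for z
  proof -
    have "Q topc v0 (cnj z) * (\<Prod>l<N. complex_of_real (t0 l)) = kappa topc * (\<Prod>l<N. complex_of_real (t0 l) - cnj z)"
      using v0(2) unfolding Fib_def by blast
    hence "cnj (Q topc v0 (cnj z) * (\<Prod>l<N. complex_of_real (t0 l))) = cnj (kappa topc * (\<Prod>l<N. complex_of_real (t0 l) - cnj z))"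
      by (rule arg_cong)
    moreover have "cnj (Q topc v0 (cnj z)) = Q topc w z" using Q_cnj[of topc v0 "cnj z"] by (simp add: w_def)
    ultimately show ?thesis by (simp add: cnj_prod kap)
  qed
  hence "Fib (\<lambda>l. of_real (t0 l)) w" unfolding Fib_def by blast
  from coords_Im_nonpos[OF et w this t0 a] have "Im (coords topc topc w a) \<le> 0" .
  moreover have "coords topc topc w a = cnj (coords topc topc v0 a)" using a by (simp add: coords_def w_def ssum_top)
  moreover have "Im (coords topc topc v0 a) \<le> 0" by (rule coords_Im_nonpos[OF et v0 t0 a])
  ultimately show "coords topc topc v0 a \<in> \<real>" by (simp add: complex_is_Real_iff)
qed

end

subsection \<open>Subspaces and osculating flags\<close>

lemma sum_fun_apply: "(\<Sum>l\<in>A. f l) j = (\<Sum>l\<in>A. f l j)" for f :: "'a \<Rightarrow> nat \<Rightarrow> complex"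
  by (induction A rule: infinite_finite_induct) (auto simp: plus_fun_def zero_fun_def)

definition rspan :: "nat \<Rightarrow> (nat \<Rightarrow> nat \<Rightarrow> complex) \<Rightarrow> (nat \<Rightarrow> complex) set" where
  "rspan k v = {\<lambda>j. \<Sum>l<k. c l * v l j | c. True}"

lemma rspan_eq_span: "rspan k v = cv.span (v ` {..<k})"
proof
  have "(\<lambda>j. \<Sum>l<k. c l * v l j) = (\<Sum>l<k. cscale (c l) (v l))" for c
    by (rule ext) (simp add: sum_fun_apply cscale_def)
  moreover have "(\<Sum>l<k. cscale (c l) (v l)) \<in> cv.span (v ` {..<k})" for c
    by (intro cv.span_sum cv.span_scale cv.span_base) auto
  ultimately show "rspan k v \<subseteq> cv.span (v ` {..<k})" by (auto simp: rspan_def)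
  have sub: "cv.subspace (rspan k v)"
  proof (rule cv.subspaceI)
    show "0 \<in> rspan k v" unfolding rspan_def by (auto intro!: exI[of _ "\<lambda>_. 0"] simp: zero_fun_def)
    fix x y assume "x \<in> rspan k v" "y \<in> rspan k v"
    then obtain a b where "x = (\<lambda>j. \<Sum>l<k. a l * v l j)" "y = (\<lambda>j. \<Sum>l<k. b l * v l j)" by (auto simp: rspan_def)
    hence "x + y = (\<lambda>j. \<Sum>l<k. (a l + b l) * v l j)" by (auto simp: plus_fun_def sum.distrib algebra_simps)
    thus "x + y \<in> rspan k v" by (auto simp: rspan_def)
  next
    fix c x assume "x \<in> rspan k v"
    then obtain a where "x = (\<lambda>j. \<Sum>l<k. a l * v l j)" by (auto simp: rspan_def)
    hence "cscale c x = (\<lambda>j. \<Sum>l<k. (c * a l) * v l j)" by (auto simp: cscale_def sum_distrib_left mult_ac)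
    thus "cscale c x \<in> rspan k v" by (auto simp: rspan_def)
  qed
  have "v i \<in> rspan k v" if "i < k" for i
    unfolding rspan_def by (rule CollectI, rule exI[of _ "\<lambda>l. if l = i then 1 else 0"]) (use that in \<open>simp add: sum_indicator_mult\<close>)
  thus "cv.span (v ` {..<k}) \<subseteq> rspan k v" by (intro cv.span_minimal sub) auto
qed

lemma cv_sum_scale: "(\<Sum>l\<in>A. cscale (c l) (v l)) = (\<lambda>j. \<Sum>l\<in>A. c l * v l j)"
  by (rule ext) (simp add: sum_fun_apply cscale_def)

text \<open>The space of all functions is infinite dimensional. The first \<open>n\<close> unit
  vectors bound the independent sets inside \<open>S\<close>, so that \<open>dim\<close> is the size
  of a finite basis extending \<open>B\<close>.\<close>

lemma Cn_dim_ge: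
  assumes S: "cv.subspace S" "S \<subseteq> Cn n" and B: "B \<subseteq> S" "cv.independent B" 
  shows "card B \<le> cv.dim S"
proof -
  obtain B' where B': "B \<subseteq> B'" "B' \<subseteq> S" "cv.independent B'" "S \<subseteq> cv.span B'"
    using cv.maximal_independent_subset_extend[OF B] by blast
  define E where "E = (\<lambda>r j. if j = r then 1 else 0 :: complex) ` {..<n}"
  have "Cn n \<subseteq> cv.span E"
  proof
    fix x assume x: "x \<in> Cn n"
    have "x = (\<Sum>r<n. cscale (x r) (\<lambda>j. if j = r then 1 else 0))"
      unfolding cv_sum_scale
    proof
      fix j
      have "(\<Sum>l<n. x l * (if j = l then 1 else 0)) = (\<Sum>l<n. if l = j then x j else 0)"
        by (intro sum.cong) auto
      thus "x j = (\<Sum>l<n. x l * (if j = l then 1 else 0))" using x by (auto simp: Cn_def)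
    qed
    moreover have "\<dots> \<in> cv.span E"
      by (intro cv.span_sum cv.span_scale cv.span_base) (auto simp: E_def)
    ultimately show "x \<in> cv.span E" by simp
  qed
  hence "B' \<subseteq> cv.span E" using B'(2) S(2) by blast
  moreover have "finite E" by (simp add: E_def)
  ultimately have "finite B'" using cv.independent_span_bound[OF _ B'(3)] by blast
  have "cv.span S = cv.span B'"
    using B'(2,4) by (metis cv.span_eq cv.span_superset subset_trans)
  hence "cv.dim S = card B'" using cv.dim_eq_card[OF _ B'(3)] by metis
  thus ?thesis using card_mono[OF \<open>finite B'\<close> B'(1)] by simp
qed

text \<open>The unipotent matrix that translates the rational normal curve: by the binomial theorem
  it takes the point with parameter \<open>z\<close> to the one with parameter \<open>z + x\<close>,
  and the osculating flags accordingly.\<close>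

definition gm :: "nat \<Rightarrow> complex \<Rightarrow> (nat \<Rightarrow> complex) \<Rightarrow> nat \<Rightarrow> complex" where
  "gm n x v i = (if i < n then \<Sum>j\<le>i. of_nat (i choose j) * x ^ (i - j) * v j else 0)"

lemma gamma_deriv_ff: "gamma_deriv n r z i = (if i < n then ff r i * z ^ (i - r) else 0)"
  by (simp add: gamma_deriv_def ff_def)

lemma ff_choose: "ff r j = fact r * of_nat (j choose r)"
proof -
  have "ff r j = fact r * (of_nat j gchoose r)"
    unfolding ff_eq_prod gbinomial_prod_rev by (simp add: atLeast0LessThan)
  thus ?thesis by (simp add: binomial_gbinomial)
qed

lemma gm_gamma: "gm n x (gamma_deriv n r z) = gamma_deriv n r (z + x)"
proof
  fix i
  show "gm n x (gamma_deriv n r z) i = gamma_deriv n r (z + x) i"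
  proof (cases "i < n")
    case i: True
    show ?thesis
    proof (cases "i < r")
      case True
      have "(\<Sum>j\<le>i. of_nat (i choose j) * x ^ (i - j) * gamma_deriv n r z j) = 0"
        using True by (intro sum.neutral) (auto simp: gamma_deriv_ff ff_eq_0)
      thus ?thesis using True by (simp add: gm_def gamma_deriv_ff ff_eq_0)
    next
      case False
      define f where "f j = of_nat (i choose j) * x ^ (i - j) * gamma_deriv n r z j" for j
      have "(\<Sum>j\<le>i. f j) = (\<Sum>j\<in>{r..i}. f j)"
        by (intro sum.mono_neutral_right) (auto simp: f_def gamma_deriv_ff ff_eq_0)
      also have "\<dots> = (\<Sum>m\<in>{0..i-r}. f (m + r))"
        using False sum.shift_bounds_cl_nat_ivl[of f 0 r "i - r"] by simp
      also have "\<dots> = (\<Sum>m\<le>i-r. ff r i * (of_nat ((i - r) choose m) * z ^ m * x ^ (i - r - m)))"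
      proof (intro sum.cong)
        fix m assume m: "m \<in> {..i-r}"
        \<comment> \<open>Pulls the falling factorial out of the sum, which is then the binomial
          expansion of \<open>(z + x) ^ (i - r)\<close>.\<close>
        have "(i choose (m + r)) * ((m + r) choose r) = (i choose r) * ((i - r) choose m)"
          using choose_mult[of r "m + r" i] m False by simp
        hence "complex_of_nat (i choose (m + r)) * of_nat ((m + r) choose r) = of_nat (i choose r) * of_nat ((i - r) choose m)"
          by (metis of_nat_mult)
        hence c: "of_nat (i choose (m + r)) * ff r (m + r) = ff r i * of_nat ((i - r) choose m)"
          unfolding ff_choose by (simp add: mult_ac)
        have "f (m + r) = (of_nat (i choose (m + r)) * ff r (m + r)) * x ^ (i - r - m) * z ^ m"
          using m i by (simp add: f_def gamma_deriv_ff add.commute)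
        thus "f (m + r) = ff r i * (of_nat ((i - r) choose m) * z ^ m * x ^ (i - r - m))"
          unfolding c by (simp add: mult_ac)
      qed (auto simp: atLeast0AtMost)
      also have "\<dots> = ff r i * (z + x) ^ (i - r)"
        unfolding binomial_ring[of z x] sum_distrib_left ..
      finally show ?thesis using i by (simp add: gm_def gamma_deriv_ff f_def)
    qed
  qed (simp add: gm_def gamma_deriv_ff)
qed

lemma gm_lin: "gm n x (\<lambda>j. \<Sum>l\<in>A. c l * v l j) i = (\<Sum>l\<in>A. c l * gm n x (v l) i)"
proof (cases "i < n")
  case True
  have "(\<Sum>j\<le>i. of_nat (i choose j) * x ^ (i - j) * (\<Sum>l\<in>A. c l * v l j))
      = (\<Sum>l\<in>A. \<Sum>j\<le>i. of_nat (i choose j) * x ^ (i - j) * (c l * v l j))"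
    unfolding sum_distrib_left by (rule sum.swap)
  thus ?thesis using True by (simp add: gm_def sum_distrib_left mult_ac)
qed (simp add: gm_def)

text \<open>At the parameter 0 the derivatives of order below \<open>n\<close> are the unit vectors,
  multiplied by \<open>ff r r\<close>.\<close>

lemma gamma_basis:
  assumes "\<And>j. j \<ge> i \<Longrightarrow> v j = 0" "i \<le> n"
  shows "v j = (\<Sum>r<i. (v r / ff r r) * gamma_deriv n r 0 j)"
proof -
  have "(v r / ff r r) * gamma_deriv n r 0 j = (if r = j then v j else 0)" if "r < i" for r
  proof -
    consider "r < j" | "r = j" | "j < r" by linarith
    thus ?thesis
    proof cases
      case 1
      thus ?thesis by (simp add: gamma_deriv_ff power_0_left)
    next
      case 2
      thus ?thesis using ff_self[of r] that assms(2) by (simp add: gamma_deriv_ff)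
    next
      case 3
      thus ?thesis by (simp add: gamma_deriv_ff ff_eq_0)
    qed
  qed
  hence "(\<Sum>r<i. (v r / ff r r) * gamma_deriv n r 0 j) = (\<Sum>r<i. if r = j then v j else 0)" by simp
  thus ?thesis using assms(1)[of j] by (cases "j < i") auto
qed

lemma gm_shifted:
  assumes "v \<in> Cn i" "i \<le> n"
  shows "gm n x v = (\<lambda>j. \<Sum>r<i. (v r / ff r r) * gamma_deriv n r x j)"
proof -
  have v: "v j = 0" if "j \<ge> i" for j using assms(1) that by (simp add: Cn_def)
  have "v = (\<lambda>j. \<Sum>r<i. (v r / ff r r) * gamma_deriv n r 0 j)" by (rule ext) (rule gamma_basis[OF v assms(2)])
  hence "gm n x v = gm n x (\<lambda>j. \<Sum>r<i. (v r / ff r r) * gamma_deriv n r 0 j)" by (rule arg_cong)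
  also have "\<dots> = (\<lambda>j. \<Sum>r<i. (v r / ff r r) * gamma_deriv n r x j)"
    by (rule ext) (simp only: gm_lin gm_gamma add_0_left)
  finally show ?thesis .
qed

lemma gm_inverse:
  assumes "v \<in> Cn n"
  shows "gm n (- x) (gm n x v) = v"
proof
  fix j
  have v: "v j = 0" if "j \<ge> n" for j using assms that by (simp add: Cn_def)
  have "gm n (- x) (gm n x v) j = (\<Sum>r<n. (v r / ff r r) * gamma_deriv n r 0 j)"
    unfolding gm_shifted[OF assms order_refl, where x = x]
    by (simp only: gm_lin gm_gamma right_minus)
  also have "\<dots> = v j" by (rule gamma_basis[OF v order_refl, symmetric])
  finally show "gm n (- x) (gm n x v) j = v j" .
qed

lemma gm_Cn: "gm n x v \<in> Cn n"
  by (simp add: gm_def Cn_def)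

text \<open>Moving \<open>t\<close> to 0 turns the osculating flag into the coordinate flag.\<close>

lemma osc_flag_imp:
  assumes "x \<in> osc_flag n i t" "j \<ge> i"
  shows "gm n (- t) x j = 0"
proof -
  let ?S = "{x. \<forall>j\<ge>i. gm n (- t) x j = 0}"
  have add: "gm n (- t) (x + y) j = gm n (- t) x j + gm n (- t) y j" for x y j
    by (simp add: gm_def plus_fun_def algebra_simps sum.distrib)
  have scale: "gm n (- t) (cscale c x) j = c * gm n (- t) x j" for c x j
    by (simp add: gm_def cscale_def algebra_simps sum_distrib_left)
  have "cv.subspace ?S"
  proof (rule cv.subspaceI)
    show "0 \<in> ?S" by (simp add: gm_def zero_fun_def)
  qed (auto simp: add scale)
  moreover have "{gamma_deriv n j t | j. j < i} \<subseteq> ?S"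
    by (auto simp: gm_gamma gamma_deriv_ff power_0_left)
  ultimately have "osc_flag n i t \<subseteq> ?S" unfolding osc_flag_def by (intro cv.span_minimal)
  thus ?thesis using assms by blast
qed

lemma osc_flag_sum: "(\<lambda>j. \<Sum>r<i. c r * gamma_deriv n r t j) \<in> osc_flag n i t"
  unfolding osc_flag_def cv_sum_scale[symmetric]
  by (intro cv.span_sum cv.span_scale cv.span_base) auto

lemma osc_flagI:
  assumes "x \<in> Cn n" "\<And>j. j \<ge> i \<Longrightarrow> gm n (- t) x j = 0" "i \<le> n"
  shows "x \<in> osc_flag n i t"
proof -
  have c: "gm n (- t) x \<in> Cn i" using assms(2) by (simp add: Cn_def)
  have "x = gm n t (gm n (- t) x)" using gm_inverse[OF assms(1), of "- t"] by simp
  also have "\<dots> \<in> osc_flag n i t"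
    unfolding gm_shifted[OF c assms(3)] by (rule osc_flag_sum)
  finally show ?thesis .
qed

lemma subspace_osc_flag: "cv.subspace (osc_flag n i t)"
  unfolding osc_flag_def by (rule cv.subspace_span)

section \<open>Row changes and translation of the determinant\<close>

context grass begin

text \<open>With every position \<open>n - 1\<close>, membership in \<open>Y full\<close> only asks
  for rows in \<open>Cn n\<close>. It serves arbitrary bases, on which no normal form is
  imposed.\<close>

definition full :: "nat \<Rightarrow> nat" where "full l = n - 1"

lemma Y_full: "v \<in> Y full \<longleftrightarrow> (\<forall>l<k. v l \<in> Cn n)"
proof -
  have "n - 1 < j \<longleftrightarrow> n \<le> j" for j using k_less by auto
  thus ?thesis by (simp add: Y_def full_def Cn_def)
qed

lemma full_less: "full l < n" and mono_full: "mono_idx full"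
  using k_less by (auto simp: full_def mono_idx_def)

definition blk :: "(nat \<Rightarrow> nat \<Rightarrow> complex) \<Rightarrow> nat \<Rightarrow> nat \<Rightarrow> complex" where
  "blk M r s = (if r < k then (if s < k then M r s else 0) else if s = r then 1 else 0)"

lemma blk_sum: "r < n \<Longrightarrow> (\<Sum>s<n. blk M r s * f s) = (if r < k then \<Sum>s<k. M r s * f s else f r)"
proof -
  assume r: "r < n"
  have "(\<Sum>s<n. blk M r s * f s) = (\<Sum>s<k. M r s * f s)" if "r < k"
  proof -
    have "(\<Sum>s<n. blk M r s * f s) = (\<Sum>s<k. blk M r s * f s)"
      using that k_less by (intro sum.mono_neutral_right) (auto simp: blk_def)
    thus ?thesis using that by (simp add: blk_def)
  qed
  moreover have "(\<Sum>s<n. blk M r s * f s) = f r" if "\<not> r < k"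
    using that r sum_indicator_mult[of r n f] by (simp add: blk_def)
  ultimately show ?thesis by simp
qed

lemma Dv_row_mix:
  assumes "\<And>l j. l < k \<Longrightarrow> j < n \<Longrightarrow> x l j = (\<Sum>p<k. M l p * w p j)"
  shows "Dv x z = cdet n (blk M) * Dv w z"
  unfolding Dv_def cdet_mult[symmetric]
  by (rule cdet_cong) (auto simp: blk_sum assms)

lemma Q_full_row_mix:
  assumes "\<And>l j. l < k \<Longrightarrow> j < n \<Longrightarrow> x l j = (\<Sum>p<k. M l p * w p j)"
  shows "Q full x z = cdet n (blk M) * Q full w z"
  unfolding Q_def cdet_mult[symmetric]
  by (rule cdet_cong) (auto simp: blk_sum assms full_def sum_distrib_left mult_ac)

text \<open>On columns, translation is multiplication by a unipotent triangular matrix.\<close>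

lemma Dv_translate: "Dv (\<lambda>l. gm n x (v l)) (z + x) = Dv v z"
proof -
  define G where "G s c = (if s \<le> c then of_nat (c choose s) * x ^ (c - s) else 0)" for s c
  have gmG: "gm n x f c = (\<Sum>s<n. f s * G s c)" if "c < n" for f c
  proof -
    have "(\<Sum>s<n. f s * G s c) = (\<Sum>s\<le>c. f s * G s c)"
      using that by (intro sum.mono_neutral_right) (auto simp: G_def)
    thus ?thesis using that by (simp add: gm_def G_def mult_ac)
  qed
  have "Dv (\<lambda>l. gm n x (v l)) (z + x)
      = cdet n (\<lambda>r c. \<Sum>s<n. (if r < k then v r s else gamma_deriv n (r - k) z s) * G s c)"
    unfolding Dv_def by (rule cdet_cong) (auto simp: gm_gamma[symmetric] gmG)
  also have "\<dots> = Dv v z * cdet n G" unfolding cdet_mult Dv_def ..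
  also have "cdet n G = cdet n (\<lambda>r c. G c r)" by (rule cdet_transpose[symmetric])
  also have "\<dots> = (\<Prod>i<n. G i i)" by (rule cdet_lower_triangular) (auto simp: G_def)
  also have "\<dots> = 1" by (simp add: G_def)
  finally show ?thesis by simp
qed

lemma tri_numbers: "N + tri + (\<Sum>r<n-k. r) = (\<Sum>r<n. r)" and ssum_topc_tri: "ssum topc + (\<Sum>r<n-k. r) = (\<Sum>r<n. r)"
proof -
  have "{..<n} = {..<n-k} \<union> {n-k..<n}" "{..<n-k} \<inter> {n-k..<n} = {}" by auto
  hence "(\<Sum>r<n. r) = (\<Sum>r<n-k. r) + (\<Sum>r\<in>{n-k..<n}. r)" by (simp add: sum.union_disjoint)
  also have "(\<Sum>r\<in>{n-k..<n}. r) = (\<Sum>l<k. l + (n - k))"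
    using k_less sum.shift_bounds_nat_ivl[of "\<lambda>r. r" 0 "n - k" k] by (simp add: atLeast0LessThan)
  also have "\<dots> = ssum topc" unfolding ssum_def topc_def by (intro sum.cong) auto
  finally show 1: "ssum topc + (\<Sum>r<n-k. r) = (\<Sum>r<n. r)" by simp
  have "ssum topc = tri + N" using top_position by (simp add: positions_def)
  thus "N + tri + (\<Sum>r<n-k. r) = (\<Sum>r<n. r)" using 1 by simp
qed

lemma Dv_topc:
  assumes "v \<in> Y topc" "z \<noteq> 0"
  shows "Dv v z = Q topc v z"
  using Dv_Q[OF assms(1), of z] assms(2) unfolding ssum_topc_tri by simp

text \<open>In a nonzero Leibniz term the exponent is largest when the first \<open>k\<close> rows
  take the smallest columns; these are distinct, so their sum is at least
  \<open>tri\<close>.\<close>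

lemma Dv_poly:
  assumes "v \<in> Y full"
  obtains P where "degree P \<le> N" "\<And>z. poly P z = Dv v z"
proof -
  define d where "d p = (\<Sum>i\<in>{k..<n}. p i - (i - k))" for p :: "nat \<Rightarrow> nat"
  define P where "P = (\<Sum>p | p permutes {..<n}. monom (Qcoef v p) (d p))"
  have "Dv v z = (\<Sum>p | p permutes {..<n}. Qcoef v p * z ^ d p)" for z
    unfolding Dv_def cdet_leibniz
  proof (intro sum.cong refl)
    fix p assume "p \<in> {p. p permutes {..<n}}"
    hence pn: "p i < n" if "i < n" for i using permutes_less that by blast
    have "(\<Prod>i<n. if i < k then v i (p i) else gamma_deriv n (i - k) z (p i))
        = (\<Prod>i<n. (if i < k then v i (p i) else ff (i - k) (p i)) * (if i < k then 1 else z ^ (p i - (i - k))))"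
      by (intro prod.cong) (auto simp: gamma_deriv_ff pn)
    also have "\<dots> = (\<Prod>i<n. if i < k then v i (p i) else ff (i - k) (p i)) * (\<Prod>i<n. if i < k then 1 else z ^ (p i - (i - k)))"
      by (rule prod.distrib)
    also have "(\<Prod>i<n. if i < k then 1 else z ^ (p i - (i - k))) = (\<Prod>i\<in>{k..<n}. if i < k then 1 else z ^ (p i - (i - k)))"
      by (intro prod.mono_neutral_right) auto
    also have "\<dots> = z ^ d p" by (simp add: d_def power_sum)
    finally show "of_int (sign p) * (\<Prod>i<n. if i < k then v i (p i) else gamma_deriv n (i - k) z (p i)) = Qcoef v p * z ^ d p"
      by (simp add: Qcoef_def)
  qed
  hence "poly P z = Dv v z" for z by (simp add: P_def poly_sum poly_monom)
  moreover have "degree P \<le> N" unfolding P_def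
  proof (rule degree_sum_le[OF finite_perms])
    fix p assume p: "p \<in> {p. p permutes {..<n}}"
    show "degree (monom (Qcoef v p) (d p)) \<le> N"
    proof (cases "Qcoef v p = 0")
      case False
      have ge: "i - k \<le> p i" if i: "i \<in> {k..<n}" for i
      proof (rule ccontr)
        assume "\<not> ?thesis"
        hence "ff (i - k) (p i) = 0" by (simp add: ff_eq_0)
        hence "(\<Prod>i<n. if i < k then v i (p i) else ff (i - k) (p i)) = 0"
          using i by (intro prod_zero bexI[of _ i]) auto
        thus False using False by (simp add: Qcoef_def)
      qed
      have "d p = (\<Sum>i\<in>{k..<n}. p i) - (\<Sum>i\<in>{k..<n}. i - k)"
        unfolding d_def using ge by (intro sum_subtractf_nat) auto
      moreover have "(\<Sum>i\<in>{k..<n}. i - k) = (\<Sum>r<n-k. r)"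
        using k_less sum.shift_bounds_nat_ivl[of "\<lambda>r. r - k" 0 k "n - k"] by (simp add: atLeast0LessThan)
      moreover have "(\<Sum>i<k. p i) + (\<Sum>i\<in>{k..<n}. p i) = (\<Sum>r<n. r)"
      proof -
        have "{..<n} = {..<k} \<union> {k..<n}" "{..<k} \<inter> {k..<n} = {}" using k_less by auto
        hence "(\<Sum>i<k. p i) + (\<Sum>i\<in>{k..<n}. p i) = (\<Sum>i<n. p i)" by (simp add: sum.union_disjoint)
        also have "\<dots> = (\<Sum>r<n. r)"
          using sum.permute[of p "{..<n}" "\<lambda>r. r"] p by (simp add: o_def)
        finally show ?thesis .
      qed
      moreover have "tri \<le> (\<Sum>i<k. p i)"
        unfolding tri_def using permutes_inj[of p "{..<n}"] p
        by (intro sum_lessThan_le_sum_inj) (auto simp: inj_on_def)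
      ultimately have "d p \<le> N" using tri_numbers by linarith
      thus ?thesis using False by (simp add: degree_monom_eq)
    qed simp
  qed
  ultimately show ?thesis using that by blast
qed

section \<open>Points of the Grassmannian and their bases\<close>

lemma indep_iff: "indep v \<longleftrightarrow> cv.independent (v ` {..<k}) \<and> inj_on v {..<k}"
proof
  assume ind: "indep v"
  have inj: "inj_on v {..<k}"
  proof (rule inj_onI, rule ccontr)
    fix l p assume lp: "l \<in> {..<k}" "p \<in> {..<k}" "v l = v p" "l \<noteq> p"
    define x where "x i = (if i = l then 1 else if i = p then -1 else 0 :: complex)" for i
    have "(\<Sum>i<k. x i * v i j) = 0" for j
    proof -
      have "(\<Sum>i<k. x i * v i j) = (\<Sum>i<k. (if i = l then v l j else 0) + (if i = p then - v p j else 0))"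
        using lp by (intro sum.cong) (auto simp: x_def)
      thus ?thesis using lp by (simp add: sum.distrib)
    qed
    hence "x l = 0" using ind lp unfolding indep_def by blast
    thus False by (simp add: x_def)
  qed
  moreover have "cv.independent (v ` {..<k})"
  proof
    assume "cv.dependent (v ` {..<k})"
    then obtain u y where u: "y \<in> v ` {..<k}" "u y \<noteq> 0" "(\<Sum>y\<in>v ` {..<k}. cscale (u y) y) = 0"
      using cv.dependent_finite[of "v ` {..<k}"] by auto
    have "(\<Sum>l<k. cscale (u (v l)) (v l)) = 0" using u(3) inj by (simp add: sum.reindex)
    hence "(\<Sum>l<k. u (v l) * v l j) = 0" for j unfolding cv_sum_scale by (metis zero_fun_def)
    hence "\<forall>l<k. u (v l) = 0" using ind unfolding indep_def by (elim allE[of _ "\<lambda>l. u (v l)"]) auto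
    thus False using u by auto
  qed
  ultimately show "cv.independent (v ` {..<k}) \<and> inj_on v {..<k}" by blast
next
  assume *: "cv.independent (v ` {..<k}) \<and> inj_on v {..<k}"
  show "indep v"
    unfolding indep_def
  proof (intro allI impI)
    fix x l assume x: "\<forall>j. (\<Sum>l<k. x l * v l j) = 0" and l: "l < k"
    define u where "u y = x (the_inv_into {..<k} v y)" for y
    have uv: "u (v l) = x l" if "l < k" for l using * that by (simp add: u_def the_inv_into_f_f)
    have "(\<Sum>y\<in>v ` {..<k}. cscale (u y) y) = (\<Sum>l<k. cscale (x l) (v l))"
      using * uv by (simp add: sum.reindex)
    also have "\<dots> = 0" unfolding cv_sum_scale using x by (simp add: zero_fun_def)
    finally have "\<forall>y\<in>v ` {..<k}. u y = 0" using * cv.dependent_finite[of "v ` {..<k}"] by auto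
    thus "x l = 0" using uv l by auto
  qed
qed

lemma Grass_rspan:
  assumes "indep v" "v \<in> Y full"
  shows "rspan k v \<in> Grass k n"
proof -
  have i: "cv.independent (v ` {..<k})" "inj_on v {..<k}" using assms(1) by (simp_all add: indep_iff)
  have "cv.dim (rspan k v) = card (v ` {..<k})"
    unfolding rspan_eq_span using i(1) by (rule cv.dim_span_eq_card_independent)
  moreover have "rspan k v \<subseteq> Cn n" using assms(2) by (auto simp: rspan_def Y_full Cn_def)
  ultimately show ?thesis using i(2) by (simp add: Grass_def card_image rspan_eq_span cv.subspace_span)
qed

lemma Grass_basis:
  assumes "K \<in> Grass k n"
  obtains v where "indep v" "v \<in> Y full" "K = rspan k v"
proof -
  have K: "cv.subspace K" "K \<subseteq> Cn n" "cv.dim K = k" using assms by (auto simp: Grass_def)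
  obtain B where B: "B \<subseteq> K" "cv.independent B" "K \<subseteq> cv.span B" "card B = k"
    using cv.basis_exists[of K] K(3) by auto
  have "finite B" using B(4) k_pos card_gt_0_iff by metis
  then obtain v where v: "bij_betw v {..<k} B"
    using ex_bij_betw_nat_finite[of B] B(4) by (auto simp: atLeast0LessThan)
  have vB: "v ` {..<k} = B" and inj: "inj_on v {..<k}" using v by (auto simp: bij_betw_def)
  have "indep v" unfolding indep_iff using vB inj B(2) by simp
  moreover have "v \<in> Y full" unfolding Y_full using vB B(1) K(2) by blast
  moreover have "K = rspan k v"
    unfolding rspan_eq_span vB using B(1,3) K(1) by (metis cv.span_minimal subset_antisym)
  ultimately show ?thesis using that by blast
qed

lemma change_of_basis:
  assumes ind: "indep w" and in': "\<And>l. l < k \<Longrightarrow> w l \<in> rspan k v"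
  obtains M M' where "\<And>l j. l < k \<Longrightarrow> w l j = (\<Sum>p<k. M l p * v p j)" "\<And>l j. l < k \<Longrightarrow> v l j = (\<Sum>p<k. M' l p * w p j)"
    "\<And>r c. r < k \<Longrightarrow> c < k \<Longrightarrow> (\<Sum>s<k. M r s * M' s c) = (if r = c then 1 else 0)"
proof -
  have "\<exists>c. w l = (\<lambda>j. \<Sum>p<k. c p * v p j)" if "l < k" for l using in'[OF that] by (auto simp: rspan_def)
  then obtain M where M: "\<And>l. l < k \<Longrightarrow> w l = (\<lambda>j. \<Sum>p<k. M l p * v p j)" by metis
  have "cdet k M \<noteq> 0"
  proof
    assume "cdet k M = 0"
    then obtain x i where x: "i < k" "x i \<noteq> 0" "\<And>c. c < k \<Longrightarrow> (\<Sum>r<k. x r * M r c) = 0"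
      unfolding cdet_left_kernel by blast
    have "(\<Sum>l<k. x l * w l j) = 0" for j
    proof -
      have "(\<Sum>l<k. x l * w l j) = (\<Sum>l<k. \<Sum>p<k. x l * M l p * v p j)"
        using M by (simp add: sum_distrib_left mult_ac)
      also have "\<dots> = (\<Sum>p<k. (\<Sum>l<k. x l * M l p) * v p j)"
        by (subst sum.swap) (simp add: sum_distrib_right)
      finally show ?thesis using x(3) by simp
    qed
    hence "x i = 0" using ind x(1) unfolding indep_def by blast
    thus False using x by simp
  qed
  then obtain M' where M': "\<And>r c. r < k \<Longrightarrow> c < k \<Longrightarrow> (\<Sum>s<k. M r s * M' s c) = (if r = c then 1 else 0)"
    "\<And>r c. r < k \<Longrightarrow> c < k \<Longrightarrow> (\<Sum>s<k. M' r s * M s c) = (if r = c then 1 else 0)"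
    by (rule cdet_inverse) blast
  have "v l j = (\<Sum>p<k. M' l p * w p j)" if l: "l < k" for l j
  proof -
    have "(\<Sum>p<k. M' l p * w p j) = (\<Sum>p<k. \<Sum>q<k. M' l p * M p q * v q j)"
      using M by (simp add: sum_distrib_left mult_ac)
    also have "\<dots> = (\<Sum>q<k. (\<Sum>p<k. M' l p * M p q) * v q j)"
      by (subst sum.swap) (simp add: sum_distrib_right)
    also have "\<dots> = (\<Sum>q<k. (if q = l then 1 else 0) * v q j)" using M'(2) l by (intro sum.cong) auto
    finally show ?thesis using l by (simp add: sum_indicator_mult)
  qed
  note vM = this
  show ?thesis
  proof (rule that[of M M'])
    show "w l j = (\<Sum>p<k. M l p * v p j)" if "l < k" for l j by (simp add: M[OF that])
  qed (use vM M'(1) in auto)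
qed

subsection \<open>Transversality and the Jacobian\<close>

lemma sum_split_rows: "(\<Sum>r<n. f r) = (\<Sum>r<k. f r) + (\<Sum>r<n-k. f (r + k))" for f :: "nat \<Rightarrow> complex"
proof -
  have "{..<n} = {..<k} \<union> {k..<n}" "{..<k} \<inter> {k..<n} = {}" using k_less by auto
  moreover have "sum f {k..<n} = (\<Sum>r<n-k. f (r + k))"
    using k_less sum.shift_bounds_nat_ivl[of f 0 k "n - k"] by (simp add: atLeast0LessThan)
  ultimately show ?thesis by (simp add: sum.union_disjoint)
qed

lemma gamma_independent:
  assumes "\<And>c. c < n \<Longrightarrow> (\<Sum>r<n-k. y r * gamma_deriv n r t c) = 0" "r < n - k"
  shows "y r = 0"
  using assms(2)
proof (induction r rule: less_induct)
  case (less r)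
  have "0 = (\<Sum>s<n-k. y s * gamma_deriv n s t r)" using assms(1)[of r] less.prems by simp
  also have "\<dots> = (\<Sum>s<n-k. if s = r then y r * ff r r else 0)"
  proof (rule sum.cong)
    fix s assume s: "s \<in> {..<n-k}"
    consider "s < r" | "s = r" | "r < s" by linarith
    thus "y s * gamma_deriv n s t r = (if s = r then y r * ff r r else 0)"
    proof cases
      case 1
      thus ?thesis using less.IH[of s] s by simp
    next
      case 2
      thus ?thesis using less.prems by (simp add: gamma_deriv_ff)
    next
      case 3
      thus ?thesis by (simp add: gamma_deriv_ff ff_eq_0)
    qed
  qed simp
  finally show ?case using less.prems ff_self[of r] by simp
qed

lemma indepD: "indep v \<Longrightarrow> (\<And>j. (\<Sum>l<k. x l * v l j) = 0) \<Longrightarrow> l < k \<Longrightarrow> x l = 0"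
  unfolding indep_def by blast

lemma indep_req:
  assumes "req x u" "indep u"
  shows "indep x"
  unfolding indep_def
proof (rule ccontr, clarsimp)
  fix y l0 assume y: "\<forall>j. (\<Sum>l<k. y l * x l j) = 0" and l0: "l0 < k" "y l0 \<noteq> 0"
  obtain b where b: "\<And>l. l < k \<Longrightarrow> b l l \<noteq> 0" "\<And>l p. l < k \<Longrightarrow> p > l \<Longrightarrow> b l p = 0"
    "\<And>l j. l < k \<Longrightarrow> x l j = (\<Sum>p<k. b l p * u p j)" using assms(1) by (rule reqE) blast
  have "(\<Sum>p<k. (\<Sum>l<k. y l * b l p) * u p j) = 0" for j
  proof -
    have "(\<Sum>l<k. y l * x l j) = (\<Sum>l<k. \<Sum>p<k. y l * b l p * u p j)"
      using b(3) by (simp add: sum_distrib_left mult_ac)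
    also have "\<dots> = (\<Sum>p<k. (\<Sum>l<k. y l * b l p) * u p j)"
      by (subst sum.swap) (simp add: sum_distrib_right)
    finally show ?thesis using y by simp
  qed
  hence "(\<Sum>l<k. y l * b l p) = 0" if "p < k" for p
    by (rule indepD[OF assms(2), where x = "\<lambda>p. \<Sum>l<k. y l * b l p"]) (rule that)
  hence "cdet k b = 0" unfolding cdet_left_kernel using l0 by blast
  moreover have "cdet k b = (\<Prod>l<k. b l l)" by (rule cdet_lower_triangular) (use b(2) in auto)
  ultimately show False using b(1) by simp
qed

lemma topc_full: "v \<in> Y topc \<Longrightarrow> v \<in> Y full"
  using Y_mono[of topc full] top_less by (fastforce simp: full_def)

lemma independent_subfamily:
  assumes "indep x" "L \<subseteq> {..<k}"
  shows "cv.independent (x ` L)" "card (x ` L) = card L"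
  using assms cv.independent_mono[of "x ` {..<k}" "x ` L"] unfolding indep_iff
  by (auto intro!: card_image intro: inj_on_subset)

text \<open>Only the last condition is a genuine one: a left kernel vector of the vanishing
  determinant gives a common nonzero vector of the plane and the flag member of dimension
  \<open>n - k\<close>. The other conditions ask for the dimension of the intersection that every
  plane has, exhibited by a basis with distinct leading positions.\<close>

lemma schubert_divisorI:
  assumes u: "u \<in> SY topc topc" and t: "t \<noteq> 0" and sol: "Q topc u t = 0"
  shows "rspan k u \<in> schubert_var k n (div_index k) t"
proof -
  have ind: "indep u" by (rule SY_imp_indep[OF u])
  have uY: "u \<in> Y topc" using u by (simp add: SY_def)
  have uF: "u \<in> Y full" by (rule topc_full[OF uY])
  have uCn: "u l \<in> Cn n" if "l < k" for l using uF that unfolding Y_full by blast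
  \<comment> \<open>Moves \<open>t\<close> to 0, where leading positions measure the position
    relative to the flag.\<close>
  define v where "v l = gm n (- t) (u l)" for l
  have gv: "gm n t (v l) = u l" if "l < k" for l using gm_inverse[OF uCn[OF that], of "- t"] by (simp add: v_def)
  have vF: "v \<in> Y full" unfolding Y_full v_def using gm_Cn by blast
  have vind: "indep v"
    unfolding indep_def
  proof (intro allI impI)
    fix x l assume x: "\<forall>j. (\<Sum>l<k. x l * v l j) = 0" and l: "l < k"
    have "(\<Sum>l<k. x l * u l j) = 0" for j
    proof -
      have "(\<Sum>l<k. x l * u l j) = (\<Sum>l<k. x l * gm n t (v l) j)" by (simp add: gv)
      also have "\<dots> = gm n t (\<lambda>j. \<Sum>l<k. x l * v l j) j" by (rule gm_lin[symmetric])
      also have "(\<lambda>j. \<Sum>l<k. x l * v l j) = (\<lambda>j. 0)" using x by blast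
      finally show ?thesis by (simp add: gm_def)
    qed
    thus "x l = 0" using ind l unfolding indep_def by blast
  qed
  obtain w f where w: "req w v" "w \<in> Y f" "inj_on f {..<k}" "\<And>l. l < k \<Longrightarrow> f l \<le> full l" "\<And>l. l < k \<Longrightarrow> w l (f l) \<noteq> 0"
    using distinct_leads[OF vind vF] by blast
  define x where "x l = gm n t (w l)" for l
  have xu: "req x u"
  proof -
    obtain b where b: "\<And>l. l < k \<Longrightarrow> b l l \<noteq> 0" "\<And>l p. l < k \<Longrightarrow> p > l \<Longrightarrow> b l p = 0"
      "\<And>l j. l < k \<Longrightarrow> w l j = (\<Sum>p<k. b l p * v p j)" using w(1) by (rule reqE) blast
    show ?thesis
    proof (rule reqI[where b = b, OF b(1,2)])
      fix l j assume l: "l < k"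
      have "w l = (\<lambda>j. \<Sum>p<k. b l p * v p j)" by (rule ext) (rule b(3)[OF l])
      hence "x l j = (\<Sum>p<k. b l p * gm n t (v p) j)" unfolding x_def by (simp only: gm_lin)
      thus "x l j = (\<Sum>p<k. b l p * u p j)" by (simp add: gv)
    qed auto
  qed
  have xind: "indep x" by (rule indep_req[OF xu ind])
  have wF: "w \<in> Y full" by (rule req_Y[OF w(1) vF mono_full])
  have wCn: "w l \<in> Cn n" if "l < k" for l using wF that unfolding Y_full by blast
  have xK: "x l \<in> rspan k u" if l: "l < k" for l
  proof -
    obtain b where b: "\<And>j. x l j = (\<Sum>p<k. b l p * u p j)" using reqE[OF xu] l by metis
    hence "x l = (\<lambda>j. \<Sum>p<k. b l p * u p j)" by blast
    thus ?thesis unfolding rspan_def by blast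
  qed
  have K: "rspan k u \<in> Grass k n" by (rule Grass_rspan[OF ind uF])
  have sub: "cv.subspace (rspan k u \<inter> osc_flag n i t)" "rspan k u \<inter> osc_flag n i t \<subseteq> Cn n" for i
    using K subspace_osc_flag by (auto simp: Grass_def intro: cv.subspace_inter)
  have "k - j \<le> cv.dim (rspan k u \<inter> osc_flag n (n + 1 - div_index k ! j) t)" if j: "j < k" for j
  proof (cases "j < k - 1")
    case True
    have len: "length [1..<k] = k - 1" by simp
    have "div_index k ! j = j + 1" using True by (simp add: div_index_def nth_append)
    hence idx: "n + 1 - div_index k ! j = n - j" by simp
    \<comment> \<open>The positions \<open>f l\<close> are distinct, so at most \<open>j\<close> of
      them are among the last \<open>j\<close>; the remaining rows lie in the flag member.\<close>
    define L where "L = {l. l < k \<and> f l < n - j}"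
    have "{..<k} - L = {l. l < k \<and> n - j \<le> f l}" by (auto simp: L_def)
    moreover have "card {l. l < k \<and> n - j \<le> f l} \<le> card {n - j..<n}"
    proof (rule card_inj_on_le)
      show "inj_on f {l. l < k \<and> n - j \<le> f l}" using w(3) by (rule inj_on_subset) auto
      show "f ` {l. l < k \<and> n - j \<le> f l} \<subseteq> {n - j..<n}"
        using le_less_trans[OF w(4) full_less] by auto
    qed simp
    moreover have "card {n - j..<n} = j" using j k_less by simp
    moreover have "card ({..<k} - L) = k - card L"
      by (subst card_Diff_subset) (auto simp: L_def)
    ultimately have cL: "k - j \<le> card L" by simp
    have "card (x ` L) \<le> cv.dim (rspan k u \<inter> osc_flag n (n - j) t)"
    proof (rule Cn_dim_ge[OF sub])
      show "cv.independent (x ` L)" by (rule independent_subfamily[OF xind]) (auto simp: L_def)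
      show "x ` L \<subseteq> rspan k u \<inter> osc_flag n (n - j) t"
      proof safe
        fix l assume l: "l \<in> L"
        hence lk: "l < k" "f l < n - j" by (auto simp: L_def)
        show "x l \<in> rspan k u" by (rule xK[OF lk(1)])
        show "x l \<in> osc_flag n (n - j) t"
        proof (rule osc_flagI)
          show "x l \<in> Cn n" unfolding x_def by (rule gm_Cn)
          fix q assume q: "n - j \<le> q"
          have "gm n (- t) (x l) q = w l q" unfolding x_def gm_inverse[OF wCn[OF lk(1)]] ..
          thus "gm n (- t) (x l) q = 0" using w(2) lk q by (simp add: Y_def)
        qed simp
      qed
    qed
    moreover have "card (x ` L) = card L" by (rule independent_subfamily[OF xind]) (auto simp: L_def)
    ultimately show ?thesis using cL unfolding idx by simp
  next
    case False
    hence jk: "j = k - 1" using j by simp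
    have "div_index k ! j = k + 1" unfolding jk using k_pos by (simp add: div_index_def nth_append)
    hence idx: "n + 1 - div_index k ! j = n - k" by simp
    have "Dv u t = 0" using Dv_topc[OF uY t] sol by simp
    then obtain y i where y: "i < n" "y i \<noteq> 0" "\<And>c. c < n \<Longrightarrow> (\<Sum>r<n. y r * (if r < k then u r c else gamma_deriv n (r - k) t c)) = 0"
      unfolding Dv_def cdet_left_kernel by blast
    have y': "(\<Sum>r<k. y r * u r c) + (\<Sum>r<n-k. y (r + k) * gamma_deriv n r t c) = 0" if "c < n" for c
      using y(3)[OF that] unfolding sum_split_rows by simp
    define X where "X c = (\<Sum>r<k. y r * u r c)" for c
    have X: "X c = (\<Sum>r<n-k. - y (r + k) * gamma_deriv n r t c)" for c
    proof (cases "c < n")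
      case True
      show ?thesis unfolding X_def using y'[OF True] by (simp add: sum_negf add_eq_0_iff)
    next
      case False
      thus ?thesis using uCn by (simp add: X_def Cn_def gamma_deriv_ff)
    qed
    have "X \<in> rspan k u" unfolding rspan_def X_def by blast
    moreover have "X = (\<lambda>c. \<Sum>r<n-k. - y (r + k) * gamma_deriv n r t c)" by (rule ext) (rule X)
    hence "X \<in> osc_flag n (n - k) t" using osc_flag_sum[where c = "\<lambda>r. - y (r + k)" and i = "n - k" and t = t] by simp
    moreover have "X \<noteq> 0"
    proof
      assume "X = 0"
      hence X0: "X c = 0" for c by simp
      hence yk: "y r = 0" if "r < k" for r using ind that unfolding indep_def X_def by blast
      have "y (r + k) = 0" if "r < n - k" for r
        by (rule gamma_independent[where y = "\<lambda>r. y (r + k)" and t = t, OF _ that])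
          (use y' X0 in \<open>simp add: X_def\<close>)
      from this[of "i - k"] have "y i = 0" using yk y(1) by (cases "i < k") auto
      thus False using y(2) by simp
    qed
    ultimately have "card {X} \<le> cv.dim (rspan k u \<inter> osc_flag n (n - k) t)"
      by (intro Cn_dim_ge[OF sub]) (auto simp: cv.dependent_single)
    thus ?thesis unfolding idx using k_pos by (simp add: jk)
  qed
  thus ?thesis using K by (simp add: schubert_var_def)
qed

text \<open>An entry beyond \<open>topc i\<close> is in the pivot column of a later row
  \<open>p\<close>. Replacing row \<open>i\<close> by row \<open>p\<close> makes two rows equal, and
  this relation reduces the derivative to the first \<open>n - k\<close> columns. The power of
  \<open>t l\<close> is the factor between the normalisations \<open>topc\<close> and
  \<open>full\<close>.\<close>

lemma full_kernel:
  assumes u: "u \<in> SY topc topc" and t: "\<And>l. l < m \<Longrightarrow> t l \<noteq> 0" "\<And>l. l < m \<Longrightarrow> Q topc u (t l) = 0"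
    and y: "\<And>i j. i < k \<Longrightarrow> j \<le> topc i \<Longrightarrow> (\<Sum>l<m. y l * dQ topc u i j (t l)) = 0"
    and ij: "i < k" "j < n"
  shows "(\<Sum>l<m. (y l / t l ^ (ssum full - ssum topc)) * dQ full u i j (t l)) = 0"
proof -
  define s where "s = ssum full - ssum topc"
  have uY: "u \<in> Y topc" using u by (simp add: SY_def)
  have tf: "topc l \<le> full l" if "l < k" for l using top_less[OF that] by (simp add: full_def)
  have low: "(\<Sum>l<m. (y l / t l ^ s) * dQ full u i j (t l)) = 0" if "j \<le> topc i" for j
  proof -
    have wY: "u(i := \<lambda>c. if c = j then 1 else 0) \<in> Y topc" using uY that by (auto simp: Y_def)
    have "dQ full u i j z = z ^ s * dQ topc u i j z" for z
      unfolding dQ_def s_def by (rule Q_change[OF wY tf])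
    hence "(\<Sum>l<m. (y l / t l ^ s) * dQ full u i j (t l)) = (\<Sum>l<m. y l * dQ topc u i j (t l))"
      using t(1) by (intro sum.cong) auto
    thus ?thesis using y[OF ij(1) that] by simp
  qed
  have "(\<Sum>l<m. (y l / t l ^ s) * dQ full u i j (t l)) = 0"
  proof (cases "j \<le> topc i")
    case False
    define p where "p = j - (n - k)"
    have p: "p < k" "j = topc p" "i < p" using False ij k_less by (auto simp: p_def topc_def)
    have rel: "(\<Sum>c<n. u p c * dQ full u i c (t l)) = 0" if l: "l < m" for l
    proof -
      have "(\<Sum>c<n. u p c * dQ full u i c (t l)) = Q full (u(i := u p)) (t l)" by (rule Q_row[symmetric]) fact
      also have "\<dots> = 0"
        unfolding Q_def by (rule cdet_identical_rows[of i _ p]) (use p ij k_less in \<open>auto simp: full_def\<close>)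
      finally show ?thesis .
    qed
    have "0 = (\<Sum>l<m. (y l / t l ^ s) * (\<Sum>c<n. u p c * dQ full u i c (t l)))" using rel by simp
    also have "\<dots> = (\<Sum>c<n. u p c * (\<Sum>l<m. (y l / t l ^ s) * dQ full u i c (t l)))"
      unfolding sum_distrib_left by (subst sum.swap) (simp add: mult_ac)
    also have "\<dots> = (\<Sum>c<n. if c = j then (\<Sum>l<m. (y l / t l ^ s) * dQ full u i j (t l)) else 0)"
    proof (rule sum.cong)
      fix c assume c: "c \<in> {..<n}"
      show "u p c * (\<Sum>l<m. (y l / t l ^ s) * dQ full u i c (t l)) = (if c = j then (\<Sum>l<m. (y l / t l ^ s) * dQ full u i j (t l)) else 0)"
      proof (cases "c < n - k")
        case True
        hence "c \<le> topc i" "c \<noteq> j" using ij p by (auto simp: topc_def)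
        thus ?thesis using low[of c] by simp
      next
        case False
        define q where "q = c - (n - k)"
        have q: "q < k" "c = topc q" using False c k_less by (auto simp: q_def topc_def)
        have "u p (topc q) = (if p = q then 1 else 0)" using u p(1) q(1) unfolding SY_def by blast
        moreover have "c = j \<longleftrightarrow> p = q" using p q by (auto simp: topc_def)
        ultimately show ?thesis using q(2) by auto
      qed
    qed simp
    finally show ?thesis using ij(2) by simp
  qed (rule low)
  thus ?thesis by (simp add: s_def)
qed

text \<open>The chain rule for \<open>v = M u\<close>: changing the entry \<open>(i, j)\<close> of
  \<open>v\<close> means changing column \<open>j\<close> of \<open>u\<close> by column
  \<open>i\<close> of the inverse matrix \<open>M'\<close>.\<close>

lemma dQ_full_row_mix:
  assumes v: "\<And>l j. l < k \<Longrightarrow> v l j = (\<Sum>p<k. M l p * u p j)"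
    and MM': "\<And>r c. r < k \<Longrightarrow> c < k \<Longrightarrow> (\<Sum>s<k. M r s * M' s c) = (if r = c then 1 else 0)"
    and ij: "i < k" "j < n"
  shows "dQ full v i j z = cdet n (blk M) * (\<Sum>a<k. M' a i * dQ full u a j z)"
proof -
  define d where "d l c = (if l = i \<and> c = j then 1 else 0 :: complex)" for l c
  define d' where "d' a c = (if c = j then M' a i else 0)" for a c
  define \<mu> where "\<mu> = cdet n (blk M)"
  have "DQ full v d z = \<mu> * DQ full u d' z"
  proof (rule tendsto_unique[OF _ DQ_limit])
    have "(Q full (\<lambda>l j. v l j + s * d l j) z - Q full v z) / s = \<mu> * ((Q full (\<lambda>l j. u l j + s * d' l j) z - Q full u z) / s)" for s
    proof -
      have "Q full (\<lambda>l j. v l j + s * d l j) z = \<mu> * Q full (\<lambda>l j. u l j + s * d' l j) z"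
        unfolding \<mu>_def
      proof (rule Q_full_row_mix)
        fix l c assume l: "l < k"
        have "(\<Sum>p<k. M l p * d' p c) = d l c"
          using MM'[OF l ij(1)] by (cases "c = j") (simp_all add: d'_def d_def)
        thus "v l c + s * d l c = (\<Sum>p<k. M l p * (u p c + s * d' p c))"
          unfolding v[OF l] by (simp add: algebra_simps sum.distrib flip: sum_distrib_left)
      qed
      moreover have "Q full v z = \<mu> * Q full u z" unfolding \<mu>_def by (rule Q_full_row_mix) (rule v)
      ultimately show ?thesis by (simp add: algebra_simps diff_divide_distrib)
    qed
    thus "((\<lambda>s. (Q full (\<lambda>l j. v l j + s * d l j) z - Q full v z) / s) \<longlongrightarrow> \<mu> * DQ full u d' z) (at 0)"
      by (simp only: tendsto_mult_left DQ_limit)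
  qed simp
  moreover have "DQ full v d z = dQ full v i j z"
  proof -
    have "DQ full v d z = (\<Sum>l<k. \<Sum>c<n. if c = j then (if l = i then dQ full v i j z else 0) else 0)"
      unfolding DQ_def by (intro sum.cong) (auto simp: d_def)
    thus ?thesis using ij by simp
  qed
  moreover have "DQ full u d' z = (\<Sum>a<k. M' a i * dQ full u a j z)"
  proof -
    have "DQ full u d' z = (\<Sum>l<k. \<Sum>c<n. if c = j then M' l i * dQ full u l j z else 0)"
      unfolding DQ_def by (intro sum.cong) (auto simp: d'_def)
    thus ?thesis using ij by simp
  qed
  ultimately show ?thesis by (simp add: \<mu>_def)
qed

lemma div_partial_Dv: "div_partial k n t v i j = Dv (v(i := (\<lambda>c. if c = j then 1 else 0))) t"
  unfolding div_partial_def Dv_def cdet_def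
  by (intro arg_cong[where f = Determinant.det] eq_matI) auto

text \<open>The hypothesis concerns some basis, all of its entries and the unscaled determinant. A
  relation between the derivatives at the normal form \<open>u\<close> is carried there by
  \<open>full_kernel\<close>, the chain rule and powers of the roots.\<close>

lemma transverse_imp_etale:
  assumes tr: "transverse_div k n t" and t: "\<And>l. l < N \<Longrightarrow> t l > 0"
  shows "etale t"
proof (intro ballI impI)
  fix u assume u: "u \<in> SY topc topc" and sol: "\<forall>l<N. Q topc u (of_real (t l)) = 0"
  define \<tau> where "\<tau> l = complex_of_real (t l)" for l
  have \<tau>: "\<tau> l \<noteq> 0" if "l < N" for l using t[OF that] by (simp add: \<tau>_def)
  have ind: "indep u" by (rule SY_imp_indep[OF u])
  have uF: "u \<in> Y full" using u by (intro topc_full) (simp add: SY_def)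
  have "rspan k u \<in> Grass k n" by (rule Grass_rspan[OF ind uF])
  moreover have "rspan k u \<in> schubert_var k n (div_index k) (of_real (t l))" if "l < k * (n - k)" for l
    by (rule schubert_divisorI[OF u]) (use \<tau> sol that in \<open>auto simp: \<tau>_def N_def\<close>)
  ultimately obtain v where v: "\<forall>i<k. v i \<in> rspan k u" "cv.independent (v ` {..<k})" "inj_on v {..<k}"
    "\<And>c. (\<forall>i<k. \<forall>j<n. (\<Sum>l < N. c l * div_partial k n (\<tau> l) v i j) = 0) \<Longrightarrow> (\<forall>l < N. c l = 0)"
    using tr unfolding transverse_div_def N_def \<tau>_def by blast
  have vind: "indep v" using v(2,3) by (simp add: indep_iff)
  obtain M M' where M: "\<And>l j. l < k \<Longrightarrow> v l j = (\<Sum>p<k. M l p * u p j)" "\<And>l j. l < k \<Longrightarrow> u l j = (\<Sum>p<k. M' l p * v p j)"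
    "\<And>r c. r < k \<Longrightarrow> c < k \<Longrightarrow> (\<Sum>s<k. M r s * M' s c) = (if r = c then 1 else 0)"
  proof (rule change_of_basis[OF vind])
    show "v l \<in> rspan k u" if "l < k" for l using v(1) that by blast
  qed auto
  have vF: "v \<in> Y full" using uF M(1) by (auto simp: Y_def full_def intro!: sum.neutral)
  show "nondeg topc u (\<lambda>l. of_real (t l)) N"
    unfolding nondeg_def \<tau>_def[symmetric]
  proof (rule allI, rule impI)
    fix y assume y: "\<forall>i<k. \<forall>j\<le>topc i. (\<Sum>l<N. y l * dQ topc u i j (\<tau> l)) = 0"
    define s where "s = ssum full - ssum topc"
    define a where "a = ssum full + (\<Sum>r<n-k. r)"
    define b where "b = (\<Sum>r<n. r)"
    \<comment> \<open>The first factor comes from the change from \<open>topc\<close> to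
      \<open>full\<close>, the second from the powers of \<open>z\<close> in
      \<open>Dv_Q\<close>.\<close>
    define c where "c l = (y l / \<tau> l ^ s) * (\<tau> l ^ a / \<tau> l ^ b)" for l
    have fk: "(\<Sum>l<N. (y l / \<tau> l ^ s) * dQ full u i j (\<tau> l)) = 0" if "i < k" "j < n" for i j
      unfolding s_def by (rule full_kernel[OF u \<tau> _ _ that]) (use y sol in \<open>auto simp: \<tau>_def\<close>)
    have "(\<Sum>l < N. c l * div_partial k n (\<tau> l) v i j) = 0" if ij: "i < k" "j < n" for i j
    proof -
      have "c l * div_partial k n (\<tau> l) v i j = (y l / \<tau> l ^ s) * dQ full v i j (\<tau> l)" if l: "l < N" for l
      proof -
        have "v(i := \<lambda>c. if c = j then 1 else 0) \<in> Y full" using vF ij by (auto simp: Y_def full_def)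
        from Dv_Q[OF this, of "\<tau> l"] have "\<tau> l ^ a * div_partial k n (\<tau> l) v i j = \<tau> l ^ b * dQ full v i j (\<tau> l)"
          by (simp add: a_def b_def div_partial_Dv dQ_def)
        hence "\<tau> l ^ a / \<tau> l ^ b * div_partial k n (\<tau> l) v i j = dQ full v i j (\<tau> l)"
          using \<tau>[OF l] by (simp add: field_simps)
        thus ?thesis unfolding c_def by (simp only: mult.assoc)
      qed
      hence "(\<Sum>l < N. c l * div_partial k n (\<tau> l) v i j) = (\<Sum>l<N. (y l / \<tau> l ^ s) * dQ full v i j (\<tau> l))" by simp
      also have "\<dots> = (\<Sum>l<N. \<Sum>r<k. cdet n (blk M) * M' r i * ((y l / \<tau> l ^ s) * dQ full u r j (\<tau> l)))"
      proof -
        have "dQ full v i j z = cdet n (blk M) * (\<Sum>r<k. M' r i * dQ full u r j z)" for z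
        proof (rule dQ_full_row_mix)
          show "v l j = (\<Sum>p<k. M l p * u p j)" if "l < k" for l j by (rule M(1)[OF that])
          show "(\<Sum>s<k. M r s * M' s c) = (if r = c then 1 else 0)" if "r < k" "c < k" for r c
            by (rule M(3)[OF that])
        qed (use ij in auto)
        thus ?thesis by (simp add: sum_distrib_left mult_ac)
      qed
      also have "\<dots> = (\<Sum>r<k. cdet n (blk M) * M' r i * (\<Sum>l<N. (y l / \<tau> l ^ s) * dQ full u r j (\<tau> l)))"
        unfolding sum_distrib_left by (rule sum.swap)
      finally show ?thesis using fk[OF _ ij(2)] by simp
    qed
    hence "\<forall>l<N. c l = 0" by (intro v(4)) blast
    thus "\<forall>l<N. y l = 0" using \<tau> by (auto simp: c_def)
  qed
qed

end

subsection \<open>Schubert conditions as vanishing orders\<close>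

text \<open>The partial product has no root at the next point, so the order of vanishing there falls
  on the cofactor.\<close>

lemma prod_linear_powers_dvd:
  fixes P :: "'a::idom poly" and s :: nat
  assumes "inj_on t {..<s}" "\<And>l. l < s \<Longrightarrow> [:- t l, 1:] ^ w l dvd P"
  shows "(\<Prod>l<s. [:- t l, 1:] ^ w l) dvd P"
  using assms
proof (induction s)
  case (Suc s)
  define B where "B = (\<Prod>l<s. [:- t l, 1:] ^ w l)"
  have "B dvd P" unfolding B_def using Suc by (auto simp: inj_on_def)
  then obtain R where R: "P = B * R" by (elim dvdE)
  have "poly B (t s) \<noteq> 0"
    using Suc.prems(1) by (auto simp: B_def poly_prod dest!: inj_onD)
  hence "order (t s) B = 0" by (rule order_0I)
  moreover have "R = 0 \<or> w s \<le> order (t s) (B * R)"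
    using Suc.prems(2)[of s] by (auto simp: R order_divides B_def)
  ultimately have "R = 0 \<or> w s \<le> order (t s) R"
    using \<open>poly B (t s) \<noteq> 0\<close> order_mult[of B R "t s"] by (cases "B = 0"; cases "R = 0") auto
  hence "[:- t s, 1:] ^ w s dvd R" by (auto simp: order_divides)
  hence "B * [:- t s, 1:] ^ w s dvd B * R" by (rule mult_dvd_mono[OF dvd_refl])
  thus ?case by (simp add: R B_def)
qed simp

context grass begin

text \<open>Chosen from \<open>l = k - 1\<close> downwards: each new intersection has dimension at
  least one more than the number of vectors already chosen, so it is not contained in their
  span.\<close>

lemma adapted_basis:
  assumes K: "K \<in> schubert_var k n a t"
  obtains w where "indep w" "\<And>l. l < k \<Longrightarrow> w l \<in> K \<inter> osc_flag n (n + 1 - a ! l) t"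
proof -
  define A where "A l = K \<inter> osc_flag n (n + 1 - a ! l) t" for l
  have dim: "k - l \<le> cv.dim (A l)" if "l < k" for l using K that by (simp add: schubert_var_def A_def)
  have "\<exists>w. (\<forall>l\<in>{k-i..<k}. w l \<in> A l) \<and> cv.independent (w ` {k-i..<k}) \<and> inj_on w {k-i..<k}" if "i \<le> k" for i
    using that
  proof (induction i)
    case 0
    show ?case by (simp add: cv.independent_empty)
  next
    case (Suc i)
    then obtain w where w: "\<forall>l\<in>{k-i..<k}. w l \<in> A l" "cv.independent (w ` {k-i..<k})" "inj_on w {k-i..<k}" by auto
    define l0 where "l0 = k - Suc i"
    have l0: "l0 < k" "l0 \<notin> {k-i..<k}" "{k - Suc i..<k} = insert l0 {k-i..<k}" using Suc.prems by (auto simp: l0_def)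
    have "\<not> A l0 \<subseteq> cv.span (w ` {k-i..<k})"
    proof
      assume "A l0 \<subseteq> cv.span (w ` {k-i..<k})"
      hence "cv.dim (A l0) \<le> card (w ` {k-i..<k})" by (intro cv.dim_le_card) auto
      also have "\<dots> \<le> i" using Suc.prems card_image_le[of "{k-i..<k}" w] by simp
      finally show False using dim[OF l0(1)] Suc.prems by (simp add: l0_def)
    qed
    then obtain x where x: "x \<in> A l0" "x \<notin> cv.span (w ` {k-i..<k})" by blast
    have xn: "x \<notin> w ` {k-i..<k}" using x(2) cv.span_base by blast
    let ?w = "w(l0 := x)"
    have im: "?w ` {k-i..<k} = w ` {k-i..<k}" using l0(2) by auto
    have "cv.independent (?w ` {k - Suc i..<k})"
      unfolding l0(3) image_insert im using cv.independent_insertI[OF x(2) w(2)] by simp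
    moreover have "inj_on ?w {k - Suc i..<k}"
      unfolding l0(3) using w(3) xn l0(2) by (auto simp: inj_on_def)
    moreover have "\<forall>l\<in>{k - Suc i..<k}. ?w l \<in> A l" unfolding l0(3) using w(1) x(1) by auto
    ultimately show ?case by blast
  qed
  from this[of k] obtain w where "\<forall>l\<in>{..<k}. w l \<in> A l" "cv.independent (w ` {..<k})" "inj_on w {..<k}"
    by (auto simp: atLeast0LessThan)
  thus ?thesis using that[of w] by (simp add: indep_iff A_def)
qed

text \<open>Compares the exponents of \<open>Dv_Q\<close> for the leading positions
  \<open>n - a ! l\<close>: the weight is the power of \<open>z\<close> that splits off.\<close>

lemma weight_identity:
  assumes "a \<in> schubert_index k n"
  shows "schubert_weight a + (ssum (\<lambda>l. n - a ! l) + (\<Sum>r<n-k. r)) = (\<Sum>r<n. r)"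
proof -
  have len: "length a = k" and sorted: "sorted_wrt (<) a" and sub: "set a \<subseteq> {1..n}"
    using assms by (auto simp: schubert_index_def)
  have range: "1 \<le> a ! l \<and> a ! l \<le> n" if "l < k" for l proof -
    have "a ! l \<in> {1..n}" using sub nth_mem[of l a] len that by blast
    thus ?thesis by simp
  qed
  have ge: "l + 1 \<le> a ! l" if "l < k" for l
    using that
  proof (induction l)
    case 0
    thus ?case using range[of 0] by simp
  next
    case (Suc l)
    have "a ! l < a ! Suc l" using sorted Suc.prems len by (simp add: sorted_wrt_iff_nth_less)
    thus ?case using Suc by simp
  qed
  have "schubert_weight a + ssum (\<lambda>l. n - a ! l) = (\<Sum>l<k. (a ! l - (l + 1)) + (n - a ! l))"
    by (simp add: schubert_weight_def ssum_def len sum.distrib)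
  also have "\<dots> = (\<Sum>l<k. n - (l + 1))" by (intro sum.cong) (use ge range in fastforce)+
  finally have 1: "schubert_weight a + ssum (\<lambda>l. n - a ! l) = (\<Sum>l<k. n - (l + 1))" .
  have "(\<Sum>l<i. n - (l + 1)) + (\<Sum>r<n-i. r) = (\<Sum>r<n. r)" if "i \<le> n" for i
    using that
  proof (induction i)
    case (Suc i)
    have "n - i = Suc (n - Suc i)" using Suc.prems by simp
    hence "(\<Sum>r<n-i. r) = (\<Sum>r<n-Suc i. r) + (n - Suc i)" by simp
    thus ?case using Suc by simp
  qed simp
  from this[of k] 1 k_less show ?thesis by linarith
qed

text \<open>Relative to the flag at \<open>t\<close> an adapted basis has leading positions at most
  \<open>n - a ! l\<close>, so \<open>Dv_Q\<close> splits off the power of \<open>z - t\<close>.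
  Passing to another basis only contributes a constant factor.\<close>

lemma schubert_order:
  assumes K: "K \<in> schubert_var k n a t" "K = rspan k v" and v: "indep v" "v \<in> Y full"
    and a: "a \<in> schubert_index k n" and P: "\<And>z. poly P z = Dv v z"
  shows "[:- t, 1:] ^ schubert_weight a dvd P"
proof -
  obtain w where w: "indep w" "\<And>l. l < k \<Longrightarrow> w l \<in> K \<inter> osc_flag n (n + 1 - a ! l) t"
    using adapted_basis[OF K(1)] by blast
  have wv: "w l \<in> rspan k v" if "l < k" for l using w(2)[OF that] K(2) by blast
  obtain M' where M: "\<And>l j. l < k \<Longrightarrow> v l j = (\<Sum>p<k. M' l p * w p j)"
  proof (rule change_of_basis[OF w(1)])
    show "w l \<in> rspan k v" if "l < k" for l by (rule wv[OF that])
  qed auto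
  define \<mu> where "\<mu> = cdet n (blk M')"
  have Dvw: "Dv v z = \<mu> * Dv w z" for z unfolding \<mu>_def by (rule Dv_row_mix) (rule M)
  \<comment> \<open>Once \<open>t\<close> is moved to 0, the flag member of dimension
    \<open>n + 1 - a ! l\<close> has its last free coordinate at the index \<open>n - a ! l\<close>,
    counted from 0.\<close>
  define e where "e l = n - a ! l" for l
  define w' where "w' l = gm n (- t) (w l)" for l
  have w'Y: "w' \<in> Y e"
  proof -
    have "w' l j = 0" if "l < k" "e l < j" for l j
    proof -
      have "n + 1 - a ! l \<le> j" using that by (simp add: e_def)
      thus ?thesis unfolding w'_def using w(2)[OF that(1)] osc_flag_imp by blast
    qed
    thus ?thesis by (simp add: Y_def)
  qed
  have wt: "schubert_weight a + (ssum e + (\<Sum>r<n-k. r)) = (\<Sum>r<n. r)"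
    unfolding e_def by (rule weight_identity[OF a])
  define W where "W = schubert_weight a"
  define R where "R = [:- t, 1:] ^ W * smult \<mu> (pcompose (Qp e w') [:- t, 1:])"
  have R: "poly R z = (z - t) ^ W * (\<mu> * Q e w' (z - t))" for z
    by (simp add: R_def poly_pcompose poly_Qp algebra_simps)
  have eq: "poly P z = poly R z" if z: "z \<noteq> t" for z
  proof -
    define y where "y = z - t"
    have y: "y \<noteq> 0" using z by (simp add: y_def)
    have "y ^ (ssum e + (\<Sum>r<n-k. r)) * Dv w' y = y ^ (\<Sum>r<n. r) * Q e w' y" by (rule Dv_Q[OF w'Y])
    also have "\<dots> = y ^ (ssum e + (\<Sum>r<n-k. r)) * (y ^ W * Q e w' y)"
      unfolding wt[symmetric] W_def power_add by (simp add: mult_ac)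
    finally have "Dv w' y = y ^ W * Q e w' y" using y by simp
    moreover have "Dv w' y = Dv w z"
      using Dv_translate[of "- t" w z] by (simp add: w'_def[abs_def] y_def)
    ultimately show ?thesis unfolding P Dvw R y_def[symmetric] by simp
  qed
  have "P = R"
  proof (rule ccontr)
    assume "P \<noteq> R"
    hence "finite {z. poly (P - R) z = 0}" by (intro poly_roots_finite) simp
    moreover have "- {t} \<subseteq> {z. poly (P - R) z = 0}" using eq by auto
    ultimately have "finite (- {t})" by (rule rev_finite_subset)
    hence "finite (insert t (- {t}))" by simp
    moreover have "insert t (- {t}) = UNIV" by auto
    ultimately show False using infinite_UNIV_char_0[where 'a = complex] by simp
  qed
  thus ?thesis unfolding R_def W_def by (simp only: dvd_triv_left)
qed

text \<open>At 0 the derivative rows are multiples of the first \<open>n - k\<close> unit vectors,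
  so the determinant is a nonzero multiple of the minor on the last \<open>k\<close> columns. A
  kernel vector of the minor extends to one of the whole matrix by clearing the first
  columns.\<close>

lemma minor_invertible:
  assumes "Dv v 0 \<noteq> 0" "v \<in> Y full"
  shows "cdet k (\<lambda>l p. v l (topc p)) \<noteq> 0"
proof
  assume "cdet k (\<lambda>l p. v l (topc p)) = 0"
  then obtain x i where x: "i < k" "x i \<noteq> 0" "\<And>p. p < k \<Longrightarrow> (\<Sum>l<k. x l * v l (topc p)) = 0"
    unfolding cdet_left_kernel by blast
  define y where "y r = (if r < k then x r else - (\<Sum>l<k. x l * v l (r - k)) / ff (r - k) (r - k))" for r
  have "(\<Sum>r<n. y r * (if r < k then v r c else gamma_deriv n (r - k) 0 c)) = 0" if c: "c < n" for c
  proof -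
    have "(\<Sum>r<n. y r * (if r < k then v r c else gamma_deriv n (r - k) 0 c))
        = (\<Sum>l<k. x l * v l c) + (\<Sum>r<n-k. y (r + k) * gamma_deriv n r 0 c)"
      unfolding sum_split_rows by (simp add: y_def)
    also have "(\<Sum>r<n-k. y (r + k) * gamma_deriv n r 0 c) = (\<Sum>r<n-k. if r = c then - (\<Sum>l<k. x l * v l c) else 0)"
    proof (rule sum.cong)
      fix r
      consider "r < c" | "r = c" | "c < r" by linarith
      thus "y (r + k) * gamma_deriv n r 0 c = (if r = c then - (\<Sum>l<k. x l * v l c) else 0)"
      proof cases
        case 1
        thus ?thesis by (simp add: gamma_deriv_ff power_0_left)
      next
        case 2
        thus ?thesis using c ff_self[of c] by (simp add: gamma_deriv_ff y_def)
      next
        case 3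
        thus ?thesis by (simp add: gamma_deriv_ff ff_eq_0)
      qed
    qed simp
    also have "(\<Sum>l<k. x l * v l c) + \<dots> = 0"
    proof (cases "c < n - k")
      case False
      define p where "p = c - (n - k)"
      have "p < k" "c = topc p" using False c k_less by (auto simp: p_def topc_def)
      thus ?thesis using x(3)[of p] False by simp
    qed simp
    finally show ?thesis .
  qed
  moreover have "i < n" "y i \<noteq> 0" using x k_less by (auto simp: y_def)
  ultimately have "Dv v 0 = 0" unfolding Dv_def cdet_left_kernel by blast
  thus False using assms by simp
qed

lemma schubert_intersection_real:
  fixes ts :: "nat \<Rightarrow> real"
  assumes et: "\<And>t. pos_decreasing t \<Longrightarrow> etale t"
    and as: "\<And>l. l < s \<Longrightarrow> as l \<in> schubert_index k n" "(\<Sum>l<s. schubert_weight (as l)) = N"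
    and ts: "inj_on ts {..<s}" and K: "K \<in> Grass k n" "\<And>l. l < s \<Longrightarrow> K \<in> schubert_var k n (as l) (of_real (ts l))"
  shows "real_point K"
proof -
  obtain v where v: "indep v" "v \<in> Y full" "K = rspan k v" using Grass_basis[OF K(1)] by blast
  obtain P where P: "degree P \<le> N" "\<And>z. poly P z = Dv v z" using Dv_poly[OF v(2)] by blast
  define B where "B = (\<Prod>l<s. [:- complex_of_real (ts l), 1:] ^ schubert_weight (as l))"
  have "B dvd P" unfolding B_def
  proof (rule prod_linear_powers_dvd[where t = "\<lambda>l. complex_of_real (ts l)" and w = "\<lambda>l. schubert_weight (as l)"])
    show "inj_on (\<lambda>l. complex_of_real (ts l)) {..<s}" using ts by (auto simp: inj_on_def)
    show "[:- complex_of_real (ts l), 1:] ^ schubert_weight (as l) dvd P" if "l < s" for l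
      by (rule schubert_order[OF K(2)[OF that] v(3,1,2) as(1)[OF that] P(2)])
  qed
  then obtain R where R: "P = B * R" by (elim dvdE)
  have B0: "B \<noteq> 0" by (simp add: B_def)
  have degB: "degree B = N"
  proof -
    have "degree B = (\<Sum>l<s. degree ([:- complex_of_real (ts l), 1:] ^ schubert_weight (as l)))"
      unfolding B_def by (rule degree_prod_eq_sum_degree) auto
    thus ?thesis using as(2) by (simp add: degree_power_eq)
  qed
  have P0: "P \<noteq> 0"
  proof -
    obtain z where z: "z \<noteq> 0" "Q full v z \<noteq> 0" using Qp_nonzero[OF v(1,2) mono_full full_less] by blast
    hence "Dv v z \<noteq> 0" using Dv_Q[OF v(2), of z] by auto
    thus ?thesis using P(2) by (metis poly_0)
  qed
  hence R0: "R \<noteq> 0" using R by auto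
  \<comment> \<open>The weights add up to \<open>N\<close>, which also bounds the degree of
    \<open>P\<close>; hence \<open>P\<close> is a constant multiple of \<open>B\<close> and has no
    further roots.\<close>
  have "degree P = degree B + degree R" unfolding R by (rule degree_mult_eq[OF B0 R0])
  hence "degree R = 0" using P(1) degB by simp
  then obtain c where c: "R = [:c:]" by (elim degree_eq_zeroE)
  have c0: "c \<noteq> 0" using R0 c by simp
  have Dv_zero: "Dv v z = 0 \<longleftrightarrow> (\<exists>l<s. schubert_weight (as l) > 0 \<and> z = of_real (ts l))" for z
  proof -
    have "Dv v z = 0 \<longleftrightarrow> poly B z = 0" unfolding P(2)[symmetric] R c using c0 by simp
    thus ?thesis by (auto simp: B_def poly_prod)
  qed
  \<comment> \<open>To the left of all parameters, so that after the translation every root is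
    positive and 0 is none.\<close>
  define x where "x = - (\<Sum>l<s. \<bar>ts l\<bar>) - 1"
  have xlt: "x < ts l" if "l < s" for l
  proof -
    have "\<bar>ts l\<bar> \<le> (\<Sum>l<s. \<bar>ts l\<bar>)" using that by (intro member_le_sum) auto
    thus ?thesis by (simp add: x_def)
  qed
  define v' where "v' l = gm n (- of_real x) (v l)" for l
  have Dv': "Dv v' z = Dv v (z + of_real x)" for z
    using Dv_translate[of "- of_real x" v "z + of_real x"] by (simp add: v'_def[abs_def])
  have v'F: "v' \<in> Y full" unfolding Y_full v'_def using gm_Cn by blast
  have "Dv v' 0 \<noteq> 0" unfolding Dv' Dv_zero using xlt by force
  \<comment> \<open>The inverse of the minor on the last \<open>k\<close> columns brings the basis
    to the normal form of the open cell.\<close>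
  from minor_invertible[OF this v'F] obtain g where
    g: "\<And>r c. r < k \<Longrightarrow> c < k \<Longrightarrow> (\<Sum>q<k. v' r (topc q) * g q c) = (if r = c then 1 else 0)"
       "\<And>r c. r < k \<Longrightarrow> c < k \<Longrightarrow> (\<Sum>q<k. g r q * v' q (topc c)) = (if r = c then 1 else 0)"
    by (rule cdet_inverse) blast
  define u where "u l j = (if l < k then \<Sum>p<k. g l p * v' p j else 0)" for l j
  have uS: "u \<in> SY topc topc"
  proof -
    have 1: "u l (topc p) = (if l = p then 1 else 0)" if "l < k" "p < k" for l p
      using g(2)[OF that] that by (simp add: u_def)
    have "u l j = 0" if l: "l < k" "topc l < j" for l j
    proof (cases "j < n")
      case True
      define p where "p = j - (n - k)"
      have "p < k" "j = topc p" "l < p" using True l k_less by (auto simp: p_def topc_def)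
      thus ?thesis using 1[OF l(1)] by simp
    next
      case False
      thus ?thesis using v'F unfolding Y_full by (simp add: u_def Cn_def)
    qed
    thus ?thesis using 1 by (simp add: SY_def Y_def)
  qed
  have v'u: "v' l j = (\<Sum>p<k. v' l (topc p) * u p j)" if l: "l < k" for l j
  proof -
    have "(\<Sum>p<k. v' l (topc p) * u p j) = (\<Sum>p<k. \<Sum>q<k. v' l (topc p) * g p q * v' q j)"
      by (simp add: u_def sum_distrib_left mult_ac)
    also have "\<dots> = (\<Sum>q<k. (\<Sum>p<k. v' l (topc p) * g p q) * v' q j)"
      by (subst sum.swap) (simp add: sum_distrib_right)
    also have "\<dots> = (\<Sum>q<k. (if q = l then 1 else 0) * v' q j)" using g(1)[OF l] by (intro sum.cong) auto
    finally show ?thesis using l by (simp add: sum_indicator_mult)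
  qed
  have uY: "u \<in> Y topc" using uS by (simp add: SY_def)
  define \<mu> where "\<mu> = cdet n (blk g)"
  have Dvu: "Dv u z = \<mu> * Dv v' z" for z
    unfolding \<mu>_def by (rule Dv_row_mix) (simp add: u_def)
  have Qu: "Q topc u z = \<mu> * Dv v (z + of_real x)" if "z \<noteq> 0" for z
    using Dv_topc[OF uY that] Dvu Dv' by simp
  define S where "S = smult \<mu> (pcompose P [:of_real x, 1:])"
  have S: "poly S z = \<mu> * Dv v (z + of_real x)" for z
    by (simp add: S_def poly_pcompose P(2) add.commute)
  have QS: "Qp topc u = S"
  proof (rule ccontr)
    assume "Qp topc u \<noteq> S"
    hence "finite {z. poly (Qp topc u - S) z = 0}" by (intro poly_roots_finite) simp
    moreover have "- {0} \<subseteq> {z. poly (Qp topc u - S) z = 0}" using Qu by (auto simp: poly_Qp S)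
    ultimately have "finite (- {0::complex})" by (rule rev_finite_subset)
    hence "finite (insert 0 (- {0::complex}))" by simp
    moreover have "insert 0 (- {0::complex}) = UNIV" by auto
    ultimately show False using infinite_UNIV_char_0[where 'a = complex] by simp
  qed
  have \<mu>0: "\<mu> \<noteq> 0"
  proof
    assume "\<mu> = 0"
    hence "Q topc u 0 = 0" using QS by (simp add: S_def flip: poly_Qp)
    thus False using Q_top_0[OF uS] kappa_top by simp
  qed
  have "degree P = N" using \<open>degree P = degree B + degree R\<close> \<open>degree R = 0\<close> degB by simp
  hence "degree (Qp topc u) = N" unfolding QS S_def using \<mu>0 by (simp add: degree_pcompose)
  then obtain t where t: "Fib t u" "\<And>l. l < N \<Longrightarrow> t l \<noteq> 0" "\<And>l. l < N \<Longrightarrow> Q topc u (t l) = 0"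
    using Fib_of_degree[OF uS] by metis
  have tr: "t l = of_real (Re (t l)) \<and> Re (t l) > 0" if l: "l < N" for l
  proof -
    have "Dv v (t l + of_real x) = 0" using t(3)[OF l] Qu[OF t(2)[OF l]] \<mu>0 by simp
    then obtain i where i: "i < s" "t l + of_real x = of_real (ts i)" unfolding Dv_zero by blast
    hence "t l = of_real (ts i - x)" by (simp add: algebra_simps)
    thus ?thesis using xlt[OF i(1)] by simp
  qed
  have "Fib (\<lambda>l. of_real (Re (t l))) u" using t(1) Fib_cong[of t "\<lambda>l. of_real (Re (t l))"] tr by simp
  from real_roots_imp_real_rows[OF et uS this] have ur: "real_rows u" using tr by blast
  have vgm: "v l = gm n (of_real x) (v' l)" if "l < k" for l
  proof -
    have "v l \<in> Cn n" using v(2) that unfolding Y_full by blast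
    from gm_inverse[OF this, of "- of_real x"] show ?thesis by (simp add: v'_def)
  qed
  \<comment> \<open>Back at the original flags: the translation is by a real number, so the basis
    stays real.\<close>
  define q where "q p = gm n (of_real x) (u p)" for p
  have q_real: "cnj (q p j) = q p j" if "p < k" for p j
  proof -
    have "cnj (u p i) = u p i" for i using ur that unfolding real_rows_def by (simp add: Reals_cnj_iff)
    thus ?thesis by (simp add: q_def gm_def)
  qed
  have q_v: "q p j = (\<Sum>l<k. g p l * v l j)" if "p < k" for p j
  proof -
    have "u p = (\<lambda>j. \<Sum>l<k. g p l * v' l j)" using that by (auto simp: u_def)
    hence "q p j = (\<Sum>l<k. g p l * gm n (of_real x) (v' l) j)" unfolding q_def by (simp only: gm_lin)
    thus ?thesis using vgm by simp
  qed
  have v_q: "v l j = (\<Sum>p<k. v' l (topc p) * q p j)" if "l < k" for l j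
  proof -
    have "v' l = (\<lambda>j. \<Sum>p<k. v' l (topc p) * u p j)" by (rule ext) (rule v'u[OF that])
    hence "gm n (of_real x) (v' l) j = gm n (of_real x) (\<lambda>j. \<Sum>p<k. v' l (topc p) * u p j) j" by simp
    thus ?thesis unfolding vgm[OF that] q_def by (simp only: gm_lin)
  qed
  have comb: "rspan k a \<subseteq> rspan k b" if "\<And>l j. l < k \<Longrightarrow> a l j = (\<Sum>p<k. M l p * b p j)" for a b M
  proof
    fix y assume "y \<in> rspan k a"
    then obtain d where d: "y = (\<lambda>j. \<Sum>l<k. d l * a l j)" by (auto simp: rspan_def)
    have "y j = (\<Sum>p<k. (\<Sum>l<k. d l * M l p) * b p j)" for j
    proof -
      have "y j = (\<Sum>l<k. \<Sum>p<k. d l * M l p * b p j)"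
        unfolding d using that by (simp add: sum_distrib_left mult_ac)
      thus ?thesis by (subst (asm) sum.swap) (simp add: sum_distrib_right)
    qed
    hence "y = (\<lambda>j. \<Sum>p<k. (\<Sum>l<k. d l * M l p) * b p j)" by (rule ext)
    thus "y \<in> rspan k b" unfolding rspan_def by (intro CollectI exI[of _ "\<lambda>p. \<Sum>l<k. d l * M l p"] conjI TrueI)
  qed
  have Kq: "K = rspan k q"
    unfolding v(3) using comb[of v "\<lambda>l p. v' l (topc p)" q, OF v_q] comb[of q g v, OF q_v] by blast
  show ?thesis
    unfolding real_point_def Kq
  proof
    fix y assume "y \<in> rspan k q"
    then obtain d where "y = (\<lambda>j. \<Sum>l<k. d l * q l j)" by (auto simp: rspan_def)
    hence "(\<lambda>i. cnj (y i)) = (\<lambda>j. \<Sum>l<k. cnj (d l) * q l j)" using q_real by auto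
    thus "(\<lambda>i. cnj (y i)) \<in> rspan k q"
      unfolding rspan_def by (intro CollectI exI[of _ "\<lambda>l. cnj (d l)"] conjI TrueI)
  qed
qed

end

theorem mainTheorem7:
  fixes n k :: nat
  assumes "0 < k" and "k < n"
    and hyp: "\<And>ts :: nat \<Rightarrow> real. inj_on ts {..<k * (n - k)} \<Longrightarrow> transverse_div k n ts"
  shows "\<forall>(s::nat) (as :: nat \<Rightarrow> nat list) (ts :: nat \<Rightarrow> real).
           (\<forall>l<s. as l \<in> schubert_index k n) \<and>
           (\<Sum>l<s. schubert_weight (as l)) = k * (n - k) \<and>
           inj_on ts {..<s}
           \<longrightarrow> (\<forall>K. K \<in> Grass k n \<and> (\<forall>l<s. K \<in> schubert_var k n (as l) (of_real (ts l)))
                    \<longrightarrow> real_point K)"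
proof -
  interpret grass k n using assms(1,2) by unfold_locales
  have et: "etale t" if t: "pos_decreasing t" for t
  proof (rule transverse_imp_etale)
    have "inj_on t {..<N}" using pos_decreasing_inj[OF t] by (auto simp: inj_on_def)
    thus "transverse_div k n t" by (intro hyp) (simp add: N_def)
  qed (use t in \<open>auto simp: pos_decreasing_def\<close>)
  show ?thesis using schubert_intersection_real[OF et] unfolding N_def by blast
qed

end
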